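(* Let $h\in L^0(M,N)$ and $p\in(1,\infty)$. Suppose that $N$ is complete. Then the isometry $\bar i_p: L^p(I,L^p_h(M,N))\to L^p_{\underline h}(M,L^p(I,N))$ induces the (well-defined) isometric mapping $$\tilde i_p:=(q_p^{-1})_*\circ\bar i_p\circ Q_p:\ (\mathcal{AC}^p(I,L^p_h(M,N)),d_{p,p})\to (L^p_{\underline h}(M,\mathcal{AC}^p(I,N)),D_{p,p}),$$ whose inverse mapping on its range is $\tilde i_p^{-1}=Q_p^{-1}\circ\bar i_p^{-1}\circ(q_p)_*$ and satisfies $$\tilde i_p^{-1}(f)(t)=(e_{t,p})_*(f)\quad\text{for all } t\in I \text{ and } f\in\tilde i_p(\mathcal{AC}^p(I,L^p_h(M,N))).$$ In addition, $\tilde i_p$ satisfies for all $c\in\mathcal{AC}^p(I,L^p_h(M,N))$ that $$|c'|_p^p(t)=\int_M|\tilde i_p(c)(x)'|_N^p(t)\,d\mu_M(x)\quad\text{for } \mathscr{L}^1\text{-a.e. } t\in I,$$ and its range is the set of all $f\in L^p_{\underline h}(M,\mathcal{AC}^p(I,N))$ such that $$\int_M\int_I|f(x)'|_N^p(t)\,dt\,d\mu_M(x)<\infty.$$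
   Context: Setting: $(M,\Sigma_M,\mu_M)$ is a measure space with $M$ nonempty (no $\sigma$-finiteness assumed), $(N,d_N)$ is a nonempty metric space with finite metric, and $I=[a,b]\subset\mathbb{R}$ with $a<b$, equipped with Lebesgue measure $\mathscr{L}^1$. "Isometry" means surjective distance-preserving map; "isometric mapping" means distance-preserving. For a measure space $(Y,\Sigma_Y,\mu_Y)$ and a nonempty metric space $(Z,d_Z)$: $\mathcal{L}^0_{\mathrm s}(Y,Z)$ is the set of measurable maps $Y\to Z$ (Borel $\sigma$-algebra on $Z$) with separable range; $[f]_Y$ is the class of $f$ modulo $\mu_Y$-a.e. equality; $L^0(Y,Z)$ is the set of classes admitting a representative in $\mathcal{L}^0_{\mathrm s}(Y,Z)$. For $g\in L^0(Y,Z)$ and $p\in[1,\infty)$, $L^p_g(Y,Z)$ is the set of $f\in L^0(Y,Z)$ with $\int_Y d_Z(f,g)^p\,d\mu_Y<\infty$, with the metric $(f,f')\mapsto(\int_Y d_Z(f,f')^p\,d\mu_Y)^{1/p}$. $L^p(I,Z)$ denotes $L^p_g(I,Z)$ with $g$ constant (all constants give the same space when $d_Z$ is finite). Classes and representatives are not distinguished when clear from context. $I\times M$ carries the product measure $\mathscr{L}^1\otimes\mu_M$ obtained by Carathéodory's process from measurable rectangles. Given $h\in L^0(M,N)$: $\hat h(t,x)=h(x)$ on $I\times M$; $\underline h(x)$ is the constant curve $t\mapsto h(x)$ in $N$. Metrics: $D_p$ on $L^p_h(M,N)$; $d_p$ on $L^p(I,N)$; $d_{p,p}(c,c')=(\int_I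 D_p(c(t),c'(t))^p dt)^{1/p}$ on $L^p(I,L^p_h(M,N))$; $D_{p,p}(f,f')=(\int_M d_p(f(x),f'(x))^p d\mu_M(x))^{1/p}$ on $L^p_{\underline h}(M,L^p(I,N))$. When $N$ is complete, $\bar i_p:=\overline{\operatorname{sec}}_{M,p}\circ\overline{\operatorname{sec}}_{I,p}^{-1}$ is an isometry, where $\overline{\operatorname{sec}}_{I,p}:L^p_{\hat h}(I\times M,N)\to L^p(I,L^p_h(M,N))$, $[\hat c]_{I\times M}\mapsto[t\mapsto[\hat c(t,\cdot)]_M]_I$, and $\overline{\operatorname{sec}}_{M,p}:L^p_{\hat h}(I\times M,N)\to L^p_{\underline h}(M,L^p(I,N))$, $[\hat c]_{I\times M}\mapsto[x\mapsto[\hat c(\cdot,x)]_I]_M$, are isometries. For a metric space $(X,d_X)$, $\mathcal{AC}^p(I,X)$ is the set of curves $c:I\to X$ for which there is $m\in L^p(I)$ with $d_X(c(s),c(t))\le\int_s^t m(r)\,dr$ for all $s\le t$ in $I$. The metric derivative $|c'|_X(t)=\lim_{s\to t}d_X(c(s),c(t))/|s-t|$ exists for a.e. $t$ and lies in $L^p(I)$. We write $|c'|_p:=|c'|_{L^p_h(M,N)}$ for $c\in\mathcal{AC}^p(I,L^p_h(M,N))$. On $\mathcal{AC}^p(I,X)$, $d_p(c,c')=(\int_I d_X(c(t),c'(t))^p\,dt)^{1/p}$ is a metric; on $\mathcal{AC}^p(I,L^p_h(M,N))$ it is denoted $d_{p,p}$. $L^p_{\underline h}(M,\mathcal{AC}^p(I,N))$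 is the set of a.e.-equality classes of measurable, separably valued maps $f:M\to(\mathcal{AC}^p(I,N),d_p)$ with $D_{p,p}(f,\underline h)<\infty$. The map $q_p:\mathcal{AC}^p(I,N)\to L^p(I,N)$, $c\mapsto[c]_I$, and the map $Q_p:\mathcal{AC}^p(I,L^p_h(M,N))\to L^p(I,L^p_h(M,N))$, $c\mapsto[c]_I$, are injective and distance-preserving ($Q_p^{-1}$, $q_p^{-1}$ are inverses on their ranges). $e_{t,p}:\mathcal{AC}^p(I,N)\to N$ is evaluation $c\mapsto c(t)$. For a map $\varphi$, $\varphi_*$ denotes post-composition $f\mapsto\varphi\circ f$ on classes (the class of the composition of $\varphi$ with a compatible representative). *)

theory Defs
  imports "HOL-Analysis.Analysis"
begin

text \<open>
  Metric spaces are given by a carrier \<open>Z\<close> and a distance function \<open>d\<close>, as in the locale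
  \<^locale>\<open>Metric_space\<close>, because spaces of classes of maps and spaces of curves occur as targets.
  Maps defined on a set are represented by extensional functions.
\<close>

section \<open>Spaces of measurable maps with values in a metric space\<close>

definition borel_metric :: "'z set \<Rightarrow> ('z \<Rightarrow> 'z \<Rightarrow> real) \<Rightarrow> 'z measure" where
  "borel_metric Z d = sigma Z {U. openin (Metric_space.mtopology Z d) U}"

definition L0s :: "'y measure \<Rightarrow> 'z set \<Rightarrow> ('z \<Rightarrow> 'z \<Rightarrow> real) \<Rightarrow> ('y \<Rightarrow> 'z) set" where
  "L0s Y Z d = {f \<in> space Y \<rightarrow>\<^sub>E Z. f \<in> measurable Y (borel_metric Z d) \<and>
     separable_space (subtopology (Metric_space.mtopology Z d) (f ` space Y))}"

text \<open>
  The map \<open>f\<close> below only needs to take values in \<open>Z\<close> almost everywhere: the class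
  consists of all maps from \<open>Y\<close> to \<open>Z\<close> that agree with \<open>f\<close> almost everywhere.
\<close>
definition cls :: "'y measure \<Rightarrow> 'z set \<Rightarrow> ('y \<Rightarrow> 'z) \<Rightarrow> ('y \<Rightarrow> 'z) set" where
  "cls Y Z f = {g \<in> space Y \<rightarrow>\<^sub>E Z. AE y in Y. g y = f y}"

definition L0 :: "'y measure \<Rightarrow> 'z set \<Rightarrow> ('z \<Rightarrow> 'z \<Rightarrow> real) \<Rightarrow> ('y \<Rightarrow> 'z) set set" where
  "L0 Y Z d = cls Y Z ` L0s Y Z d"

definition rep :: "'y measure \<Rightarrow> 'z set \<Rightarrow> ('z \<Rightarrow> 'z \<Rightarrow> real) \<Rightarrow> ('y \<Rightarrow> 'z) set \<Rightarrow> 'y \<Rightarrow> 'z" where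
  "rep Y Z d F = (SOME f. f \<in> F \<and> f \<in> L0s Y Z d)"

definition int_dist_powr ::
    "'y measure \<Rightarrow> ('z \<Rightarrow> 'z \<Rightarrow> real) \<Rightarrow> real \<Rightarrow> ('y \<Rightarrow> 'z) \<Rightarrow> ('y \<Rightarrow> 'z) \<Rightarrow> ennreal" where
  "int_dist_powr Y d p f g = (\<integral>\<^sup>+ y. ennreal (d (f y) (g y) powr p) \<partial>Y)"

text \<open>The distance $(\int_Y d(f,g)^p)^{1/p}$, first for maps, then for classes.\<close>
definition map_dist ::
    "'y measure \<Rightarrow> ('z \<Rightarrow> 'z \<Rightarrow> real) \<Rightarrow> real \<Rightarrow> ('y \<Rightarrow> 'z) \<Rightarrow> ('y \<Rightarrow> 'z) \<Rightarrow> real" where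
  "map_dist Y d p f g = enn2real (int_dist_powr Y d p f g) powr (1 / p)"

definition Lp_dist :: "'y measure \<Rightarrow> 'z set \<Rightarrow> ('z \<Rightarrow> 'z \<Rightarrow> real) \<Rightarrow> real \<Rightarrow>
    ('y \<Rightarrow> 'z) set \<Rightarrow> ('y \<Rightarrow> 'z) set \<Rightarrow> real" where
  "Lp_dist Y Z d p F G = map_dist Y d p (rep Y Z d F) (rep Y Z d G)"

definition Lp :: "'y measure \<Rightarrow> 'z set \<Rightarrow> ('z \<Rightarrow> 'z \<Rightarrow> real) \<Rightarrow> real \<Rightarrow> ('y \<Rightarrow> 'z) set
    \<Rightarrow> ('y \<Rightarrow> 'z) set set" where
  "Lp Y Z d p G = {F \<in> L0 Y Z d. int_dist_powr Y d p (rep Y Z d F) (rep Y Z d G) < \<infinity>}"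

text \<open>The space $L^p(I,Z)$, whose base point is any constant map.\<close>
definition LpI :: "real set \<Rightarrow> 'z set \<Rightarrow> ('z \<Rightarrow> 'z \<Rightarrow> real) \<Rightarrow> real \<Rightarrow> (real \<Rightarrow> 'z) set set" where
  "LpI I Z d p = (\<Union>z\<in>Z. Lp (lebesgue_on I) Z d p (cls (lebesgue_on I) Z (\<lambda>_. z)))"

text \<open>
  Post-composition of classes with a map \<open>\<phi>\<close> from \<open>D\<close> to \<open>W\<close>; a compatible representative
  is one with values in the domain \<open>D\<close> of \<open>\<phi>\<close>.
\<close>
definition compatible :: "'y measure \<Rightarrow> 'z set \<Rightarrow> ('y \<Rightarrow> 'z) set \<Rightarrow> ('y \<Rightarrow> 'z) \<Rightarrow> bool" where
  "compatible Y D F f \<longleftrightarrow> f \<in> F \<and> f \<in> space Y \<rightarrow> D"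

definition push :: "'y measure \<Rightarrow> 'z set \<Rightarrow> 'w set \<Rightarrow> ('z \<Rightarrow> 'w) \<Rightarrow> ('y \<Rightarrow> 'z) set \<Rightarrow> ('y \<Rightarrow> 'w) set" where
  "push Y D W \<phi> F = cls Y W (\<phi> \<circ> (SOME f. compatible Y D F f))"

definition isometric_mapping ::
    "'x set \<Rightarrow> ('x \<Rightarrow> 'x \<Rightarrow> real) \<Rightarrow> 'y set \<Rightarrow> ('y \<Rightarrow> 'y \<Rightarrow> real) \<Rightarrow> ('x \<Rightarrow> 'y) \<Rightarrow> bool" where
  "isometric_mapping X dX Y dY \<phi> \<longleftrightarrow>
     \<phi> \<in> X \<rightarrow> Y \<and> (\<forall>x\<in>X. \<forall>x'\<in>X. dY (\<phi> x) (\<phi> x') = dX x x')"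

definition isometry ::
    "'x set \<Rightarrow> ('x \<Rightarrow> 'x \<Rightarrow> real) \<Rightarrow> 'y set \<Rightarrow> ('y \<Rightarrow> 'y \<Rightarrow> real) \<Rightarrow> ('x \<Rightarrow> 'y) \<Rightarrow> bool" where
  "isometry X dX Y dY \<phi> \<longleftrightarrow> isometric_mapping X dX Y dY \<phi> \<and> \<phi> ` X = Y"

section \<open>The product measure\<close>

text \<open>
  The library's \<^const>\<open>pair_measure\<close> is defined by iterated integration and is only useful
  for sigma-finite factors. For arbitrary factors we apply Caratheodory's process to the
  outer measure generated by measurable rectangles.
\<close>
definition rectangle_outer :: "'a measure \<Rightarrow> 'b measure \<Rightarrow> ('a \<times> 'b) set \<Rightarrow> ennreal" where
  "rectangle_outer A B E =
     (INF (X, Y) \<in> {(X :: nat \<Rightarrow> 'a set, Y :: nat \<Rightarrow> 'b set).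
         range X \<subseteq> sets A \<and> range Y \<subseteq> sets B \<and> E \<subseteq> (\<Union>n. X n \<times> Y n)}.
       \<Sum>n. emeasure A (X n) * emeasure B (Y n))"

definition caratheodory_product :: "'a measure \<Rightarrow> 'b measure \<Rightarrow> ('a \<times> 'b) measure" where
  "caratheodory_product A B =
     (let \<Omega> = space A \<times> space B in
       measure_of \<Omega> (lambda_system \<Omega> (Pow \<Omega>) (rectangle_outer A B)) (rectangle_outer A B))"

section \<open>Absolutely continuous curves\<close>

definition AC :: "real set \<Rightarrow> 'x set \<Rightarrow> ('x \<Rightarrow> 'x \<Rightarrow> real) \<Rightarrow> real \<Rightarrow> (real \<Rightarrow> 'x) set" where
  "AC I X d p = {c \<in> I \<rightarrow>\<^sub>E X. \<exists>m :: real \<Rightarrow> real.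
     m \<in> borel_measurable (lebesgue_on I) \<and>
     (\<integral>\<^sup>+ t. ennreal (\<bar>m t\<bar> powr p) \<partial>lebesgue_on I) < \<infinity> \<and>
     (\<forall>s\<in>I. \<forall>t\<in>I. s \<le> t \<longrightarrow> d (c s) (c t) \<le> (LINT r:{s..t}|lebesgue. m r))}"

definition metric_deriv :: "real set \<Rightarrow> ('x \<Rightarrow> 'x \<Rightarrow> real) \<Rightarrow> (real \<Rightarrow> 'x) \<Rightarrow> real \<Rightarrow> real" where
  "metric_deriv I d c t = Lim (at t within I) (\<lambda>s. d (c s) (c t) / \<bar>s - t\<bar>)"

section \<open>The section maps and the induced maps\<close>

context
  fixes I :: "real set" and M :: "'m measure"
    and N :: "'n set" and d :: "'n \<Rightarrow> 'n \<Rightarrow> real" and p :: real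
begin

definition h_hat :: "('m \<Rightarrow> 'n) set \<Rightarrow> (real \<times> 'm \<Rightarrow> 'n) set" where
  "h_hat h = cls (caratheodory_product (lebesgue_on I) M) N (\<lambda>(t, x). rep M N d h x)"

text \<open>
  The class of the map sending \<open>x\<close> to the constant curve \<open>h(x)\<close>, with values in $L^p(I,N)$
  and in $\mathcal{AC}^p(I,N)$, respectively.
\<close>
definition h_const :: "('m \<Rightarrow> 'n) set \<Rightarrow> ('m \<Rightarrow> (real \<Rightarrow> 'n) set) set" where
  "h_const h = cls M (LpI I N d p) (\<lambda>x. cls (lebesgue_on I) N (\<lambda>t. rep M N d h x))"

definition h_const_AC :: "('m \<Rightarrow> 'n) set \<Rightarrow> ('m \<Rightarrow> real \<Rightarrow> 'n) set" where
  "h_const_AC h = cls M (AC I N d p) (\<lambda>x. \<lambda>t\<in>I. rep M N d h x)"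

definition Lp_prod :: "('m \<Rightarrow> 'n) set \<Rightarrow> (real \<times> 'm \<Rightarrow> 'n) set set" where
  "Lp_prod h = Lp (caratheodory_product (lebesgue_on I) M) N d p (h_hat h)"

definition sec_I :: "('m \<Rightarrow> 'n) set \<Rightarrow> (real \<times> 'm \<Rightarrow> 'n) set \<Rightarrow> (real \<Rightarrow> ('m \<Rightarrow> 'n) set) set" where
  "sec_I h F = cls (lebesgue_on I) (Lp M N d p h)
     (\<lambda>t. cls M N (\<lambda>x. rep (caratheodory_product (lebesgue_on I) M) N d F (t, x)))"

definition sec_M :: "(real \<times> 'm \<Rightarrow> 'n) set \<Rightarrow> ('m \<Rightarrow> (real \<Rightarrow> 'n) set) set" where
  "sec_M F = cls M (LpI I N d p)
     (\<lambda>x. cls (lebesgue_on I) N (\<lambda>t. rep (caratheodory_product (lebesgue_on I) M) N d F (t, x)))"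

definition i_bar :: "('m \<Rightarrow> 'n) set \<Rightarrow> (real \<Rightarrow> ('m \<Rightarrow> 'n) set) set \<Rightarrow> ('m \<Rightarrow> (real \<Rightarrow> 'n) set) set" where
  "i_bar h = sec_M \<circ> inv_into (Lp_prod h) (sec_I h)"

definition q_map :: "(real \<Rightarrow> 'n) \<Rightarrow> (real \<Rightarrow> 'n) set" where
  "q_map c = cls (lebesgue_on I) N c"

definition AC_Lp :: "('m \<Rightarrow> 'n) set \<Rightarrow> (real \<Rightarrow> ('m \<Rightarrow> 'n) set) set" where
  "AC_Lp h = AC I (Lp M N d p h) (Lp_dist M N d p) p"

definition Q_map :: "('m \<Rightarrow> 'n) set \<Rightarrow> (real \<Rightarrow> ('m \<Rightarrow> 'n) set) \<Rightarrow> (real \<Rightarrow> ('m \<Rightarrow> 'n) set) set" where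
  "Q_map h c = cls (lebesgue_on I) (Lp M N d p h) c"

text \<open>The space $L^p_{\underline h}(M, \mathcal{AC}^p(I,N))$.\<close>
definition Lp_AC :: "('m \<Rightarrow> 'n) set \<Rightarrow> ('m \<Rightarrow> real \<Rightarrow> 'n) set set" where
  "Lp_AC h = Lp M (AC I N d p) (map_dist (lebesgue_on I) d p) p (h_const_AC h)"

text \<open>The maps $(q_p)_*$, $(q_p^{-1})_*$ and $(e_{t,p})_*$.\<close>
definition q_push :: "('m \<Rightarrow> real \<Rightarrow> 'n) set \<Rightarrow> ('m \<Rightarrow> (real \<Rightarrow> 'n) set) set" where
  "q_push = push M (AC I N d p) (LpI I N d p) q_map"

definition q_inv_push :: "('m \<Rightarrow> (real \<Rightarrow> 'n) set) set \<Rightarrow> ('m \<Rightarrow> real \<Rightarrow> 'n) set" where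
  "q_inv_push = push M (q_map ` AC I N d p) (AC I N d p) (inv_into (AC I N d p) q_map)"

definition e_push :: "real \<Rightarrow> ('m \<Rightarrow> real \<Rightarrow> 'n) set \<Rightarrow> ('m \<Rightarrow> 'n) set" where
  "e_push t = push M (AC I N d p) N (\<lambda>c. c t)"

definition i_tilde :: "('m \<Rightarrow> 'n) set \<Rightarrow> (real \<Rightarrow> ('m \<Rightarrow> 'n) set) \<Rightarrow> ('m \<Rightarrow> real \<Rightarrow> 'n) set" where
  "i_tilde h = q_inv_push \<circ> i_bar h \<circ> Q_map h"

end

end

(*
  A curve of classes is lifted to a jointly measurable family of curves. For an absolutely
  continuous c : I -> L^p_h(M,N) with representatives at the dyadic times, the discrete p-energies
  of the curves t |-> c(t)(x) increase under refinement, and their integrals over M are bounded by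
  the p-energy of c. Hence for almost every x the dyadic values extend, N being complete, to a curve
  in AC^p(I,N), and by Fatou's lemma these curves represent c(t) for every t. The formula for
  |c'|^p follows from Fatou's lemma in one direction and from Minkowski's integral inequality
  in the other; the latter also shows that a family of curves of finite energy comes from a curve
  in AC^p(I, L^p_h(M,N)).

  Without sigma-finiteness of M, Tonelli's theorem is applied on the sigma-finite set of points
  where a family differs from h: every class at finite distance from h has a representative that
  is measurable for the product sigma-algebra and equals h outside such a set.

  In the existence of metric derivatives, the speed of a curve is the supremum of the derivatives
  of its distances to a countable dense set of points.
*)
theory Submission
  imports Defs
begin

section \<open>Separably valued measurable maps and their classes\<close>

text \<open>Two obstacles shape the constructions. Measurability of a map into a space of classes
  includes separability of its range, although no sigma-algebra is assumed to be countably
  generated. It is obtained from single product sets: the sections of a set of a product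
  sigma-algebra form a separable family for the measure of the symmetric difference. Countably many
  level sets of a map, controlled together with the distances of its sections to the base point,
  then force convergence in L^p. Absolute continuity has to be available before any density is
  known, since a lifted curve exists at first only at dyadic times. It is therefore expressed by
  sums over cells of one dyadic level, bounded by \<theta> times their total length plus an error e;
  an energy bound supplies \<theta> for every e > 0 because p > 1. The densities are Radon-Nikodym
  derivatives of Stieltjes measures of the variation, and the pointwise statements follow from
  Lebesgue's differentiation theorem, which is derived from Vitali's covering theorem.\<close>

locale metric_target = Metric_space Z d for Z :: "'z set" and d :: "'z => 'z => real"
begin

text \<open>For every z in D and every n one point of S at distance below 1/(n+1) from z is
  selected, provided there is one. These countably many points lie in S itself, unlike those of D,
  and are dense by the triangle inequality.\<close>

lemma countable_dense_in_subset:
 assumes D: "countable D" "D \<subseteq> Z" and S: "S \<subseteq> Z"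
  and dense: "!!y e. y \<in> S ==> e > 0 ==> \<exists>z\<in>D. d y z < e"
 obtains C where "countable C" "C \<subseteq> S" "!!y e. y \<in> S ==> e > 0 ==> \<exists>z\<in>C. d y z < e"
proof
 define P where "P z n y \<longleftrightarrow> y \<in> S & d y z < inverse (real (Suc n))" for z n y
 define w where "w z n = (SOME y. P z n y)" for z n
 let ?C = "{w z n |z n. z \<in> D & (EX y. P z n y)}"
 have wP: "P z n (w z n)" if "EX y. P z n y" for z n
  unfolding w_def using that by (rule someI_ex)
 have "?C \<subseteq> (%(z, n). w z n) ` (D \<times> UNIV)" by auto
 thus "countable ?C" by (rule countable_subset) (simp add: D)
 show "?C \<subseteq> S" using wP by (auto simp: P_def)
 fix y and e :: real assume y: "y \<in> S" and e: "e > 0"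
 obtain n where n: "inverse (real (Suc n)) < e / 2" using reals_Archimedean[of "e / 2"] e by auto
 obtain z where z: "z \<in> D" "d y z < inverse (real (Suc n))" using dense[OF y, of "inverse (real (Suc n))"] by auto
 have ex: "EX y. P z n y" using z y by (auto simp: P_def)
 have "d y (w z n) <= d y z + d (w z n) z"
  using triangle'[of y z "w z n"] y z(1) wP[OF ex] S D by (auto simp: P_def)
 also have "\<dots> < e" using z(2) wP[OF ex] n by (auto simp: P_def)
 finally show "\<exists>z\<in>?C. d y z < e" using z(1) ex by blast
qed

text \<open>The criterion by which membership is verified below. An open set meets the range of f in
  a countable union of traces of balls with centre in D and rational radius, so countably many
  distance functions decide measurability. D may lie outside the range;
  \<open>countable_dense_in_subset\<close> moves it inside.\<close>

lemma L0sI: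
 assumes f: "f \<in> space Y \<rightarrow>\<^sub>E Z" and D: "countable D" "D \<subseteq> Z"
  and dense: "!!y e. y \<in> space Y ==> e > 0 ==> \<exists>z\<in>D. d (f y) z < e"
  and meas: "!!z. z \<in> D ==> (%y. d (f y) z) \<in> borel_measurable Y"
 shows "f \<in> L0s Y Z d"
proof -
 have fZ: "f y \<in> Z" if "y \<in> space Y" for y using f that by auto
 have "f \<in> measurable Y (borel_metric Z d)"
  unfolding borel_metric_def
 proof (rule measurable_measure_of)
  show "{U. openin mtopology U} \<subseteq> Pow Z" using openin_subset by fastforce
  show "f \<in> space Y \<rightarrow> Z" using fZ by auto
  fix U assume "U \<in> {U. openin mtopology U}"
  hence U: "U \<subseteq> Z" "!!x. x \<in> U ==> \<exists>r>0. mball x r \<subseteq> U" by (auto simp: openin_mtopology)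
  define J where "J = {(z, q). z \<in> D & q \<in> \<rat> & mball z q \<subseteq> U}"
  have "countable J"
   by (rule countable_subset[of _ "D \<times> \<rat>"]) (auto simp: J_def D countable_rat)
  have eq: "f -` U \<inter> space Y = (\<Union>(z, q)\<in>J. {y \<in> space Y. d (f y) z < q})"
  proof (intro equalityI subsetI)
   fix y assume y: "y \<in> f -` U \<inter> space Y"
   hence "f y \<in> U" by simp
   from U(2)[OF this] obtain r where r: "r > 0" "mball (f y) r \<subseteq> U" by auto
   obtain q where q: "q \<in> \<rat>" "0 < q" "q < r / 2" using Rats_dense_in_real[of 0 "r / 2"] r by auto
   obtain z where z: "z \<in> D" "d (f y) z < q" using dense[of y q] y q by auto
   have "mball z q \<subseteq> mball (f y) r"
    using z q y fZ commute[of z "f y"] by (intro mball_subset) auto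
   hence "(z, q) \<in> J" using z q r by (auto simp: J_def)
   thus "y \<in> (\<Union>(z, q)\<in>J. {y \<in> space Y. d (f y) z < q})" using z y by auto
  next
   fix y assume "y \<in> (\<Union>(z, q)\<in>J. {y \<in> space Y. d (f y) z < q})"
   then obtain z q where zq: "(z, q) \<in> J" "y \<in> space Y" "d (f y) z < q" by auto
   hence "f y \<in> mball z q" using D fZ by (auto simp: J_def commute)
   thus "y \<in> f -` U \<inter> space Y" using zq by (auto simp: J_def)
  qed
  show "f -` U \<inter> space Y \<in> sets Y"
   unfolding eq
  proof (rule sets.countable_UN'[OF \<open>countable J\<close>], safe)
   fix z q assume "(z, q) \<in> J"
   hence [measurable]: "(%y. d (f y) z) \<in> borel_measurable Y" using meas by (auto simp: J_def)
   show "{y \<in> space Y. d (f y) z < q} \<in> sets Y" by measurable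
  qed
 qed
 moreover have "separable_space (subtopology mtopology (f ` space Y))"
 proof -
  have sub: "f ` space Y \<subseteq> Z" using fZ by auto
  have "\<exists>z\<in>D. d y z < e" if "y \<in> f ` space Y" "e > 0" for y e using that dense by auto
  from countable_dense_in_subset[OF D sub this]
  obtain C where C: "countable C" "C \<subseteq> f ` space Y" "!!y e. y \<in> f ` space Y ==> e > 0 ==> \<exists>z\<in>C. d y z < e"
   by blast
  have "f ` space Y \<subseteq> mtopology closure_of C"
  proof
   fix y assume y: "y \<in> f ` space Y"
   have "\<exists>z\<in>C. z \<in> mball y r" if "r > 0" for r
    using C(3)[OF y that] C(2) sub y by (auto simp: subset_iff)
   thus "y \<in> mtopology closure_of C" unfolding metric_closure_of using y sub by blast
  qed
  thus ?thesis
   unfolding separable_space_def using C(1,2) sub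
   by (intro exI[of _ C]) (auto simp: closure_of_subtopology Int_absorb2 Int_absorb1)
 qed
 ultimately show ?thesis using f by (simp add: L0s_def)
qed

lemma L0s_ext: "f \<in> L0s Y Z d ==> f \<in> space Y \<rightarrow>\<^sub>E Z"
 by (simp add: L0s_def)

lemma L0s_in: "f \<in> L0s Y Z d ==> y \<in> space Y ==> f y \<in> Z"
 by (auto simp: L0s_def)

lemma L0s_dense:
 assumes "f \<in> L0s Y Z d"
 obtains C where "countable C" "C \<subseteq> f ` space Y" "C \<subseteq> Z"
  "!!y e. y \<in> space Y ==> e > 0 ==> \<exists>z\<in>C. d (f y) z < e"
proof -
 have sub: "f ` space Y \<subseteq> Z" using assms by (auto simp: L0s_def)
 obtain C where C: "countable C" "C \<subseteq> f ` space Y"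
   "(subtopology mtopology (f ` space Y)) closure_of C = f ` space Y"
  using assms sub by (auto simp: L0s_def separable_space_def Int_absorb1)
 have "\<exists>z\<in>C. d (f y) z < e" if "y \<in> space Y" "e > 0" for y e
 proof -
  have "f y \<in> mtopology closure_of C" using arg_cong[OF C(3), of "%S. f y \<in> S"] that(1)
   unfolding closure_of_subtopology by (simp add: C(2) Int_absorb1)
  thus ?thesis using that(2) unfolding metric_closure_of by auto
 qed
 thus ?thesis using C(1,2) sub by (intro that[of C]) auto
qed

lemma L0s_dist_const:
 assumes f: "f \<in> L0s Y Z d" and z: "z \<in> Z"
 shows "(%y. d (f y) z) \<in> borel_measurable Y"
 unfolding borel_measurable_iff_less
proof
 fix a :: real
 have "{U. openin mtopology U} \<subseteq> Pow Z" by (rule subsetI) (metis CollectD PowI openin_subset topspace_mtopology)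
 hence "mball z a \<in> sets (borel_metric Z d)" unfolding borel_metric_def
  by (subst sets_measure_of) (auto intro: sigma_sets.Basic)
 moreover have "f \<in> measurable Y (borel_metric Z d)" using f by (simp add: L0s_def)
 ultimately have "f -` mball z a \<inter> space Y \<in> sets Y" by (rule measurable_sets[rotated])
 moreover have "f -` mball z a \<inter> space Y = {w \<in> space Y. d (f w) z < a}"
  using z L0s_in[OF f] by (auto simp: commute[of z])
 ultimately show "{w \<in> space Y. d (f w) z < a} \<in> sets Y" by simp
qed

text \<open>For nonseparable Z the metric need not be measurable for the product of the Borel
  sigma-algebras. The separable range of f replaces this: d(f, g) < a holds iff d(f, z) + d(g, z) <
  a for some z of a countable set dense in that range.\<close>

lemma L0s_dist_measurable:
 assumes f: "f \<in> L0s Y Z d" and g: "g \<in> L0s Y Z d"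
 shows "(%y. d (f y) (g y)) \<in> borel_measurable Y"
proof -
 obtain C where C: "countable C" "C \<subseteq> Z" "!!y e. y \<in> space Y ==> e > 0 ==> \<exists>z\<in>C. d (f y) z < e"
  using L0s_dense[OF f] by metis
 show ?thesis unfolding borel_measurable_iff_less
 proof
  fix a :: real
  have eq: "{y \<in> space Y. d (f y) (g y) < a} =
    (\<Union>z\<in>C. {y \<in> space Y. d (f y) z + d (g y) z < a})"
  proof (intro equalityI subsetI)
   fix y assume y: "y \<in> {y \<in> space Y. d (f y) (g y) < a}"
   define e where "e = (a - d (f y) (g y)) / 2"
   have "e > 0" using y by (auto simp: e_def)
   then obtain z where z: "z \<in> C" "d (f y) z < e" using C y by blast
   have "d (g y) z <= d (f y) (g y) + d (f y) z"
    using triangle[of "g y" "f y" z] y z C L0s_in[OF f] L0s_in[OF g] by (auto simp: commute)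
   hence "d (f y) z + d (g y) z < a" using z(2) unfolding e_def by (simp add: field_simps)
   thus "y \<in> (\<Union>z\<in>C. {y \<in> space Y. d (f y) z + d (g y) z < a})" using z y by auto
  next
   fix y assume "y \<in> (\<Union>z\<in>C. {y \<in> space Y. d (f y) z + d (g y) z < a})"
   then obtain z where z: "z \<in> C" "y \<in> space Y" "d (f y) z + d (g y) z < a" by auto
   hence "d (f y) (g y) <= d (f y) z + d (g y) z"
    using triangle'[of "f y" z "g y"] C L0s_in[OF f] L0s_in[OF g] by auto
   thus "y \<in> {y \<in> space Y. d (f y) (g y) < a}" using z by auto
  qed
  show "{y \<in> space Y. d (f y) (g y) < a} \<in> sets Y"
   unfolding eq
  proof (rule sets.countable_UN''[OF C(1)])
   fix z assume "z \<in> C"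
   hence zZ: "z \<in> Z" using C(2) by auto
   note [measurable] = L0s_dist_const[OF f zZ] L0s_dist_const[OF g zZ]
   show "{y \<in> space Y. d (f y) z + d (g y) z < a} \<in> sets Y" by measurable
  qed
 qed
qed

text \<open>The countable sets that approximate the ranges of the maps \<open>fn n\<close> together
  approximate the range of the limit, and distances to a fixed point pass to the limit.\<close>

lemma L0s_limit:
 assumes fn: "!!n. fn n \<in> L0s Y Z d" and f: "f \<in> space Y \<rightarrow>\<^sub>E Z"
  and lim: "!!y. y \<in> space Y ==> (%n. d (fn n y) (f y)) \<longlonglongrightarrow> 0"
 shows "f \<in> L0s Y Z d"
proof -
 have "EX C. countable C & C \<subseteq> Z & (\<forall>y\<in>space Y. \<forall>e>0. \<exists>z\<in>C. d (fn n y) z < e)" for n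
  using L0s_dense[OF fn[of n]] by metis
 then obtain C where C: "!!n. countable (C n)" "!!n. C n \<subseteq> Z"
   "!!n y e. y \<in> space Y ==> e > 0 ==> \<exists>z\<in>C n. d (fn n y) z < e" by metis
 have in1: "f y \<in> Z" "fn n y \<in> Z" if "y \<in> space Y" for y n
  using f that L0s_in[OF fn] by auto
 show ?thesis
 proof (rule L0sI[OF f, where D = "\<Union>n. C n"])
  show "countable (\<Union>n. C n)" "(\<Union>n. C n) \<subseteq> Z" using C by auto
  fix y and e :: real assume y: "y \<in> space Y" "e > 0"
  have "\<forall>\<^sub>F n in sequentially. d (fn n y) (f y) < e / 2"
   using lim[OF y(1)] y(2) by (intro order_tendstoD) auto
  then obtain n where n: "d (fn n y) (f y) < e / 2" by (auto simp: eventually_sequentially)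
  obtain z where z: "z \<in> C n" "d (fn n y) z < e / 2" using C(3)[OF y(1), of "e/2" n] y by auto
  hence "d (f y) z < e"
   using triangle''[of "f y" "fn n y" z] n in1[OF y(1)] C(2) z by (smt (verit) subsetD field_sum_of_halves)
  thus "\<exists>z\<in>\<Union>n. C n. d (f y) z < e" using z by auto
 next
  fix z assume "z \<in> (\<Union>n. C n)"
  hence z: "z \<in> Z" using C by auto
  show "(%y. d (f y) z) \<in> borel_measurable Y"
  proof (rule borel_measurable_LIMSEQ_real)
   fix y assume y: "y \<in> space Y"
   show "(%n. d (fn n y) z) \<longlonglongrightarrow> d (f y) z"
   proof (rule LIM_zero_cancel, rule Lim_null_comparison[OF _ lim[OF y]], rule always_eventually, rule allI)
    fix n
    show "norm (d (fn n y) z - d (f y) z) <= d (fn n y) (f y)"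
     using mdist_reverse_triangle[of "fn n y" z "f y"] in1[OF y] z by (simp add: commute)
   qed
  next
   show "(%y. d (fn n y) z) \<in> borel_measurable Y" for n
    by (rule L0s_dist_const[OF fn z])
  qed
 qed
qed

lemma L0s_compose:
 assumes f: "f \<in> L0s Y Z d" and \<phi>: "\<phi> \<in> measurable W Y"
 shows "(\<lambda>w\<in>space W. f (\<phi> w)) \<in> L0s W Z d"
proof -
 have sp: "\<phi> w \<in> space Y" if "w \<in> space W" for w using \<phi> that by (rule measurable_space)
 obtain C where C: "countable C" "C \<subseteq> Z" "!!y e. y \<in> space Y ==> e > 0 ==> \<exists>z\<in>C. d (f y) z < e"
  using L0s_dense[OF f] by metis
 show ?thesis
 proof (rule L0sI[where D = C])
  show "(\<lambda>w\<in>space W. f (\<phi> w)) \<in> space W \<rightarrow>\<^sub>E Z" using sp L0s_in[OF f] by auto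
  show "countable C" "C \<subseteq> Z" by fact+
  show "\<exists>z\<in>C. d ((\<lambda>w\<in>space W. f (\<phi> w)) y) z < e" if "y \<in> space W" "e > 0" for y e
   using C(3)[OF sp[OF that(1)] that(2)] that by simp
  fix z assume "z \<in> C"
  hence "(%y. d (f y) z) \<in> borel_measurable Y" using L0s_dist_const[OF f] C by auto
  from measurable_compose[OF \<phi> this]
  show "(%y. d ((\<lambda>w\<in>space W. f (\<phi> w)) y) z) \<in> borel_measurable W"
   by (rule measurable_cong[THEN iffD1, rotated]) auto
 qed
qed

text \<open>Gluing along a countable partition. It yields step functions in time, with k the index
  of a dyadic cell, and maps rounded to a dense sequence, with k the index of a nearby
  member.\<close>

lemma L0s_pieces:
 fixes k :: "'y => nat"
 assumes F: "!!i. F i \<in> L0s Y Z d" and k: "k \<in> measurable Y (count_space UNIV)"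
 shows "(\<lambda>y\<in>space Y. F (k y) y) \<in> L0s Y Z d"
proof -
 have "EX C. countable C & C \<subseteq> Z & (\<forall>y\<in>space Y. \<forall>e>0. \<exists>z\<in>C. d (F n y) z < e)" for n
  using L0s_dense[OF F[of n]] by metis
 then obtain C where C: "!!n. countable (C n)" "!!n. C n \<subseteq> Z"
   "!!n y e. y \<in> space Y ==> e > 0 ==> \<exists>z\<in>C n. d (F n y) z < e" by metis
 show ?thesis
 proof (rule L0sI[where D = "\<Union>n. C n"])
  show "(\<lambda>y\<in>space Y. F (k y) y) \<in> space Y \<rightarrow>\<^sub>E Z" using L0s_in[OF F] by auto
  show "countable (\<Union>n. C n)" "(\<Union>n. C n) \<subseteq> Z" using C by auto
  show "\<exists>z\<in>\<Union>n. C n. d ((\<lambda>y\<in>space Y. F (k y) y) y) z < e" if "y \<in> space Y" "e > 0" for y e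
   using C(3)[OF that, of "k y"] that by auto
  fix z assume "z \<in> (\<Union>n. C n)"
  hence "z \<in> Z" using C by auto
  hence "(%y. d (F i y) z) \<in> borel_measurable Y" for i using L0s_dist_const[OF F] by auto
  hence "(%y. d (F (k y) y) z) \<in> borel_measurable Y"
   by (rule measurable_compose_countable[OF _ k])
  thus "(%y. d ((\<lambda>y\<in>space Y. F (k y) y) y) z) \<in> borel_measurable Y"
   by (rule measurable_cong[THEN iffD1, rotated]) auto
 qed
qed

lemma L0s_if:
 assumes f: "f \<in> L0s Y Z d" and g: "g \<in> L0s Y Z d" and P: "{y \<in> space Y. P y} \<in> sets Y"
 shows "(\<lambda>y\<in>space Y. if P y then f y else g y) \<in> L0s Y Z d"
proof -
 note [measurable] = P
 have "(%y. if P y then 0 else Suc 0) \<in> measurable Y (count_space UNIV)" by measurable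
 from L0s_pieces[of "%i. if i = 0 then f else g", OF _ this] f g
 have "(\<lambda>y\<in>space Y. (if (if P y then 0 else Suc 0) = 0 then f else g) y) \<in> L0s Y Z d" by auto
 moreover have "(\<lambda>y\<in>space Y. (if (if P y then 0 else Suc 0) = 0 then f else g) y) = 
  (\<lambda>y\<in>space Y. if P y then f y else g y)" by (rule restrict_ext) auto
 ultimately show ?thesis by simp
qed

lemma L0s_const: "z \<in> Z ==> (\<lambda>y\<in>space Y. z) \<in> L0s Y Z d"
proof (rule L0sI[where D = "{z}"])
 show "(%y. d ((\<lambda>y\<in>space Y. z) y) w) \<in> borel_measurable Y" for w
  by (subst measurable_cong[where g = "%_. d z w"]) auto
qed auto

end

section \<open>Classes modulo almost everywhere equality and their representatives\<close>

lemma cls_self: "f \<in> space Y \<rightarrow>\<^sub>E Z ==> f \<in> cls Y Z f"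
 by (simp add: cls_def)

lemma cls_cong_AE: "AE y in Y. f y = g y ==> cls Y Z f = cls Y Z g"
 unfolding cls_def by (intro Collect_cong conj_cong refl) (auto elim: eventually_elim2)

lemma cls_cong: "(!!y. y \<in> space Y ==> f y = g y) ==> cls Y Z f = cls Y Z g"
 by (rule cls_cong_AE) simp

lemma cls_eq_iff: "f \<in> space Y \<rightarrow>\<^sub>E Z ==> cls Y Z f = cls Y Z g \<longleftrightarrow> (AE y in Y. f y = g y)"
 using cls_self[of f Y Z] cls_cong_AE[of f g Y Z] cls_def[of Y Z g] by blast

lemma cls_memD: "g \<in> cls Y Z f ==> (AE y in Y. g y = f y)"
 by (simp add: cls_def)

lemma cls_in_L0: "f \<in> L0s Y Z d ==> cls Y Z f \<in> L0 Y Z d"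
 by (auto simp: L0_def)

lemma rep_in:
 assumes "F \<in> L0 Y Z d" shows "rep Y Z d F \<in> F" "rep Y Z d F \<in> L0s Y Z d"
proof -
 obtain f where "f \<in> L0s Y Z d" "F = cls Y Z f" using assms by (auto simp: L0_def)
 hence "f \<in> F & f \<in> L0s Y Z d" by (auto simp: L0s_def cls_self)
 hence "rep Y Z d F \<in> F & rep Y Z d F \<in> L0s Y Z d" unfolding rep_def by (rule someI[where P = "%f. f \<in> F & f \<in> L0s Y Z d"])
 thus "rep Y Z d F \<in> F" "rep Y Z d F \<in> L0s Y Z d" by auto
qed

lemma cls_rep: assumes "F \<in> L0 Y Z d" shows "cls Y Z (rep Y Z d F) = F"
proof -
 obtain f where f: "f \<in> L0s Y Z d" "F = cls Y Z f" using assms by (auto simp: L0_def)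
 have "AE y in Y. rep Y Z d F y = f y" using rep_in(1)[OF assms] f by (auto simp: cls_def)
 thus ?thesis using f cls_cong_AE by metis
qed

lemma rep_cls: assumes "f \<in> L0s Y Z d" shows "AE y in Y. rep Y Z d (cls Y Z f) y = f y"
 using rep_in(1)[OF cls_in_L0[OF assms]] by (rule cls_memD)

lemma int_dist_powr_cong_AE:
 assumes "AE y in Y. f y = f' y" "AE y in Y. g y = g' y"
 shows "int_dist_powr Y d p f g = int_dist_powr Y d p f' g'"
 unfolding int_dist_powr_def using assms by (intro nn_integral_cong_AE) (auto elim: eventually_elim2)

lemma map_dist_cong_AE:
 assumes "AE y in Y. f y = f' y" "AE y in Y. g y = g' y"
 shows "map_dist Y d p f g = map_dist Y d p f' g'"
 unfolding map_dist_def using int_dist_powr_cong_AE[OF assms] by simp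

lemma Lp_dist_cls:
 assumes "f \<in> L0s Y Z d" "g \<in> L0s Y Z d"
 shows "Lp_dist Y Z d p (cls Y Z f) (cls Y Z g) = map_dist Y d p f g"
 unfolding Lp_dist_def by (rule map_dist_cong_AE) (use assms rep_cls in auto)

lemma cls_in_Lp_iff:
 assumes "f \<in> L0s Y Z d" "g \<in> L0s Y Z d"
 shows "cls Y Z f \<in> Lp Y Z d p (cls Y Z g) \<longleftrightarrow> int_dist_powr Y d p f g < \<infinity>"
 unfolding Lp_def using int_dist_powr_cong_AE[OF rep_cls[OF assms(1)] rep_cls[OF assms(2)], of d p]
 by (simp add: cls_in_L0[OF assms(1)])

lemma Lp_in_L0: "F \<in> Lp Y Z d p G ==> F \<in> L0 Y Z d"
 by (simp add: Lp_def)

text \<open>Convexity of the p-th power, applied to u + v as the combination of u / l and v / (1 -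
  l) with weights l and 1 - l. The choice of l yields Minkowski's inequality; l = 1/2 yields the
  growth of energies under bisection.\<close>

lemma powr_convex_combination:
 fixes u v l p :: real
 assumes "1 < p" "0 <= u" "0 <= v" "0 < l" "l < 1"
 shows "(u + v) powr p <= l powr (1 - p) * u powr p + (1 - l) powr (1 - p) * v powr p"
proof -
 have 1: "l powr (1 - p) * u powr p = l * (u / l) powr p"
  using assms by (simp add: powr_divide powr_diff)
 have 2: "(1 - l) powr (1 - p) * v powr p = (1 - l) * (v / (1 - l)) powr p"
  using assms by (simp add: powr_divide powr_diff)
 \<comment> \<open>The exponent 1 - p is negative, so the factor is at least 1 for 0 < y < 1; this
   settles the case of a vanishing u or v.\<close>
 have small: "x powr p * y powr (1 - p) \<ge> x powr p" if "0 <= x" "0 < y" "y < 1" for x y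
 proof -
  have "y powr 0 <= y powr (1 - p)" using that assms by (intro powr_mono') auto
  thus ?thesis using that by (simp add: mult_le_cancel_left1)
 qed
 show ?thesis
 proof (cases "u = 0 \<or> v = 0")
  case True
  thus ?thesis using small[of u l] small[of v "1 - l"] assms by (auto simp: mult.commute)
 next
  case False
  hence uv: "u / l > 0" "v / (1 - l) > 0" using assms by auto
  have "((1 - l) *\<^sub>R (v / (1 - l)) + l *\<^sub>R (u / l)) powr p
    <= (1 - l) * (v / (1 - l)) powr p + l * (u / l) powr p"
   using convex_onD[OF powr_convex[of p], of l "v / (1 - l)" "u / l"] uv assms by auto
  thus ?thesis unfolding 1 2 using assms by (simp add: add.commute)
 qed
qed

text \<open>An integrated form of \<open>powr_convex_combination\<close>. Upper bounds U and V in
  place of the norms keep p-th roots of extended reals out of the argument.\<close>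

lemma nn_integral_Minkowski:
 fixes u v :: "'y => real"
 assumes p: "1 < p" and u [measurable]: "u \<in> borel_measurable Y" and v [measurable]: "v \<in> borel_measurable Y"
  and u0: "!!y. 0 <= u y" and v0: "!!y. 0 <= v y" and U: "0 <= U" and V: "0 <= V"
  and IU: "(\<integral>\<^sup>+ y. ennreal (u y powr p) \<partial>Y) <= ennreal (U powr p)"
  and IV: "(\<integral>\<^sup>+ y. ennreal (v y powr p) \<partial>Y) <= ennreal (V powr p)"
 shows "(\<integral>\<^sup>+ y. ennreal ((u y + v y) powr p) \<partial>Y) <= ennreal ((U + V) powr p)"
proof -
 have z: "AE y in Y. w y = 0" if [measurable]: "w \<in> borel_measurable Y" and "(\<integral>\<^sup>+ y. ennreal (w y powr p) \<partial>Y) <= ennreal (0 powr p)"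
  for w :: "'y => real"
 proof -
  have "(\<integral>\<^sup>+ y. ennreal (w y powr p) \<partial>Y) = 0" using that by simp
  hence "AE y in Y. ennreal (w y powr p) = 0" by (subst (asm) nn_integral_0_iff_AE) auto
  thus ?thesis by eventually_elim (auto simp: ennreal_eq_0_iff powr_eq_0_iff)
 qed
 consider "U = 0" | "V = 0" | "U > 0" "V > 0" using U V by linarith
 thus ?thesis
 proof cases
  case 1
  hence "AE y in Y. u y = 0" using z[OF u] IU by auto
  hence "(\<integral>\<^sup>+ y. ennreal ((u y + v y) powr p) \<partial>Y) = (\<integral>\<^sup>+ y. ennreal (v y powr p) \<partial>Y)"
   by (intro nn_integral_cong_AE) auto
  thus ?thesis using IV 1 by simp
 next
  case 2
  hence "AE y in Y. v y = 0" using z[OF v] IV by auto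
  hence "(\<integral>\<^sup>+ y. ennreal ((u y + v y) powr p) \<partial>Y) = (\<integral>\<^sup>+ y. ennreal (u y powr p) \<partial>Y)"
   by (intro nn_integral_cong_AE) auto
  thus ?thesis using IU 2 by simp
 next
  case 3
  \<comment> \<open>This l minimises l^(1-p) U^p + (1-l)^(1-p) V^p, and the minimum is (U + V)^p. It
    lies strictly between 0 and 1 only if U and V are positive, whence the case distinction.\<close>
  define l where "l = U / (U + V)"
  have l: "0 < l" "l < 1" "1 - l = V / (U + V)" using 3 by (auto simp: l_def field_simps)
  have "(\<integral>\<^sup>+ y. ennreal ((u y + v y) powr p) \<partial>Y)
    <= (\<integral>\<^sup>+ y. ennreal (l powr (1 - p)) * ennreal (u y powr p) + ennreal ((1 - l) powr (1 - p)) * ennreal (v y powr p) \<partial>Y)"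
   using powr_convex_combination[OF p u0 v0 l(1,2)]
   by (intro nn_integral_mono) (simp add: ennreal_mult[symmetric] ennreal_plus[symmetric] ennreal_leI del: ennreal_plus)
  also have "\<dots> = ennreal (l powr (1 - p)) * (\<integral>\<^sup>+ y. ennreal (u y powr p) \<partial>Y) +
    ennreal ((1 - l) powr (1 - p)) * (\<integral>\<^sup>+ y. ennreal (v y powr p) \<partial>Y)"
   by (subst nn_integral_add) (auto simp: nn_integral_cmult)
  also have "\<dots> <= ennreal (l powr (1 - p)) * ennreal (U powr p) + ennreal ((1 - l) powr (1 - p)) * ennreal (V powr p)"
   using IU IV by (intro add_mono mult_left_mono) auto
  also have "\<dots> = ennreal (l powr (1 - p) * U powr p + (1 - l) powr (1 - p) * V powr p)"
   by (simp add: ennreal_mult[symmetric] ennreal_plus[symmetric] del: ennreal_plus)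
  also have "l powr (1 - p) * U powr p + (1 - l) powr (1 - p) * V powr p = (U + V) powr p"
  proof -
   have *: "(W / (U + V)) powr (1 - p) * W powr p = W / (U + V) * (U + V) powr p" if "W > 0" for W
    using that 3 by (simp add: powr_divide powr_diff)
   have e1: "U / (U + V) + V / (U + V) = 1" using 3 by (simp flip: add_divide_distrib)
   show ?thesis unfolding l(3) unfolding l_def *[OF 3(1)] *[OF 3(2)]
    using e1 by (metis distrib_right mult_1)
  qed
  finally show ?thesis .
 qed
qed


section \<open>The metric space of p-integrable classes\<close>

locale Lp_target = metric_target Z d for Z :: "'z set" and d :: "'z => 'z => real" +
 fixes p :: real
 assumes p_gt_1: "1 < p"
begin

lemma map_dist_nonneg: "0 <= map_dist Y d p f g"
 by (simp add: map_dist_def)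

lemma map_dist_powr:
 assumes "int_dist_powr Y d p f g < \<infinity>"
 shows "ennreal (map_dist Y d p f g powr p) = int_dist_powr Y d p f g"
 using assms p_gt_1 by (simp add: map_dist_def powr_powr)

lemma map_dist_le:
 assumes "int_dist_powr Y d p f g <= ennreal (K powr p)" "0 <= K"
 shows "map_dist Y d p f g <= K"
proof -
 have "enn2real (int_dist_powr Y d p f g) <= K powr p" using assms by (simp add: enn2real_leI)
 hence "map_dist Y d p f g <= (K powr p) powr (1 / p)"
  unfolding map_dist_def using p_gt_1 by (intro powr_mono2) auto
 thus ?thesis using assms p_gt_1 by (simp add: powr_powr)
qed

lemma int_dist_powr_commute: "int_dist_powr Y d p f g = int_dist_powr Y d p g f"
 by (simp add: int_dist_powr_def commute)

lemma map_dist_commute: "map_dist Y d p f g = map_dist Y d p g f"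
 unfolding map_dist_def int_dist_powr_commute[of Y f g] ..

text \<open>The pointwise triangle inequality followed by Minkowski's inequality. Finiteness is
  carried along since \<open>enn2real\<close> sends infinity to 0, so \<open>map_dist\<close> by
  itself does not reveal a divergent integral.\<close>

lemma map_dist_triangle:
 assumes f: "f \<in> L0s Y Z d" and g: "g \<in> L0s Y Z d" and k: "k \<in> L0s Y Z d"
  and fg: "int_dist_powr Y d p f g < \<infinity>" and gk: "int_dist_powr Y d p g k < \<infinity>"
 shows "int_dist_powr Y d p f k < \<infinity>" "map_dist Y d p f k <= map_dist Y d p f g + map_dist Y d p g k"
proof -
 have "int_dist_powr Y d p f k <= (\<integral>\<^sup>+ y. ennreal ((d (f y) (g y) + d (g y) (k y)) powr p) \<partial>Y)"
  unfolding int_dist_powr_def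
  using p_gt_1 by (intro nn_integral_mono ennreal_leI powr_mono2 triangle)
   (auto intro: L0s_in[OF f] L0s_in[OF g] L0s_in[OF k])
 also have "\<dots> <= ennreal ((map_dist Y d p f g + map_dist Y d p g k) powr p)"
 proof (rule nn_integral_Minkowski[OF p_gt_1])
  show "(%y. d (f y) (g y)) \<in> borel_measurable Y" "(%y. d (g y) (k y)) \<in> borel_measurable Y"
   by (rule L0s_dist_measurable[OF f g], rule L0s_dist_measurable[OF g k])
  show "(\<integral>\<^sup>+ y. ennreal (d (f y) (g y) powr p) \<partial>Y) <= ennreal (map_dist Y d p f g powr p)"
   "(\<integral>\<^sup>+ y. ennreal (d (g y) (k y) powr p) \<partial>Y) <= ennreal (map_dist Y d p g k powr p)"
   unfolding map_dist_powr[OF fg] map_dist_powr[OF gk] by (simp_all add: int_dist_powr_def)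
 qed (auto simp: map_dist_nonneg)
 finally have *: "int_dist_powr Y d p f k <= ennreal ((map_dist Y d p f g + map_dist Y d p g k) powr p)" .
 thus "int_dist_powr Y d p f k < \<infinity>" by (rule order.strict_trans1) simp
 show "map_dist Y d p f k <= map_dist Y d p f g + map_dist Y d p g k"
  by (rule map_dist_le[OF *]) (simp add: map_dist_nonneg)
qed

lemma int_dist_powr_eq_0:
 assumes f: "f \<in> L0s Y Z d" and g: "g \<in> L0s Y Z d"
 shows "int_dist_powr Y d p f g = 0 \<longleftrightarrow> (AE y in Y. f y = g y)"
proof -
 have [measurable]: "(%y. d (f y) (g y)) \<in> borel_measurable Y" by (rule L0s_dist_measurable[OF f g])
 have "int_dist_powr Y d p f g = 0 \<longleftrightarrow> (AE y in Y. ennreal (d (f y) (g y) powr p) = 0)"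
  unfolding int_dist_powr_def by (subst nn_integral_0_iff_AE) auto
 also have "\<dots> \<longleftrightarrow> (AE y in Y. f y = g y)"
  using L0s_in[OF f] L0s_in[OF g] by (intro AE_cong) (auto simp: ennreal_eq_0_iff)
 finally show ?thesis .
qed

lemma map_dist_eq_0:
 assumes f: "f \<in> L0s Y Z d" and g: "g \<in> L0s Y Z d" and fin: "int_dist_powr Y d p f g < \<infinity>"
 shows "map_dist Y d p f g = 0 \<longleftrightarrow> (AE y in Y. f y = g y)"
proof -
 have "map_dist Y d p f g = 0 \<longleftrightarrow> int_dist_powr Y d p f g = 0"
  using fin by (auto simp: map_dist_def enn2real_eq_0_iff)
 thus ?thesis using int_dist_powr_eq_0[OF f g] by simp
qed

lemma LpD:
 assumes "F \<in> Lp Y Z d p G" "G \<in> L0 Y Z d"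
 shows "rep Y Z d F \<in> L0s Y Z d" "int_dist_powr Y d p (rep Y Z d F) (rep Y Z d G) < \<infinity>"
  "cls Y Z (rep Y Z d F) = F"
 using assms rep_in(2)[of F Y Z d] cls_rep[of F Y Z d] by (auto simp: Lp_def)

lemma Lp_finite:
 assumes "F \<in> Lp Y Z d p G" "F' \<in> Lp Y Z d p G" "G \<in> L0 Y Z d"
 shows "int_dist_powr Y d p (rep Y Z d F) (rep Y Z d F') < \<infinity>"
 by (rule map_dist_triangle(1)[OF LpD(1)[OF assms(1,3)] rep_in(2)[OF assms(3)] LpD(1)[OF assms(2,3)] LpD(2)[OF assms(1,3)]])
  (subst int_dist_powr_commute, rule LpD(2)[OF assms(2,3)])

lemma Lp_base_in: "G \<in> L0 Y Z d ==> G \<in> Lp Y Z d p G"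
 using rep_in(2)[of G Y Z d] by (simp add: Lp_def int_dist_powr_eq_0[THEN iffD2])

lemma Lp_dist_powr:
 assumes "F \<in> Lp Y Z d p G" "F' \<in> Lp Y Z d p G" "G \<in> L0 Y Z d"
 shows "ennreal (Lp_dist Y Z d p F F' powr p) = int_dist_powr Y d p (rep Y Z d F) (rep Y Z d F')"
 unfolding Lp_dist_def by (rule map_dist_powr[OF Lp_finite[OF assms]])

lemma Lp_dist_eq_0:
 assumes "F \<in> Lp Y Z d p G" "F' \<in> Lp Y Z d p G" "G \<in> L0 Y Z d"
 shows "Lp_dist Y Z d p F F' = 0 \<longleftrightarrow> F = F'"
proof -
 have "Lp_dist Y Z d p F F' = 0 \<longleftrightarrow> (AE y in Y. rep Y Z d F y = rep Y Z d F' y)"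
  unfolding Lp_dist_def by (rule map_dist_eq_0[OF LpD(1) LpD(1) Lp_finite]) (use assms in auto)
 also have "\<dots> \<longleftrightarrow> F = F'"
  using cls_eq_iff[OF L0s_ext[OF LpD(1)[OF assms(1,3)]], of "rep Y Z d F'"]
  unfolding LpD(3)[OF assms(1,3)] LpD(3)[OF assms(2,3)] by simp
 finally show ?thesis .
qed

lemma Metric_space_Lp:
 assumes G: "G \<in> L0 Y Z d"
 shows "Metric_space (Lp Y Z d p G) (Lp_dist Y Z d p)"
proof
 show "0 <= Lp_dist Y Z d p F F'" "Lp_dist Y Z d p F F' = Lp_dist Y Z d p F' F" for F F'
  by (auto simp: Lp_dist_def map_dist_nonneg map_dist_commute)
 show "Lp_dist Y Z d p F F' = 0 \<longleftrightarrow> F = F'" if "F \<in> Lp Y Z d p G" "F' \<in> Lp Y Z d p G" for F F'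
  using Lp_dist_eq_0[OF that G] .
 show "Lp_dist Y Z d p F H <= Lp_dist Y Z d p F F' + Lp_dist Y Z d p F' H"
  if "F \<in> Lp Y Z d p G" "F' \<in> Lp Y Z d p G" "H \<in> Lp Y Z d p G" for F F' H
  unfolding Lp_dist_def
  by (rule map_dist_triangle(2)) (rule LpD(1)[OF _ G] Lp_finite[OF _ _ G] that)+
qed

text \<open>Lets the construction be iterated: the results on maps into Z apply to maps into the
  classes over Z.\<close>

lemma Lp_target_Lp:
 assumes "G \<in> L0 Y Z d"
 shows "Lp_target (Lp Y Z d p G) (Lp_dist Y Z d p) p"
 using Metric_space_Lp[OF assms] p_gt_1
 by (simp add: Lp_target_def metric_target_def Lp_target_axioms_def)

end

section \<open>Tonelli's theorem for the Caratheodory product\<close>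

definition sigma_finite_set :: "'b measure => 'b set => bool" where
 "sigma_finite_set B S \<longleftrightarrow> S \<in> sets B \<and>
   (\<exists>F :: nat => 'b set. range F \<subseteq> sets B & (ALL n. emeasure B (F n) < \<infinity>) & S \<subseteq> (\<Union>n. F n))"

lemma sigma_finite_set_sets: "sigma_finite_set B S ==> S \<in> sets B"
 by (simp add: sigma_finite_set_def)

lemma sigma_finite_set_UN:
 assumes "!!n :: nat. sigma_finite_set B (S n)"
 shows "sigma_finite_set B (\<Union>n. S n)"
proof -
 have "\<exists>F :: nat => 'a set. range F \<subseteq> sets B & (ALL n. emeasure B (F n) < \<infinity>) & S m \<subseteq> (\<Union>n. F n)" for m
  using assms[of m] by (simp add: sigma_finite_set_def)
 then obtain F :: "nat => nat => 'a set" where F: "!!m. range (F m) \<subseteq> sets B"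
   "!!m n. emeasure B (F m n) < \<infinity>" "!!m. S m \<subseteq> (\<Union>n. F m n)" by metis
 define G where "G k = F (fst (prod_decode k)) (snd (prod_decode k))" for k
 have "S m \<subseteq> (\<Union>k. G k)" for m
 proof
  fix x assume "x \<in> S m"
  then obtain n where "x \<in> F m n" using F(3) by auto
  hence "x \<in> G (prod_encode (m, n))" by (simp add: G_def)
  thus "x \<in> (\<Union>k. G k)" by blast
 qed
 moreover have "range G \<subseteq> sets B" "!!n. emeasure B (G n) < \<infinity>" using F(1,2) by (auto simp: G_def)
 moreover have "(\<Union>n. S n) \<in> sets B" using assms by (auto simp: sigma_finite_set_def)
 ultimately show ?thesis unfolding sigma_finite_set_def by blast
qed

lemma sigma_finite_set_Un:
 assumes "sigma_finite_set B S" "sigma_finite_set B T" shows "sigma_finite_set B (S \<union> T)"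
proof -
 have "(\<Union>n::nat. if n = 0 then S else T) = S \<union> T" by (auto split: if_splits)
 moreover have "sigma_finite_set B (\<Union>n::nat. if n = 0 then S else T)"
  using assms by (intro sigma_finite_set_UN) auto
 ultimately show ?thesis by simp
qed

lemma sigma_finite_set_space: "finite_measure B ==> sigma_finite_set B (space B)"
 unfolding sigma_finite_set_def
 by (intro conjI exI[of _ "%_. space B"]) (auto simp: finite_measure.emeasure_finite top.not_eq_extremum[symmetric])

text \<open>By Markov's inequality the set where w is at least 1/n has measure at most n times the
  integral. For an arbitrary measure this is where sigma-finite sets come from.\<close>

lemma sigma_finite_set_support:
 fixes w :: "'b => ennreal"
 assumes [measurable]: "w \<in> borel_measurable B" and fin: "(\<integral>\<^sup>+ x. w x \<partial>B) < \<infinity>"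
 shows "sigma_finite_set B {x \<in> space B. w x ~= 0}"
proof -
 define F where "F n = {x \<in> space B. 1 <= of_nat n * w x}" for n :: nat
 have [measurable]: "F n \<in> sets B" for n unfolding F_def by measurable
 have "emeasure B (F n) < \<infinity>" for n
 proof -
  have "emeasure B (F n) <= of_nat n * (\<integral>\<^sup>+ x. w x * indicator (space B) x \<partial>B)"
   unfolding F_def by (rule nn_integral_Markov_inequality) auto
  also have "\<dots> = of_nat n * (\<integral>\<^sup>+ x. w x \<partial>B)" by (auto intro!: arg_cong2[where f = "(*)"] nn_integral_cong)
  also have "\<dots> < \<infinity>" using fin by (auto simp: ennreal_mult_less_top of_nat_less_top)
  finally show ?thesis .
 qed
 moreover have "{x \<in> space B. w x ~= 0} \<subseteq> (\<Union>n. F n)"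
 proof
  fix x assume x: "x \<in> {x \<in> space B. w x ~= 0}"
  show "x \<in> (\<Union>n. F n)"
  proof (cases "w x")
   case (real r)
   hence "r > 0" using x by (auto simp: ennreal_eq_0_iff)
   then obtain n where "1 <= real n * r" using ex_less_of_nat_mult[of r 1] by (auto intro: less_imp_le)
   hence "1 <= of_nat n * w x" using real
    by (simp add: ennreal_of_nat_eq_real_of_nat ennreal_mult[symmetric] ennreal_ge_1)
   thus ?thesis using x by (auto simp: F_def)
  next
   case top
   hence "x \<in> F 1" using x by (simp add: F_def)
   thus ?thesis by blast
  qed
 qed
 ultimately show ?thesis unfolding sigma_finite_set_def
  by (intro conjI exI[of _ F]) auto
qed

text \<open>Restricting B to S by a density makes the complement of S a null set but keeps the
  sigma-algebra, so products with a further measure have the same measurable sets as before.\<close>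

lemma sigma_finite_density_indicator:
 assumes "sigma_finite_set B S"
 shows "sigma_finite_measure (density B (indicator S))"
proof
 obtain F :: "nat => 'a set" where F: "range F \<subseteq> sets B" "!!n. emeasure B (F n) < \<infinity>" "S \<subseteq> (\<Union>n. F n)"
  and S [measurable]: "S \<in> sets B" using assms by (auto simp: sigma_finite_set_def)
 have [measurable]: "F n \<in> sets B" for n using F by auto
 have em: "emeasure (density B (indicator S)) X = emeasure B (S \<inter> X)" if [measurable]: "X \<in> sets B" for X
  by (subst emeasure_density) (auto simp: nn_integral_indicator[symmetric] indicator_inter_arith intro!: nn_integral_cong simp del: nn_integral_indicator)
 show "EX A. countable A & A \<subseteq> sets (density B (indicator S)) & \<Union> A = space (density B (indicator S)) \<and>
   (\<forall>a\<in>A. emeasure (density B (indicator S)) a ~= \<infinity>)"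
 proof (intro exI[of _ "insert (space B - S) (range F)"] conjI ballI)
  show "\<Union> (insert (space B - S) (range F)) = space (density B (indicator S))"
   using F sets.sets_into_space[of _ B] by (auto; blast)
  fix a assume "a \<in> insert (space B - S) (range F)"
  then consider "a = space B - S" | n where "a = F n" by auto
  thus "emeasure (density B (indicator S)) a ~= \<infinity>"
  proof cases
   case 1 thus ?thesis by (simp add: em)
  next
   case (2 n)
   have "emeasure B (S \<inter> F n) <= emeasure B (F n)" by (intro emeasure_mono) auto
   thus ?thesis using 2 F(2)[of n] by (auto simp: em top_unique)
  qed
 qed (use F in auto)
qed

section \<open>The outer measure generated by measurable rectangles\<close>

lemma rectangle_outer_le:
 fixes X :: "nat => 'a set" and Y :: "nat => 'b set"
 assumes "range X \<subseteq> sets A" "range Y \<subseteq> sets B" "E \<subseteq> (\<Union>n. X n \<times> Y n)"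
 shows "rectangle_outer A B E <= (\<Sum>n. emeasure A (X n) * emeasure B (Y n))"
 unfolding rectangle_outer_def using assms
 by (intro INF_lower2[of "(X, Y)"]) auto

lemma rectangle_outer_approx:
 assumes "rectangle_outer A B E < \<infinity>" "0 < (e :: real)"
 obtains X :: "nat => 'a set" and Y :: "nat => 'b set"
 where "range X \<subseteq> sets A" "range Y \<subseteq> sets B" "E \<subseteq> (\<Union>n. X n \<times> Y n)"
  "(\<Sum>n. emeasure A (X n) * emeasure B (Y n)) <= rectangle_outer A B E + ennreal e"
proof -
 have "rectangle_outer A B E < rectangle_outer A B E + ennreal e"
  using assms by (cases "rectangle_outer A B E") (auto simp: ennreal_plus[symmetric] ennreal_less_iff simp del: ennreal_plus)
 then obtain X Y where "range X \<subseteq> sets A" "range Y \<subseteq> sets B" "E \<subseteq> (\<Union>n. X n \<times> Y n)"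
   "(\<Sum>n. emeasure A (X n) * emeasure B (Y n)) < rectangle_outer A B E + ennreal e"
  by (subst (asm) (2) rectangle_outer_def) (auto simp: INF_less_iff)
 thus ?thesis using that[of X Y] by (simp add: less_imp_le)
qed

lemma choice2: "ALL i. EX x y. P i x y ==> EX f g. ALL i. P i (f i) (g i)"
 by metis

lemma rectangle_outer_mono: "E \<subseteq> E' ==> rectangle_outer A B E <= rectangle_outer A B E'"
 unfolding rectangle_outer_def by (rule INF_superset_mono) auto

lemma rectangle_outer_empty: "rectangle_outer A B {} = 0"
proof -
 have "rectangle_outer A B {} <= (\<Sum>n::nat. emeasure A {} * emeasure B {})"
  by (rule rectangle_outer_le) auto
 thus ?thesis by simp
qed

lemma rectangle_outer_UN:
 fixes E :: "nat => ('a \<times> 'b) set"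
 shows "rectangle_outer A B (\<Union>i. E i) <= (\<Sum>i. rectangle_outer A B (E i))"
proof (rule ennreal_le_epsilon)
 fix e :: real assume fin: "(\<Sum>i. rectangle_outer A B (E i)) < top" and e: "0 < e"
 have fin': "rectangle_outer A B (E i) < \<infinity>" for i
  using fin ennreal_suminf_lessD[of "%i. rectangle_outer A B (E i)" top i] by simp
 have "ALL i. EX X Y. range X \<subseteq> sets A & range Y \<subseteq> sets B & E i \<subseteq> (\<Union>n. X n \<times> Y n) \<and>
  (\<Sum>n. emeasure A (X n) * emeasure B (Y n)) <= rectangle_outer A B (E i) + ennreal (e * (1/2)^Suc i)"
 proof
  fix i
  show "EX X Y. range X \<subseteq> sets A & range Y \<subseteq> sets B & E i \<subseteq> (\<Union>n. X n \<times> Y n) \<and>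
   (\<Sum>n. emeasure A (X n) * emeasure B (Y n)) <= rectangle_outer A B (E i) + ennreal (e * (1/2)^Suc i)"
   by (rule rectangle_outer_approx[OF fin'[of i], of "e * (1/2)^Suc i"]) (use e in auto)
 qed
 from choice2[OF this] obtain X Y where "ALL i. range (X i) \<subseteq> sets A & range (Y i) \<subseteq> sets B & E i \<subseteq> (\<Union>n. X i n \<times> Y i n) \<and>
  (\<Sum>n. emeasure A (X i n) * emeasure B (Y i n)) <= rectangle_outer A B (E i) + ennreal (e * (1/2)^Suc i)"
  by (elim exE)
 hence XY: "!!i. range (X i) \<subseteq> sets A" "!!i. range (Y i) \<subseteq> sets B"
   "!!i. E i \<subseteq> (\<Union>n. X i n \<times> Y i n)"
   "!!i. (\<Sum>n. emeasure A (X i n) * emeasure B (Y i n)) <= rectangle_outer A B (E i) + ennreal (e * (1/2)^Suc i)"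
  by simp_all
 define f where "f = (%(i, n). emeasure A (X i n) * emeasure B (Y i n))"
 have "rectangle_outer A B (\<Union>i. E i) \<le>
  (\<Sum>k. emeasure A (case prod_decode k of (i, n) => X i n) * emeasure B (case prod_decode k of (i, n) => Y i n))"
 proof (rule rectangle_outer_le)
  show "range (%k. case prod_decode k of (i, n) => X i n) \<subseteq> sets A" using XY(1) by (auto split: prod.split)
  show "range (%k. case prod_decode k of (i, n) => Y i n) \<subseteq> sets B" using XY(2) by (auto split: prod.split)
  show "(\<Union>i. E i) \<subseteq> (\<Union>k. (case prod_decode k of (i, n) => X i n) \<times> (case prod_decode k of (i, n) => Y i n))"
  proof
   fix z assume "z \<in> (\<Union>i. E i)"
   then obtain i where "z \<in> E i" by auto
   then obtain n where "z \<in> X i n \<times> Y i n" using XY(3)[of i] by auto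
   thus "z \<in> (\<Union>k. (case prod_decode k of (i, n) => X i n) \<times> (case prod_decode k of (i, n) => Y i n))"
    by (intro UN_I[of "prod_encode (i, n)"]) auto
  qed
 qed
 also have "\<dots> = (\<Sum>k. f (prod_decode k))" by (intro suminf_cong) (auto simp: f_def split: prod.split)
 also have "\<dots> = (\<Sum>i. \<Sum>n. emeasure A (X i n) * emeasure B (Y i n))"
  by (rule suminf_ennreal_2dimen) (simp add: f_def)
 also have "\<dots> <= (\<Sum>i. rectangle_outer A B (E i) + ennreal (e * (1/2)^Suc i))"
  by (intro suminf_le XY(4)) auto
 also have "\<dots> = (\<Sum>i. rectangle_outer A B (E i)) + (\<Sum>i. ennreal (e * (1/2)^Suc i))"
  by (rule suminf_add[symmetric]) auto
 also have "(\<Sum>i. ennreal (e * (1/2)^Suc i)) = ennreal e"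
  using sums_mult[OF power_half_series, of e] e by (intro suminf_ennreal_eq) auto
 finally show "rectangle_outer A B (\<Union>i. E i) <= (\<Sum>i. rectangle_outer A B (E i)) + ennreal e" .
qed

lemma rectangle_outer_Un: "rectangle_outer A B (E \<union> E') <= rectangle_outer A B E + rectangle_outer A B E'"
proof -
 define F where "F i = (if i = 0 then E else if i = Suc 0 then E' else {})" for i :: nat
 have "E \<union> E' = (\<Union>i. F i)" by (auto simp: F_def split: if_splits)
 moreover have "(\<Sum>i. rectangle_outer A B (F i)) = (\<Sum>i\<in>{0, 1}. rectangle_outer A B (F i))"
  by (rule suminf_finite) (auto simp: F_def rectangle_outer_empty)
 ultimately show ?thesis using rectangle_outer_UN[of A B F] by (simp add: F_def)
qed

lemma outer_measure_space_rectangle_outer: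
 "outer_measure_space (Pow \<Omega>) (rectangle_outer A B)"
 unfolding outer_measure_space_def positive_def increasing_def countably_subadditive_def
 by (auto simp: rectangle_outer_empty rectangle_outer_mono rectangle_outer_UN)

lemma caratheodory_product_eqs:
 shows space_caratheodory_product: "space (caratheodory_product A B) = space A \<times> space B"
  and sets_caratheodory_product: "sets (caratheodory_product A B) =
    lambda_system (space A \<times> space B) (Pow (space A \<times> space B)) (rectangle_outer A B)"
  and emeasure_caratheodory_product: "E \<in> sets (caratheodory_product A B) ==>
    emeasure (caratheodory_product A B) E = rectangle_outer A B E"
proof -
 let ?\<Omega> = "space A \<times> space B" and ?L = "lambda_system (space A \<times> space B) (Pow (space A \<times> space B)) (rectangle_outer A B)"
 have ms: "measure_space ?\<Omega> ?L (rectangle_outer A B)"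
  by (rule sigma_algebra.caratheodory_lemma[OF sigma_algebra_Pow outer_measure_space_rectangle_outer])
 hence sa: "sigma_algebra ?\<Omega> ?L" by (simp add: measure_space_def)
 have eq: "caratheodory_product A B = measure_of ?\<Omega> ?L (rectangle_outer A B)"
  by (simp add: caratheodory_product_def Let_def)
 have sub: "?L \<subseteq> Pow ?\<Omega>" by (auto simp: lambda_system_def)
 show "space (caratheodory_product A B) = ?\<Omega>" unfolding eq by (rule space_measure_of[OF sub])
 show s: "sets (caratheodory_product A B) = ?L"
  unfolding eq using sub sigma_algebra.sigma_sets_eq[OF sa] by simp
 show "E \<in> sets (caratheodory_product A B) ==>
    emeasure (caratheodory_product A B) E = rectangle_outer A B E"
  unfolding s unfolding eq using ms
  by (intro emeasure_measure_of_sigma) (auto simp: measure_space_def)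
qed

text \<open>A rectangle X n x Y n of a cover is cut by P x Q into the three rectangles (X n \<inter>
  P) x (Y n \<inter> Q), (X n \<inter> P) x (Y n - Q) and (X n - P) x Y n, whose weights add up to
  the original one. Thus P x Q splits every outer measure additively.\<close>

lemma sets_rectangle_caratheodory:
 assumes P [measurable]: "P \<in> sets A" and Q [measurable]: "Q \<in> sets B"
 shows "P \<times> Q \<in> sets (caratheodory_product A B)"
proof -
 let ?\<Omega> = "space A \<times> space B" and ?O = "rectangle_outer A B"
 have alg: "algebra ?\<Omega> (Pow ?\<Omega>)" by (rule algebra_Pow)
 have sub: "P \<times> Q \<subseteq> ?\<Omega>" using sets.sets_into_space[OF P] sets.sets_into_space[OF Q] by auto
 have ge: "?O (E \<inter> P \<times> Q) + ?O (E - P \<times> Q) <= ?O E" for E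
  unfolding rectangle_outer_def[of A B E]
 proof (rule INF_greatest, clarify)
  fix X :: "nat => 'a set" and Y :: "nat => 'b set"
  assume X: "range X \<subseteq> sets A" and Y: "range Y \<subseteq> sets B" and E: "E \<subseteq> (\<Union>n. X n \<times> Y n)"
  have [measurable]: "X n \<in> sets A" "Y n \<in> sets B" for n using X Y by auto
  let ?s = "%X Y. \<Sum>n. emeasure A (X n) * emeasure B (Y n)"
  have 1: "?O (E \<inter> P \<times> Q) <= ?s (%n. X n \<inter> P) (%n. Y n \<inter> Q)"
   using E by (intro rectangle_outer_le) auto
  have "?O (E - P \<times> Q) <= ?O ((\<Union>n. (X n \<inter> P) \<times> (Y n - Q)) \<union> (\<Union>n. (X n - P) \<times> Y n))"
   using E by (intro rectangle_outer_mono) auto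
  also have "\<dots> <= ?O (\<Union>n. (X n \<inter> P) \<times> (Y n - Q)) + ?O (\<Union>n. (X n - P) \<times> Y n)"
   by (rule rectangle_outer_Un)
  also have "\<dots> <= ?s (%n. X n \<inter> P) (%n. Y n - Q) + ?s (%n. X n - P) Y"
   by (intro add_mono rectangle_outer_le) auto
  finally have 2: "?O (E - P \<times> Q) <= ?s (%n. X n \<inter> P) (%n. Y n - Q) + ?s (%n. X n - P) Y" .
  have "?O (E \<inter> P \<times> Q) + ?O (E - P \<times> Q) \<le>
    ?s (%n. X n \<inter> P) (%n. Y n \<inter> Q) + (?s (%n. X n \<inter> P) (%n. Y n - Q) + ?s (%n. X n - P) Y)"
   by (intro add_mono 1 2)
  also have "\<dots> = (\<Sum>n. emeasure A (X n \<inter> P) * emeasure B (Y n \<inter> Q) +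
    (emeasure A (X n \<inter> P) * emeasure B (Y n - Q) + emeasure A (X n - P) * emeasure B (Y n)))"
   by (simp add: suminf_add[symmetric])
  also have "\<dots> = ?s X Y"
  proof (rule suminf_cong)
   fix n
   have a: "emeasure A (X n \<inter> P) + emeasure A (X n - P) = emeasure A (X n)"
    by (subst plus_emeasure) (auto intro!: arg_cong2[where f = emeasure])
   have b: "emeasure B (Y n \<inter> Q) + emeasure B (Y n - Q) = emeasure B (Y n)"
    by (subst plus_emeasure) (auto intro!: arg_cong2[where f = emeasure])
   show "emeasure A (X n \<inter> P) * emeasure B (Y n \<inter> Q) +
     (emeasure A (X n \<inter> P) * emeasure B (Y n - Q) + emeasure A (X n - P) * emeasure B (Y n)) =
     emeasure A (X n) * emeasure B (Y n)"
    unfolding add.assoc[symmetric] distrib_left[symmetric] b unfolding distrib_right[symmetric] a ..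
  qed
  finally show "?O (E \<inter> P \<times> Q) + ?O (E - P \<times> Q) <= ?s X Y" .
 qed
 have "?O (E \<inter> P \<times> Q) + ?O (E - P \<times> Q) = ?O E" for E
 proof (rule antisym[OF ge])
  have "?O E <= ?O ((E \<inter> P \<times> Q) \<union> (E - P \<times> Q))" by (rule rectangle_outer_mono) auto
  also have "\<dots> <= ?O (E \<inter> P \<times> Q) + ?O (E - P \<times> Q)" by (rule rectangle_outer_Un)
  finally show "?O E <= ?O (E \<inter> P \<times> Q) + ?O (E - P \<times> Q)" .
 qed
 thus ?thesis
  unfolding sets_caratheodory_product algebra.lambda_system_eq[OF alg] using sub by auto
qed

lemma sets_pair_subset_caratheodory:
 "sets (A \<Otimes>\<^sub>M B) \<subseteq> sets (caratheodory_product A B)"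
proof -
 have "sets (A \<Otimes>\<^sub>M B) = sigma_sets (space (caratheodory_product A B)) {a \<times> b | a b. a \<in> sets A & b \<in> sets B}"
  by (simp add: sets_pair_measure space_caratheodory_product)
 also have "\<dots> \<subseteq> sets (caratheodory_product A B)"
  by (rule sets.sigma_sets_subset) (auto intro: sets_rectangle_caratheodory)
 finally show ?thesis .
qed

lemma measurable_caratheodory_product:
 "f \<in> measurable (A \<Otimes>\<^sub>M B) W ==> f \<in> measurable (caratheodory_product A B) W"
 using sets_pair_subset_caratheodory[of A B]
 by (auto simp: measurable_def space_caratheodory_product space_pair_measure)

text \<open>For the lower bound, the indicator of P x Q is dominated by the sum of the indicators of
  a cover, and both sides are integrated twice. Products of indicators integrate factor by factor,
  so this works for arbitrary measures.\<close>

lemma emeasure_rectangle_caratheodory: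
 assumes P [measurable]: "P \<in> sets A" and Q [measurable]: "Q \<in> sets B"
 shows "emeasure (caratheodory_product A B) (P \<times> Q) = emeasure A P * emeasure B Q"
proof -
 have "emeasure A P * emeasure B Q <= rectangle_outer A B (P \<times> Q)"
  unfolding rectangle_outer_def
 proof (rule INF_greatest, clarify)
  fix X :: "nat => 'a set" and Y :: "nat => 'b set"
  assume X: "range X \<subseteq> sets A" and Y: "range Y \<subseteq> sets B" and E: "P \<times> Q \<subseteq> (\<Union>n. X n \<times> Y n)"
  have [measurable]: "X n \<in> sets A" "Y n \<in> sets B" for n using X Y by auto
  have "emeasure A P * emeasure B Q = (\<integral>\<^sup>+ a. \<integral>\<^sup>+ b. indicator P a * indicator Q b \<partial>B \<partial>A)"
   by (simp add: nn_integral_cmult nn_integral_multc)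
  also have "\<dots> <= (\<integral>\<^sup>+ a. \<integral>\<^sup>+ b. (\<Sum>n. indicator (X n) a * indicator (Y n) b) \<partial>B \<partial>A)"
  proof (intro nn_integral_mono)
   fix a b
   show "indicator P a * indicator Q b <= (\<Sum>n. indicator (X n) a * indicator (Y n) b :: ennreal)"
   proof (cases "(a, b) \<in> P \<times> Q")
    case True
    then obtain n where "a \<in> X n" "b \<in> Y n" using E by blast
    hence "1 = (\<Sum>i\<in>{n}. indicator (X i) a * indicator (Y i) b :: ennreal)" by simp
    also have "\<dots> <= (\<Sum>n. indicator (X n) a * indicator (Y n) b)" by (rule sum_le_suminf) auto
    finally show ?thesis using True by auto
   qed (auto simp: indicator_def)
  qed
  also have "\<dots> = (\<Sum>n. emeasure A (X n) * emeasure B (Y n))"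
   by (simp add: nn_integral_suminf nn_integral_cmult nn_integral_multc)
  finally show "emeasure A P * emeasure B Q <= (\<Sum>n. emeasure A (X n) * emeasure B (Y n))" .
 qed
 moreover have "rectangle_outer A B (P \<times> Q) <= (\<Sum>n::nat. emeasure A (if n = 0 then P else {}) * emeasure B (if n = 0 then Q else {}))"
  by (rule rectangle_outer_le) (auto split: if_splits)
 moreover have "(\<Sum>n::nat. emeasure A (if n = 0 then P else {}) * emeasure B (if n = 0 then Q else {})) = emeasure A P * emeasure B Q"
  by (subst suminf_finite[of "{0}"]) auto
 ultimately show ?thesis
  using emeasure_caratheodory_product[OF sets_rectangle_caratheodory[OF P Q]] by auto
qed

text \<open>The section at a is covered, at level k, by the sets Y k n with a in X k n, of total
  measure \<open>s k a\<close>. The integrals of these functions tend to 0, so their infimum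
  vanishes almost everywhere. This is Tonelli's theorem for null sets and holds for arbitrary
  measures.\<close>

lemma AE_sections_null:
 fixes X :: "nat => nat => 'a set" and Y :: "nat => nat => 'b set"
 assumes X: "!!k n. X k n \<in> sets A" and Y: "!!k n. Y k n \<in> sets B"
  and small: "!!k. (\<Sum>n. emeasure A (X k n) * emeasure B (Y k n)) <= ennreal ((1/2)^k)"
 shows "AE a in A. {b \<in> space B. ALL k. EX n. a \<in> X k n & b \<in> Y k n} \<in> null_sets B"
proof -
 note [measurable] = X Y
 define s where "s k a = (\<Sum>n. indicator (X k n) a * emeasure B (Y k n))" for k a
 have [measurable]: "s k \<in> borel_measurable A" for k unfolding s_def by measurable
 have sint: "(\<integral>\<^sup>+ a. s k a \<partial>A) <= ennreal ((1/2)^k)" for k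
  unfolding s_def using small[of k] by (simp add: nn_integral_suminf nn_integral_multc)
 have "(\<integral>\<^sup>+ a. (INF k. s k a) \<partial>A) = 0"
 proof -
  have "(\<integral>\<^sup>+ a. (INF k. s k a) \<partial>A) <= ennreal e" if e: "e > 0" for e :: real
  proof -
   obtain k where "(1/2 :: real)^k < e" using real_arch_pow_inv[of e "1/2"] e by auto
   have "(\<integral>\<^sup>+ a. (INF k. s k a) \<partial>A) <= (\<integral>\<^sup>+ a. s k a \<partial>A)"
    by (intro nn_integral_mono INF_lower) auto
   also have "\<dots> <= ennreal e"
    using sint[of k] \<open>(1/2 :: real)^k < e\<close> by (meson ennreal_leI less_imp_le order_trans)
   finally show ?thesis .
  qed
  note le = this
  have "(\<integral>\<^sup>+ a. (INF k. s k a) \<partial>A) <= 0"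
  proof (rule ennreal_le_epsilon)
   fix e :: real assume "0 < e"
   from le[OF this] show "(\<integral>\<^sup>+ a. (INF k. s k a) \<partial>A) <= 0 + ennreal e" by (simp only: add_0)
  qed
  thus ?thesis by (simp only: le_zero_eq)
 qed
 hence "AE a in A. (INF k. s k a) = 0" by (subst (asm) nn_integral_0_iff_AE) auto
 thus ?thesis
 proof (eventually_elim)
  fix a assume a: "(INF k. s k a) = 0"
  let ?E = "{b \<in> space B. ALL k. EX n. a \<in> X k n & b \<in> Y k n}"
  have [measurable]: "?E \<in> sets B" by measurable
  have "emeasure B ?E <= s k a" for k
  proof -
   have "emeasure B ?E = (\<integral>\<^sup>+ b. indicator ?E b \<partial>B)" by simp
   also have "\<dots> <= (\<integral>\<^sup>+ b. (\<Sum>n. indicator (X k n) a * indicator (Y k n) b) \<partial>B)"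
   proof (rule nn_integral_mono)
    fix b assume "b \<in> space B"
    show "indicator ?E b <= (\<Sum>n. indicator (X k n) a * indicator (Y k n) b :: ennreal)"
    proof (cases "b \<in> ?E")
     case True
     then obtain n where "a \<in> X k n" "b \<in> Y k n" by auto
     hence "1 = (\<Sum>i\<in>{n}. indicator (X k i) a * indicator (Y k i) b :: ennreal)" by simp
     also have "\<dots> <= (\<Sum>n. indicator (X k n) a * indicator (Y k n) b)" by (rule sum_le_suminf) auto
     finally show ?thesis using True by auto
    qed auto
   qed
   also have "\<dots> = s k a" unfolding s_def by (simp add: nn_integral_suminf nn_integral_cmult)
   finally show ?thesis .
  qed
  hence "emeasure B ?E <= (INF k. s k a)" by (intro INF_greatest)
  thus "?E \<in> null_sets B" using a by (auto simp: null_sets_def)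
 qed
qed

text \<open>G is the intersection of covers of total weight at most 2^(-k). The weights are
  symmetric in the two factors, so \<open>AE_sections_null\<close> applies in both orders.\<close>

lemma null_caratheodory_hull:
 assumes "E \<in> null_sets (caratheodory_product A B)"
 obtains G where "G \<in> sets (A \<Otimes>\<^sub>M B)" "E \<subseteq> G" "G \<in> null_sets (caratheodory_product A B)"
  "AE a in A. AE b in B. (a, b) \<notin> G" "AE b in B. AE a in A. (a, b) \<notin> G"
proof -
 have O: "rectangle_outer A B E = 0" using assms emeasure_caratheodory_product[of E A B] by (auto simp: null_sets_def)
 have "ALL k. EX X Y. range X \<subseteq> sets A & range Y \<subseteq> sets B & E \<subseteq> (\<Union>n::nat. X n \<times> Y n) \<and>
  (\<Sum>n. emeasure A (X n) * emeasure B (Y n)) <= ennreal ((1/2)^k)"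
 proof
  fix k :: nat
  obtain X :: "nat => 'a set" and Y :: "nat => 'b set"
   where "range X \<subseteq> sets A" "range Y \<subseteq> sets B" "E \<subseteq> (\<Union>n. X n \<times> Y n)"
    "(\<Sum>n. emeasure A (X n) * emeasure B (Y n)) <= rectangle_outer A B E + ennreal ((1/2)^k)"
   by (rule rectangle_outer_approx[of A B E "(1/2)^k"]) (auto simp: O)
  thus "EX X Y. range X \<subseteq> sets A & range Y \<subseteq> sets B & E \<subseteq> (\<Union>n::nat. X n \<times> Y n) \<and>
  (\<Sum>n. emeasure A (X n) * emeasure B (Y n)) <= ennreal ((1/2)^k)" using O by auto
 qed
 from choice2[OF this] obtain X Y where "ALL k. range (X k) \<subseteq> sets A & range (Y k) \<subseteq> sets B \<and>
   E \<subseteq> (\<Union>n::nat. X k n \<times> Y k n) \<and>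
   (\<Sum>n. emeasure A (X k n) * emeasure B (Y k n)) <= ennreal ((1/2)^k)"
  by (elim exE)
 hence XY: "!!k. range (X k) \<subseteq> sets A" "!!k. range (Y k) \<subseteq> sets B"
   "!!k. E \<subseteq> (\<Union>n::nat. X k n \<times> Y k n)"
   "!!k. (\<Sum>n. emeasure A (X k n) * emeasure B (Y k n)) <= ennreal ((1/2)^k)"
  by simp_all
 have X [measurable]: "X k n \<in> sets A" and Y [measurable]: "Y k n \<in> sets B" for k n using XY(1,2) by auto
 define G where "G = (\<Inter>k. \<Union>n. X k n \<times> Y k n)"
 have Gs [measurable]: "G \<in> sets (A \<Otimes>\<^sub>M B)" unfolding G_def by measurable
 have "rectangle_outer A B G <= 0"
 proof (rule ennreal_le_epsilon)
  fix e :: real assume "0 < e"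
  then obtain k where k: "(1/2 :: real)^k < e" using real_arch_pow_inv[of e "1/2"] by auto
  have "rectangle_outer A B G <= (\<Sum>n. emeasure A (X k n) * emeasure B (Y k n))"
   using XY(1,2) by (intro rectangle_outer_le) (auto simp: G_def)
  also have "\<dots> <= ennreal e" using XY(4)[of k] k by (meson ennreal_leI less_imp_le order_trans)
  finally show "rectangle_outer A B G <= 0 + ennreal e" by simp
 qed
 moreover have Gp: "G \<in> sets (caratheodory_product A B)" using Gs sets_pair_subset_caratheodory by blast
 ultimately have "G \<in> null_sets (caratheodory_product A B)"
  by (auto simp: null_sets_def emeasure_caratheodory_product)
 moreover have "AE a in A. AE b in B. (a, b) \<notin> G"
  using AE_sections_null[OF X Y XY(4)]
  by eventually_elim (rule AE_I', assumption, auto simp: G_def)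
 moreover have "AE b in B. AE a in A. (a, b) \<notin> G"
 proof -
  have "(\<Sum>n. emeasure B (Y k n) * emeasure A (X k n)) <= ennreal ((1/2)^k)" for k
   using XY(4)[of k] by (simp add: mult.commute)
  from AE_sections_null[OF Y X this] show ?thesis
   by eventually_elim (rule AE_I', assumption, auto simp: G_def)
 qed
 ultimately show ?thesis using that[of G] XY(3) Gs by (auto simp: G_def)
qed

text \<open>This makes the section maps independent of representatives: agreement almost everywhere
  on the product passes to almost every section, in either order.\<close>

lemma AE_caratheodory_hull:
 assumes "AE z in caratheodory_product A B. P z"
 obtains G where "G \<in> sets (A \<Otimes>\<^sub>M B)" "G \<in> null_sets (caratheodory_product A B)"
  "!!z. z \<in> space A \<times> space B - G ==> P z"
  "AE a in A. AE b in B. P (a, b)" "AE b in B. AE a in A. P (a, b)"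
proof -
 obtain E where E: "E \<in> null_sets (caratheodory_product A B)" "{z \<in> space (caratheodory_product A B). \<not> P z} \<subseteq> E"
  using assms by (auto simp: eventually_ae_filter)
 obtain G where G: "G \<in> sets (A \<Otimes>\<^sub>M B)" "E \<subseteq> G" "G \<in> null_sets (caratheodory_product A B)"
  "AE a in A. AE b in B. (a, b) \<notin> G" "AE b in B. AE a in A. (a, b) \<notin> G"
  using null_caratheodory_hull[OF E(1)] by metis
 have P: "P z" if "z \<in> space A \<times> space B - G" for z
  using that E(2) G(2) by (auto simp: space_caratheodory_product)
 have 1: "AE a in A. AE b in B. P (a, b)"
  using G(4) AE_space by eventually_elim (use AE_space P in "auto elim!: eventually_elim2[OF AE_space, rotated]")
 have 2: "AE b in B. AE a in A. P (a, b)"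
  using G(5) AE_space by eventually_elim (use AE_space P in "auto elim!: eventually_elim2[OF AE_space, rotated]")
 show ?thesis by (rule that[OF G(1,3) P 1 2])
qed

text \<open>G is the intersection of covers whose weights exceed the measure of E by at most 2^(-k).
  The cover of level 0 is returned as well: its finite weight will locate G over a sigma-finite set
  of second coordinates.\<close>

lemma finite_caratheodory_hull:
 assumes E: "E \<in> sets (caratheodory_product A B)" and fin: "emeasure (caratheodory_product A B) E < \<infinity>"
 obtains G X Y where "G \<in> sets (A \<Otimes>\<^sub>M B)" "AE z in caratheodory_product A B. z \<in> E \<longleftrightarrow> z \<in> G"
  "range X \<subseteq> sets A" "range Y \<subseteq> sets B" "G \<subseteq> (\<Union>n::nat. X n \<times> Y n)"
  "(\<Sum>n. emeasure A (X n) * emeasure B (Y n)) < \<infinity>"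
proof -
 let ?P = "caratheodory_product A B"
 have O: "rectangle_outer A B E = emeasure ?P E" by (simp add: emeasure_caratheodory_product E)
 have "ALL k. EX X Y. range X \<subseteq> sets A & range Y \<subseteq> sets B & E \<subseteq> (\<Union>n::nat. X n \<times> Y n) \<and>
  (\<Sum>n. emeasure A (X n) * emeasure B (Y n)) <= emeasure ?P E + ennreal ((1/2)^k)"
 proof
  fix k :: nat
  obtain X :: "nat => 'a set" and Y :: "nat => 'b set"
   where "range X \<subseteq> sets A" "range Y \<subseteq> sets B" "E \<subseteq> (\<Union>n. X n \<times> Y n)"
    "(\<Sum>n. emeasure A (X n) * emeasure B (Y n)) <= rectangle_outer A B E + ennreal ((1/2)^k)"
   by (rule rectangle_outer_approx[of A B E "(1/2)^k"]) (use fin in "auto simp: O")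
  thus "EX X Y. range X \<subseteq> sets A & range Y \<subseteq> sets B & E \<subseteq> (\<Union>n::nat. X n \<times> Y n) \<and>
  (\<Sum>n. emeasure A (X n) * emeasure B (Y n)) <= emeasure ?P E + ennreal ((1/2)^k)" using O by auto
 qed
 from choice2[OF this] obtain X Y where "ALL k. range (X k) \<subseteq> sets A & range (Y k) \<subseteq> sets B \<and>
   E \<subseteq> (\<Union>n::nat. X k n \<times> Y k n) \<and>
   (\<Sum>n. emeasure A (X k n) * emeasure B (Y k n)) <= emeasure ?P E + ennreal ((1/2)^k)"
  by (elim exE)
 hence XY: "!!k. range (X k) \<subseteq> sets A" "!!k. range (Y k) \<subseteq> sets B"
   "!!k. E \<subseteq> (\<Union>n::nat. X k n \<times> Y k n)"
   "!!k. (\<Sum>n. emeasure A (X k n) * emeasure B (Y k n)) <= emeasure ?P E + ennreal ((1/2)^k)"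
  by simp_all
 have X [measurable]: "X k n \<in> sets A" and Y [measurable]: "Y k n \<in> sets B" for k n using XY(1,2) by auto
 define G where "G = (\<Inter>k. \<Union>n. X k n \<times> Y k n)"
 have Gs [measurable]: "G \<in> sets (A \<Otimes>\<^sub>M B)" unfolding G_def by measurable
 have Gp: "G \<in> sets ?P" using Gs sets_pair_subset_caratheodory by blast
 have EG: "E \<subseteq> G" using XY(3) by (auto simp: G_def)
 have le: "emeasure ?P G <= emeasure ?P E"
 proof (rule ennreal_le_epsilon)
  fix e :: real assume "0 < e"
  then obtain k where k: "(1/2 :: real)^k < e" using real_arch_pow_inv[of e "1/2"] by auto
  have "emeasure ?P G <= (\<Sum>n. emeasure A (X k n) * emeasure B (Y k n))"
   unfolding emeasure_caratheodory_product[OF Gp]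
   using XY(1,2) by (intro rectangle_outer_le) (auto simp: G_def)
  also have "\<dots> <= emeasure ?P E + ennreal ((1/2)^k)" by (rule XY(4))
  also have "\<dots> <= emeasure ?P E + ennreal e" using k by (intro add_left_mono ennreal_leI) auto
  finally show "emeasure ?P G <= emeasure ?P E + ennreal e" .
 qed
 have "emeasure ?P (G - E) = emeasure ?P G - emeasure ?P E"
  using fin by (intro emeasure_Diff Gp E EG) auto
 also have "\<dots> = 0" using le fin by (metis diff_eq_0_iff_ennreal infinity_ennreal_def order.strict_trans1)
 finally have "G - E \<in> null_sets ?P" using Gp E by auto
 hence "AE z in ?P. z \<in> E \<longleftrightarrow> z \<in> G" by (rule AE_I') (use EG in auto)
 moreover have "(\<Sum>n. emeasure A (X 0 n) * emeasure B (Y 0 n)) < \<infinity>"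
  using XY(4)[of 0] fin by (auto intro: order.strict_trans1)
 moreover have "G \<subseteq> (\<Union>n. X 0 n \<times> Y 0 n)" by (auto simp: G_def)
 ultimately show ?thesis using that[OF Gs _ XY(1)[of 0] XY(2)[of 0]] by blast
qed

text \<open>Over S both factors are sigma-finite, so a measure on the product sigma-algebra is
  determined by its values on rectangles; hence the restricted Caratheodory product is the usual
  product with the density of S. Vanishing of w elsewhere carries Tonelli's theorem back to
  B.\<close>

lemma nn_integral_caratheodory_product:
 fixes w :: "'a \<times> 'b => ennreal"
 assumes A: "finite_measure A" and S: "sigma_finite_set B S"
  and w: "w \<in> borel_measurable (A \<Otimes>\<^sub>M B)"
  and w0: "!!a b. a \<in> space A ==> b \<in> space B - S ==> w (a, b) = 0"
 shows "(\<integral>\<^sup>+ z. w z \<partial>caratheodory_product A B) = (\<integral>\<^sup>+ a. \<integral>\<^sup>+ b. w (a, b) \<partial>B \<partial>A)"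
  and "(\<integral>\<^sup>+ z. w z \<partial>caratheodory_product A B) = (\<integral>\<^sup>+ b. \<integral>\<^sup>+ a. w (a, b) \<partial>A \<partial>B)"
  and "(%a. \<integral>\<^sup>+ b. w (a, b) \<partial>B) \<in> borel_measurable A"
  and "(%b. \<integral>\<^sup>+ a. w (a, b) \<partial>A) \<in> borel_measurable B"
proof -
 let ?P = "caratheodory_product A B" and ?B = "density B (indicator S)"
 let ?T = "space A \<times> S"
 have Ss [measurable]: "S \<in> sets B" using S by (rule sigma_finite_set_sets)
 interpret A: finite_measure A by fact
 interpret B: sigma_finite_measure ?B by (rule sigma_finite_density_indicator[OF S])
 interpret AB: pair_sigma_finite A ?B ..
 have T: "?T \<in> sets ?P" by (intro sets_rectangle_caratheodory) auto
 have Tm: "indicator ?T \<in> borel_measurable ?P" using T by (rule borel_measurable_indicator)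
 have setsB: "sets (A \<Otimes>\<^sub>M ?B) = sets (A \<Otimes>\<^sub>M B)" by (rule sets_pair_measure_cong) auto
 have wB [measurable]: "w \<in> borel_measurable (A \<Otimes>\<^sub>M ?B)" using w by (simp cong: measurable_cong_sets add: setsB)
 have wP [measurable]: "w \<in> borel_measurable ?P" by (rule measurable_caratheodory_product[OF w])
 \<comment> \<open>The identity as a map into the smaller product sigma-algebra; the image measure
   under it forgets the sets that only the Caratheodory process makes measurable.\<close>
 have idm: "(%z. z) \<in> measurable (density ?P (indicator ?T)) (A \<Otimes>\<^sub>M B)"
  using measurable_caratheodory_product[of "%z. z" A B "A \<Otimes>\<^sub>M B"] by simp
 have eq: "A \<Otimes>\<^sub>M ?B = distr (density ?P (indicator ?T)) (A \<Otimes>\<^sub>M B) (%z. z)"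
 proof (rule pair_measure_eqI)
  show "sigma_finite_measure A" "sigma_finite_measure ?B" by unfold_locales
  show "sets (A \<Otimes>\<^sub>M ?B) = sets (distr (density ?P (indicator ?T)) (A \<Otimes>\<^sub>M B) (%z. z))"
   by (simp add: setsB)
  fix X Y assume X [measurable]: "X \<in> sets A" and "Y \<in> sets ?B"
  hence Y [measurable]: "Y \<in> sets B" by simp
  have R: "X \<times> Y \<in> sets ?P" using X Y by (rule sets_rectangle_caratheodory)
  have "emeasure (distr (density ?P (indicator ?T)) (A \<Otimes>\<^sub>M B) (%z. z)) (X \<times> Y) =
    emeasure (density ?P (indicator ?T)) (X \<times> Y)"
   using idm sets.sets_into_space[OF R] by (subst emeasure_distr) (auto simp: Int_absorb2)
  also have "\<dots> = (\<integral>\<^sup>+ z. indicator (X \<times> (Y \<inter> S)) z \<partial>?P)"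
   unfolding emeasure_density[OF Tm R] using sets.sets_into_space[OF X]
   by (intro nn_integral_cong) (auto split: split_indicator)
  also have "\<dots> = emeasure A X * emeasure B (Y \<inter> S)"
   using sets_rectangle_caratheodory[of X A "Y \<inter> S" B] by (simp add: emeasure_rectangle_caratheodory)
  also have "emeasure B (Y \<inter> S) = emeasure ?B Y"
   by (subst emeasure_density)
    (auto simp: nn_integral_indicator[symmetric] simp del: nn_integral_indicator intro!: nn_integral_cong split: split_indicator)
  finally show "emeasure A X * emeasure ?B Y =
    emeasure (distr (density ?P (indicator ?T)) (A \<Otimes>\<^sub>M B) (%z. z)) (X \<times> Y)" by simp
 qed
 have "(\<integral>\<^sup>+ z. w z \<partial>?P) = (\<integral>\<^sup>+ z. indicator ?T z * w z \<partial>?P)"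
  using w0 by (intro nn_integral_cong) (auto simp: space_caratheodory_product split: split_indicator)
 also have "\<dots> = (\<integral>\<^sup>+ z. w z \<partial>density ?P (indicator ?T))" by (simp add: nn_integral_density[OF Tm wP])
 also have "\<dots> = (\<integral>\<^sup>+ z. w z \<partial>(A \<Otimes>\<^sub>M ?B))" unfolding eq using w by (simp add: nn_integral_distr[OF idm])
 finally have P: "(\<integral>\<^sup>+ z. w z \<partial>?P) = (\<integral>\<^sup>+ z. w z \<partial>(A \<Otimes>\<^sub>M ?B))" .
 have inner: "(\<integral>\<^sup>+ b. w (a, b) \<partial>?B) = (\<integral>\<^sup>+ b. w (a, b) \<partial>B)" if a: "a \<in> space A" for a
 proof -
  have "(%b. w (a, b)) \<in> borel_measurable B" using w a by (rule measurable_Pair2)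
  hence "(\<integral>\<^sup>+ b. w (a, b) \<partial>?B) = (\<integral>\<^sup>+ b. indicator S b * w (a, b) \<partial>B)"
   by (subst nn_integral_density) auto
  also have "\<dots> = (\<integral>\<^sup>+ b. w (a, b) \<partial>B)" using w0 a by (intro nn_integral_cong) (auto split: split_indicator)
  finally show ?thesis .
 qed
 have "(\<integral>\<^sup>+ a. \<integral>\<^sup>+ b. w (a, b) \<partial>B \<partial>A) = (\<integral>\<^sup>+ a. \<integral>\<^sup>+ b. w (a, b) \<partial>?B \<partial>A)"
  by (intro nn_integral_cong) (simp add: inner)
 also have "\<dots> = (\<integral>\<^sup>+ z. w z \<partial>(A \<Otimes>\<^sub>M ?B))" by (rule B.nn_integral_fst) measurable
 finally show "(\<integral>\<^sup>+ z. w z \<partial>?P) = (\<integral>\<^sup>+ a. \<integral>\<^sup>+ b. w (a, b) \<partial>B \<partial>A)" using P by simp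
 have "(%a. \<integral>\<^sup>+ b. w (a, b) \<partial>?B) \<in> borel_measurable A" by measurable
 thus "(%a. \<integral>\<^sup>+ b. w (a, b) \<partial>B) \<in> borel_measurable A"
  by (rule measurable_cong[THEN iffD1, rotated]) (simp add: inner)
 have swap: "(%(b, a). w (a, b)) \<in> borel_measurable (B \<Otimes>\<^sub>M A)" using w by (rule measurable_pair_swap)
 hence "case_prod (%b a. w (a, b)) \<in> borel_measurable (B \<Otimes>\<^sub>M A)" by simp
 from A.borel_measurable_nn_integral[OF this]
 show mb: "(%b. \<integral>\<^sup>+ a. w (a, b) \<partial>A) \<in> borel_measurable B" .
 have z: "(\<integral>\<^sup>+ a. w (a, b) \<partial>A) = 0" if "b \<in> space B - S" for b
 proof -
  have "(\<integral>\<^sup>+ a. w (a, b) \<partial>A) = (\<integral>\<^sup>+ a. 0 \<partial>A)" using w0 that by (intro nn_integral_cong) auto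
  thus ?thesis by simp
 qed
 have "(\<integral>\<^sup>+ b. \<integral>\<^sup>+ a. w (a, b) \<partial>A \<partial>B) = (\<integral>\<^sup>+ b. indicator S b * (\<integral>\<^sup>+ a. w (a, b) \<partial>A) \<partial>B)"
  using z by (intro nn_integral_cong) (auto split: split_indicator)
 also have "\<dots> = (\<integral>\<^sup>+ b. \<integral>\<^sup>+ a. w (a, b) \<partial>A \<partial>?B)" by (rule nn_integral_density[symmetric]) (auto intro: mb)
 also have "\<dots> = (\<integral>\<^sup>+ z. w z \<partial>(A \<Otimes>\<^sub>M ?B))" by (rule AB.nn_integral_snd) measurable
 finally show "(\<integral>\<^sup>+ z. w z \<partial>?P) = (\<integral>\<^sup>+ b. \<integral>\<^sup>+ a. w (a, b) \<partial>A \<partial>B)" using P by simp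
qed

section \<open>Separability of sections\<close>

text \<open>In a cover of finite weight a factor Y n of infinite measure forces X n to be null. Such
  rectangles are null in the product and are dropped, and the remaining factors Y n have finite
  measure.\<close>

lemma sigma_finite_caratheodory_hull:
 assumes E: "E \<in> sets (caratheodory_product A B)" and fin: "emeasure (caratheodory_product A B) E < \<infinity>"
 obtains G S where "G \<in> sets (A \<Otimes>\<^sub>M B)" "AE z in caratheodory_product A B. z \<in> E \<longleftrightarrow> z \<in> G"
  "sigma_finite_set B S" "G \<subseteq> space A \<times> S"
proof -
 obtain G X Y where G: "G \<in> sets (A \<Otimes>\<^sub>M B)" "AE z in caratheodory_product A B. z \<in> E \<longleftrightarrow> z \<in> G"
  "range X \<subseteq> sets A" "range Y \<subseteq> sets B" "G \<subseteq> (\<Union>n::nat. X n \<times> Y n)"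
  "(\<Sum>n. emeasure A (X n) * emeasure B (Y n)) < \<infinity>"
  by (rule finite_caratheodory_hull[OF E fin])
 have [measurable]: "X n \<in> sets A" "Y n \<in> sets B" for n using G by auto
 define T where "T n = (if emeasure B (Y n) < \<infinity> then Y n else {})" for n
 define S where "S = (\<Union>n. T n)"
 have T: "sigma_finite_set B (T n)" for n
  unfolding sigma_finite_set_def by (intro conjI exI[of _ "%_. T n"]) (auto simp: T_def)
 hence S: "sigma_finite_set B S" unfolding S_def by (rule sigma_finite_set_UN)
 have [measurable]: "S \<in> sets B" by (rule sigma_finite_set_sets[OF S])
 have null: "X n \<times> Y n \<in> null_sets (caratheodory_product A B)" if "\<not> emeasure B (Y n) < \<infinity>" for n
 proof -
  have "emeasure A (X n) * emeasure B (Y n) < top"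
   using ennreal_suminf_lessD[OF G(6)[unfolded infinity_ennreal_def], of n] .
  hence "emeasure A (X n) * emeasure B (Y n) = 0"
   using that by (auto simp: ennreal_mult_less_top)
  thus ?thesis
   by (auto simp: null_sets_def emeasure_rectangle_caratheodory sets_rectangle_caratheodory)
 qed
 have "AE z in caratheodory_product A B. \<not> emeasure B (Y n) < \<infinity> --> z \<notin> X n \<times> Y n" for n
  using null[of n] by (cases "emeasure B (Y n) < \<infinity>") (auto dest: AE_not_in)
 hence "AE z in caratheodory_product A B. ALL n. \<not> emeasure B (Y n) < \<infinity> --> z \<notin> X n \<times> Y n"
  by (subst AE_all_countable) auto
 with G(2) AE_space have "AE z in caratheodory_product A B. z \<in> E \<longleftrightarrow> z \<in> G \<inter> space A \<times> S"
 proof eventually_elim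
  case (elim z)
  have "z \<in> space A \<times> S" if zG: "z \<in> G"
  proof -
   obtain n where "z \<in> X n \<times> Y n" using G(5) zG by auto
   thus ?thesis using elim by (auto simp: S_def T_def space_caratheodory_product)
  qed
  thus ?case using elim by auto
 qed
 moreover have "G \<inter> space A \<times> S \<in> sets (A \<Otimes>\<^sub>M B)" using G(1) by measurable
 ultimately show ?thesis using that[of "G \<inter> space A \<times> S" S] S by simp
qed

text \<open>Here A stays arbitrary, because it will be M itself when the maps are regarded as
  families of curves indexed by M.\<close>

lemma borel_measurable_nn_integral_sections:
 fixes w :: "'a \<times> 'b => ennreal"
 assumes S: "sigma_finite_set B S" and w: "w \<in> borel_measurable (A \<Otimes>\<^sub>M B)"
  and w0: "!!a b. a \<in> space A ==> b \<in> space B - S ==> w (a, b) = 0"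
 shows "(%a. \<integral>\<^sup>+ b. w (a, b) \<partial>B) \<in> borel_measurable A"
proof -
 let ?B = "density B (indicator S)"
 have Ss [measurable]: "S \<in> sets B" using S by (rule sigma_finite_set_sets)
 interpret B: sigma_finite_measure ?B by (rule sigma_finite_density_indicator[OF S])
 have setsB: "sets (A \<Otimes>\<^sub>M ?B) = sets (A \<Otimes>\<^sub>M B)" by (rule sets_pair_measure_cong) auto
 have wB [measurable]: "w \<in> borel_measurable (A \<Otimes>\<^sub>M ?B)" using w by (simp cong: measurable_cong_sets add: setsB)
 have inner: "(\<integral>\<^sup>+ b. w (a, b) \<partial>?B) = (\<integral>\<^sup>+ b. w (a, b) \<partial>B)" if a: "a \<in> space A" for a
 proof -
  have "(%b. w (a, b)) \<in> borel_measurable B" using w a by (rule measurable_Pair2)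
  hence "(\<integral>\<^sup>+ b. w (a, b) \<partial>?B) = (\<integral>\<^sup>+ b. indicator S b * w (a, b) \<partial>B)"
   by (subst nn_integral_density) auto
  also have "\<dots> = (\<integral>\<^sup>+ b. w (a, b) \<partial>B)" using w0 a by (intro nn_integral_cong) (auto split: split_indicator)
  finally show ?thesis .
 qed
 have "(%a. \<integral>\<^sup>+ b. w (a, b) \<partial>?B) \<in> borel_measurable A" by measurable
 thus "(%a. \<integral>\<^sup>+ b. w (a, b) \<partial>B) \<in> borel_measurable A"
  by (rule measurable_cong[THEN iffD1, rotated]) (simp add: inner)
qed

section \<open>Separability of the family of sections of a product set\<close>

lemma sets_section:
 assumes E: "E \<in> sets (A \<Otimes>\<^sub>M B)" and a: "a \<in> space A"
 shows "{b \<in> space B. (a, b) \<in> E} \<in> sets B"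
proof -
 have "(%b. (a, b)) \<in> measurable B (A \<Otimes>\<^sub>M B)" using a by measurable
 from measurable_sets[OF this E] show ?thesis by (simp add: vimage_def Int_def conj_commute)
qed

text \<open>Induction over the product sigma-algebra. Complements preserve the approximation; a
  countable union is truncated, with a remainder that is small since B is finite, and the finite
  unions of approximating sets again form a countable family. The truncation index may depend on the
  point a.\<close>

lemma sections_approximable:
 assumes B: "finite_measure B" and E: "E \<in> sets (A \<Otimes>\<^sub>M B)"
 shows "\<exists>\<C>. countable \<C> & \<C> \<subseteq> sets B \<and>
  (\<forall>a\<in>space A. \<forall>e>0. \<exists>C\<in>\<C>. measure B {b \<in> space B. ((a, b) \<in> E) ~= (b \<in> C)} < e)"
proof -
 interpret B: finite_measure B by fact
 have "E \<in> sigma_sets (space A \<times> space B) {a \<times> b |a b. a \<in> sets A & b \<in> sets B}"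
  using E by (simp add: sets_pair_measure)
 thus ?thesis
 proof induction
  case (Basic E)
  then obtain X Y where XY: "E = X \<times> Y" "X \<in> sets A" "Y \<in> sets B" by auto
  show ?case
  proof (intro exI[of _ "{Y, {}}"] conjI ballI allI impI)
   fix a and e :: real assume "e > 0"
   have "{b \<in> space B. ((a, b) \<in> E) ~= (b \<in> (if a \<in> X then Y else {}))} = {}"
    by (auto simp: XY(1))
   hence "measure B {b \<in> space B. ((a, b) \<in> E) ~= (b \<in> (if a \<in> X then Y else {}))} < e"
    using \<open>e > 0\<close> by (simp only: measure_empty)
   thus "\<exists>C\<in>{Y, {}}. measure B {b \<in> space B. ((a, b) \<in> E) ~= (b \<in> C)} < e"
    by (rule bexI) auto
  qed (use XY in auto)
 next
  case Empty
  thus ?case by (intro exI[of _ "{{}}"]) auto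
 next
  case (Compl E)
  then obtain \<C> where C: "countable \<C>" "\<C> \<subseteq> sets B"
   "!!a e. a \<in> space A ==> e > 0 ==> \<exists>C\<in>\<C>. measure B {b \<in> space B. ((a, b) \<in> E) ~= (b \<in> C)} < e" by blast
  show ?case
  proof (intro exI[of _ "(%C. space B - C) ` \<C>"] conjI ballI allI impI)
   fix a and e :: real assume a: "a \<in> space A" and "e > 0"
   then obtain C where "C \<in> \<C>" "measure B {b \<in> space B. ((a, b) \<in> E) ~= (b \<in> C)} < e" using C(3) by blast
   moreover have "{b \<in> space B. ((a, b) \<in> space A \<times> space B - E) ~= (b \<in> space B - C)} =
     {b \<in> space B. ((a, b) \<in> E) ~= (b \<in> C)}" using a by auto
   ultimately have "measure B {b \<in> space B. ((a, b) \<in> space A \<times> space B - E) ~= (b \<in> space B - C)} < e"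
    by (simp only:)
   thus "\<exists>C\<in>(%C. space B - C) ` \<C>.
     measure B {b \<in> space B. ((a, b) \<in> space A \<times> space B - E) ~= (b \<in> C)} < e"
    by (rule bexI) (use \<open>C \<in> \<C>\<close> in auto)
  qed (use C in auto)
 next
  case (Union E)
  have "ALL i. \<exists>\<C>. countable \<C> & \<C> \<subseteq> sets B \<and>
   (\<forall>a\<in>space A. \<forall>e>0. \<exists>C\<in>\<C>. measure B {b \<in> space B. ((a, b) \<in> E i) ~= (b \<in> C)} < e)"
   by (rule allI) (rule Union(2))
  from choice[OF this] obtain \<C> where C0: "ALL i. countable (\<C> i) & \<C> i \<subseteq> sets B \<and>
   (\<forall>a\<in>space A. \<forall>e>0. \<exists>C\<in>\<C> i. measure B {b \<in> space B. ((a, b) \<in> E i) ~= (b \<in> C)} < e)"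
   by (elim exE)
  have C: "countable (\<C> i)" "\<C> i \<subseteq> sets B"
   "a \<in> space A ==> e > 0 ==> \<exists>C\<in>\<C> i. measure B {b \<in> space B. ((a, b) \<in> E i) ~= (b \<in> C)} < e" for i a e
   using C0[THEN spec, of i] by auto
  have "sigma_sets (space A \<times> space B) {a \<times> b |a b. a \<in> sets A & b \<in> sets B} = sets (A \<Otimes>\<^sub>M B)"
   by (simp add: sets_pair_measure)
  hence Em: "E i \<in> sets (A \<Otimes>\<^sub>M B)" for i using Union(1) by simp
  define \<D> where "\<D> = (%l. \<Union>(set l)) ` lists (\<Union>i. \<C> i)"
  show ?case
  proof (intro exI[of _ \<D>] conjI ballI allI impI)
   show "countable \<D>" unfolding \<D>_def using C(1) by (intro countable_image countable_lists) auto
   show "\<D> \<subseteq> sets B"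
   proof
    fix X assume "X \<in> \<D>"
    then obtain l where l: "l \<in> lists (\<Union>i. \<C> i)" "X = \<Union>(set l)" by (auto simp: \<D>_def)
    have "set l \<subseteq> (\<Union>i. \<C> i)" using l(1) by (simp add: in_lists_conv_set subset_iff)
    also have "\<dots> \<subseteq> sets B" using C(2) by (rule UN_least)
    finally show "X \<in> sets B" unfolding l(2) by (intro sets.finite_Union) auto
   qed
   fix a and e :: real assume a: "a \<in> space A" and e: "e > 0"
   have Ea [measurable]: "{b \<in> space B. (a, b) \<in> E i} \<in> sets B" for i
    by (rule sets_section[OF Em a])
   define U where "U n = {b \<in> space B. EX i. (a, b) \<in> E i} - (\<Union>i<n. {b \<in> space B. (a, b) \<in> E i})" for n :: nat
   have Um [measurable]: "U n \<in> sets B" for n unfolding U_def by measurable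
   have "(%n. measure B (U n)) \<longlonglongrightarrow> measure B (\<Inter>n. U n)"
    by (rule B.finite_Lim_measure_decseq) (use Um in "auto simp: decseq_def U_def")
   moreover have "(\<Inter>n. U n) = {}" by (auto simp: U_def)
   ultimately have "(%n. measure B (U n)) \<longlonglongrightarrow> 0" by simp
   hence "\<forall>\<^sub>F n in sequentially. measure B (U n) < e / 2" using e by (intro order_tendstoD) auto
   then obtain n where n: "measure B (U n) < e / 2" by (auto simp: eventually_sequentially)
   \<comment> \<open>The n pieces kept after truncation contribute at most n e', hence at most e /
     2; the successor avoids division by zero for n = 0.\<close>
   define e' where "e' = e / (2 * real (Suc n))"
   have "ALL i. EX C. C \<in> \<C> i & measure B {b \<in> space B. ((a, b) \<in> E i) ~= (b \<in> C)} < e'"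
   proof
    fix i
    have "0 < e'" using e by (simp add: e'_def)
    from C(3)[OF a this, of i]
    show "EX C. C \<in> \<C> i & measure B {b \<in> space B. ((a, b) \<in> E i) ~= (b \<in> C)} < e'" by (simp only: Bex_def)
   qed
   from choice[OF this] obtain c where
    "ALL i. c i \<in> \<C> i & measure B {b \<in> space B. ((a, b) \<in> E i) ~= (b \<in> c i)} < e'" by (elim exE)
   hence c: "c i \<in> \<C> i" "measure B {b \<in> space B. ((a, b) \<in> E i) ~= (b \<in> c i)} < e'" for i
    by (simp_all only:)
   have [measurable]: "c i \<in> sets B" for i using c C(2) by auto
   define V where "V i = {b \<in> space B. ((a, b) \<in> E i) ~= (b \<in> c i)}" for i
   have "V i = ({b \<in> space B. (a, b) \<in> E i} - c i) \<union> (c i - {b \<in> space B. (a, b) \<in> E i})" for i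
    using sets.sets_into_space[of "c i" B] by (auto simp: V_def)
   hence Vm [measurable]: "V i \<in> sets B" for i by auto
   let ?C = "\<Union>(set (map c [0..<n]))"
   have CD: "?C \<in> \<D>" unfolding \<D>_def
   proof (rule imageI)
    have "c i \<in> (\<Union>i. \<C> i)" for i using c(1)[of i] by blast
    thus "map c [0..<n] \<in> lists (\<Union>i. \<C> i)" by (simp add: in_lists_conv_set image_subset_iff subset_iff)
   qed
   have "measure B {b \<in> space B. ((a, b) \<in> (\<Union>i. E i)) ~= (b \<in> ?C)} <= measure B (U n \<union> (\<Union>i\<in>{..<n}. V i))"
    by (intro B.finite_measure_mono) (auto simp: U_def V_def)
   also have "\<dots> <= measure B (U n) + measure B (\<Union>i\<in>{..<n}. V i)"
    by (intro measure_Un_le) auto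
   also have "\<dots> <= measure B (U n) + (\<Sum>i<n. measure B (V i))"
    by (intro add_left_mono B.finite_measure_subadditive_finite) auto
   also have "\<dots> <= measure B (U n) + (\<Sum>i<n. e')"
    using c(2) by (intro add_left_mono sum_mono less_imp_le) (simp add: V_def)
   also have "\<dots> < e / 2 + e / 2"
   proof (rule add_less_le_mono[OF n])
    have "real n * e <= real (Suc n) * e" using e by (intro mult_right_mono) auto
    thus "(\<Sum>i<n. e') <= e / 2" by (simp add: e'_def field_simps)
   qed
   finally show "\<exists>C\<in>\<D>. measure B {b \<in> space B. ((a, b) \<in> \<Union> (range E)) ~= (b \<in> C)} < e"
    using CD by (intro bexI[of _ ?C]) auto
  qed
 qed
qed

definition separable_on :: "'a set => ('a => 'a => real) => bool" where
 "separable_on S \<rho> \<longleftrightarrow> (EX D. countable D & D \<subseteq> S & (\<forall>a\<in>S. \<forall>e>0. \<exists>x\<in>D. \<rho> a x < e))"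

text \<open>Level n deals with the pseudometrics of index at most n: a list of points, one close to
  a for each of them, is drawn from the given countable dense sets, and \<open>w\<close> selects one
  point close to the whole list. The rate (1/2)^n is summable, as required by the Borel-Cantelli
  lemma later on.\<close>

lemma separable_on_join:
 fixes \<rho> :: "'i :: countable => 'a => 'a => real"
 assumes sep: "!!i. separable_on S (\<rho> i)" and sym: "!!i x y. \<rho> i x y = \<rho> i y x"
  and tri: "!!i x y z. x \<in> S ==> y \<in> S ==> z \<in> S ==> \<rho> i x z <= \<rho> i x y + \<rho> i y z"
 obtains D where "countable D" "D \<subseteq> S"
  "!!a. a \<in> S ==> EX x. ALL n. x n \<in> D & (ALL i. to_nat i <= n --> \<rho> i a (x n) < (1/2)^n)"
proof -
 have "ALL i. EX D. countable D & D \<subseteq> S & (\<forall>a\<in>S. \<forall>e>0. \<exists>x\<in>D. \<rho> i a x < e)"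
  using sep by (simp add: separable_on_def)
 from choice[OF this] obtain D0 where
  "ALL i. countable (D0 i) & D0 i \<subseteq> S & (\<forall>a\<in>S. \<forall>e>0. \<exists>x\<in>D0 i. \<rho> i a x < e)" by (elim exE)
 hence D0: "countable (D0 i)" "D0 i \<subseteq> S" "a \<in> S ==> e > 0 ==> \<exists>x\<in>D0 i. \<rho> i a x < e" for i a e
  by simp_all
 define W where "W n l a \<longleftrightarrow> a \<in> S & (ALL i. to_nat i <= n --> \<rho> i a (l ! to_nat i) < (1/2)^Suc n)" for n l a
 define w where "w n l = (SOME a. W n l a)" for n l
 have ww: "W n l (w n l)" if "W n l a" for n l a unfolding w_def using that by (rule someI)
 define D where "D = {w n l | n l. l \<in> lists (\<Union>i. D0 i) & (EX a. W n l a)}"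
 have "D \<subseteq> (%(n, l). w n l) ` (UNIV \<times> lists (\<Union>i. D0 i))" by (auto simp: D_def)
 hence "countable D" by (rule countable_subset) (use D0(1) in auto)
 moreover have "D \<subseteq> S" using ww by (auto simp: D_def W_def)
 moreover have "EX x. ALL n. x n \<in> D & (ALL i. to_nat i <= n --> \<rho> i a (x n) < (1/2)^n)" if a: "a \<in> S" for a
 proof -
  have "ALL n. EX x. x \<in> D & (ALL i. to_nat i <= n --> \<rho> i a x < (1/2)^n)"
  proof
   fix n
   have "ALL i. EX x. x \<in> D0 i & \<rho> i a x < (1/2)^Suc n"
    using D0(3)[OF a, of "(1/2)^Suc n"] by (simp add: Bex_def)
   from choice[OF this] obtain y where "ALL i. y i \<in> D0 i & \<rho> i a (y i) < (1/2)^Suc n" by (elim exE)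
   hence y: "y i \<in> D0 i" "\<rho> i a (y i) < (1/2)^Suc n" for i by (simp_all only:)
   define l where "l = map (%k. y (from_nat k)) [0..<Suc n]"
   have l: "l ! to_nat i = y i" if "to_nat i <= n" for i :: 'i
    using that by (simp add: l_def del: upt_Suc)
   have lD: "l \<in> lists (\<Union>i. D0 i)" using y(1) by (auto simp: l_def simp del: upt_Suc) (use y(1) in blast)
   have Wa: "W n l a" using a l y(2) by (auto simp: W_def)
   have "w n l \<in> D" using Wa lD by (auto simp: D_def)
   moreover have "\<rho> i a (w n l) < (1/2)^n" if i: "to_nat i <= n" for i
   proof -
    have S: "w n l \<in> S" "y i \<in> S" using ww[OF Wa] y(1)[of i] D0(2) by (auto simp: W_def)
    have "\<rho> i a (w n l) <= \<rho> i a (y i) + \<rho> i (w n l) (y i)"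
     using tri[OF a S(2,1), of i] sym[of i "y i"] by simp
    also have "\<dots> < (1/2)^Suc n + (1/2)^Suc n"
     using y(2)[of i] ww[OF Wa] l[OF i] i by (intro add_strict_mono) (auto simp: W_def)
    finally show ?thesis by simp
   qed
   ultimately show "EX x. x \<in> D & (ALL i. to_nat i <= n --> \<rho> i a x < (1/2)^n)" by (intro exI[of _ "w n l"]) simp
  qed
  from choice[OF this] show ?thesis .
 qed
 ultimately show ?thesis using that by blast
qed

text \<open>An approximating set that is within (1/2)^(n+1) of some section is replaced by one such
  section, so the dense family consists of genuine sections.\<close>

lemma separable_on_sections:
 assumes B: "finite_measure B" and E: "E \<in> sets (A \<Otimes>\<^sub>M B)"
 shows "separable_on (space A) (%a a'. measure B {b \<in> space B. ((a, b) \<in> E) ~= ((a', b) \<in> E)})"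
proof -
 interpret B: finite_measure B by fact
 obtain \<C> where C: "countable \<C>" "\<C> \<subseteq> sets B"
  "!!a e. a \<in> space A ==> e > 0 ==> \<exists>C\<in>\<C>. measure B {b \<in> space B. ((a, b) \<in> E) ~= (b \<in> C)} < e"
  using sections_approximable[OF B E] by blast
 define P where "P n C a \<longleftrightarrow> a \<in> space A & measure B {b \<in> space B. ((a, b) \<in> E) ~= (b \<in> C)} < (1/2)^Suc n" for n C a
 define w where "w n C = (SOME a. P n C a)" for n C
 have wP: "P n C (w n C)" if "P n C a" for n C a unfolding w_def using that by (rule someI)
 let ?D = "{w n C | n C. C \<in> \<C> & (EX a. P n C a)}"
 have Es: "{b \<in> space B. (a, b) \<in> E} \<in> sets B" if "a \<in> space A" for a
  by (rule sets_section[OF E that])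
 have sm: "{b \<in> space B. ((a, b) \<in> E) ~= (b \<in> C)} \<in> sets B" if a: "a \<in> space A" and "C \<in> \<C>" for a C
 proof -
  have [measurable]: "C \<in> sets B" using that C(2) by auto
  have "{b \<in> space B. ((a, b) \<in> E) ~= (b \<in> C)} = ({b \<in> space B. (a, b) \<in> E} - C) \<union> (C - {b \<in> space B. (a, b) \<in> E})"
   using sets.sets_into_space[of C B] by auto
  thus ?thesis using Es[OF a] by auto
 qed
 show ?thesis unfolding separable_on_def
 proof (intro exI[of _ ?D] conjI ballI allI impI)
  have "?D \<subseteq> (%(n, C). w n C) ` (UNIV \<times> \<C>)" by auto
  thus "countable ?D" by (rule countable_subset) (use C(1) in auto)
  show "?D \<subseteq> space A" using wP by (auto simp: P_def)
  fix a and e :: real assume a: "a \<in> space A" and e: "e > 0"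
  obtain n where n: "(1/2 :: real)^n < e" using real_arch_pow_inv[OF e, of "1/2"] by auto
  obtain c where c: "c \<in> \<C>" "measure B {b \<in> space B. ((a, b) \<in> E) ~= (b \<in> c)} < (1/2)^Suc n"
   using C(3)[OF a, of "(1/2)^Suc n"] by auto
  have Pa: "P n c a" using a c by (simp add: P_def)
  note wc = wP[OF Pa]
  have "measure B {b \<in> space B. ((a, b) \<in> E) ~= ((w n c, b) \<in> E)} \<le>
    measure B ({b \<in> space B. ((a, b) \<in> E) ~= (b \<in> c)} \<union> {b \<in> space B. ((w n c, b) \<in> E) ~= (b \<in> c)})"
   using sm[OF _ c(1)] a wc by (intro B.finite_measure_mono) (auto simp: P_def)
  also have "\<dots> <= measure B {b \<in> space B. ((a, b) \<in> E) ~= (b \<in> c)} + measure B {b \<in> space B. ((w n c, b) \<in> E) ~= (b \<in> c)}"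
   using sm[OF _ c(1)] a wc by (intro measure_Un_le) (auto simp: P_def)
  also have "\<dots> < (1/2)^Suc n + (1/2)^Suc n" using c(2) wc by (intro add_strict_mono) (auto simp: P_def)
  also have "\<dots> = (1/2)^n" by simp
  also note n
  finally show "\<exists>x\<in>?D. measure B {b \<in> space B. ((a, b) \<in> E) ~= ((x, b) \<in> E)} < e"
   using c(1) Pa by (intro bexI[of _ "w n c"]) auto
 qed
qed

lemma separable_on_real: "separable_on S (%a a'. \<bar>f a - f a'\<bar> :: real)"
proof -
 interpret R: metric_target UNIV "dist :: real => real => real"
  by (simp add: metric_target_def Met_TC.Metric_space_axioms)
 obtain C where C: "countable C" "C \<subseteq> f ` S" "!!y e. y \<in> f ` S ==> e > 0 ==> \<exists>z\<in>C. dist y z < e"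
 proof (rule R.countable_dense_in_subset[of "\<rat>" "f ` S"])
  show "\<exists>z\<in>\<rat>. dist y z < e" if "e > 0" for y e :: real
   using Rats_dense_in_real[of y "y + e"] that by (auto simp: dist_real_def intro!: bexI)
 qed (auto simp: countable_rat)
 obtain D where D: "countable D" "D \<subseteq> S" "f ` D = C"
  using countable_subset_image[of C f S] C(1,2) by auto
 show ?thesis unfolding separable_on_def
  using C(3) D by (intro exI[of _ D]) (fastforce simp: dist_real_def)
qed

section \<open>Separably valued maps on product spaces\<close>

context metric_target
begin

lemma L0s_caratheodory: "f \<in> L0s (A \<Otimes>\<^sub>M B) Z d ==> f \<in> L0s (caratheodory_product A B) Z d"
proof -
 assume f: "f \<in> L0s (A \<Otimes>\<^sub>M B) Z d"
 have "(\<lambda>w\<in>space (caratheodory_product A B). f w) \<in> L0s (caratheodory_product A B) Z d"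
  by (rule L0s_compose[OF f]) (auto intro: measurable_caratheodory_product)
 moreover have "(\<lambda>w\<in>space (caratheodory_product A B). f w) = f"
  using L0s_ext[OF f] by (intro extensionalityI[of _ "space (A \<Otimes>\<^sub>M B)"])
   (auto simp: space_caratheodory_product space_pair_measure PiE_def)
 ultimately show ?thesis by simp
qed

lemma L0s_snd: "h \<in> L0s B Z d ==> (\<lambda>z\<in>space (A \<Otimes>\<^sub>M B). h (snd z)) \<in> L0s (A \<Otimes>\<^sub>M B) Z d"
 by (rule L0s_compose) auto

lemma L0s_swap:
 assumes g: "g \<in> L0s (A \<Otimes>\<^sub>M B) Z d"
 shows "(\<lambda>z\<in>space (B \<Otimes>\<^sub>M A). g (snd z, fst z)) \<in> L0s (B \<Otimes>\<^sub>M A) Z d"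
 by (rule L0s_compose[OF g]) measurable

lemma L0s_section:
 assumes g: "g \<in> L0s (A \<Otimes>\<^sub>M B) Z d" and a: "a \<in> space A"
 shows "(\<lambda>b\<in>space B. g (a, b)) \<in> L0s B Z d"
 by (rule L0s_compose[OF g]) (use a in measurable)

end

section \<open>Representatives measurable for the product sigma-algebra\<close>

context Lp_target
begin

lemma sigma_finite_set_distinct:
 assumes f: "f \<in> L0s B Z d" and h: "h \<in> L0s B Z d" and fin: "int_dist_powr B d p f h < \<infinity>"
 shows "sigma_finite_set B {b \<in> space B. f b ~= h b}"
proof -
 have [measurable]: "(%b. d (f b) (h b)) \<in> borel_measurable B" by (rule L0s_dist_measurable[OF f h])
 have "sigma_finite_set B {b \<in> space B. ennreal (d (f b) (h b) powr p) ~= 0}"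
  using fin by (intro sigma_finite_set_support) (auto simp: int_dist_powr_def)
 moreover have "{b \<in> space B. ennreal (d (f b) (h b) powr p) ~= 0} = {b \<in> space B. f b ~= h b}"
  using L0s_in[OF f] L0s_in[OF h] by (auto simp: ennreal_eq_0_iff)
 ultimately show ?thesis by simp
qed

text \<open>Where c differs from the base map, its level sets around the points of a countable dense
  set, with rational radii, have sigma-finite support. Each agrees almost everywhere with a set of
  the product sigma-algebra, and as there are countably many, one null set N0 accounts for all the
  discrepancies.\<close>

lemma nice_representative:
 assumes c: "c \<in> L0s (caratheodory_product A B) Z d" and h: "h \<in> L0s B Z d"
  and fin: "int_dist_powr (caratheodory_product A B) d p c (%z. h (snd z)) < \<infinity>"
 obtains g S where "g \<in> L0s (A \<Otimes>\<^sub>M B) Z d" "sigma_finite_set B S"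
  "AE z in caratheodory_product A B. c z = g z"
  "!!a b. a \<in> space A ==> b \<in> space B - S ==> g (a, b) = h b"
proof -
 let ?P = "caratheodory_product A B" and ?Q = "A \<Otimes>\<^sub>M B"
 define H where "H = (\<lambda>z\<in>space ?Q. h (snd z))"
 have sp: "space ?P = space ?Q" by (simp add: space_caratheodory_product space_pair_measure)
 have HQ: "H \<in> L0s ?Q Z d" unfolding H_def by (rule L0s_snd[OF h])
 hence HP: "H \<in> L0s ?P Z d" by (rule L0s_caratheodory)
 define K0 where "K0 = {z \<in> space ?P. c z ~= H z}"
 have "int_dist_powr ?P d p c H < \<infinity>"
  using fin by (subst int_dist_powr_cong_AE[of c c _ H "%z. h (snd z)"]) (auto simp: H_def sp)
 hence "sigma_finite_set ?P K0" unfolding K0_def by (rule sigma_finite_set_distinct[OF c HP])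
 then obtain F :: "nat => _" where F: "range F \<subseteq> sets ?P" "!!n. emeasure ?P (F n) < \<infinity>" "K0 \<subseteq> (\<Union>n. F n)"
  and K0: "K0 \<in> sets ?P" by (auto simp: sigma_finite_set_def)
 obtain D1 where D1: "countable D1" "D1 \<subseteq> Z" "!!y e. y \<in> space ?P ==> e > 0 ==> \<exists>z\<in>D1. d (c y) z < e"
  using L0s_dense[OF c] by metis
 obtain D2 where D2: "countable D2" "D2 \<subseteq> Z" "!!y e. y \<in> space ?P ==> e > 0 ==> \<exists>z\<in>D2. d (H y) z < e"
  using L0s_dense[OF HP] by metis
 define D where "D = D1 \<union> D2"
 have D: "countable D" "D \<subseteq> Z" using D1 D2 by (auto simp: D_def)
 define K where "K n = F n \<inter> K0" for n
 define L where "L n u q = {z \<in> K n. d (c z) u < q}" for n u and q :: real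
 have Ks: "K n \<in> sets ?P" "emeasure ?P (K n) < \<infinity>" for n
 proof -
  show "K n \<in> sets ?P" using F K0 by (auto simp: K_def)
  have "emeasure ?P (K n) <= emeasure ?P (F n)" using F by (intro emeasure_mono) (auto simp: K_def)
  thus "emeasure ?P (K n) < \<infinity>" using F(2)[of n] by (rule order.strict_trans1)
 qed
 have Ls: "L n u q \<in> sets ?P" "emeasure ?P (L n u q) < \<infinity>" if "u \<in> D" for n u q
 proof -
  have [measurable]: "(%z. d (c z) u) \<in> borel_measurable ?P" using D that by (intro L0s_dist_const[OF c]) auto
  have "L n u q = K n \<inter> {z \<in> space ?P. d (c z) u < q}"
   using sets.sets_into_space[OF Ks(1)] by (auto simp: L_def)
  moreover have "{z \<in> space ?P. d (c z) u < q} \<in> sets ?P" by measurable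
  ultimately show "L n u q \<in> sets ?P" using Ks(1)[of n] by simp
  have "emeasure ?P (L n u q) <= emeasure ?P (K n)" using Ks by (intro emeasure_mono) (auto simp: L_def)
  thus "emeasure ?P (L n u q) < \<infinity>" using Ks(2)[of n] by (rule order.strict_trans1)
 qed
 have "ALL n. EX G S. G \<in> sets ?Q & (AE z in ?P. (z \<in> K n) = (z \<in> G)) & sigma_finite_set B S & G \<subseteq> space A \<times> S"
 proof
  fix n show "EX G S. G \<in> sets ?Q & (AE z in ?P. (z \<in> K n) = (z \<in> G)) & sigma_finite_set B S & G \<subseteq> space A \<times> S"
   by (rule sigma_finite_caratheodory_hull[OF Ks(1)[of n] Ks(2)[of n]]) auto
 qed
 from choice2[OF this] obtain G S where GS: "ALL n. G n \<in> sets ?Q & (AE z in ?P. (z \<in> K n) = (z \<in> G n)) \<and>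
   sigma_finite_set B (S n) & G n \<subseteq> space A \<times> S n" by (elim exE)
 define hl where "hl E = (SOME G. G \<in> sets ?Q & (AE z in ?P. z \<in> E \<longleftrightarrow> z \<in> G))" for E
 have hl: "hl (L n u q) \<in> sets ?Q" "AE z in ?P. z \<in> L n u q \<longleftrightarrow> z \<in> hl (L n u q)" if "u \<in> D" for n u q
 proof -
  have "EX G. G \<in> sets ?Q & (AE z in ?P. z \<in> L n u q \<longleftrightarrow> z \<in> G)"
   by (rule sigma_finite_caratheodory_hull[OF Ls[OF that]]) auto
  from someI_ex[OF this] show "hl (L n u q) \<in> sets ?Q" "AE z in ?P. z \<in> L n u q \<longleftrightarrow> z \<in> hl (L n u q)"
   unfolding hl_def by auto
 qed
 have "AE z in ?P. (ALL n. (z \<in> K n) = (z \<in> G n)) & (ALL n. \<forall>u\<in>D. \<forall>q\<in>\<rat>. (z \<in> L n u q) = (z \<in> hl (L n u q)))"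
  using GS hl(2)
  by (simp add: AE_all_countable AE_ball_countable[OF D(1)] AE_ball_countable[OF countable_rat])
 then obtain N0 where N0: "N0 \<in> sets ?Q" "N0 \<in> null_sets ?P"
  "!!z. z \<in> space A \<times> space B - N0 ==> (ALL n. (z \<in> K n) = (z \<in> G n)) & (ALL n. \<forall>u\<in>D. \<forall>q\<in>\<rat>. (z \<in> L n u q) = (z \<in> hl (L n u q)))"
  by (rule AE_caratheodory_hull) (rule that, assumption+)
 \<comment> \<open>Off N0 this is exactly the set where c differs from H. On N0 the new map takes
   the base value, so its behaviour there is measurable too.\<close>
 define G0 where "G0 = (\<Union>n. G n) - N0"
 have G0 [measurable]: "G0 \<in> sets ?Q" using GS N0 by (auto simp: G0_def)
 have KG: "z \<in> K0 \<longleftrightarrow> z \<in> G0" if "z \<in> space ?Q - N0" for z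
 proof -
  have "z \<in> K0 \<longleftrightarrow> (EX n. z \<in> K n)" using F(3) by (auto simp: K_def)
  also have "\<dots> \<longleftrightarrow> (EX n. z \<in> G n)" using N0(3)[of z] that by (simp add: space_pair_measure)
  finally show ?thesis using that by (simp add: G0_def)
 qed
 define g where "g = (\<lambda>z\<in>space ?Q. if z \<in> G0 then c z else H z)"
 have inZ: "c z \<in> Z" "H z \<in> Z" if "z \<in> space ?Q" for z using L0s_in[OF c] L0s_in[OF HQ] that sp by auto
 have "g \<in> L0s ?Q Z d"
 proof (rule L0sI[OF _ D])
  show "g \<in> space ?Q \<rightarrow>\<^sub>E Z" using inZ by (auto simp: g_def)
  show "\<exists>z\<in>D. d (g y) z < e" if "y \<in> space ?Q" "e > 0" for y e
   using D1(3)[of y e] D2(3)[of y e] that sp by (auto simp: g_def D_def)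
  fix u assume u: "u \<in> D"
  show "(%y. d (g y) u) \<in> borel_measurable ?Q"
   unfolding borel_measurable_iff_less
  proof
   fix r :: real
   have Hu [measurable]: "(%y. d (H y) u) \<in> borel_measurable ?Q" using u D(2) by (intro L0s_dist_const[OF HQ]) auto
   have eq: "{z \<in> space ?Q. d (g z) u < r} = (G0 \<inter> (\<Union>n. \<Union>q\<in>{q\<in>\<rat>. q < r}. hl (L n u q))) \<union>
     ({z \<in> space ?Q. d (H z) u < r} - G0)" (is "?l = ?r")
   proof -
    have "z \<in> ?l \<longleftrightarrow> z \<in> ?r" if z: "z \<in> space ?Q" for z
    proof (cases "z \<in> G0")
     case True
     hence zN: "z \<in> space ?Q - N0" using z by (auto simp: G0_def)
     hence zK: "z \<in> K0" using KG True by simp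
     then obtain m where m: "z \<in> K m" using F(3) by (auto simp: K_def)
     have "d (c z) u < r \<longleftrightarrow> (\<exists>q\<in>\<rat>. q < r & d (c z) u < q)"
      using Rats_dense_in_real[of "d (c z) u" r] by (auto intro: less_trans)
     also have "\<dots> \<longleftrightarrow> (EX n. \<exists>q\<in>\<rat>. q < r & z \<in> L n u q)"
      using m by (auto simp: L_def)
     also have "\<dots> \<longleftrightarrow> (EX n. \<exists>q\<in>\<rat>. q < r & z \<in> hl (L n u q))"
      using N0(3)[of z] zN u by (auto simp: space_pair_measure)
     finally show ?thesis using True z by (auto simp: g_def)
    next
     case False
     thus ?thesis using z by (auto simp: g_def)
    qed
    moreover have "?l \<subseteq> space ?Q" "?r \<subseteq> space ?Q" using sets.sets_into_space[OF G0] by auto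
    ultimately show ?thesis by blast
   qed
   have "(\<Union>n. \<Union>q\<in>{q\<in>\<rat>. q < r}. hl (L n u q)) \<in> sets ?Q"
    using hl(1)[OF u] by (intro sets.countable_UN'' countable_subset[OF _ countable_rat]) auto
   moreover have "{z \<in> space ?Q. d (H z) u < r} \<in> sets ?Q" by measurable
   ultimately show "?l \<in> sets ?Q" unfolding eq using G0 by auto
  qed
 qed
 moreover have "sigma_finite_set B (\<Union>n. S n)" using GS by (intro sigma_finite_set_UN) auto
 moreover have "AE z in ?P. c z = g z"
  using AE_not_in[OF N0(2)] AE_space
  by eventually_elim (use KG in "auto simp: g_def sp K0_def")
 moreover have "g (a, b) = h b" if "a \<in> space A" "b \<in> space B - (\<Union>n. S n)" for a b
  using that GS by (auto simp: g_def G0_def H_def space_pair_measure)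
 ultimately show ?thesis using that by blast
qed

end

section \<open>Sections of jointly measurable maps\<close>

context Lp_target
begin

lemma int_dist_powr_Fatou:
 assumes fn: "!!n. fn n \<in> L0s Y Z d" and f: "f \<in> L0s Y Z d" and k: "k \<in> L0s Y Z d"
  and lim: "AE y in Y. (%n. d (fn n y) (f y)) \<longlonglongrightarrow> 0"
 shows "int_dist_powr Y d p f k <= liminf (%n. int_dist_powr Y d p (fn n) k)"
proof -
 have [measurable]: "(%y. d (fn n y) (k y)) \<in> borel_measurable Y" for n by (rule L0s_dist_measurable[OF fn k])
 have "AE y in Y. ennreal (d (f y) (k y) powr p) = liminf (%n. ennreal (d (fn n y) (k y) powr p))"
  using lim AE_space
 proof eventually_elim
  fix y assume l: "(%n. d (fn n y) (f y)) \<longlonglongrightarrow> 0" and y: "y \<in> space Y"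
  have "(%n. d (fn n y) (k y)) \<longlonglongrightarrow> d (f y) (k y)"
  proof (rule LIM_zero_cancel, rule Lim_null_comparison[OF _ l], rule always_eventually, rule allI)
   fix n show "norm (d (fn n y) (k y) - d (f y) (k y)) <= d (fn n y) (f y)"
    using mdist_reverse_triangle[of "fn n y" "k y" "f y"] L0s_in[OF fn y] L0s_in[OF f y] L0s_in[OF k y]
    by (simp add: commute[of "k y"])
  qed
  hence "(%n. d (fn n y) (k y) powr p) \<longlonglongrightarrow> d (f y) (k y) powr p"
   using p_gt_1 by (intro tendsto_powr') auto
  hence "(%n. ennreal (d (fn n y) (k y) powr p)) \<longlonglongrightarrow> ennreal (d (f y) (k y) powr p)" by (rule tendsto_ennrealI)
  thus "ennreal (d (f y) (k y) powr p) = liminf (%n. ennreal (d (fn n y) (k y) powr p))"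
   by (rule lim_imp_Liminf[OF sequentially_bot, symmetric])
 qed
 hence "int_dist_powr Y d p f k = (\<integral>\<^sup>+ y. liminf (%n. ennreal (d (fn n y) (k y) powr p)) \<partial>Y)"
  unfolding int_dist_powr_def by (rule nn_integral_cong_AE)
 also have "\<dots> <= liminf (%n. int_dist_powr Y d p (fn n) k)"
  unfolding int_dist_powr_def by (rule nn_integral_liminf) measurable
 finally show ?thesis .
qed

lemma powr_dist_bound:
 assumes "x \<in> Z" "y \<in> Z" "z \<in> Z"
 shows "d x y powr p <= 2 powr p * (d x z powr p + d y z powr p)"
proof -
 have "d x y <= 2 * max (d x z) (d y z)" using triangle'[of x z y] assms by (auto simp: max_def)
 hence "d x y powr p <= (2 * max (d x z) (d y z)) powr p" using p_gt_1 by (intro powr_mono2) auto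
 also have "\<dots> = 2 powr p * (max (d x z) (d y z)) powr p" by (simp add: powr_mult)
 also have "(max (d x z) (d y z)) powr p <= d x z powr p + d y z powr p" by (auto simp: max_def)
 finally show ?thesis by simp
qed

text \<open>Almost everywhere convergence and convergence of the norms imply convergence in L^p. No
  single function dominates the distances; instead the part of \<open>rn\<close> above r has
  vanishing integral, by convergence of the norms, and the rest is dominated by a multiple of
  r.\<close>

lemma int_dist_powr_tendsto_0:
 assumes fn: "!!n. fn n \<in> L0s Y Z d" and f: "f \<in> L0s Y Z d" and k: "k \<in> L0s Y Z d"
  and fin: "int_dist_powr Y d p f k < \<infinity>"
  and norms: "(%n. int_dist_powr Y d p (fn n) k) \<longlonglongrightarrow> int_dist_powr Y d p f k"
  and lim: "AE y in Y. (%n. d (fn n y) (f y)) \<longlonglongrightarrow> 0"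
 shows "(%n. int_dist_powr Y d p (fn n) f) \<longlonglongrightarrow> 0"
proof -
 define r where "r y = d (f y) (k y) powr p" for y
 define rn where "rn n y = d (fn n y) (k y) powr p" for n y
 define dn where "dn n y = d (fn n y) (f y) powr p" for n y
 define c where "c = (2 :: real) powr p"
 have c0: "c > 0" by (simp add: c_def)
 have [measurable]: "(%y. d (fn n y) (k y)) \<in> borel_measurable Y" "(%y. d (fn n y) (f y)) \<in> borel_measurable Y"
   "(%y. d (f y) (k y)) \<in> borel_measurable Y" for n
  by (rule L0s_dist_measurable[OF fn k] L0s_dist_measurable[OF fn f] L0s_dist_measurable[OF f k])+
 have [measurable]: "r \<in> borel_measurable Y" "rn n \<in> borel_measurable Y" "dn n \<in> borel_measurable Y" for n
  unfolding r_def rn_def dn_def by measurable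
 have nonneg: "0 <= r y" "0 <= rn n y" "0 <= dn n y" for n y by (auto simp: r_def rn_def dn_def)
 have Ir: "int_dist_powr Y d p f k = (\<integral>\<^sup>+ y. r y \<partial>Y)" "int_dist_powr Y d p (fn n) k = (\<integral>\<^sup>+ y. rn n y \<partial>Y)" for n
  by (simp_all add: int_dist_powr_def r_def rn_def)
 have finr: "(\<integral>\<^sup>+ y. r y \<partial>Y) < \<infinity>" using fin by (simp add: Ir)
 have conv: "AE y in Y. (%n. rn n y) \<longlonglongrightarrow> r y & (%n. dn n y) \<longlonglongrightarrow> 0"
  using lim AE_space
 proof eventually_elim
  fix y assume l: "(%n. d (fn n y) (f y)) \<longlonglongrightarrow> 0" and y: "y \<in> space Y"
  have "(%n. d (fn n y) (k y)) \<longlonglongrightarrow> d (f y) (k y)"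
  proof (rule LIM_zero_cancel, rule Lim_null_comparison[OF _ l], rule always_eventually, rule allI)
   fix n show "norm (d (fn n y) (k y) - d (f y) (k y)) <= d (fn n y) (f y)"
    using mdist_reverse_triangle[of "fn n y" "k y" "f y"] L0s_in[OF fn y] L0s_in[OF f y] L0s_in[OF k y]
    by (simp add: commute[of "k y"])
  qed
  hence "(%n. rn n y) \<longlonglongrightarrow> r y" unfolding rn_def r_def using p_gt_1 by (intro tendsto_powr') auto
  moreover have "(%n. dn n y) \<longlonglongrightarrow> 0 powr p" unfolding dn_def using l p_gt_1 by (intro tendsto_powr') auto
  ultimately show "(%n. rn n y) \<longlonglongrightarrow> r y & (%n. dn n y) \<longlonglongrightarrow> 0" by simp
 qed
 have "(%n. \<integral>\<^sup>+ y. ennreal (min (rn n y) (r y)) \<partial>Y) \<longlonglongrightarrow> (\<integral>\<^sup>+ y. ennreal (r y) \<partial>Y)"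
 proof (rule nn_integral_dominated_convergence[where w = "%y. ennreal (r y)"])
  show "AE y in Y. (%n. ennreal (min (rn n y) (r y))) \<longlonglongrightarrow> ennreal (r y)"
   using conv
  proof eventually_elim
   fix y assume "(%n. rn n y) \<longlonglongrightarrow> r y & (%n. dn n y) \<longlonglongrightarrow> 0"
   hence "(%n. min (rn n y) (r y)) \<longlonglongrightarrow> min (r y) (r y)" by (intro tendsto_min tendsto_const) auto
   thus "(%n. ennreal (min (rn n y) (r y))) \<longlonglongrightarrow> ennreal (r y)" by (intro tendsto_ennrealI) simp
  qed
 qed (use finr in "auto intro!: ennreal_leI")
 hence "(%n. (\<integral>\<^sup>+ y. rn n y \<partial>Y) - (\<integral>\<^sup>+ y. ennreal (min (rn n y) (r y)) \<partial>Y)) \<longlonglongrightarrow>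
   (\<integral>\<^sup>+ y. r y \<partial>Y) - (\<integral>\<^sup>+ y. r y \<partial>Y)"
  using norms finr unfolding Ir by (intro tendsto_diff_ennreal_general) auto
 hence diff0: "(%n. (\<integral>\<^sup>+ y. rn n y \<partial>Y) - (\<integral>\<^sup>+ y. ennreal (min (rn n y) (r y)) \<partial>Y)) \<longlonglongrightarrow> 0"
  using finr by (simp add: ennreal_minus_cancel_iff)
 have diffn: "(\<integral>\<^sup>+ y. ennreal (rn n y - min (rn n y) (r y)) \<partial>Y) =
   (\<integral>\<^sup>+ y. rn n y \<partial>Y) - (\<integral>\<^sup>+ y. ennreal (min (rn n y) (r y)) \<partial>Y)" for n
 proof -
  have "(\<integral>\<^sup>+ y. ennreal (min (rn n y) (r y)) \<partial>Y) <= (\<integral>\<^sup>+ y. r y \<partial>Y)"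
   by (intro nn_integral_mono ennreal_leI) auto
  hence "(\<integral>\<^sup>+ y. ennreal (min (rn n y) (r y)) \<partial>Y) ~= \<infinity>" using finr by (auto simp: top_unique)
  hence "(\<integral>\<^sup>+ y. ennreal (rn n y) - ennreal (min (rn n y) (r y)) \<partial>Y) =
    (\<integral>\<^sup>+ y. rn n y \<partial>Y) - (\<integral>\<^sup>+ y. ennreal (min (rn n y) (r y)) \<partial>Y)"
   by (intro nn_integral_diff) (auto intro!: ennreal_leI)
  thus ?thesis using nonneg by (simp add: ennreal_minus)
 qed
 have kn: "(%n. \<integral>\<^sup>+ y. ennreal (min (dn n y) (2 * c * r y)) \<partial>Y) \<longlonglongrightarrow> (\<integral>\<^sup>+ y. ennreal 0 \<partial>Y)"
 proof (rule nn_integral_dominated_convergence[where w = "%y. ennreal (2 * c) * ennreal (r y)"])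
  show "AE y in Y. ennreal (min (dn n y) (2 * c * r y)) <= ennreal (2 * c) * ennreal (r y)" for n
   using c0 nonneg by (intro AE_I2) (simp add: ennreal_mult[symmetric] ennreal_leI)
  show "(\<integral>\<^sup>+ y. ennreal (2 * c) * ennreal (r y) \<partial>Y) < \<infinity>"
   using finr by (simp add: nn_integral_cmult ennreal_mult_less_top)
  show "AE y in Y. (%n. ennreal (min (dn n y) (2 * c * r y))) \<longlonglongrightarrow> ennreal 0"
   using conv
  proof eventually_elim
   fix y assume "(%n. rn n y) \<longlonglongrightarrow> r y & (%n. dn n y) \<longlonglongrightarrow> 0"
   hence "(%n. min (dn n y) (2 * c * r y)) \<longlonglongrightarrow> min 0 (2 * c * r y)" by (intro tendsto_min tendsto_const) auto
   thus "(%n. ennreal (min (dn n y) (2 * c * r y))) \<longlonglongrightarrow> ennreal 0"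
    using c0 nonneg by (intro tendsto_ennrealI) (simp add: min_def)
  qed
 qed auto
 \<comment> \<open>If rn <= r then dn <= 2 c r and the minimum equals dn. Otherwise dn exceeds 2 c r
   by at most c (rn - r).\<close>
 have bound: "int_dist_powr Y d p (fn n) f <= (\<integral>\<^sup>+ y. ennreal (min (dn n y) (2 * c * r y)) \<partial>Y) +
   ennreal c * ((\<integral>\<^sup>+ y. rn n y \<partial>Y) - (\<integral>\<^sup>+ y. ennreal (min (rn n y) (r y)) \<partial>Y))" for n
 proof -
  have "int_dist_powr Y d p (fn n) f = (\<integral>\<^sup>+ y. ennreal (dn n y) \<partial>Y)"
   by (simp add: int_dist_powr_def dn_def)
  also have "\<dots> <= (\<integral>\<^sup>+ y. ennreal (min (dn n y) (2 * c * r y)) + ennreal c * ennreal (rn n y - min (rn n y) (r y)) \<partial>Y)"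
  proof (rule nn_integral_mono)
   fix y assume y: "y \<in> space Y"
   have 1: "dn n y <= c * (rn n y + r y)"
    unfolding dn_def rn_def r_def c_def by (intro powr_dist_bound L0s_in[OF fn y] L0s_in[OF f y] L0s_in[OF k y])
   have 2: "0 <= c * (rn n y - min (rn n y) (r y))" "0 <= 2 * c * r y" using c0 nonneg by auto
   have "dn n y <= min (dn n y) (2 * c * r y) + c * (rn n y - min (rn n y) (r y))"
   proof (cases "rn n y <= r y")
    case True
    hence "c * (rn n y + r y) <= c * (2 * r y)" using c0 by (intro mult_left_mono) auto
    thus ?thesis using 1 2 by (simp add: min_def mult_ac)
   next
    case False
    hence "c * (rn n y - min (rn n y) (r y)) = c * (rn n y + r y) - 2 * c * r y"
     by (simp add: algebra_simps)
    thus ?thesis using 1 2 by (simp add: min_def)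
   qed
   thus "ennreal (dn n y) <= ennreal (min (dn n y) (2 * c * r y)) + ennreal c * ennreal (rn n y - min (rn n y) (r y))"
    using nonneg c0 2 by (simp add: ennreal_mult[symmetric] ennreal_plus[symmetric] ennreal_leI del: ennreal_plus)
  qed
  also have "\<dots> = (\<integral>\<^sup>+ y. ennreal (min (dn n y) (2 * c * r y)) \<partial>Y) +
   ennreal c * ((\<integral>\<^sup>+ y. rn n y \<partial>Y) - (\<integral>\<^sup>+ y. ennreal (min (rn n y) (r y)) \<partial>Y))"
   by (subst nn_integral_add) (auto simp: nn_integral_cmult diffn)
  finally show ?thesis .
 qed
 have "(%n. (\<integral>\<^sup>+ y. ennreal (min (dn n y) (2 * c * r y)) \<partial>Y) +
   ennreal c * ((\<integral>\<^sup>+ y. rn n y \<partial>Y) - (\<integral>\<^sup>+ y. ennreal (min (rn n y) (r y)) \<partial>Y))) \<longlonglongrightarrow> 0 + ennreal c * 0"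
  using kn by (intro tendsto_add ennreal_tendsto_cmult diff0) auto
 hence *: "(%n. (\<integral>\<^sup>+ y. ennreal (min (dn n y) (2 * c * r y)) \<partial>Y) +
   ennreal c * ((\<integral>\<^sup>+ y. rn n y \<partial>Y) - (\<integral>\<^sup>+ y. ennreal (min (rn n y) (r y)) \<partial>Y))) \<longlonglongrightarrow> 0" by simp
 show ?thesis
  by (rule tendsto_sandwich[OF _ _ tendsto_const *]) (use bound in auto)
qed

text \<open>The difficulty is separability of the range. Countably many pseudometrics on the
  parameters are used: on pieces F m of finite measure, the measure of the symmetric difference of
  the level sets of two sections, and in addition the difference of the p-th powers of their
  distances to h. A sequence approximating a in all of them has level sets that eventually agree
  almost everywhere, by Borel-Cantelli, so the sections converge almost everywhere; with the norms
  they converge in L^p.\<close>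

lemma Lp_classes_L0sI:
 fixes A :: "'a measure" and B :: "'b measure"
 assumes h: "h \<in> L0s B Z d" and g: "g \<in> L0s (A \<Otimes>\<^sub>M B) Z d" and S: "sigma_finite_set B S"
  and gh: "!!a b. a \<in> space A ==> b \<in> space B - S ==> g (a, b) = h b"
  and fin: "!!a. a \<in> space A ==> int_dist_powr B d p (%b. g (a, b)) h < \<infinity>"
 shows "(\<lambda>a\<in>space A. cls B Z (%b. g (a, b))) \<in> L0s A (Lp B Z d p (cls B Z h)) (Lp_dist B Z d p)"
proof -
 let ?X = "Lp B Z d p (cls B Z h)" and ?D = "Lp_dist B Z d p"
 define s where "s a = (\<lambda>b\<in>space B. g (a, b))" for a
 have s: "s a \<in> L0s B Z d" if "a \<in> space A" for a unfolding s_def by (rule L0s_section[OF g that])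
 have scls: "cls B Z (%b. g (a, b)) = cls B Z (s a)" for a by (rule cls_cong) (simp add: s_def)
 have sint: "int_dist_powr B d p (s a) k = int_dist_powr B d p (%b. g (a, b)) k" for a k
  unfolding int_dist_powr_def by (intro nn_integral_cong) (simp add: s_def)
 have finS: "int_dist_powr B d p (s a) h < \<infinity>" if "a \<in> space A" for a using fin[OF that] by (simp add: sint)
 have hL0: "cls B Z h \<in> L0 B Z d" by (rule cls_in_L0[OF h])
 interpret X: Lp_target ?X ?D p by (rule Lp_target_Lp[OF hL0])
 have sX: "cls B Z (s a) \<in> ?X" if "a \<in> space A" for a
  unfolding cls_in_Lp_iff[OF s[OF that] h] by (rule finS[OF that])
 have fin2: "int_dist_powr B d p (s a) f < \<infinity>" if a: "a \<in> space A" and f: "f \<in> L0s B Z d" "int_dist_powr B d p f h < \<infinity>" for a f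
  by (rule map_dist_triangle(1)[OF s[OF a] h f(1) finS[OF a]]) (subst int_dist_powr_commute, rule f(2))
 have meas: "(%a. int_dist_powr B d p (s a) f) \<in> borel_measurable A"
  if f: "f \<in> L0s B Z d" "int_dist_powr B d p f h < \<infinity>" for f
 proof -
  let ?S = "S \<union> {b \<in> space B. f b ~= h b}"
  have S': "sigma_finite_set B ?S"
   by (rule sigma_finite_set_Un[OF S sigma_finite_set_distinct[OF f(1) h f(2)]])
  define F where "F = (\<lambda>z\<in>space (A \<Otimes>\<^sub>M B). f (snd z))"
  have F: "F \<in> L0s (A \<Otimes>\<^sub>M B) Z d" unfolding F_def by (rule L0s_snd[OF f(1)])
  have [measurable]: "(%z. d (g z) (F z)) \<in> borel_measurable (A \<Otimes>\<^sub>M B)" by (rule L0s_dist_measurable[OF g F])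
  have "(%a. \<integral>\<^sup>+ b. ennreal (d (g (a, b)) (F (a, b)) powr p) \<partial>B) \<in> borel_measurable A"
  proof (rule borel_measurable_nn_integral_sections[OF S'])
   show "(%z. ennreal (d (g z) (F z) powr p)) \<in> borel_measurable (A \<Otimes>\<^sub>M B)" by measurable
   show "ennreal (d (g (a, b)) (F (a, b)) powr p) = 0" if "a \<in> space A" "b \<in> space B - ?S" for a b
    using that gh[of a b] L0s_in[OF h, of b] by (simp add: F_def space_pair_measure)
  qed
  thus ?thesis
   by (rule measurable_cong[THEN iffD1, rotated])
    (auto simp: s_def int_dist_powr_def F_def space_pair_measure intro!: nn_integral_cong)
 qed
 obtain C where C: "countable C" "C \<subseteq> Z" "!!z e. z \<in> space (A \<Otimes>\<^sub>M B) ==> e > 0 ==> \<exists>u\<in>C. d (g z) u < e"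
  by (rule L0s_dense[OF g]) (rule that, assumption+)
 obtain F :: "nat => 'b set" where F: "range F \<subseteq> sets B" "!!n. emeasure B (F n) < \<infinity>" "S \<subseteq> (\<Union>n. F n)"
  using S by (auto simp: sigma_finite_set_def)
 have Fm [measurable]: "F n \<in> sets B" for n using F(1) by auto
 define \<nu> where "\<nu> n = density B (indicator (F n))" for n
 have \<nu>em: "emeasure (\<nu> n) T = emeasure B (F n \<inter> T)" if [measurable]: "T \<in> sets B" for n T
  unfolding \<nu>_def by (subst emeasure_density)
   (auto simp: nn_integral_indicator[symmetric] indicator_inter_arith intro!: nn_integral_cong simp del: nn_integral_indicator)
 have \<nu>: "finite_measure (\<nu> n)" for n
 proof
  have sp: "space (\<nu> n) = space B" by (simp add: \<nu>_def)
  have "emeasure B (F n \<inter> space B) <= emeasure B (F n)" by (intro emeasure_mono) auto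
  thus "emeasure (\<nu> n) (space (\<nu> n)) ~= \<infinity>" using F(2)[of n] by (auto simp: sp \<nu>em top_unique)
 qed
 have s\<nu>: "sets (A \<Otimes>\<^sub>M \<nu> n) = sets (A \<Otimes>\<^sub>M B)" for n by (rule sets_pair_measure_cong) (auto simp: \<nu>_def)
 define E where "E i = {z \<in> space (A \<Otimes>\<^sub>M B). d (g z) (from_nat_into C (fst i)) < real_of_rat (snd i)}" for i :: "nat \<times> rat"
 have Em: "E i \<in> sets (A \<Otimes>\<^sub>M B)" if "C ~= {}" for i
 proof -
  have "from_nat_into C (fst i) \<in> Z" using C(2) from_nat_into[OF that] by auto
  from L0s_dist_const[OF g this] show ?thesis unfolding E_def by measurable
 qed
 define nrm where "nrm a = enn2real (int_dist_powr B d p (s a) h)" for a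
 define \<rho> where "\<rho> i a a' = (case i of None => \<bar>nrm a - nrm a'\<bar>
   | Some (m, j) => measure (\<nu> m) {b \<in> space B. ((a, b) \<in> E j) ~= ((a', b) \<in> E j)})" for i :: "(nat \<times> (nat \<times> rat)) option" and a a'
 have symm: "{b \<in> space B. ((x, b) \<in> E j) ~= ((y, b) \<in> E j)} \<in> sets B" if "C ~= {}" "x \<in> space A" "y \<in> space A" for x y j
 proof -
  have "{b \<in> space B. ((x, b) \<in> E j) ~= ((y, b) \<in> E j)} =
   ({b \<in> space B. (x, b) \<in> E j} - {b \<in> space B. (y, b) \<in> E j}) \<union> ({b \<in> space B. (y, b) \<in> E j} - {b \<in> space B. (x, b) \<in> E j})"
   by auto
  thus ?thesis
   using sets_section[OF Em[OF that(1), of j] that(2)] sets_section[OF Em[OF that(1), of j] that(3)] by auto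
 qed
 have sepD: "EX D. countable D & D \<subseteq> space A & (\<forall>a\<in>space A. \<forall>e>0. \<exists>x\<in>D. ?D (cls B Z (s a)) (cls B Z (s x)) < e)"
 proof (cases "space A = {} \<or> space B = {}")
  case True
  show ?thesis
  proof (cases "space A = {}")
   case False
   then obtain a0 where a0: "a0 \<in> space A" by auto
   have "?D (cls B Z (s a)) (cls B Z (s a0)) = 0" if "a \<in> space A" for a
   proof -
    have "s a = s a0" using True False by (auto simp: s_def)
    thus ?thesis using sX[OF a0] by simp
   qed
   thus ?thesis using a0 by (intro exI[of _ "{a0}"]) auto
  qed auto
 next
  case False
  then obtain a0 b0 where "a0 \<in> space A" "b0 \<in> space B" by auto
  hence Cne: "C ~= {}" using C(3)[of "(a0, b0)" 1] by (auto simp: space_pair_measure)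
  have sep: "separable_on (space A) (\<rho> i)" for i
  proof (cases i)
   case None
   thus ?thesis using separable_on_real[of "space A" nrm] by (simp add: \<rho>_def[abs_def])
  next
   case (Some mj)
   obtain m j where mj: "mj = (m, j)" by (cases mj) auto
   have "E j \<in> sets (A \<Otimes>\<^sub>M \<nu> m)" using Em[OF Cne] by (simp add: s\<nu>)
   from separable_on_sections[OF \<nu> this] show ?thesis by (simp add: Some mj \<rho>_def[abs_def] \<nu>_def)
  qed
  have sym: "\<rho> i x y = \<rho> i y x" for i x y
  proof (cases i)
   case None thus ?thesis by (simp add: \<rho>_def abs_minus_commute)
  next
   case (Some mj)
   obtain m j where mj: "mj = (m, j)" by (cases mj) auto
   have "{b \<in> space B. ((x, b) \<in> E j) ~= ((y, b) \<in> E j)} = {b \<in> space B. ((y, b) \<in> E j) ~= ((x, b) \<in> E j)}" by auto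
   thus ?thesis unfolding \<rho>_def Some mj by (simp only: option.case prod.case)
  qed
  have tri: "\<rho> i x z <= \<rho> i x y + \<rho> i y z" if "x \<in> space A" "y \<in> space A" "z \<in> space A" for i x y z
  proof (cases i)
   case None thus ?thesis by (simp add: \<rho>_def)
  next
   case (Some mj)
   obtain m j where mj: "mj = (m, j)" by (cases mj) auto
   interpret \<nu>: finite_measure "\<nu> m" by (rule \<nu>)
   have ss: "{b \<in> space B. ((x, b) \<in> E j) ~= ((y, b) \<in> E j)} \<in> sets (\<nu> m)" "{b \<in> space B. ((y, b) \<in> E j) ~= ((z, b) \<in> E j)} \<in> sets (\<nu> m)"
    using symm[OF Cne] that by (auto simp: \<nu>_def)
   have "measure (\<nu> m) {b \<in> space B. ((x, b) \<in> E j) ~= ((z, b) \<in> E j)} \<le>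
    measure (\<nu> m) ({b \<in> space B. ((x, b) \<in> E j) ~= ((y, b) \<in> E j)} \<union> {b \<in> space B. ((y, b) \<in> E j) ~= ((z, b) \<in> E j)})"
    using ss by (intro \<nu>.finite_measure_mono) auto
   also have "\<dots> <= measure (\<nu> m) {b \<in> space B. ((x, b) \<in> E j) ~= ((y, b) \<in> E j)} +
     measure (\<nu> m) {b \<in> space B. ((y, b) \<in> E j) ~= ((z, b) \<in> E j)}"
    using ss by (rule measure_Un_le)
   finally show ?thesis by (simp add: Some mj \<rho>_def)
  qed
  obtain D where D: "countable D" "D \<subseteq> space A"
   "!!a. a \<in> space A ==> EX x. ALL n. x n \<in> D & (ALL i. to_nat i <= n --> \<rho> i a (x n) < (1/2)^n)"
   by (rule separable_on_join[of "space A" \<rho>, OF sep sym tri]) (assumption+, rule that, assumption+)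
  show ?thesis
  proof (intro exI[of _ D] conjI ballI allI impI D(1,2))
   fix a and e :: real assume a: "a \<in> space A" and e: "e > 0"
   from D(3)[OF a] obtain x where x: "ALL n. x n \<in> D & (ALL i. to_nat i <= n --> \<rho> i a (x n) < (1/2)^n)" by (elim exE)
   have xA: "x n \<in> space A" for n using x D(2) by auto
   have ev: "AE b in B. b \<in> F m --> (\<forall>\<^sub>F n in sequentially. ((a, b) \<in> E j) = ((x n, b) \<in> E j))" for m j
   proof -
    interpret \<nu>: finite_measure "\<nu> m" by (rule \<nu>)
    let ?i = "Some (m, j) :: (nat \<times> (nat \<times> rat)) option"
    \<comment> \<open>The estimate for this pseudometric holds from the level
      \<open>to_nat ?i\<close> on, hence the shift of the sequence.\<close>
    let ?A = "%n. {b \<in> space B. ((a, b) \<in> E j) ~= ((x (n + to_nat ?i), b) \<in> E j)}"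
    have "AE b in \<nu> m. \<forall>\<^sub>F n in sequentially. b \<in> space (\<nu> m) - ?A n"
    proof (rule borel_cantelli_AE1)
     show "?A n \<in> sets (\<nu> m)" for n using symm[OF Cne a xA[of "n + to_nat ?i"], of j] by (simp add: \<nu>_def)
     show "emeasure (\<nu> m) (?A n) < \<infinity>" for n using \<nu>.emeasure_finite[of "?A n"] by (simp only: top.not_eq_extremum infinity_ennreal_def)
     show "summable (%n. measure (\<nu> m) (?A n))"
     proof (rule summable_comparison_test'[where g = "%n. (1/2)^n"])
      fix n :: nat
      have "\<rho> ?i a (x (n + to_nat ?i)) < (1/2)^(n + to_nat ?i)" using x by (metis le_add2)
      also have "\<dots> <= (1/2)^n" by (rule power_decreasing) auto
      finally show "norm (measure (\<nu> m) (?A n)) <= (1/2)^n" by (simp add: \<rho>_def)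
     qed (simp add: summable_geometric)
    qed
    hence "AE b in B. 0 < (indicator (F m) b :: ennreal) --> (\<forall>\<^sub>F n in sequentially. b \<in> space (\<nu> m) - ?A n)"
     unfolding \<nu>_def by (subst (asm) AE_density) auto
    thus ?thesis
    proof eventually_elim
     case (elim b)
     show ?case
     proof
      assume "b \<in> F m"
      hence "\<forall>\<^sub>F n in sequentially. b \<in> space (\<nu> m) - ?A n" using elim by simp
      hence "\<forall>\<^sub>F n in sequentially. ((a, b) \<in> E j) = ((x (n + to_nat ?i), b) \<in> E j)"
       by eventually_elim (auto simp: \<nu>_def)
      thus "\<forall>\<^sub>F n in sequentially. ((a, b) \<in> E j) = ((x n, b) \<in> E j)"
       using eventually_sequentially_seg[of "%n. ((a, b) \<in> E j) = ((x n, b) \<in> E j)" "to_nat ?i"] by simp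
     qed
    qed
   qed
   have "AE b in B. ALL m j. b \<in> F m --> (\<forall>\<^sub>F n in sequentially. ((a, b) \<in> E j) = ((x n, b) \<in> E j))"
    by (intro AE_all_countable[THEN iffD2] allI ev)
   hence conv: "AE b in B. (%n. d (s (x n) b) (s a b)) \<longlonglongrightarrow> 0"
    using AE_space
   proof eventually_elim
    fix b assume evb: "ALL m j. b \<in> F m --> (\<forall>\<^sub>F n in sequentially. ((a, b) \<in> E j) = ((x n, b) \<in> E j))" and b: "b \<in> space B"
    have inZ: "g (a, b) \<in> Z" "g (x n, b) \<in> Z" for n using L0s_in[OF g] a b xA by (auto simp: space_pair_measure)
    show "(%n. d (s (x n) b) (s a b)) \<longlonglongrightarrow> 0"
    proof (cases "b \<in> S")
     case False
     hence "d (s (x n) b) (s a b) = 0" for n using gh[OF a, of b] gh[OF xA, of b n] b L0s_in[OF h b] by (simp add: s_def)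
     thus ?thesis by simp
    next
     case True
     then obtain m where m: "b \<in> F m" using F(3) by auto
     show ?thesis
     proof (rule tendstoI)
      fix r :: real assume r: "0 < r"
      obtain q where q: "q \<in> \<rat>" "0 < q" "q < r / 2" using Rats_dense_in_real[of 0 "r / 2"] r by auto
      then obtain q' where q': "q = real_of_rat q'" by (auto elim: Rats_cases)
      obtain u where u: "u \<in> C" "d (g (a, b)) u < q" using C(3)[of "(a, b)" q] a b q by (auto simp: space_pair_measure)
      obtain k where k: "from_nat_into C k = u" using from_nat_into_surj[OF C(1) u(1)] by auto
      have "\<forall>\<^sub>F n in sequentially. ((a, b) \<in> E (k, q')) = ((x n, b) \<in> E (k, q'))" using evb m by blast
      thus "\<forall>\<^sub>F n in sequentially. dist (d (s (x n) b) (s a b)) 0 < r"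
      proof eventually_elim
       case (elim n)
       have "(a, b) \<in> E (k, q')" using a b k u q' by (simp add: E_def space_pair_measure)
       hence "d (g (x n, b)) u < q" using elim k q' by (simp add: E_def)
       hence "d (g (x n, b)) (g (a, b)) < r"
        using triangle'[of "g (x n, b)" u "g (a, b)"] inZ u C(2) q by (auto simp: subset_iff)
       thus ?case using b by (simp add: s_def)
      qed
     qed
    qed
   qed
   have "(%n. nrm (x n)) \<longlonglongrightarrow> nrm a"
   proof (rule LIM_zero_cancel, rule Lim_null_comparison)
    show "\<forall>\<^sub>F n in sequentially. norm (nrm (x n) - nrm a) <= (1/2)^n"
     using eventually_ge_at_top[of "to_nat (None :: (nat \<times> (nat \<times> rat)) option)"]
    proof eventually_elim
     case (elim n)
     hence "\<rho> None a (x n) < (1/2)^n" using x by blast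
     thus ?case by (simp add: \<rho>_def abs_minus_commute)
    qed
    show "(%n. (1/2 :: real)^n) \<longlonglongrightarrow> 0" by (rule LIMSEQ_power_zero) simp
   qed
   hence l: "(%n. ennreal (nrm (x n))) \<longlonglongrightarrow> ennreal (nrm a)" by (rule tendsto_ennrealI)
   have norms: "(%n. int_dist_powr B d p (s (x n)) h) \<longlonglongrightarrow> int_dist_powr B d p (s a) h"
   proof -
    have eq: "ennreal (nrm y) = int_dist_powr B d p (s y) h" if "y \<in> space A" for y
     using finS[OF that] by (simp add: nrm_def)
    show ?thesis using l by (simp only: eq[OF a] eq[OF xA])
   qed
   have "(%n. int_dist_powr B d p (s (x n)) (s a)) \<longlonglongrightarrow> 0"
    by (rule int_dist_powr_tendsto_0[OF s[OF xA] s[OF a] h finS[OF a] norms conv])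
   hence "\<forall>\<^sub>F n in sequentially. int_dist_powr B d p (s (x n)) (s a) < ennreal ((e / 2) powr p)"
    using e by (intro order_tendstoD) auto
   then obtain n where n: "int_dist_powr B d p (s (x n)) (s a) < ennreal ((e / 2) powr p)"
    by (auto simp: eventually_sequentially)
   have "map_dist B d p (s (x n)) (s a) <= e / 2" using n e by (intro map_dist_le) auto
   hence "?D (cls B Z (s a)) (cls B Z (s (x n))) < e"
    using Lp_dist_cls[OF s[OF a] s[OF xA[of n]], of p] map_dist_commute[of B "s a" "s (x n)"] e by simp
   thus "\<exists>x\<in>D. ?D (cls B Z (s a)) (cls B Z (s x)) < e" using x by auto
  qed
 qed
 then obtain D where D: "countable D" "D \<subseteq> space A"
   "!!a e. a \<in> space A ==> e > 0 ==> \<exists>x\<in>D. ?D (cls B Z (s a)) (cls B Z (s x)) < e" by blast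
 show ?thesis
 proof (rule X.L0sI[where D = "(%x. cls B Z (s x)) ` D"])
  show "(\<lambda>a\<in>space A. cls B Z (%b. g (a, b))) \<in> space A \<rightarrow>\<^sub>E ?X" using sX by (auto simp: scls)
  show "countable ((%x. cls B Z (s x)) ` D)" using D by auto
  show "(%x. cls B Z (s x)) ` D \<subseteq> ?X" using D sX by auto
  show "\<exists>z\<in>(%x. cls B Z (s x)) ` D. ?D ((\<lambda>a\<in>space A. cls B Z (%b. g (a, b))) y) z < e" if "y \<in> space A" "e > 0" for y e
   using D(3)[OF that] that by (simp add: scls)
  fix z assume "z \<in> (%x. cls B Z (s x)) ` D"
  then obtain x where x: "x \<in> space A" "z = cls B Z (s x)" using D(2) by auto
  have [measurable]: "(%a. int_dist_powr B d p (s a) (s x)) \<in> borel_measurable A"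
   by (rule meas[OF s[OF x(1)] finS[OF x(1)]])
  have "(%a. enn2real (int_dist_powr B d p (s a) (s x)) powr (1 / p)) \<in> borel_measurable A" by measurable
  thus "(%y. ?D ((\<lambda>a\<in>space A. cls B Z (%b. g (a, b))) y) z) \<in> borel_measurable A"
   by (rule measurable_cong[THEN iffD1, rotated])
    (simp add: x(2) scls Lp_dist_cls[OF s s[OF x(1)]] map_dist_def)
 qed
qed

end

section \<open>Joint representatives\<close>

context Lp_target
begin

text \<open>
 A separably valued map into a space of classes is a uniform limit of maps that are constant
 on the pieces of a countable partition; the representatives of the values of such
 maps depend measurably on both variables, and converge almost everywhere.
\<close>
lemma joint_representative:
 fixes A :: "'a measure" and B :: "'b measure"
 assumes h: "h \<in> L0s B Z d" and compl: "mcomplete"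
  and u: "u \<in> L0s A (Lp B Z d p (cls B Z h)) (Lp_dist B Z d p)"
 obtains g S where "g \<in> L0s (A \<Otimes>\<^sub>M B) Z d" "sigma_finite_set B S"
  "!!a b. a \<in> space A ==> b \<in> space B - S ==> g (a, b) = h b"
  "!!a. a \<in> space A ==> cls B Z (%b. g (a, b)) = u a"
  "!!a. a \<in> space A ==> (AE b in B. g (a, b) = rep B Z d (u a) b)"
proof (cases "space A = {}")
 case True
 have "(%_. undefined) \<in> L0s (A \<Otimes>\<^sub>M B) Z d"
  by (rule L0sI[where D = "{}"]) (auto simp: space_pair_measure True PiE_def extensional_def)
 moreover have "sigma_finite_set B {}" by (auto simp: sigma_finite_set_def)
 ultimately show ?thesis using that[of "%_. undefined" "{}"] True by auto
next
 case False
 let ?X = "Lp B Z d p (cls B Z h)" and ?D = "Lp_dist B Z d p" and ?Q = "A \<Otimes>\<^sub>M B"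
 have hL0: "cls B Z h \<in> L0 B Z d" by (rule cls_in_L0[OF h])
 interpret X: Lp_target ?X ?D p by (rule Lp_target_Lp[OF hL0])
 have uX: "u a \<in> ?X" if "a \<in> space A" for a using X.L0s_in[OF u that] .
 obtain C where C: "countable C" "C \<subseteq> ?X" "!!a e. a \<in> space A ==> e > 0 ==> \<exists>z\<in>C. ?D (u a) z < e"
  by (rule X.L0s_dense[OF u]) (rule that, assumption+)
 obtain a0 where "a0 \<in> space A" using False by auto
 hence Cne: "C ~= {}" using C(3)[of a0 1] by auto
 define z where "z = from_nat_into C"
 have zX: "z j \<in> ?X" for j using from_nat_into[OF Cne] C(2) by (auto simp: z_def)
 define \<zeta> where "\<zeta> j = rep B Z d (z j)" for j
 have \<zeta>: "\<zeta> j \<in> L0s B Z d" "cls B Z (\<zeta> j) = z j" for j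
  unfolding \<zeta>_def by (rule LpD(1)[OF zX hL0], rule LpD(3)[OF zX hL0])
 have \<zeta>fin: "int_dist_powr B d p (\<zeta> j) h < \<infinity>" for j
  using cls_in_Lp_iff[OF \<zeta>(1)[of j] h, of p] zX[of j] \<zeta>(2) by simp
 define S where "S = (\<Union>j. {b \<in> space B. \<zeta> j b ~= h b})"
 have S: "sigma_finite_set B S"
  unfolding S_def by (intro sigma_finite_set_UN sigma_finite_set_distinct \<zeta> h \<zeta>fin)
 \<comment> \<open>The rate 1/4, rather than 1/2, leaves a factor (1/2)^n after the increments have
   been weighted by 2^n in \<open>Ie\<close>.\<close>
 define k where "k n a = (LEAST j. ?D (u a) (z j) < (1/4)^n)" for n a
 have kD: "?D (u a) (z (k n a)) < (1/4)^n" if a: "a \<in> space A" for n a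
 proof -
  obtain y where y: "y \<in> C" "?D (u a) y < (1/4)^n" using C(3)[OF a, of "(1/4)^n"] by auto
  obtain j where "z j = y" using from_nat_into_surj[OF C(1) y(1)] by (auto simp: z_def)
  hence "?D (u a) (z j) < (1/4)^n" using y by simp
  thus ?thesis unfolding k_def by (rule LeastI)
 qed
 have km [measurable]: "k n \<in> measurable A (count_space UNIV)" for n
 proof -
  have [measurable]: "(%a. ?D (u a) (z j)) \<in> borel_measurable A" for j by (rule X.L0s_dist_const[OF u zX])
  show ?thesis unfolding k_def by measurable
 qed
 define gn where "gn n = (\<lambda>w\<in>space ?Q. (%j. \<lambda>w\<in>space ?Q. \<zeta> j (snd w)) (k n (fst w)) w)" for n
 have gn: "gn n \<in> L0s ?Q Z d" for n
  unfolding gn_def by (rule L0s_pieces[OF L0s_snd[OF \<zeta>(1)]]) measurable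
 have gn_eq: "gn n (a, b) = \<zeta> (k n a) b" if "a \<in> space A" "b \<in> space B" for n a b
  using that by (simp add: gn_def space_pair_measure)
 have gnZ: "gn n w \<in> Z" if "w \<in> space ?Q" for n w using L0s_in[OF gn that] .
 define H where "H = (\<lambda>w\<in>space ?Q. h (snd w))"
 have H: "H \<in> L0s ?Q Z d" unfolding H_def by (rule L0s_snd[OF h])
 \<comment> \<open>One jointly measurable set on which the approximants converge. For each a its
   section has full measure, although the exceptional null set varies with a; outside
   \<open>Q\<close> the base value is taken.\<close>
 define Q where "Q w \<longleftrightarrow> (ALL i. EX N. \<forall>m\<ge>N. \<forall>n\<ge>N. d (gn m w) (gn n w) < inverse (real (Suc i)))" for w
 have Qs: "{w \<in> space ?Q. Q w} \<in> sets ?Q"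
 proof -
  have [measurable]: "(%w. d (gn m w) (gn n w)) \<in> borel_measurable ?Q" for m n by (rule L0s_dist_measurable[OF gn gn])
  show ?thesis unfolding Q_def by measurable
 qed
 have Qlim: "EX x. x \<in> Z & (%n. d (gn n w) x) \<longlonglongrightarrow> 0" if w: "w \<in> space ?Q" and "Q w" for w
 proof -
  have "MCauchy (%n. gn n w)"
   unfolding MCauchy_def
  proof (intro conjI allI impI)
   show "range (%n. gn n w) \<subseteq> Z" using gnZ[OF w] by auto
   fix e :: real assume "e > 0"
   then obtain i where i: "inverse (real (Suc i)) < e" using reals_Archimedean by auto
   then obtain N where "\<forall>m\<ge>N. \<forall>n\<ge>N. d (gn m w) (gn n w) < inverse (real (Suc i))" using \<open>Q w\<close>[unfolded Q_def, THEN spec, of i] by (elim exE)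
   thus "EX N. ALL n n'. N <= n --> N <= n' --> d (gn n w) (gn n' w) < e" using i by (intro exI[of _ N] allI impI) (rule less_trans, simp_all)
  qed
  with compl obtain x where x: "limitin mtopology (%n. gn n w) x sequentially"
   unfolding mcomplete_def by blast
  hence "x \<in> Z" using limitin_topspace[of mtopology] by simp
  moreover have "(%n. d (gn n w) x) \<longlonglongrightarrow> 0"
  proof (rule tendstoI)
   fix e :: real assume "e > 0"
   thus "\<forall>\<^sub>F n in sequentially. dist (d (gn n w) x) 0 < e"
    using x by (auto simp: limitin_metric elim: eventually_mono)
  qed
  ultimately show ?thesis by blast
 qed
 define L where "L w = (SOME x. x \<in> Z & (%n. d (gn n w) x) \<longlonglongrightarrow> 0)" for w
 have L: "L w \<in> Z" "(%n. d (gn n w) (L w)) \<longlonglongrightarrow> 0" if "w \<in> space ?Q" "Q w" for w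
  using someI_ex[OF Qlim[OF that]] by (auto simp: L_def)
 define g where "g = (\<lambda>w\<in>space ?Q. if Q w then L w else H w)"
 have g: "g \<in> L0s ?Q Z d"
 proof (rule L0s_limit[of "%n. \<lambda>w\<in>space ?Q. if Q w then gn n w else H w"])
  show "(\<lambda>w\<in>space ?Q. if Q w then gn n w else H w) \<in> L0s ?Q Z d" for n by (rule L0s_if[OF gn H Qs])
  show "g \<in> space ?Q \<rightarrow>\<^sub>E Z" using L(1) L0s_in[OF H] by (auto simp: g_def)
  fix w assume w: "w \<in> space ?Q"
  show "(%n. d ((\<lambda>w\<in>space ?Q. if Q w then gn n w else H w) w) (g w)) \<longlonglongrightarrow> 0"
   using L(2)[OF w] w L0s_in[OF H w] by (cases "Q w") (auto simp: g_def)
 qed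
 have gh: "g (a, b) = h b" if a: "a \<in> space A" and b: "b \<in> space B - S" for a b
 proof -
  have w: "(a, b) \<in> space ?Q" using a b by (simp add: space_pair_measure)
  have gnh: "gn n (a, b) = h b" for n using gn_eq[OF a, of b n] b by (auto simp: S_def)
  have "L (a, b) = h b" if "Q (a, b)"
  proof -
   have "(%n. d (h b) (L (a, b))) \<longlonglongrightarrow> 0" using L(2)[OF w that] by (simp add: gnh)
   hence "d (h b) (L (a, b)) = 0" by (simp add: LIMSEQ_const_iff)
   thus ?thesis using L(1)[OF w that] L0s_in[OF h, of b] b by simp
  qed
  thus ?thesis using w by (auto simp: g_def H_def)
 qed
 have main: "AE b in B. g (a, b) = rep B Z d (u a) b" if a: "a \<in> space A" for a
 proof -
  let ?f = "rep B Z d (u a)"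
  have f: "?f \<in> L0s B Z d" "cls B Z ?f = u a" by (rule LpD(1)[OF uX[OF a] hL0], rule LpD(3)[OF uX[OF a] hL0])
  define x where "x n = \<zeta> (k n a)" for n
  have xL: "x n \<in> L0s B Z d" for n by (simp add: x_def \<zeta>)
  have clsx: "cls B Z (x n) = z (k n a)" for n by (simp add: x_def \<zeta>)
  have ffin: "int_dist_powr B d p ?f h < \<infinity>" using cls_in_Lp_iff[OF f(1) h, of p] uX[OF a] f(2) by simp
  have xfin: "int_dist_powr B d p (x n) h < \<infinity>" for n by (simp add: x_def \<zeta>fin[unfolded infinity_ennreal_def])
  have hx: "int_dist_powr B d p h (x n) < \<infinity>" for n using xfin by (subst int_dist_powr_commute)
  have xf_fin: "int_dist_powr B d p (x n) ?f < \<infinity>" for n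
   by (rule map_dist_triangle(1)[OF xL h f(1) xfin]) (subst int_dist_powr_commute, rule ffin)
  have xx_fin: "int_dist_powr B d p (x n) (x m) < \<infinity>" for n m
   by (rule map_dist_triangle(1)[OF xL h xL xfin hx])
  have xf: "map_dist B d p (x n) ?f < (1/4)^n" for n
   using kD[OF a, of n] Lp_dist_cls[OF f(1) xL[of n], of p] by (simp add: f(2) clsx map_dist_commute)
  have xx: "map_dist B d p (x n) (x (Suc n)) <= 2 * (1/4)^n" for n
  proof -
   have "map_dist B d p (x n) (x (Suc n)) <= map_dist B d p (x n) ?f + map_dist B d p ?f (x (Suc n))"
    by (rule map_dist_triangle(2)[OF xL f(1) xL xf_fin]) (subst int_dist_powr_commute, rule xf_fin)
   also have "\<dots> <= (1/4)^n + (1/4)^Suc n" using xf[of n] xf[of "Suc n"] by (simp add: map_dist_commute)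
   also have "\<dots> <= 2 * (1/4)^n" by simp
   finally show ?thesis .
  qed
  define e where "e n b = d (x n b) (x (Suc n) b)" for n b
  have em [measurable]: "e n \<in> borel_measurable B" for n unfolding e_def by (rule L0s_dist_measurable[OF xL xL])
  \<comment> \<open>The weighted increments have summable p-th powers, since (2^n * 2 * 4^(-n))^p <=
    2^p * 2^(-n) for p > 1. Where the sum of these powers is finite, the increments are bounded by a
    constant times 2^(-n), so the approximants form a Cauchy sequence.\<close>
  have Ie: "(\<integral>\<^sup>+ b. ennreal ((2^n * e n b) powr p) \<partial>B) <= ennreal (2 powr p * (1/2)^n)" for n
  proof -
   have "(\<integral>\<^sup>+ b. ennreal ((2^n * e n b) powr p) \<partial>B) = (\<integral>\<^sup>+ b. ennreal ((2^n) powr p) * ennreal (e n b powr p) \<partial>B)"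
    by (intro nn_integral_cong) (simp add: powr_mult ennreal_mult[symmetric] e_def)
   also have "\<dots> = ennreal ((2^n) powr p) * int_dist_powr B d p (x n) (x (Suc n))"
    by (simp add: nn_integral_cmult int_dist_powr_def e_def[symmetric])
   also have "\<dots> = ennreal ((2^n * map_dist B d p (x n) (x (Suc n))) powr p)"
    by (simp add: map_dist_powr[OF xx_fin, symmetric] powr_mult ennreal_mult[symmetric] map_dist_nonneg)
   also have "\<dots> <= ennreal (2 powr p * (1/2)^n)"
   proof (rule ennreal_leI)
    have "2^n * map_dist B d p (x n) (x (Suc n)) <= 2^n * (2 * (1/4)^n)" using xx by (intro mult_left_mono) auto
    also have "\<dots> = 2 * (2 * (1/4))^n" by (simp only: power_mult_distrib mult.left_commute)
    also have "\<dots> = 2 * (1/2)^n" by simp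
    finally have "(2^n * map_dist B d p (x n) (x (Suc n))) powr p <= (2 * (1/2)^n) powr p"
     using p_gt_1 by (intro powr_mono2) (auto simp: map_dist_nonneg)
    also have "\<dots> = 2 powr p * ((1/2)^n) powr p" by (simp add: powr_mult)
    also have "((1/2 :: real)^n) powr p <= ((1/2)^n) powr 1" using p_gt_1 by (intro powr_mono') (auto simp: power_le_one)
    finally show "(2^n * map_dist B d p (x n) (x (Suc n))) powr p <= 2 powr p * (1/2)^n" by simp
   qed
   finally show ?thesis .
  qed
  have "(\<integral>\<^sup>+ b. (\<Sum>n. ennreal ((2^n * e n b) powr p)) \<partial>B) = (\<Sum>n. \<integral>\<^sup>+ b. ennreal ((2^n * e n b) powr p) \<partial>B)"
   by (rule nn_integral_suminf) measurable
  also have "\<dots> <= (\<Sum>n. ennreal (2 powr p * (1/2)^n))" by (intro suminf_le Ie) auto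
  also have "\<dots> = ennreal (2 powr p * 2)"
   using sums_mult[OF geometric_sums[of "1/2 :: real"], of "2 powr p"] by (intro suminf_ennreal_eq) auto
  finally have "(\<integral>\<^sup>+ b. (\<Sum>n. ennreal ((2^n * e n b) powr p)) \<partial>B) ~= \<infinity>" by (auto simp: top_unique)
  hence "AE b in B. (\<Sum>n. ennreal ((2^n * e n b) powr p)) ~= \<infinity>"
   by (intro nn_integral_PInf_AE) auto
  hence limx: "AE b in B. (%n. d (x n b) (g (a, b))) \<longlonglongrightarrow> 0"
   using AE_space
  proof eventually_elim
   fix b assume fin: "(\<Sum>n. ennreal ((2^n * e n b) powr p)) ~= \<infinity>" and b: "b \<in> space B"
   have w: "(a, b) \<in> space ?Q" using a b by (simp add: space_pair_measure)
   have xg: "x n b = gn n (a, b)" for n by (simp add: x_def gn_eq[OF a b])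
   have xZ: "x n b \<in> Z" for n unfolding xg by (rule gnZ[OF w])
   define K where "K = enn2real (\<Sum>n. ennreal ((2^n * e n b) powr p))"
   have K: "(\<Sum>n. ennreal ((2^n * e n b) powr p)) = ennreal K" "K \<ge> 0"
    unfolding K_def using fin by (simp_all add: less_top)
   have eb: "e n b <= K powr (1/p) * (1/2)^n" for n
   proof -
    have "ennreal ((2^n * e n b) powr p) = (\<Sum>i\<in>{n}. ennreal ((2^i * e i b) powr p))" by simp
    also have "\<dots> <= ennreal K" unfolding K(1)[symmetric] by (rule sum_le_suminf) auto
    finally have "(2^n * e n b) powr p <= K" using K by simp
    hence "((2^n * e n b) powr p) powr (1/p) <= K powr (1/p)" using p_gt_1 by (intro powr_mono2) auto
    hence "2^n * e n b <= K powr (1/p)" using p_gt_1 by (simp add: powr_powr e_def)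
    thus ?thesis by (simp add: field_simps power_divide)
   qed
   have dist_tail: "d (x n b) (x (n + m) b) <= K powr (1/p) * 2 * (1/2)^n" for n m
   proof -
    have "d (x n b) (x (n + m) b) <= K powr (1/p) * (2 * (1/2)^n - 2 * (1/2)^(n + m))"
    proof (induction m)
     case 0 thus ?case using xZ by simp
    next
     case (Suc m)
     have "d (x n b) (x (n + Suc m) b) <= d (x n b) (x (n + m) b) + e (n + m) b"
      using triangle[of "x n b" "x (n + m) b" "x (n + Suc m) b", OF xZ xZ xZ] by (simp add: e_def)
     also have "\<dots> <= K powr (1/p) * (2 * (1/2)^n - 2 * (1/2)^(n + m)) + K powr (1/p) * (1/2)^(n + m)"
      using Suc eb[of "n + m"] by linarith
     also have "\<dots> = K powr (1/p) * (2 * (1/2)^n - 2 * (1/2)^(n + Suc m))" by (simp add: algebra_simps)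
     finally show ?case .
    qed
    also have "\<dots> <= K powr (1/p) * (2 * (1/2)^n)" by (intro mult_left_mono) auto
    finally show ?thesis by simp
   qed
   have "Q (a, b)" unfolding Q_def
   proof
    fix i
    have "(%n. K powr (1/p) * 2 * (1/2)^n) \<longlonglongrightarrow> K powr (1/p) * 2 * 0"
     by (intro tendsto_mult tendsto_const LIMSEQ_power_zero) auto
    hence "\<forall>\<^sub>F n in sequentially. K powr (1/p) * 2 * (1/2)^n < inverse (real (Suc i))"
     by (intro order_tendstoD) auto
    then obtain N where N: "!!n. n \<ge> N ==> K powr (1/p) * 2 * (1/2)^n < inverse (real (Suc i))"
     by (auto simp: eventually_sequentially)
    have 1: "d (gn m (a, b)) (gn n (a, b)) < inverse (real (Suc i))" if "N <= m" "m <= n" for m n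
     using dist_tail[of m "n - m"] N[OF that(1)] that by (simp add: xg)
    show "EX N. \<forall>m\<ge>N. \<forall>n\<ge>N. d (gn m (a, b)) (gn n (a, b)) < inverse (real (Suc i))"
    proof (intro exI[of _ N] allI impI)
     fix m n assume "N <= m" "N <= n"
     thus "d (gn m (a, b)) (gn n (a, b)) < inverse (real (Suc i))"
      using 1[of m n] 1[of n m] commute by (cases "m <= n") auto
    qed
   qed
   thus "(%n. d (x n b) (g (a, b))) \<longlonglongrightarrow> 0"
    using L(2)[OF w] w by (simp add: g_def xg)
  qed
  define ga where "ga = (\<lambda>b\<in>space B. g (a, b))"
  have ga: "ga \<in> L0s B Z d" unfolding ga_def by (rule L0s_section[OF g a])
  have "int_dist_powr B d p ga ?f <= liminf (%n. int_dist_powr B d p (x n) ?f)"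
  proof (rule int_dist_powr_Fatou[OF xL ga f(1)])
   show "AE y in B. (%n. d (x n y) (ga y)) \<longlonglongrightarrow> 0"
    using limx AE_space by eventually_elim (simp add: ga_def)
  qed
  also have "liminf (%n. int_dist_powr B d p (x n) ?f) = 0"
  proof (rule lim_imp_Liminf[OF sequentially_bot])
   have "(%n. map_dist B d p (x n) ?f) \<longlonglongrightarrow> 0"
   proof (rule Lim_null_comparison)
    show "\<forall>\<^sub>F n in sequentially. norm (map_dist B d p (x n) ?f) <= (1/4)^n"
     using xf by (auto simp: map_dist_nonneg less_imp_le)
    show "(%n. (1/4 :: real)^n) \<longlonglongrightarrow> 0" by (rule LIMSEQ_power_zero) simp
   qed
   hence "(%n. map_dist B d p (x n) ?f powr p) \<longlonglongrightarrow> 0 powr p" using p_gt_1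
    by (intro tendsto_powr') (auto simp: map_dist_nonneg)
   hence "(%n. ennreal (map_dist B d p (x n) ?f powr p)) \<longlonglongrightarrow> ennreal (0 powr p)" by (rule tendsto_ennrealI)
   thus "(%n. int_dist_powr B d p (x n) ?f) \<longlonglongrightarrow> 0" by (simp add: map_dist_powr[OF xf_fin])
  qed
  finally have "int_dist_powr B d p ga ?f = 0" by simp
  hence "AE b in B. ga b = ?f b" unfolding int_dist_powr_eq_0[OF ga f(1)] .
  thus ?thesis using AE_space by eventually_elim (simp add: ga_def)
 qed
 have "cls B Z (%b. g (a, b)) = u a" if a: "a \<in> space A" for a
  using cls_cong_AE[OF main[OF a], of Z] LpD(3)[OF uX[OF a] hL0] by simp
 thus ?thesis using that[OF g S gh _ main] by blast
qed

end

section \<open>Lebesgue differentiation\<close>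

text \<open>Open supersets with Lebesgue excess 2^(-n) are intersected successively. What remains of
  the excess in the limit is a Lebesgue null set, hence null for the density, and finiteness of the
  density lets its mass on the excess tend to 0.\<close>

lemma open_superset_small_density:
 fixes f :: "real => ennreal"
 assumes [measurable]: "f \<in> borel_measurable lebesgue" and fin: "(\<integral>\<^sup>+ x. f x \<partial>lebesgue) < \<infinity>"
  and E [measurable]: "E \<in> sets lebesgue" and e: "0 < (e :: ennreal)"
 obtains U where "open U" "E \<subseteq> U" "(\<integral>\<^sup>+ x \<in> U - E. f x \<partial>lebesgue) < e"
proof -
 let ?P = "density lebesgue f"
 have "EX T. open T & E \<subseteq> T & emeasure lebesgue (T - E) < ennreal ((1/2)^n)" for n :: nat
  by (rule sets_lebesgue_outer_open[OF E, of "(1/2)^n"]) auto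
 hence "ALL n. EX T. open T & E \<subseteq> T & emeasure lebesgue (T - E) < ennreal ((1/2)^n)" by blast
 from choice[OF this] obtain T where T: "\<forall>n::nat. open (T n) & E \<subseteq> T n & emeasure lebesgue (T n - E) < ennreal ((1/2)^n)"
  by (elim exE)
 define V where "V n = (\<Inter>k\<in>{..n}. T k)" for n
 have Vo: "open (V n)" "E \<subseteq> V n" for n using T by (auto simp: V_def)
 have [measurable]: "V n \<in> sets lebesgue" for n using Vo(1)[of n] by (simp add: borel_open sets_completionI_sets)
 have em: "emeasure ?P X = (\<integral>\<^sup>+ x \<in> X. f x \<partial>lebesgue)" if "X \<in> sets lebesgue" for X
  using that by (simp add: emeasure_density)
 define N where "N = (\<Inter>n. V n - E)"
 have [measurable]: "N \<in> sets lebesgue" unfolding N_def by measurable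
 have Nr: "emeasure lebesgue N <= ennreal r" if r: "r > 0" for r
 proof -
  obtain n where n: "(1/2 :: real)^n < r" using real_arch_pow_inv[OF r, of "1/2"] by auto
  have Tn: "T n \<in> sets lebesgue" using T by (simp add: borel_open sets_completionI_sets)
  have "emeasure lebesgue N <= emeasure lebesgue (T n - E)"
   using Tn by (intro emeasure_mono) (auto simp: N_def V_def)
  also have "\<dots> <= ennreal r" using T n by (meson ennreal_leI less_imp_le order_trans)
  finally show ?thesis .
 qed
 have "emeasure lebesgue N <= 0"
  by (rule ennreal_le_epsilon) (simp only: add_0 Nr)
 hence "N \<in> null_sets lebesgue" by (simp add: null_sets_def)
 from AE_not_in[OF this] have "N \<in> null_sets ?P"
  by (auto simp: null_sets_density_iff elim: eventually_mono)
 hence z: "emeasure ?P N = 0" by auto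
 have "emeasure ?P (V n - E) ~= \<infinity>" for n
 proof -
  have "emeasure ?P (V n - E) <= emeasure ?P (space lebesgue)" by (intro emeasure_mono) auto
  also have "\<dots> = (\<integral>\<^sup>+ x. f x \<partial>lebesgue)" by (subst em) auto
  finally show ?thesis using fin by (auto simp: top_unique)
 qed
 note Vfin = this
 have "(%n. emeasure ?P (V n - E)) \<longlonglongrightarrow> emeasure ?P (\<Inter>n. V n - E)"
 proof (rule Lim_emeasure_decseq[OF _ _ Vfin])
  show "range (%n. V n - E) \<subseteq> sets ?P" by auto
  show "decseq (%n. V n - E)" by (auto simp: decseq_def V_def)
 qed
 hence "(%n. emeasure ?P (V n - E)) \<longlonglongrightarrow> 0" unfolding N_def[symmetric] z .
 from order_tendstoD(2)[OF this e] have "\<forall>\<^sub>F n in sequentially. emeasure ?P (V n - E) < e" .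
 then obtain n where "emeasure ?P (V n - E) < e" by (auto simp: eventually_sequentially)
 thus ?thesis using that[of "V n"] Vo em[of "V n - E"] by simp
qed

lemma negligible_bad_averages:
 fixes f1 f2 :: "real => ennreal" and \<eta> :: real
 assumes f1 [measurable]: "f1 \<in> borel_measurable lebesgue" and f2 [measurable]: "f2 \<in> borel_measurable lebesgue"
  and fin: "(\<integral>\<^sup>+ x. f1 x \<partial>lebesgue) < \<infinity>" and \<eta>: "0 < \<eta>"
 shows "negligible {t. f1 t + ennreal \<eta> <= f2 t \<and>
  (\<forall>d>0. EX u v. u <= t & t <= v & u < v & v - u < d \<and>
   (\<integral>\<^sup>+ x \<in> {u..v}. f2 x \<partial>lebesgue) <= (\<integral>\<^sup>+ x \<in> {u..v}. f1 x \<partial>lebesgue))}" (is "negligible ?B")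
 unfolding negligible_outer_le
proof (intro allI impI)
 fix r :: real assume r: "0 < r"
 define E where "E = {t. f1 t + ennreal \<eta> <= f2 t}"
 have "{t \<in> space lebesgue. f1 t + ennreal \<eta> <= f2 t} \<in> sets lebesgue" by measurable
 hence E [measurable]: "E \<in> sets lebesgue" by (simp add: E_def)
 obtain U where U: "open U" "E \<subseteq> U" "(\<integral>\<^sup>+ x \<in> U - E. f1 x \<partial>lebesgue) < ennreal (\<eta> * r)"
  by (rule open_superset_small_density[OF f1 fin E, of "ennreal (\<eta> * r)"]) (use r \<eta> in auto)
 have [measurable]: "U \<in> sets lebesgue" using U(1) by (simp add: borel_open sets_completionI_sets)
 define K where "K = {(u, v). u < v & {u..v} \<subseteq> U \<and>
   (\<integral>\<^sup>+ x \<in> {u..v}. f2 x \<partial>lebesgue) <= (\<integral>\<^sup>+ x \<in> {u..v}. f1 x \<partial>lebesgue)}"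
 let ?c = "%(u, v). (u + v) / 2 :: real" and ?r = "%(u, v). (v - u) / 2 :: real"
 have cb: "cball (?c i) (?r i) = {fst i..snd i}" for i
  by (cases i) (simp add: cball_eq_atLeastAtMost field_simps)
 obtain C where C: "countable C" "C \<subseteq> K"
   "pairwise (%i j. disjnt (cball (?c i) (?r i)) (cball (?c j) (?r j))) C"
   "negligible (?B - (\<Union>i\<in>C. cball (?c i) (?r i)))"
 proof (rule Vitali_covering_theorem_cballs[of K ?r ?B ?c])
  show "0 < ?r i" if "i \<in> K" for i using that by (auto simp: K_def)
  fix t d :: real assume t: "t \<in> ?B" and d: "0 < d"
  hence "t \<in> U" using U(2) by (auto simp: E_def)
  then obtain k where k: "k > 0" "ball t k \<subseteq> U" using U(1) openE by blast
  have "min d k > 0" using d k by simp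
  with t obtain u v where uv: "u <= t" "t <= v" "u < v" "v - u < min d k"
   "(\<integral>\<^sup>+ x \<in> {u..v}. f2 x \<partial>lebesgue) <= (\<integral>\<^sup>+ x \<in> {u..v}. f1 x \<partial>lebesgue)" by blast
  have "{u..v} \<subseteq> ball t k" using uv by (auto simp: dist_real_def)
  hence "(u, v) \<in> K" using uv k by (auto simp: K_def)
  moreover have "t \<in> cball (?c (u, v)) (?r (u, v))" unfolding cb using uv by simp
  ultimately show "EX i. i \<in> K & t \<in> cball (?c i) (?r i) & ?r i < d"
   using uv by (intro exI[of _ "(u, v)"]) (simp del: mem_cball)
 qed (rule that, assumption+)
 define W where "W = (\<Union>i\<in>C. {fst i..snd i})"
 have Wm [measurable]: "W \<in> sets lebesgue" unfolding W_def using C(1) by (intro sets.countable_UN'') auto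
 have disj: "disjoint_family_on (%i. {fst i..snd i}) C"
  using C(3) unfolding disjoint_family_on_def pairwise_def disjnt_def cb by blast
 let ?F = "%f S. \<integral>\<^sup>+ x \<in> S. f x \<partial>lebesgue"
 have CK: "{fst i..snd i} \<subseteq> U" "?F f2 {fst i..snd i} <= ?F f1 {fst i..snd i}" if "i \<in> C" for i
  using subsetD[OF C(2) that] by (auto simp: K_def split: prod.splits)
 have UW: "W \<subseteq> U" unfolding W_def using CK(1) by (rule UN_least)
 have dens: "?F f S = emeasure (density lebesgue f) S"
  if "f \<in> borel_measurable lebesgue" "S \<in> sets lebesgue" for f :: "real => ennreal" and S
  using that by (simp add: emeasure_density)
 have sum: "?F f W = (\<integral>\<^sup>+ i. ?F f {fst i..snd i} \<partial>count_space C)" if f [measurable]: "f \<in> borel_measurable lebesgue" for f :: "real => ennreal"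
 proof -
  have "?F f W = emeasure (density lebesgue f) (\<Union>i\<in>C. {fst i..snd i})" unfolding W_def[symmetric] by (rule dens) auto
  also have "\<dots> = (\<integral>\<^sup>+ i. emeasure (density lebesgue f) {fst i..snd i} \<partial>count_space C)"
   using C(1) disj by (intro emeasure_UN_countable) auto
  finally show ?thesis by (simp add: dens)
 qed
 have le: "?F f2 W <= ?F f1 W"
  unfolding sum[OF f1] sum[OF f2] by (rule nn_integral_mono) (simp only: space_count_space CK(2))
 have split: "?F f W = ?F f (W \<inter> E) + ?F f (W - E)" if f [measurable]: "f \<in> borel_measurable lebesgue" for f :: "real => ennreal"
  by (subst nn_integral_add[symmetric]) (auto intro!: nn_integral_cong split: split_indicator)
 have f1fin: "?F f1 S < \<infinity>" for S
 proof -
  have "?F f1 S <= (\<integral>\<^sup>+ x. f1 x \<partial>lebesgue)" by (intro nn_integral_mono) (auto split: split_indicator)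
  thus ?thesis using fin by (rule order.strict_trans1)
 qed
 \<comment> \<open>On E the function f2 gains \<eta>, while over the whole of W its integral is at
   most that of f1. The finite integral of f1 over W \<inter> E cancels, so the gain is paid for by
   f1 on W - E.\<close>
 have "?F f1 (W \<inter> E) + ennreal \<eta> * emeasure lebesgue (W \<inter> E) = (\<integral>\<^sup>+ x \<in> W \<inter> E. (f1 x + ennreal \<eta>) \<partial>lebesgue)"
  by (subst nn_integral_cmult_indicator[symmetric], simp, subst nn_integral_add[symmetric])
   (auto intro!: nn_integral_cong split: split_indicator)
 also have "\<dots> <= ?F f2 (W \<inter> E)" by (intro nn_integral_mono) (auto simp: E_def split: split_indicator)
 also have "\<dots> <= ?F f2 W" by (intro nn_integral_mono) (auto split: split_indicator)
 also have "\<dots> <= ?F f1 (W \<inter> E) + ?F f1 (W - E)" using le by (simp only: split[OF f1])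
 finally have "ennreal \<eta> * emeasure lebesgue (W \<inter> E) <= ?F f1 (W - E)"
  using f1fin[of "W \<inter> E"] unfolding ennreal_add_left_cancel_le by auto
 also have "\<dots> <= ?F f1 (U - E)" using UW by (intro nn_integral_mono) (auto split: split_indicator)
 also have "\<dots> <= ennreal (\<eta> * r)" using U(3) by simp
 finally have "ennreal \<eta> * emeasure lebesgue (W \<inter> E) <= ennreal \<eta> * ennreal r" using \<eta> r by (simp add: ennreal_mult)
 hence ler: "emeasure lebesgue (W \<inter> E) <= ennreal r"
  using \<eta> by (subst (asm) ennreal_mult_le_mult_iff) auto
 hence "emeasure lebesgue (W \<inter> E) < \<infinity>" by (rule order.strict_trans1) simp
 hence WE: "W \<inter> E \<in> lmeasurable" by (intro fmeasurableI) auto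
 let ?N = "?B - W"
 have N: "negligible ?N" using C(4) unfolding W_def cb .
 show "EX T. ?B \<subseteq> T & T \<in> lmeasurable & measure lebesgue T <= r"
 proof (intro exI[of _ "(W \<inter> E) \<union> ?N"] conjI)
  show "?B \<subseteq> (W \<inter> E) \<union> ?N" by (auto simp: E_def)
  show "(W \<inter> E) \<union> ?N \<in> lmeasurable" using WE N negligible_imp_measurable by (intro fmeasurable.Un) auto
  have "measure lebesgue ((W \<inter> E) \<union> ?N) <= measure lebesgue (W \<inter> E) + measure lebesgue ?N"
   using WE N negligible_imp_measurable by (intro measure_Un_le) (auto simp: fmeasurableD)
  also have "measure lebesgue ?N = 0" using N by (rule negligible_imp_measure0)
  also have "measure lebesgue (W \<inter> E) <= r" unfolding measure_def using ler r by (intro enn2real_leI) auto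
  finally show "measure lebesgue ((W \<inter> E) \<union> ?N) <= r" by simp
 qed
qed

text \<open>\<open>negligible_bad_averages\<close> compares f with constants q: the pair (f, q)
  excludes averages of at least q where f < q, the pair (q, f) excludes averages of at most q where
  f > q. Rational q and margins 1/(k+1) keep the exceptional sets countable in number. The intervals
  only have to contain t, which later permits dyadic cells.\<close>

lemma lebesgue_differentiation_nonneg:
 fixes f :: "real => real"
 assumes f: "integrable lebesgue f" and f0: "!!x. 0 <= f x"
 shows "AE t in lebesgue. \<forall>e>0. \<exists>d>0. ALL u v. u <= t --> t <= v --> u < v --> v - u < d -->
   \<bar>(LINT x:{u..v}|lebesgue. f x) - f t * (v - u)\<bar> <= e * (v - u)"
proof -
 have [measurable]: "f \<in> borel_measurable lebesgue" using f by simp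
 have fin: "(\<integral>\<^sup>+ x. f x \<partial>lebesgue) < \<infinity>"
  using f f0 by (simp add: nn_integral_eq_integral)
 let ?I = "%u v. LINT x:{u..v}|lebesgue. f x"
 have Inn: "(\<integral>\<^sup>+ x \<in> {u..v}. f x \<partial>lebesgue) = ennreal (?I u v)" "0 <= ?I u v" for u v
 proof -
  have "integrable lebesgue (%x. indicator {u..v} x *\<^sub>R f x)" using f by (intro integrable_mult_indicator) auto
  hence "(\<integral>\<^sup>+ x. ennreal (indicator {u..v} x *\<^sub>R f x) \<partial>lebesgue) = ennreal (?I u v)"
   unfolding set_lebesgue_integral_def using f0 by (intro nn_integral_eq_integral) auto
  moreover have "(\<integral>\<^sup>+ x. ennreal (indicator {u..v} x *\<^sub>R f x) \<partial>lebesgue) = (\<integral>\<^sup>+ x \<in> {u..v}. f x \<partial>lebesgue)"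
   by (intro nn_integral_cong) (auto split: split_indicator)
  ultimately show "(\<integral>\<^sup>+ x \<in> {u..v}. f x \<partial>lebesgue) = ennreal (?I u v)" by simp
  show "0 <= ?I u v" unfolding set_lebesgue_integral_def using f0 by (intro integral_nonneg_AE) auto
 qed
 have Ic: "(\<integral>\<^sup>+ x \<in> {u..v}. ennreal q \<partial>lebesgue) = ennreal (q * (v - u))" if "u < v" "0 <= q" for u v q
  using that by (simp add: nn_integral_cmult_indicator ennreal_mult)
 define P where "P t q = (\<exists>d>0. ALL u v. u <= t --> t <= v --> u < v --> v - u < d --> ?I u v < q * (v - u))" for t q
 define Q where "Q t q = (\<exists>d>0. ALL u v. u <= t --> t <= v --> u < v --> v - u < d --> q * (v - u) < ?I u v)" for t q
 have up: "AE t in lebesgue. f t + inverse (real (Suc k)) <= q --> P t q" for q k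
 proof (cases "0 <= q")
  case True
  have "negligible {t. ennreal (f t) + ennreal (inverse (real (Suc k))) <= ennreal q \<and>
   (\<forall>d>0. EX u v. u <= t & t <= v & u < v & v - u < d \<and>
   (\<integral>\<^sup>+ x \<in> {u..v}. ennreal q \<partial>lebesgue) <= (\<integral>\<^sup>+ x \<in> {u..v}. ennreal (f x) \<partial>lebesgue))}" (is "negligible ?B")
   using fin by (intro negligible_bad_averages) auto
  hence "AE t in lebesgue. t \<notin> ?B" unfolding negligible_iff_null_sets by (rule AE_not_in)
  thus ?thesis
  proof eventually_elim
   case (elim t)
   show ?case
   proof
    assume "f t + inverse (real (Suc k)) <= q"
    hence "ennreal (f t) + ennreal (inverse (real (Suc k))) <= ennreal q"
     using f0[of t] by (simp add: ennreal_plus[symmetric] ennreal_leI del: ennreal_plus)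
    with elim obtain d where d: "d > 0" and H: "\<not> (EX u v. u <= t & t <= v & u < v & v - u < d \<and>
     (\<integral>\<^sup>+ x \<in> {u..v}. ennreal q \<partial>lebesgue) <= (\<integral>\<^sup>+ x \<in> {u..v}. ennreal (f x) \<partial>lebesgue))" by blast
    have "?I u v < q * (v - u)" if "u <= t" "t <= v" "u < v" "v - u < d" for u v
    proof -
     have "\<not> (\<integral>\<^sup>+ x \<in> {u..v}. ennreal q \<partial>lebesgue) <= (\<integral>\<^sup>+ x \<in> {u..v}. ennreal (f x) \<partial>lebesgue)"
      using H that by blast
     hence "\<not> ennreal (q * (v - u)) <= ennreal (?I u v)" unfolding Ic[OF that(3) True] Inn(1) .
     thus ?thesis using Inn(2)[of u v] by (auto simp: not_le ennreal_less_iff intro: ccontr)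
    qed
    thus "P t q" unfolding P_def using d by blast
   qed
  qed
 next
  case False
  hence "\<not> f t + inverse (real (Suc k)) <= q" for t
   using f0[of t] inverse_nonnegative_iff_nonnegative[of "real (Suc k)"] by (auto simp del: inverse_nonnegative_iff_nonnegative)
  thus ?thesis by simp
 qed
 have lo: "AE t in lebesgue. q + inverse (real (Suc k)) <= f t --> 0 <= q --> \<bar>t\<bar> < real R --> Q t q" for q k R
 proof (cases "0 <= q")
  case True
  \<comment> \<open>The constant is cut off to [-R, R] because the lower function must have a finite
    integral; for |t| < R short intervals around t do not see the cut-off.\<close>
  have ifin: "(\<integral>\<^sup>+ x. ennreal q * indicator {-real R..real R} x \<partial>lebesgue) < \<infinity>"
   by (subst nn_integral_cmult_indicator) (auto simp: ennreal_mult_less_top)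
  have "negligible {t. ennreal q * indicator {-real R..real R} t + ennreal (inverse (real (Suc k))) <= ennreal (f t) \<and>
   (\<forall>d>0. EX u v. u <= t & t <= v & u < v & v - u < d \<and>
   (\<integral>\<^sup>+ x \<in> {u..v}. ennreal (f x) \<partial>lebesgue) <= (\<integral>\<^sup>+ x \<in> {u..v}. (ennreal q * indicator {-real R..real R} x) \<partial>lebesgue))}" (is "negligible ?B")
  proof (rule negligible_bad_averages)
   have [measurable]: "{- real R..real R} \<in> sets lebesgue" by auto
   show "(%t. ennreal q * indicator {-real R..real R} t) \<in> borel_measurable lebesgue" by measurable
  qed (use ifin in auto)
  hence "AE t in lebesgue. t \<notin> ?B" unfolding negligible_iff_null_sets by (rule AE_not_in)
  thus ?thesis
  proof eventually_elim
   case (elim t)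
   show ?case
   proof (intro impI)
    assume a: "q + inverse (real (Suc k)) <= f t" and R: "\<bar>t\<bar> < real R"
    have "ennreal q + ennreal (inverse (real (Suc k))) <= ennreal (f t)"
     using True a by (simp add: ennreal_plus[symmetric] ennreal_leI del: ennreal_plus)
    hence "ennreal q * indicator {-real R..real R} t + ennreal (inverse (real (Suc k))) <= ennreal (f t)"
     using R by (simp add: indicator_def abs_less_iff)
    with elim obtain d where d: "d > 0" and H: "\<not> (EX u v. u <= t & t <= v & u < v & v - u < d \<and>
     (\<integral>\<^sup>+ x \<in> {u..v}. ennreal (f x) \<partial>lebesgue) <= (\<integral>\<^sup>+ x \<in> {u..v}. (ennreal q * indicator {-real R..real R} x) \<partial>lebesgue))" by blast
    define d' where "d' = min d (real R - \<bar>t\<bar>)"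
    have "q * (v - u) < ?I u v" if "u <= t" "t <= v" "u < v" "v - u < d'" for u v
    proof -
     have "(\<integral>\<^sup>+ x \<in> {u..v}. (ennreal q * indicator {-real R..real R} x) \<partial>lebesgue) = (\<integral>\<^sup>+ x \<in> {u..v}. ennreal q \<partial>lebesgue)"
      using that R by (intro nn_integral_cong) (auto simp: d'_def split: split_indicator)
     moreover have "v - u < d" using that by (simp add: d'_def)
     hence "\<not> (\<integral>\<^sup>+ x \<in> {u..v}. ennreal (f x) \<partial>lebesgue) <= (\<integral>\<^sup>+ x \<in> {u..v}. (ennreal q * indicator {-real R..real R} x) \<partial>lebesgue)"
      using H that(1-3) by blast
     ultimately have "\<not> ennreal (?I u v) <= ennreal (q * (v - u))"
      by (simp only: Ic[OF that(3) True] Inn(1) not_False_eq_True simp_thms)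
     thus ?thesis using that True by (auto simp: not_le ennreal_less_iff intro: ccontr)
    qed
    moreover have "d' > 0" using d R by (simp add: d'_def)
    ultimately show "Q t q" unfolding Q_def by blast
   qed
  qed
 qed simp
 have "AE t in lebesgue. \<forall>q\<in>\<rat>. ALL k. f t + inverse (real (Suc k)) <= q --> P t q"
  by (subst AE_ball_countable[OF countable_rat]) (intro ballI AE_all_countable[THEN iffD2] allI up)
 moreover have "AE t in lebesgue. \<forall>q\<in>\<rat>. ALL k. ALL R. q + inverse (real (Suc k)) <= f t --> 0 <= q --> \<bar>t\<bar> < real R --> Q t q"
  by (subst AE_ball_countable[OF countable_rat]) (intro ballI AE_all_countable[THEN iffD2] allI lo)
 ultimately show ?thesis
 proof eventually_elim
  case (elim t)
  show ?case
  proof (intro allI impI)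
   fix e :: real assume e: "0 < e"
   obtain q where q: "q \<in> \<rat>" "f t < q" "q < f t + e" using Rats_dense_in_real[of "f t" "f t + e"] e by auto
   obtain k where "inverse (real (Suc k)) < q - f t" using reals_Archimedean[of "q - f t"] q by auto
   hence "P t q" using elim(1) q(1) by (auto intro: less_imp_le simp: algebra_simps)
   then obtain d1 where d1: "d1 > 0" "!!u v. u <= t ==> t <= v ==> u < v ==> v - u < d1 ==> ?I u v < q * (v - u)"
    unfolding P_def by blast
   have "\<exists>d2>0. ALL u v. u <= t --> t <= v --> u < v --> v - u < d2 --> (f t - e) * (v - u) <= ?I u v"
   \<comment> \<open>The estimate from below is trivial if f vanishes at t; only otherwise is there
     a nonnegative rational strictly below f t.\<close>
   proof (cases "f t = 0")
    case True
    have "(f t - e) * (v - u) <= 0" if "u < v" for u v using that e True by (simp add: mult_nonpos_nonneg)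
    hence "(f t - e) * (v - u) <= ?I u v" if "u < v" for u v using Inn(2)[of u v] that order_trans by blast
    thus ?thesis by (intro exI[of _ 1]) simp
   next
    case False
    hence "f t > 0" using f0[of t] by simp
    then obtain q' where q': "q' \<in> \<rat>" "max 0 (f t - e) < q'" "q' < f t" using Rats_dense_in_real[of "max 0 (f t - e)" "f t"] e by auto
    obtain k where k: "inverse (real (Suc k)) < f t - q'" using reals_Archimedean[of "f t - q'"] q' by auto
    obtain R :: nat where R: "\<bar>t\<bar> < real R" using reals_Archimedean2 by blast
    have "q' + inverse (real (Suc k)) <= f t" "0 <= q'" using k q' by auto
    hence "Q t q'" using elim(2) q'(1) R by blast
    then obtain d2 where d2: "d2 > 0" "!!u v. u <= t ==> t <= v ==> u < v ==> v - u < d2 ==> q' * (v - u) < ?I u v"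
     unfolding Q_def by blast
    have "(f t - e) * (v - u) <= ?I u v" if "u <= t" "t <= v" "u < v" "v - u < d2" for u v
    proof -
     have "(f t - e) * (v - u) <= q' * (v - u)" using q' that by (intro mult_right_mono) auto
     thus ?thesis using d2(2)[OF that] by simp
    qed
    thus ?thesis using d2(1) by blast
   qed
   then obtain d2 where d2: "d2 > 0" "!!u v. u <= t ==> t <= v ==> u < v ==> v - u < d2 ==> (f t - e) * (v - u) <= ?I u v" by blast
   have "\<bar>?I u v - f t * (v - u)\<bar> <= e * (v - u)" if uv: "u <= t" "t <= v" "u < v" "v - u < min d1 d2" for u v
   proof -
    have 1: "?I u v < q * (v - u)" using d1(2) uv by simp
    have 2: "q * (v - u) <= (f t + e) * (v - u)" using q uv by (intro mult_right_mono) auto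
    have 3: "(f t - e) * (v - u) <= ?I u v" using d2(2) uv by simp
    show ?thesis using 1 2 3 by (simp add: abs_le_iff algebra_simps)
   qed
   moreover have "min d1 d2 > 0" using d1 d2 by simp
   ultimately show "\<exists>d>0. ALL u v. u <= t --> t <= v --> u < v --> v - u < d --> \<bar>?I u v - f t * (v - u)\<bar> <= e * (v - u)"
    by blast
  qed
 qed
qed

theorem lebesgue_differentiation:
 fixes f :: "real => real"
 assumes f: "integrable lebesgue f"
 shows "AE t in lebesgue. \<forall>e>0. \<exists>d>0. ALL u v. u <= t --> t <= v --> u < v --> v - u < d -->
   \<bar>(LINT x:{u..v}|lebesgue. f x) - f t * (v - u)\<bar> <= e * (v - u)"
proof -
 have 1: "integrable lebesgue (%x. max 0 (f x))" "integrable lebesgue (%x. max 0 (- f x))" using f by auto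
 let ?I = "%f u v. LINT x:{u..v}|lebesgue. (f x :: real)"
 have diff: "?I f u v = ?I (%x. max 0 (f x)) u v - ?I (%x. max 0 (- f x)) u v" for u v
 proof -
  have "?I (%x. max 0 (f x) - max 0 (- f x)) u v = ?I (%x. max 0 (f x)) u v - ?I (%x. max 0 (- f x)) u v"
  proof (rule set_integral_diff(2))
   show "set_integrable lebesgue {u..v} (%x. max 0 (f x))" "set_integrable lebesgue {u..v} (%x. max 0 (- f x))"
    unfolding set_integrable_def by (rule integrable_mult_indicator; use 1 in auto)+
  qed
  moreover have "(%x. max 0 (f x) - max 0 (- f x)) = f" by (auto simp: max_def)
  ultimately show ?thesis by simp
 qed
 show ?thesis
  using lebesgue_differentiation_nonneg[OF 1(1) max.cobounded1] lebesgue_differentiation_nonneg[OF 1(2) max.cobounded1]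
 proof eventually_elim
  case (elim t)
  show ?case
  proof (intro allI impI)
  fix e :: real assume e: "0 < e"
  hence e2: "0 < e / 2" by simp
  obtain d1 where d1: "d1 > 0" "!!u v. u <= t ==> t <= v ==> u < v ==> v - u < d1 ==>
   \<bar>?I (%x. max 0 (f x)) u v - max 0 (f t) * (v - u)\<bar> <= e / 2 * (v - u)" using elim(1) e2 by blast
  obtain d2 where d2: "d2 > 0" "!!u v. u <= t ==> t <= v ==> u < v ==> v - u < d2 ==>
   \<bar>?I (%x. max 0 (- f x)) u v - max 0 (- f t) * (v - u)\<bar> <= e / 2 * (v - u)" using elim(2) e2 by blast
  have "\<bar>?I f u v - f t * (v - u)\<bar> <= e * (v - u)" if "u <= t" "t <= v" "u < v" "v - u < min d1 d2" for u v
  proof -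
   have "f t * (v - u) = max 0 (f t) * (v - u) - max 0 (- f t) * (v - u)" by (auto simp: max_def)
   moreover have "e * (v - u) = e / 2 * (v - u) + e / 2 * (v - u)" by (simp add: field_simps)
   ultimately show ?thesis using d1(2)[of u v] d2(2)[of u v] that unfolding diff by linarith
  qed
  thus "\<exists>d>0. ALL u v. u <= t --> t <= v --> u < v --> v - u < d --> \<bar>?I f u v - f t * (v - u)\<bar> <= e * (v - u)"
   using d1(1) d2(1) by (intro exI[of _ "min d1 d2"]) auto
  qed
 qed
qed

section \<open>Dyadic partitions and monotone functions\<close>

locale dyadic_interval =
 fixes a b :: real
 assumes ab: "a < b"
begin

text \<open>The mesh of the dyadic partition of level n; \<open>\<tau> n i\<close> is its i-th node,
  and \<open>\<phi> n t\<close> the index of the last node not after t, which is 2^n only for t =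
  b.\<close>

definition \<delta> :: "nat => real" where "\<delta> n = (b - a) / 2 ^ n"

definition \<tau> :: "nat => nat => real" where "\<tau> n i = a + real i * \<delta> n"

definition \<phi> :: "nat => real => nat" where "\<phi> n t = nat \<lfloor>(t - a) / \<delta> n\<rfloor>"

lemma \<delta>_pos [simp]: "0 < \<delta> n" using ab by (simp add: \<delta>_def)

lemma \<delta>_nonneg [simp]: "0 <= \<delta> n" using \<delta>_pos[of n] by linarith

lemma \<delta>_add: "\<delta> n = 2 ^ m * \<delta> (n + m)" by (simp add: \<delta>_def power_add)

lemma \<delta>_Suc: "\<delta> n = 2 * \<delta> (Suc n)" using \<delta>_add[of n 1] by simp

lemma \<delta>_tendsto: "\<delta> \<longlonglongrightarrow> 0"
proof -
 have "(%n. (b - a) * (1/2)^n) \<longlonglongrightarrow> (b - a) * 0" by (intro tendsto_mult tendsto_const LIMSEQ_power_zero) simp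
 thus ?thesis by (simp add: \<delta>_def[abs_def] power_divide)
qed

lemma \<tau>_0 [simp]: "\<tau> n 0 = a" by (simp add: \<tau>_def)

lemma \<tau>_end: "\<tau> n (2 ^ n) = b" by (simp add: \<tau>_def \<delta>_def)

lemma \<tau>_Suc: "\<tau> n (Suc i) = \<tau> n i + \<delta> n" by (simp add: \<tau>_def algebra_simps)

lemma \<tau>_mono: "i <= j ==> \<tau> n i <= \<tau> n j" by (simp add: \<tau>_def mult_right_mono)

lemma \<tau>_in: "i <= 2 ^ n ==> \<tau> n i \<in> {a..b}"
 using \<tau>_mono[of 0 i n] \<tau>_mono[of i "2^n" n] \<tau>_end[of n] by simp

lemma \<tau>_refine: "\<tau> n i = \<tau> (n + m) (2 ^ m * i)"
 using \<delta>_add[of n m] by (simp add: \<tau>_def mult_ac)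

lemma \<phi>_bounds:
 assumes "t \<in> {a..b}"
 shows "\<tau> n (\<phi> n t) <= t" "t < \<tau> n (\<phi> n t) + \<delta> n" "\<phi> n t <= 2 ^ n"
proof -
 let ?x = "(t - a) / \<delta> n"
 have x: "0 <= ?x" using assms by simp
 hence r: "real (\<phi> n t) = of_int \<lfloor>?x\<rfloor>" by (simp add: \<phi>_def)
 have "real (\<phi> n t) <= ?x" "?x < real (\<phi> n t) + 1" unfolding r by linarith+
 hence *: "real (\<phi> n t) * \<delta> n <= t - a" "t - a < (real (\<phi> n t) + 1) * \<delta> n"
  using \<delta>_pos[of n] by (simp_all add: pos_le_divide_eq pos_divide_less_eq)
 thus "\<tau> n (\<phi> n t) <= t" "t < \<tau> n (\<phi> n t) + \<delta> n" by (simp_all add: \<tau>_def algebra_simps)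
 have "real (\<phi> n t) * \<delta> n <= 2 ^ n * \<delta> n" using *(1) assms by (simp add: \<delta>_def)
 hence "real (\<phi> n t) <= real (2 ^ n)" using \<delta>_pos[of n] by (simp add: mult_le_cancel_right)
 thus "\<phi> n t <= 2 ^ n" unfolding of_nat_le_iff .
qed

lemma \<phi>_\<tau> [simp]: "\<phi> n (\<tau> n i) = i"
 using \<delta>_pos[of n] by (simp add: \<phi>_def \<tau>_def del: \<delta>_pos)

lemma \<phi>_mono: "s <= t ==> \<phi> n s <= \<phi> n t"
 unfolding \<phi>_def by (intro nat_mono floor_mono divide_right_mono) auto

lemma \<phi>_double: "t \<in> {a..b} ==> 2 * \<phi> n t <= \<phi> (Suc n) t"
proof -
 assume t: "t \<in> {a..b}"
 have "\<tau> (Suc n) (2 * \<phi> n t) <= t" using \<phi>_bounds(1)[OF t, of n] \<tau>_refine[of n "\<phi> n t" 1] by simp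
 hence "\<phi> (Suc n) (\<tau> (Suc n) (2 * \<phi> n t)) <= \<phi> (Suc n) t" by (rule \<phi>_mono)
 thus ?thesis by simp
qed

lemma \<tau>_\<phi>_tendsto: "t \<in> {a..b} ==> (%n. \<tau> n (\<phi> n t)) \<longlonglongrightarrow> t"
proof (rule LIM_zero_cancel, rule Lim_null_comparison[OF _ \<delta>_tendsto], rule always_eventually, rule allI)
 fix n assume "t \<in> {a..b}"
 thus "norm (\<tau> n (\<phi> n t) - t) <= \<delta> n" using \<phi>_bounds(1,2)[of t n] by simp
qed

lemma \<phi>_less: "t \<in> {a..<b} ==> \<phi> n t < 2 ^ n"
proof -
 assume t: "t \<in> {a..<b}"
 hence tt: "t \<in> {a..b}" by simp
 have "\<phi> n t ~= 2 ^ n" using \<phi>_bounds(1)[OF tt, of n] \<tau>_end[of n] t by auto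
 thus ?thesis using \<phi>_bounds(3)[OF tt, of n] by simp
qed

text \<open>Cells open on the left match the intervals on which \<open>interval_measure\<close> is
  prescribed. A node therefore belongs to the cell that ends there.\<close>

lemma Ioc_cell: 
 assumes "x \<in> {a<..b}"
 obtains i where "i < 2 ^ n" "x \<in> {\<tau> n i<..\<tau> n (Suc i)}"
proof (cases "x = \<tau> n (\<phi> n x)")
 case True
 hence "\<phi> n x ~= 0" using assms by (auto intro: gr0I)
 then obtain i where i: "\<phi> n x = Suc i" using not0_implies_Suc by blast
 have "x = \<tau> n (Suc i)" using True i by simp
 moreover have "i < 2 ^ n" using \<phi>_bounds(3)[of x n] assms i by auto
 ultimately show ?thesis using that[of i] by (simp add: \<tau>_Suc)
next
 case False
 have x: "x \<in> {a..b}" using assms by auto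
 have "\<phi> n x ~= 2 ^ n" using False \<phi>_bounds(1)[OF x, of n] \<tau>_end[of n] x by auto
 thus ?thesis using that[of "\<phi> n x"] False \<phi>_bounds[OF x, of n] by (auto simp: \<tau>_Suc)
qed

lemma cells_disjoint: "disjoint_family_on (%i. {\<tau> n i<..\<tau> n (Suc i)}) J"
proof -
 have "{\<tau> n i<..\<tau> n (Suc i)} \<inter> {\<tau> n j<..\<tau> n (Suc j)} = {}" if "i < j" for i j
  using \<tau>_mono[of "Suc i" j n] that by auto
 thus ?thesis unfolding disjoint_family_on_def by (metis Int_commute linorder_neqE_nat)
qed

text \<open>The density is the Radon-Nikodym derivative of the Stieltjes measure of U. The
  assumption \<open>small\<close> is absolute continuity in dyadic form: the dyadic cells inside a
  small open set around a null set exhaust that set within the interval, and the increments of U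
  over those cells add up to at most 2 e.\<close>

lemma density_of_monotone:
 fixes U :: "real => real"
 assumes mono: "!!s t. a <= s ==> s <= t ==> t <= b ==> U s <= U t" and cont: "continuous_on {a..b} U"
  and small: "!!e. 0 < e ==> \<exists>\<theta>>0. ALL n J. J \<subseteq> {..<2 ^ n} -->
    (\<Sum>i\<in>J. U (\<tau> n (Suc i)) - U (\<tau> n i)) <= \<theta> * (real (card J) * \<delta> n) + e"
 obtains g where "integrable lebesgue g" "!!x. 0 <= g x"
  "!!s t. a <= s ==> s <= t ==> t <= b ==> (LINT x:{s..t}|lebesgue. g x) = U t - U s"
proof -
 \<comment> \<open>U is continued by constants, because \<open>interval_measure\<close> is built
   from a monotone right-continuous function on the whole line.\<close>
 define F where "F x = U (max a (min b x))" for x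
 have Fmono: "F x <= F y" if "x <= y" for x y using that ab by (auto simp: F_def intro!: mono)
 have "continuous_on UNIV (%x. U (max a (min b x)))"
  by (rule continuous_on_compose2[OF cont]) (use ab in "auto intro!: continuous_intros")
 hence "isCont F x" for x by (auto simp: F_def[abs_def] continuous_on_eq_continuous_at)
 hence Fright: "continuous (at_right x) F" for x by (rule continuous_at_imp_continuous_within)
 have FU: "F x = U x" if "x \<in> {a..b}" for x using that by (auto simp: F_def)
 let ?I = "interval_measure F"
 have Ioc: "emeasure ?I {s<..t} = ennreal (U t - U s)" if "a <= s" "s <= t" "t <= b" for s t
  using emeasure_interval_measure_Ioc[OF that(2), of F] Fmono Fright FU[of s] FU[of t] that by auto
 define \<nu> where "\<nu> = density ?I (indicator {a<..b})"
 have \<nu>: "emeasure \<nu> X = emeasure ?I (X \<inter> {a<..b})" if [measurable]: "X \<in> sets borel" for X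
  unfolding \<nu>_def by (subst emeasure_density)
   (auto simp: nn_integral_indicator[symmetric] simp del: nn_integral_indicator intro!: nn_integral_cong split: split_indicator)
 have ac: "absolutely_continuous lborel \<nu>"
  unfolding absolutely_continuous_def
 proof
  fix N :: "real set" assume N: "N \<in> null_sets lborel"
  hence Nb [measurable]: "N \<in> sets borel" by auto
  have "emeasure \<nu> N <= 0 + ennreal (2 * e)" if e: "e > 0" for e
  proof -
   obtain \<theta> where \<theta>: "\<theta> > 0" "!!n J. J \<subseteq> {..<2 ^ n} ==>
     (\<Sum>i\<in>J. U (\<tau> n (Suc i)) - U (\<tau> n i)) <= \<theta> * (real (card J) * \<delta> n) + e"
    using small[OF e] by blast
   \<comment> \<open>With measure at most e / \<theta>, the term \<theta> times the total length of
     the cells inside V is at most e.\<close>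
   obtain V where V: "open V" "N \<subseteq> V" "emeasure lborel (V - N) < ennreal (e / \<theta>)"
    by (rule outer_regular_lborel[OF Nb, of "e / \<theta>"]) (use e \<theta> in auto)
   have [measurable]: "V \<in> sets borel" using V(1) by simp
   have Ve: "emeasure lborel V <= ennreal (e / \<theta>)"
   proof -
    have "emeasure lborel V = emeasure lborel (V - N)" using N by (simp add: emeasure_Diff_null_set)
    thus ?thesis using V(3) by simp
   qed
   define J where "J n = {i. i < 2 ^ n & {\<tau> n i<..\<tau> n (Suc i)} \<subseteq> V}" for n :: nat
   define A where "A n = (\<Union>i\<in>J n. {\<tau> n i<..\<tau> n (Suc i)})" for n
   have Jf: "finite (J n)" "J n \<subseteq> {..<2 ^ n}" for n by (auto simp: J_def)
   have [measurable]: "A n \<in> sets borel" for n unfolding A_def using Jf(1) by (intro sets.finite_UN) auto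
   have disj: "disjoint_family_on (%i. {\<tau> n i<..\<tau> n (Suc i)}) (J n)" for n by (rule cells_disjoint)
   have "incseq A"
   proof (rule incseq_SucI, rule subsetI)
    fix n x assume "x \<in> A n"
    then obtain i where i: "i < 2 ^ n" "{\<tau> n i<..\<tau> n (Suc i)} \<subseteq> V" "x \<in> {\<tau> n i<..\<tau> n (Suc i)}"
     by (auto simp: A_def J_def)
    have e1: "\<tau> n i = \<tau> (Suc n) (2 * i)" using \<tau>_refine[of n i 1] by simp
    have e2: "\<tau> n (Suc i) = \<tau> (Suc n) (Suc (Suc (2 * i)))" using \<tau>_refine[of n "Suc i" 1] by simp
    show "x \<in> A (Suc n)"
    proof (cases "x <= \<tau> (Suc n) (Suc (2 * i))")
     case True
     hence "x \<in> {\<tau> (Suc n) (2 * i)<..\<tau> (Suc n) (Suc (2 * i))}" using i(3) e1 by simp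
     moreover have "2 * i \<in> J (Suc n)" using i(1,2) e1 e2 \<tau>_mono[of "Suc (2 * i)" "Suc (Suc (2 * i))" "Suc n"]
      by (auto simp: J_def subset_iff)
     ultimately show ?thesis unfolding A_def by blast
    next
     case False
     hence "x \<in> {\<tau> (Suc n) (Suc (2 * i))<..\<tau> (Suc n) (Suc (Suc (2 * i)))}" using i(3) e2 by simp
     moreover have "Suc (2 * i) \<in> J (Suc n)" using i(1,2) e1 e2 \<tau>_mono[of "2 * i" "Suc (2 * i)" "Suc n"]
      by (auto simp: J_def subset_iff)
     ultimately show ?thesis unfolding A_def by blast
    qed
   qed
   have cover: "N \<inter> {a<..b} \<subseteq> (\<Union>n. A n)"
   proof
    fix x assume x: "x \<in> N \<inter> {a<..b}"
    then obtain r where r: "r > 0" "ball x r \<subseteq> V" using V(1,2) openE by blast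
    have "\<forall>\<^sub>F n in sequentially. \<delta> n < r" using \<delta>_tendsto r(1) by (intro order_tendstoD) auto
    then obtain n where n: "\<delta> n < r" by (auto simp: eventually_sequentially)
    obtain i where i: "i < 2 ^ n" "x \<in> {\<tau> n i<..\<tau> n (Suc i)}" using x by (auto intro: Ioc_cell[of x n])
    have "{\<tau> n i<..\<tau> n (Suc i)} \<subseteq> ball x r" using i(2) n by (auto simp: dist_real_def \<tau>_Suc)
    hence "i \<in> J n" using i r by (auto simp: J_def)
    thus "x \<in> (\<Union>n. A n)" using i(2) by (auto simp: A_def)
   qed
   have An: "emeasure ?I (A n) <= ennreal (2 * e)" for n
   proof -
    have le: "U (\<tau> n i) <= U (\<tau> n (Suc i))" if "i \<in> J n" for i
     using that \<tau>_in[of i n] \<tau>_in[of "Suc i" n] \<tau>_mono[of i "Suc i" n] by (intro mono) (auto simp: J_def)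
    have c1: "emeasure lborel (A n) = ennreal (real (card (J n)) * \<delta> n)"
    proof -
     have "emeasure lborel (A n) = (\<Sum>i\<in>J n. emeasure lborel {\<tau> n i<..\<tau> n (Suc i)})"
      unfolding A_def using disj Jf by (intro sum_emeasure[symmetric]) auto
     also have "\<dots> = (\<Sum>i\<in>J n. ennreal (\<delta> n))" by (intro sum.cong) (auto simp: \<tau>_Suc)
     finally show ?thesis by (simp add: ennreal_mult ennreal_of_nat_eq_real_of_nat)
    qed
    have "emeasure lborel (A n) <= emeasure lborel V" by (intro emeasure_mono) (auto simp: A_def J_def)
    hence "ennreal (real (card (J n)) * \<delta> n) <= ennreal (e / \<theta>)" using Ve c1 by simp
    hence c2: "real (card (J n)) * \<delta> n <= e / \<theta>" using e \<theta>(1) by (subst (asm) ennreal_le_iff) auto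
    have "emeasure ?I (A n) = (\<Sum>i\<in>J n. emeasure ?I {\<tau> n i<..\<tau> n (Suc i)})"
     unfolding A_def using disj Jf by (intro sum_emeasure[symmetric]) auto
    also have "\<dots> = (\<Sum>i\<in>J n. ennreal (U (\<tau> n (Suc i)) - U (\<tau> n i)))"
    proof (rule sum.cong[OF refl])
     fix i assume "i \<in> J n"
     thus "emeasure ?I {\<tau> n i<..\<tau> n (Suc i)} = ennreal (U (\<tau> n (Suc i)) - U (\<tau> n i))"
      using \<tau>_in[of i n] \<tau>_in[of "Suc i" n] \<tau>_mono[of i "Suc i" n] by (intro Ioc) (auto simp: J_def)
    qed
    also have "\<dots> = ennreal (\<Sum>i\<in>J n. U (\<tau> n (Suc i)) - U (\<tau> n i))" using le by (intro sum_ennreal) auto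
    also have "\<dots> <= ennreal (\<theta> * (e / \<theta>) + e)"
     using \<theta>(2)[OF Jf(2), of n] mult_left_mono[OF c2, of \<theta>] \<theta>(1) by (intro ennreal_leI) linarith
    finally show ?thesis using \<theta>(1) by simp
   qed
   have "emeasure \<nu> N <= emeasure ?I (\<Union>n. A n)" unfolding \<nu>[OF Nb] using cover by (intro emeasure_mono) auto
   also have "\<dots> = (SUP n. emeasure ?I (A n))" using \<open>incseq A\<close> by (intro SUP_emeasure_incseq[symmetric]) auto
   also have "\<dots> <= ennreal (2 * e)" by (intro SUP_least An)
   finally show ?thesis by simp
  qed
  note le = this
  have "emeasure \<nu> N <= 0"
  proof (rule ennreal_le_epsilon)
   fix e :: real assume "0 < e"
   thus "emeasure \<nu> N <= 0 + ennreal e" using le[of "e / 2"] by simp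
  qed
  thus "N \<in> null_sets \<nu>" using N by (auto simp: null_sets_def \<nu>_def)
 qed
 obtain f where f [measurable]: "f \<in> borel_measurable lborel" and fd: "density lborel f = \<nu>"
  using sigma_finite_measure.Radon_Nikodym[OF sigma_finite_lborel ac] by (auto simp: \<nu>_def)
 have fI: "(\<integral>\<^sup>+ x \<in> {s<..t}. f x \<partial>lborel) = ennreal (U t - U s)" if "a <= s" "s <= t" "t <= b" for s t
 proof -
  have "(\<integral>\<^sup>+ x \<in> {s<..t}. f x \<partial>lborel) = emeasure \<nu> {s<..t}" unfolding fd[symmetric] by (simp add: emeasure_density)
  also have "\<dots> = emeasure ?I {s<..t}" using that by (subst \<nu>) (auto intro!: arg_cong[where f = "emeasure ?I"])
  finally show ?thesis using Ioc[OF that] by simp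
 qed
 define f' where "f' x = f x * indicator {a<..b} x" for x
 have [measurable]: "f' \<in> borel_measurable lborel" unfolding f'_def by measurable
 have f'I: "(\<integral>\<^sup>+ x. f' x \<partial>lborel) = ennreal (U b - U a)" unfolding f'_def using fI[of a b] ab by simp
 hence "AE x in lborel. f' x ~= \<infinity>" by (intro nn_integral_PInf_AE) auto
 hence fin: "AE x in lborel. ennreal (enn2real (f' x)) = f' x" by eventually_elim (simp add: less_top)
 define g where "g x = enn2real (f' x)" for x
 have gb [measurable]: "g \<in> borel_measurable lborel" unfolding g_def by measurable
 have g0: "0 <= g x" for x by (simp add: g_def)
 have "(\<integral>\<^sup>+ x. ennreal (g x) \<partial>lborel) = ennreal (U b - U a)"
  unfolding f'I[symmetric] g_def by (rule nn_integral_cong_AE[OF fin])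
 hence "integrable lborel g" by (intro integrableI_nonneg) (auto simp: g0)
 hence gi: "integrable lebesgue g" by (simp add: integrable_completion)
 have "(LINT x:{s..t}|lebesgue. g x) = U t - U s" if st: "a <= s" "s <= t" "t <= b" for s t
 proof -
  have "(\<integral>\<^sup>+ x. ennreal (indicator {s..t} x *\<^sub>R g x) \<partial>lborel) = (\<integral>\<^sup>+ x \<in> {s<..t}. f x \<partial>lborel)"
   using fin AE_lborel_singleton[of s]
   by (intro nn_integral_cong_AE, eventually_elim) (use st in "auto simp: g_def f'_def split: split_indicator")
  also have "\<dots> = ennreal (U t - U s)" by (rule fI[OF st])
  finally have *: "(\<integral>\<^sup>+ x. ennreal (indicator {s..t} x *\<^sub>R g x) \<partial>lborel) = ennreal (U t - U s)" .
  have "(LINT x:{s..t}|lebesgue. g x) = (LINT x:{s..t}|lborel. g x)"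
   unfolding set_lebesgue_integral_def by (rule integral_completion) measurable
  also have "\<dots> = enn2real (\<integral>\<^sup>+ x. ennreal (indicator {s..t} x *\<^sub>R g x) \<partial>lborel)"
   unfolding set_lebesgue_integral_def by (rule integral_eq_nn_integral) (auto simp: g0)
  finally show ?thesis using * mono[OF st] by simp
 qed
 thus ?thesis using that[OF gi g0] by blast
qed

end

text \<open>Either x is at most \<theta> \<delta>, or x / (\<theta> \<delta>) exceeds 1 and x may be
  multiplied by its (p-1)-th power. Summed over cells, this turns a bound on the energies into
  absolute continuity.\<close>

lemma le_theta_energy:
 fixes x \<delta> \<theta> p :: real
 assumes "0 <= x" "0 < \<delta>" "0 < \<theta>" "1 < p"
 shows "x <= \<theta> * \<delta> + \<theta> powr (1 - p) * (x powr p / \<delta> powr (p - 1))"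
proof (cases "x <= \<theta> * \<delta>")
 case True
 thus ?thesis using assms by (smt (verit) divide_nonneg_nonneg mult_nonneg_nonneg powr_ge_zero)
next
 case False
 hence x: "0 < x" "\<theta> * \<delta> < x" using assms by (auto intro: le_less_trans[of 0 "\<theta> * \<delta>"])
 have "(\<theta> * \<delta>) powr (p - 1) <= x powr (p - 1)" using assms x by (intro powr_mono2) auto
 hence "1 <= x powr (p - 1) / (\<theta> * \<delta>) powr (p - 1)" using assms by simp
 hence "x * 1 <= x * (x powr (p - 1) / (\<theta> * \<delta>) powr (p - 1))" using x by (intro mult_left_mono) auto
 also have "\<dots> = \<theta> powr (1 - p) * (x powr p / \<delta> powr (p - 1))"
  using x assms by (simp add: powr_mult powr_diff field_simps)
 finally show ?thesis using assms by (smt (verit) mult_pos_pos)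
qed

lemma ex_theta_small:
 fixes K e p :: real
 assumes "0 < e" "1 < p"
 obtains \<theta> where "0 < \<theta>" "\<theta> powr (1 - p) * K <= e"
proof -
 \<comment> \<open>K may be nonpositive, whereas the base e / K' of the power has to be positive.
   Since 1 - p is negative, a small right-hand side means a large \<theta>.\<close>
 define K' where "K' = max K 1"
 define \<theta> where "\<theta> = (e / K') powr (1 / (1 - p))"
 have K': "K' > 0" "K <= K'" by (auto simp: K'_def)
 have "\<theta> powr (1 - p) = e / K'" unfolding \<theta>_def using assms K' by (simp add: powr_powr)
 hence "\<theta> powr (1 - p) * K <= e" using K' assms by (simp add: pos_divide_le_eq mult_left_mono)
 moreover have "\<theta> > 0" using assms K' by (simp add: \<theta>_def)
 ultimately show ?thesis using that by blast
qed

section \<open>Variation of absolutely continuous curves\<close>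

text \<open>The third assumption is absolute continuity tested on cells of a single dyadic level. It
  contains no exponent and no density; \<open>small_of_energy\<close> derives it from bounded
  energies.\<close>

locale ac_curve = metric_target Z d + dyadic_interval a b
 for Z :: "'z set" and d :: "'z => 'z => real" and a b :: real +
 fixes \<gamma> :: "real => 'z"
 assumes \<gamma>_in: "t \<in> {a..b} ==> \<gamma> t \<in> Z"
  and \<gamma>_cont: "t \<in> {a..b} ==> ((%s. d (\<gamma> s) (\<gamma> t)) \<longlongrightarrow> 0) (at t within {a..b})"
  and \<gamma>_small: "0 < e ==> \<exists>\<theta>>0. ALL n J. J \<subseteq> {..<2 ^ n} -->
    (\<Sum>i\<in>J. d (\<gamma> (\<tau> n i)) (\<gamma> (\<tau> n (Suc i)))) <= \<theta> * (real (card J) * \<delta> n) + e"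
begin

definition D :: "nat => nat => real" where "D n i = d (\<gamma> (\<tau> n i)) (\<gamma> (\<tau> n (Suc i)))"

lemma D_nonneg [simp]: "0 <= D n i" by (simp add: D_def)

lemma \<gamma>_\<tau>_in: "i <= 2 ^ n ==> \<gamma> (\<tau> n i) \<in> Z" by (rule \<gamma>_in[OF \<tau>_in])

lemma \<gamma>_seq:
 assumes t: "t \<in> {a..b}" and x: "!!n. x n \<in> {a..b}" "x \<longlonglongrightarrow> t"
 shows "(%n. d (\<gamma> (x n)) (\<gamma> t)) \<longlonglongrightarrow> 0"
proof -
 have "continuous (at t within {a..b}) (%s. d (\<gamma> s) (\<gamma> t))"
  using \<gamma>_cont[OF t] \<gamma>_in[OF t] by (simp add: continuous_within)
 from continuous_within_tendsto_compose'[OF this x] show ?thesis using \<gamma>_in[OF t] by simp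
qed

lemma D_Suc: "i < 2 ^ n ==> D n i <= D (Suc n) (2 * i) + D (Suc n) (Suc (2 * i))"
proof -
 assume i: "i < 2 ^ n"
 have e1: "\<tau> n i = \<tau> (Suc n) (2 * i)" using \<tau>_refine[of n i 1] by simp
 have e2: "\<tau> n (Suc i) = \<tau> (Suc n) (Suc (Suc (2 * i)))" using \<tau>_refine[of n "Suc i" 1] by simp
 show ?thesis unfolding D_def e1 e2 using i by (intro triangle \<gamma>_\<tau>_in) auto
qed

lemma D_chain: "i <= j ==> j <= 2 ^ n ==> d (\<gamma> (\<tau> n i)) (\<gamma> (\<tau> n j)) <= (\<Sum>k\<in>{i..<j}. D n k)"
proof (induction j)
 case 0 thus ?case using \<gamma>_\<tau>_in[of 0 n] by simp
next
 case (Suc j)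
 show ?case
 proof (cases "i <= j")
  case True
  have "d (\<gamma> (\<tau> n i)) (\<gamma> (\<tau> n (Suc j))) <= d (\<gamma> (\<tau> n i)) (\<gamma> (\<tau> n j)) + D n j"
   unfolding D_def using Suc.prems by (intro triangle \<gamma>_\<tau>_in) auto
  thus ?thesis using Suc True by simp
 next
  case False
  hence "i = Suc j" using Suc.prems by simp
  thus ?thesis using \<gamma>_\<tau>_in[of "Suc j" n] Suc.prems by simp
 qed
qed

text \<open>Length of the polygon through the nodes up to t. The piece between the last node and t
  is omitted and disappears in the limit.\<close>

definition S :: "nat => real => real" where "S n t = (\<Sum>i<\<phi> n t. D n i)"

lemma S_Suc: "t \<in> {a..b} ==> S n t <= S (Suc n) t"
proof -
 assume t: "t \<in> {a..b}"
 have dbl: "(\<Sum>i<k. f (2 * i) + f (Suc (2 * i))) = (\<Sum>j<2 * k. f j)" for k and f :: "nat => real"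
  by (induction k) auto
 have "S n t <= (\<Sum>i<\<phi> n t. D (Suc n) (2 * i) + D (Suc n) (Suc (2 * i)))"
  unfolding S_def using \<phi>_bounds(3)[OF t, of n] by (intro sum_mono D_Suc) auto
 also have "\<dots> = (\<Sum>j<2 * \<phi> n t. D (Suc n) j)" by (rule dbl)
 also have "\<dots> <= S (Suc n) t"
  unfolding S_def using \<phi>_double[OF t, of n] by (intro sum_mono2) auto
 finally show ?thesis .
qed

lemma S_diff: "s <= t ==> S n t - S n s = (\<Sum>i\<in>{\<phi> n s..<\<phi> n t}. D n i)"
 unfolding S_def using sum_diff_nat_ivl[of 0 "\<phi> n s" "\<phi> n t" "D n"] \<phi>_mono[of s t n]
 by (simp add: atLeast0LessThan)

text \<open>The last nodes before s and t may be further apart than s and t themselves, by at most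
  one mesh width.\<close>

lemma S_diff_le:
 assumes "!!n J. J \<subseteq> {..<2 ^ n} ==> (\<Sum>i\<in>J. D n i) <= \<theta> * (real (card J) * \<delta> n) + e" "0 < \<theta>"
  "a <= s" "s <= t" "t <= b"
 shows "S n t - S n s <= \<theta> * (t - s + \<delta> n) + e"
proof -
 have st: "s \<in> {a..b}" "t \<in> {a..b}" using assms by auto
 have "S n t - S n s <= \<theta> * (real (card {\<phi> n s..<\<phi> n t}) * \<delta> n) + e"
  unfolding S_diff[OF assms(4)] using \<phi>_bounds(3)[OF st(2), of n] by (intro assms(1)) auto
 also have "real (card {\<phi> n s..<\<phi> n t}) * \<delta> n = \<tau> n (\<phi> n t) - \<tau> n (\<phi> n s)"
  using \<phi>_mono[OF assms(4), of n] by (simp add: \<tau>_def of_nat_diff algebra_simps)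
 also have "\<theta> * (\<tau> n (\<phi> n t) - \<tau> n (\<phi> n s)) <= \<theta> * (t - s + \<delta> n)"
  using \<phi>_bounds(1)[OF st(2), of n] \<phi>_bounds(2)[OF st(1), of n] assms(2) by (intro mult_left_mono) auto
 finally show ?thesis by simp
qed

lemma small_D: "0 < e ==> \<exists>\<theta>>0. ALL n J. J \<subseteq> {..<2 ^ n} --> (\<Sum>i\<in>J. D n i) <= \<theta> * (real (card J) * \<delta> n) + e"
 using \<gamma>_small by (simp add: D_def)

text \<open>The length of the curve from a to t.\<close>

definition v :: "real => real" where "v t = lim (%n. S n t)"

lemma S_tendsto: "t \<in> {a..b} ==> (%n. S n t) \<longlonglongrightarrow> v t"
proof -
 assume t: "t \<in> {a..b}"
 obtain \<theta> where \<theta>: "\<theta> > 0" "!!n J. J \<subseteq> {..<2 ^ n} ==> (\<Sum>i\<in>J. D n i) <= \<theta> * (real (card J) * \<delta> n) + 1"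
  using small_D[of 1] by auto
 have z: "S n a = 0" for n using \<phi>_\<tau>[of n 0] by (simp add: S_def)
 have "S n t <= \<theta> * (t - a + (b - a)) + 1" for n
 proof -
  have "S n t - S n a <= \<theta> * (t - a + \<delta> n) + 1" using S_diff_le[OF \<theta>(2,1), of a t n] t by auto
  moreover have "\<theta> * (t - a + \<delta> n) <= \<theta> * (t - a + (b - a))"
  proof -
   have "1 * \<delta> n <= 2 ^ n * \<delta> n" by (intro mult_right_mono) auto
   hence "\<delta> n <= b - a" by (simp add: \<delta>_def)
   thus ?thesis using \<theta>(1) by (intro mult_left_mono) auto
  qed
  ultimately show ?thesis using z[of n] by linarith
 qed
 hence "bdd_above (range (%n. S n t))" by (rule bdd_aboveI2)
 moreover have "incseq (%n. S n t)" by (rule incseq_SucI) (rule S_Suc[OF t])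
 ultimately have "convergent (%n. S n t)" by (rule convergentI[OF LIMSEQ_incseq_SUP])
 thus ?thesis by (simp add: v_def convergent_LIMSEQ_iff)
qed

lemma v_diff_le:
 assumes "!!n J. J \<subseteq> {..<2 ^ n} ==> (\<Sum>i\<in>J. D n i) <= \<theta> * (real (card J) * \<delta> n) + e" "0 < \<theta>"
  "a <= s" "s <= t" "t <= b"
 shows "v t - v s <= \<theta> * (t - s) + e"
proof (rule LIMSEQ_le)
 show "(%n. S n t - S n s) \<longlonglongrightarrow> v t - v s" using assms by (intro tendsto_diff S_tendsto) auto
 have "(%n. \<theta> * (t - s + \<delta> n) + e) \<longlonglongrightarrow> \<theta> * (t - s + 0) + e" by (intro tendsto_intros \<delta>_tendsto)
 thus "(%n. \<theta> * (t - s + \<delta> n) + e) \<longlonglongrightarrow> \<theta> * (t - s) + e" by simp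
 show "EX N. \<forall>n\<ge>N. S n t - S n s <= \<theta> * (t - s + \<delta> n) + e" using S_diff_le[OF assms] by blast
qed

lemma dist_le_v: "a <= s ==> s <= t ==> t <= b ==> d (\<gamma> s) (\<gamma> t) <= v t - v s"
proof -
 assume st: "a <= s" "s <= t" "t <= b"
 hence I: "s \<in> {a..b}" "t \<in> {a..b}" by auto
 let ?s = "%n. \<tau> n (\<phi> n s)" and ?t = "%n. \<tau> n (\<phi> n t)"
 have sI: "?s n \<in> {a..b}" "?t n \<in> {a..b}" for n using \<phi>_bounds(3) I \<tau>_in by blast+
 have "d (\<gamma> s) (\<gamma> t) <= (S n t - S n s) + d (\<gamma> (?s n)) (\<gamma> s) + d (\<gamma> (?t n)) (\<gamma> t)" for n
 proof -
  have "d (\<gamma> (?s n)) (\<gamma> (?t n)) <= S n t - S n s"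
   unfolding S_diff[OF st(2)] by (rule D_chain[OF \<phi>_mono[OF st(2)] \<phi>_bounds(3)[OF I(2)]])
  moreover have "d (\<gamma> s) (\<gamma> t) <= d (\<gamma> (?s n)) (\<gamma> s) + d (\<gamma> (?s n)) (\<gamma> t)"
   by (rule triangle''[OF \<gamma>_in[OF I(1)] \<gamma>_in[OF sI(1)] \<gamma>_in[OF I(2)]])
  moreover have "d (\<gamma> (?s n)) (\<gamma> t) <= d (\<gamma> (?s n)) (\<gamma> (?t n)) + d (\<gamma> (?t n)) (\<gamma> t)"
   by (rule triangle[OF \<gamma>_in[OF sI(1)] \<gamma>_in[OF sI(2)] \<gamma>_in[OF I(2)]])
  ultimately show ?thesis by linarith
 qed
 moreover have "(%n. (S n t - S n s) + d (\<gamma> (?s n)) (\<gamma> s) + d (\<gamma> (?t n)) (\<gamma> t)) \<longlonglongrightarrow> (v t - v s) + 0 + 0"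
  by (intro tendsto_add tendsto_diff S_tendsto I \<gamma>_seq sI \<tau>_\<phi>_tendsto)
 ultimately show ?thesis by (intro LIMSEQ_le_const[where X = "%n. (S n t - S n s) + d (\<gamma> (?s n)) (\<gamma> s) + d (\<gamma> (?t n)) (\<gamma> t)"]) auto
qed

lemma v_mono: "a <= s ==> s <= t ==> t <= b ==> v s <= v t"
 using dist_le_v[of s t] nonneg[of "\<gamma> s" "\<gamma> t"] by linarith

lemma continuous_if_dominated_by_v:
 assumes "!!s t. a <= s ==> s <= t ==> t <= b ==> \<bar>U t - U s\<bar> <= c * (v t - v s)" "0 < c"
 shows "continuous_on {a..b} (U :: real => real)"
 unfolding continuous_on_iff
proof (intro ballI allI impI)
 fix t e :: real assume t: "t \<in> {a..b}" and e: "0 < e"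
 have "0 < e / (2 * c)" using e assms(2) by simp
 from small_D[OF this] obtain \<theta> where \<theta>: "\<theta> > 0"
  "!!n J. J \<subseteq> {..<2 ^ n} ==> (\<Sum>i\<in>J. D n i) <= \<theta> * (real (card J) * \<delta> n) + e / (2 * c)" by blast
 have *: "\<bar>U y - U x\<bar> < e" if "a <= x" "x <= y" "y <= b" "y - x < e / (2 * c * \<theta>)" for x y
 proof -
  have "v y - v x <= \<theta> * (y - x) + e / (2 * c)" by (rule v_diff_le[OF \<theta>(2,1) that(1-3)])
  also have "\<theta> * (y - x) < \<theta> * (e / (2 * c * \<theta>))" using that(4) \<theta>(1) by (rule mult_strict_left_mono)
  also have "\<theta> * (e / (2 * c * \<theta>)) = e / (2 * c)" using \<theta>(1) by simp
  finally have "v y - v x < e / c" by simp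
  hence "c * (v y - v x) < e" using assms(2) by (simp add: pos_less_divide_eq mult.commute)
  thus ?thesis using assms(1)[OF that(1-3)] by linarith
 qed
 show "\<exists>k>0. \<forall>x\<in>{a..b}. dist x t < k --> dist (U x) (U t) < e"
 proof (intro exI[of _ "e / (2 * c * \<theta>)"] conjI ballI impI)
  show "0 < e / (2 * c * \<theta>)" using e \<theta>(1) assms(2) by simp
  fix x assume "x \<in> {a..b}" "dist x t < e / (2 * c * \<theta>)"
  thus "dist (U x) (U t) < e" using *[of x t] *[of t x] t by (cases "x <= t") (auto simp: dist_real_def)
 qed
qed

text \<open>The increment of v over a cell is the limit of sums over its 2^m subcells. Their number
  times their mesh is unchanged by refinement, so the bound for the curve carries over to v with the
  same \<theta> and e.\<close>

lemma v_increments: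
 assumes \<theta>: "!!n J. J \<subseteq> {..<2 ^ n} ==> (\<Sum>i\<in>J. D n i) <= \<theta> * (real (card J) * \<delta> n) + e" and J: "J \<subseteq> {..<2 ^ n}"
 shows "(\<Sum>i\<in>J. v (\<tau> n (Suc i)) - v (\<tau> n i)) <= \<theta> * (real (card J) * \<delta> n) + e"
proof (rule LIMSEQ_le_const2)
 have fJ: "finite J" using J finite_subset by blast
 show "(%m. \<Sum>i\<in>J. S (m + n) (\<tau> n (Suc i)) - S (m + n) (\<tau> n i)) \<longlonglongrightarrow> (\<Sum>i\<in>J. v (\<tau> n (Suc i)) - v (\<tau> n i))"
  using J by (intro tendsto_sum tendsto_diff LIMSEQ_ignore_initial_segment S_tendsto \<tau>_in) (auto simp: subset_iff Suc_leI less_imp_le)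
 show "EX N. \<forall>m\<ge>N. (\<Sum>i\<in>J. S (m + n) (\<tau> n (Suc i)) - S (m + n) (\<tau> n i)) <= \<theta> * (real (card J) * \<delta> n) + e"
 proof (intro exI[of _ 0] allI impI)
  fix m :: nat
  let ?B = "%i. {2 ^ m * i..<2 ^ m * Suc i}"
  have dis: "?B i \<inter> ?B j = {}" if "i < j" for i j
  proof -
   have "2 ^ m * Suc i <= 2 ^ m * j" using that by (intro mult_le_mono2) simp
   thus ?thesis by auto
  qed
  hence dis': "?B i \<inter> ?B j = {}" if "i ~= j" for i j
   using that by (cases i j rule: linorder_cases) (auto simp: Int_commute)
  have "(\<Sum>i\<in>J. S (m + n) (\<tau> n (Suc i)) - S (m + n) (\<tau> n i)) = (\<Sum>i\<in>J. \<Sum>k\<in>?B i. D (m + n) k)"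
  proof (rule sum.cong[OF refl])
   fix i
   have "\<phi> (m + n) (\<tau> n j) = 2 ^ m * j" for j
    using \<phi>_\<tau>[of "m + n" "2 ^ m * j"] \<tau>_refine[of n j m] by (simp add: add.commute)
   thus "S (m + n) (\<tau> n (Suc i)) - S (m + n) (\<tau> n i) = (\<Sum>k\<in>?B i. D (m + n) k)"
    by (subst S_diff) (auto intro: \<tau>_mono)
  qed
  also have "\<dots> = (\<Sum>k\<in>(\<Union>i\<in>J. ?B i). D (m + n) k)"
   using fJ dis' by (intro sum.UNION_disjoint[symmetric]) auto
  also have "\<dots> <= \<theta> * (real (card (\<Union>i\<in>J. ?B i)) * \<delta> (m + n)) + e"
  proof (rule \<theta>)
   have "2 ^ m * Suc i <= 2 ^ (m + n)" if "i \<in> J" for i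
    using that J mult_le_mono2[of "Suc i" "2 ^ n" "2 ^ m"] by (auto simp: power_add)
   thus "(\<Union>i\<in>J. ?B i) \<subseteq> {..<2 ^ (m + n)}" by fastforce
  qed
  also have "card (\<Union>i\<in>J. ?B i) = (\<Sum>i\<in>J. card (?B i))"
   using fJ dis' by (intro card_UN_disjoint) auto
  also have "\<dots> = 2 ^ m * card J" by (simp add: algebra_simps)
  also have "real (2 ^ m * card J) * \<delta> (m + n) = real (card J) * \<delta> n"
   using \<delta>_add[of n m] by (simp add: add.commute)
  finally show "(\<Sum>i\<in>J. S (m + n) (\<tau> n (Suc i)) - S (m + n) (\<tau> n i)) <= \<theta> * (real (card J) * \<delta> n) + e" .
 qed
qed

text \<open>The factor 2 accommodates U = v + w, where the increments of w are at most those of v in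
  absolute value.\<close>

lemma density_if_dominated_by_v:
 fixes U :: "real => real"
 assumes mono: "!!s t. a <= s ==> s <= t ==> t <= b ==> U s <= U t"
  and dom: "!!s t. a <= s ==> s <= t ==> t <= b ==> U t - U s <= 2 * (v t - v s)"
 obtains g where "integrable lebesgue g" "!!x. 0 <= g x"
  "!!s t. a <= s ==> s <= t ==> t <= b ==> (LINT x:{s..t}|lebesgue. g x) = U t - U s"
proof (rule density_of_monotone[of U, OF mono])
 show "continuous_on {a..b} U"
 proof (rule continuous_if_dominated_by_v[of U 2])
  show "\<bar>U t - U s\<bar> <= 2 * (v t - v s)" if "a <= s" "s <= t" "t <= b" for s t
   using mono[OF that] dom[OF that] by linarith
 qed simp
 fix e :: real assume "0 < e"
 hence "0 < e / 2" by simp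
 from small_D[OF this] obtain \<theta> where \<theta>: "\<theta> > 0"
  "!!n J. J \<subseteq> {..<2 ^ n} ==> (\<Sum>i\<in>J. D n i) <= \<theta> * (real (card J) * \<delta> n) + e / 2" by blast
 have "(\<Sum>i\<in>J. U (\<tau> n (Suc i)) - U (\<tau> n i)) <= (2 * \<theta>) * (real (card J) * \<delta> n) + e" if J: "J \<subseteq> {..<2 ^ n}" for n J
 proof -
  have "(\<Sum>i\<in>J. U (\<tau> n (Suc i)) - U (\<tau> n i)) <= (\<Sum>i\<in>J. 2 * (v (\<tau> n (Suc i)) - v (\<tau> n i)))"
  proof (rule sum_mono)
   fix i assume "i \<in> J"
   hence "i < 2 ^ n" using J by auto
   thus "U (\<tau> n (Suc i)) - U (\<tau> n i) <= 2 * (v (\<tau> n (Suc i)) - v (\<tau> n i))"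
    using \<tau>_in[of i n] \<tau>_in[of "Suc i" n] \<tau>_mono[of i "Suc i" n] by (intro dom) auto
  qed
  also have "\<dots> = 2 * (\<Sum>i\<in>J. v (\<tau> n (Suc i)) - v (\<tau> n i))" by (simp add: sum_distrib_left)
  also have "\<dots> <= 2 * (\<theta> * (real (card J) * \<delta> n) + e / 2)"
   using v_increments[OF \<theta>(2) J] by simp
  finally show ?thesis by simp
 qed
 thus "\<exists>\<theta>>0. ALL n J. J \<subseteq> {..<2 ^ n} --> (\<Sum>i\<in>J. U (\<tau> n (Suc i)) - U (\<tau> n i)) <= \<theta> * (real (card J) * \<delta> n) + e"
  using \<theta>(1) by (intro exI[of _ "2 * \<theta>"]) auto
next
 fix g assume "integrable lebesgue g" "!!x. 0 <= g x"
  "!!s t. a <= s ==> s <= t ==> t <= b ==> (LINT x:{s..t}|lebesgue. g x) = U t - U s"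
 thus thesis by (rule that)
qed

end

lemma set_integrable_interval: "integrable lebesgue (f :: real => real) ==> set_integrable lebesgue {s..t} f"
 unfolding set_integrable_def by (rule integrable_mult_indicator) auto

lemma averages_le_AE:
 fixes f g :: "real => real"
 assumes f: "integrable lebesgue f" and g: "integrable lebesgue g"
  and le: "!!s t. a <= s ==> s <= t ==> t <= b ==> (LINT x:{s..t}|lebesgue. f x) <= (LINT x:{s..t}|lebesgue. g x)"
 shows "AE t in lebesgue. t \<in> {a<..<b} --> f t <= g t"
 using lebesgue_differentiation[OF f] lebesgue_differentiation[OF g]
proof eventually_elim
 case (elim t)
 show ?case
 proof (rule impI, rule field_le_epsilon)
  fix e :: real assume t: "t \<in> {a<..<b}" and e: "0 < e"
  hence e2: "0 < e / 2" by simp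
  obtain d1 where d1: "d1 > 0" "!!u v. u <= t ==> t <= v ==> u < v ==> v - u < d1 ==>
   \<bar>(LINT x:{u..v}|lebesgue. f x) - f t * (v - u)\<bar> <= e / 2 * (v - u)" using elim(1) e2 by blast
  obtain d2 where d2: "d2 > 0" "!!u v. u <= t ==> t <= v ==> u < v ==> v - u < d2 ==>
   \<bar>(LINT x:{u..v}|lebesgue. g x) - g t * (v - u)\<bar> <= e / 2 * (v - u)" using elim(2) e2 by blast
  define v where "v = t + min (min d1 d2 / 2) (b - t)"
  have v: "t < v" "v - t < d1" "v - t < d2" "v <= b" using d1(1) d2(1) t by (auto simp: v_def min_def)
  have "f t * (v - t) <= (LINT x:{t..v}|lebesgue. f x) + e / 2 * (v - t)"
   using d1(2)[OF order_refl less_imp_le[OF v(1)] v(1,2)] unfolding abs_le_iff by linarith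
  also have "\<dots> <= (LINT x:{t..v}|lebesgue. g x) + e / 2 * (v - t)" using le[of t v] t v by simp
  also have "\<dots> <= g t * (v - t) + e / 2 * (v - t) + e / 2 * (v - t)"
   using d2(2)[OF order_refl less_imp_le[OF v(1)] v(1,3)] unfolding abs_le_iff by linarith
  also have "\<dots> = (g t + e) * (v - t)" by (simp add: algebra_simps)
  finally show "f t <= g t + e" using v(1) by (simp add: mult_le_cancel_right)
 qed
qed

section \<open>Metric derivatives\<close>

context ac_curve
begin

text \<open>
 The metric derivative is the supremum of the derivatives of the distances to the points
 of a countable dense subset of the curve.
\<close>
lemma metric_derivative:
 obtains G where "integrable lebesgue G" "!!x. 0 <= G x"
  "!!s t. a <= s ==> s <= t ==> t <= b ==> d (\<gamma> s) (\<gamma> t) <= (LINT x:{s..t}|lebesgue. G x)"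
  "AE t in lebesgue. t \<in> {a<..<b} --> ((%s. d (\<gamma> s) (\<gamma> t) / \<bar>s - t\<bar>) \<longlongrightarrow> G t) (at t within {a..b})"
  "!!p K. 1 < p ==> (!!n. (\<Sum>i<2 ^ n. D n i powr p) <= K * \<delta> n powr (p - 1)) ==>
    (\<integral>\<^sup>+ x. ennreal (G x powr p) \<partial>lebesgue) <= ennreal K"
proof -
 \<comment> \<open>The values of the curve at all dyadic nodes; the minimum keeps the index in range
   for every code k.\<close>
 define P where "P k = \<gamma> (\<tau> (fst (prod_decode k)) (min (snd (prod_decode k)) (2 ^ fst (prod_decode k))))" for k
 have PZ: "P k \<in> Z" for k unfolding P_def by (rule \<gamma>_\<tau>_in) simp
 have Pd: "EX k. d (\<gamma> t) (P k) < e" if t: "t \<in> {a..b}" and e: "0 < e" for t e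
 proof -
  have "(%n. d (\<gamma> (\<tau> n (\<phi> n t))) (\<gamma> t)) \<longlonglongrightarrow> 0"
   by (rule \<gamma>_seq[OF t \<tau>_in[OF \<phi>_bounds(3)[OF t]] \<tau>_\<phi>_tendsto[OF t]])
  hence "\<forall>\<^sub>F n in sequentially. d (\<gamma> (\<tau> n (\<phi> n t))) (\<gamma> t) < e" using e by (rule order_tendstoD(2))
  then obtain n where n: "d (\<gamma> (\<tau> n (\<phi> n t))) (\<gamma> t) < e" by (auto simp: eventually_sequentially)
  have "P (prod_encode (n, \<phi> n t)) = \<gamma> (\<tau> n (\<phi> n t))" using \<phi>_bounds(3)[OF t, of n] by (simp add: P_def min_def)
  hence "d (\<gamma> t) (P (prod_encode (n, \<phi> n t))) < e" using n by (simp add: commute[of "\<gamma> t"])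
  thus ?thesis by blast
 qed
 define w where "w k t = d (\<gamma> t) (P k)" for k t
 have wd: "\<bar>w k t - w k s\<bar> <= d (\<gamma> s) (\<gamma> t)" if "s \<in> {a..b}" "t \<in> {a..b}" for k s t
  using mdist_reverse_triangle[of "\<gamma> t" "P k" "\<gamma> s"] \<gamma>_in[OF that(1)] \<gamma>_in[OF that(2)] PZ[of k]
  unfolding w_def by (simp add: commute)
 have wv: "\<bar>w k t - w k s\<bar> <= v t - v s" if "a <= s" "s <= t" "t <= b" for k s t
  using wd[of s t k] dist_le_v[OF that] that by simp
 obtain g0 where g0: "integrable lebesgue g0" "!!x. 0 <= g0 x"
  "!!s t. a <= s ==> s <= t ==> t <= b ==> (LINT x:{s..t}|lebesgue. g0 x) = v t - v s"
  by (rule density_if_dominated_by_v[of v, OF v_mono]) (use v_mono in force)+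
 \<comment> \<open>The distance \<open>w k\<close> to a fixed point is not monotone, but v + w k is,
   with increments at most twice those of v. Its density minus that of v represents the increments
   of w k.\<close>
 have "ALL k. EX h. integrable lebesgue h & (ALL s t. a <= s --> s <= t --> t <= b -->
   (LINT x:{s..t}|lebesgue. h x) = (v t + w k t) - (v s + w k s))"
 proof
  fix k
  show "EX h. integrable lebesgue h & (ALL s t. a <= s --> s <= t --> t <= b -->
   (LINT x:{s..t}|lebesgue. h x) = (v t + w k t) - (v s + w k s))"
  proof (rule density_if_dominated_by_v[of "%t. v t + w k t"])
   show "v s + w k s <= v t + w k t" "v t + w k t - (v s + w k s) <= 2 * (v t - v s)"
    if "a <= s" "s <= t" "t <= b" for s t using wv[OF that, of k] by (simp_all add: abs_le_iff)
  qed blast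
 qed
 from choice[OF this] obtain h where "ALL k. integrable lebesgue (h k) & (ALL s t. a <= s --> s <= t --> t <= b -->
   (LINT x:{s..t}|lebesgue. h k x) = (v t + w k t) - (v s + w k s))" by (elim exE)
 hence h: "integrable lebesgue (h k)"
  "a <= s ==> s <= t ==> t <= b ==> (LINT x:{s..t}|lebesgue. h k x) = (v t + w k t) - (v s + w k s)" for k s t by auto
 define f where "f k x = h k x - g0 x" for k x
 have fi: "integrable lebesgue (f k)" for k unfolding f_def using h(1) g0(1) by (rule Bochner_Integration.integrable_diff)
 have fI: "(LINT x:{s..t}|lebesgue. f k x) = w k t - w k s" if "a <= s" "s <= t" "t <= b" for k s t
  unfolding f_def using set_integral_diff(2)[OF set_integrable_interval[OF h(1)] set_integrable_interval[OF g0(1)], of s t k]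
   h(2)[OF that, of k] g0(3)[OF that] by simp
 have fneg: "(LINT x:{s..t}|lebesgue. - f k x) = - (LINT x:{s..t}|lebesgue. f k x)" for k s t
  by (simp add: set_lebesgue_integral_def)
 have fle: "AE t in lebesgue. t \<in> {a<..<b} --> \<bar>f k t\<bar> <= g0 t" for k
 proof -
  have "AE t in lebesgue. t \<in> {a<..<b} --> f k t <= g0 t"
  proof (rule averages_le_AE[OF fi g0(1)])
   fix s t assume st: "a <= s" "s <= t" "t <= b"
   show "(LINT x:{s..t}|lebesgue. f k x) <= (LINT x:{s..t}|lebesgue. g0 x)"
    unfolding fI[OF st] g0(3)[OF st] using wv[OF st, of k] by (simp add: abs_le_iff)
  qed
  moreover have "AE t in lebesgue. t \<in> {a<..<b} --> - f k t <= g0 t"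
  proof (rule averages_le_AE[OF _ g0(1)])
   show "integrable lebesgue (%t. - f k t)" using fi by simp
   fix s t assume st: "a <= s" "s <= t" "t <= b"
   show "(LINT x:{s..t}|lebesgue. - f k x) <= (LINT x:{s..t}|lebesgue. g0 x)"
    unfolding fneg fI[OF st] g0(3)[OF st] using wv[OF st, of k] by (simp add: abs_le_iff)
  qed
  ultimately show ?thesis by eventually_elim (auto simp: abs_le_iff)
 qed
 \<comment> \<open>Almost everywhere in the interval the supremum is at most the density g0 of v,
   hence finite, and \<open>enn2real\<close> loses nothing there.\<close>
 define G where "G x = indicator {a<..<b} x * enn2real (SUP k. ennreal \<bar>f k x\<bar>)" for x
 have [measurable]: "f k \<in> borel_measurable lebesgue" for k using fi[of k] by simp
 have [measurable]: "{a<..<b} \<in> sets lebesgue" by simp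
 have Gm [measurable]: "G \<in> borel_measurable lebesgue" unfolding G_def by measurable
 have G0: "0 <= G x" for x by (simp add: G_def)
 have good: "AE t in lebesgue. t \<in> {a<..<b} --> (ALL k. \<bar>f k t\<bar> <= G t) & G t <= g0 t & (\<forall>c<G t. EX k. c < \<bar>f k t\<bar>)"
 proof -
  have "AE t in lebesgue. ALL k. t \<in> {a<..<b} --> \<bar>f k t\<bar> <= g0 t" by (intro AE_all_countable[THEN iffD2] allI fle)
  thus ?thesis
  proof eventually_elim
   case (elim t)
   show ?case
   proof
    assume t: "t \<in> {a<..<b}"
    let ?S = "SUP k. ennreal \<bar>f k t\<bar>"
    have "?S <= ennreal (g0 t)" using elim t by (intro SUP_least ennreal_leI) auto
    hence fin: "?S < top" by (rule order.strict_trans1) simp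
    have Gt: "G t = enn2real ?S" "ennreal (G t) = ?S" using t fin by (auto simp: G_def)
    have "\<bar>f k t\<bar> <= G t" for k
    proof -
     have "ennreal \<bar>f k t\<bar> <= ennreal (G t)" unfolding Gt(2) by (rule SUP_upper) simp
     thus ?thesis using G0[of t] by simp
    qed
    moreover have "G t <= g0 t"
    proof -
     have "ennreal (G t) <= ennreal (g0 t)" unfolding Gt(2) by fact
     thus ?thesis using g0(2)[of t] by simp
    qed
    moreover have "EX k. c < \<bar>f k t\<bar>" if c: "c < G t" for c
    proof (cases "c < 0")
     case True
     thus ?thesis by (intro exI[of _ 0]) (rule less_le_trans, auto)
    next
     case False
     hence "ennreal c < ?S" unfolding Gt(2)[symmetric] using c by (simp add: ennreal_less_iff)
     then obtain k where "ennreal c < ennreal \<bar>f k t\<bar>" unfolding less_SUP_iff by blast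
     thus ?thesis using False by (auto simp: ennreal_less_iff)
    qed
    ultimately show "(ALL k. \<bar>f k t\<bar> <= G t) & G t <= g0 t & (\<forall>c<G t. EX k. c < \<bar>f k t\<bar>)" by blast
   qed
  qed
 qed
 have Gi: "integrable lebesgue G"
 proof (rule Bochner_Integration.integrable_bound[OF g0(1) Gm])
  show "AE x in lebesgue. norm (G x) <= norm (g0 x)"
   using good
  proof eventually_elim
   case (elim x)
   thus ?case using G0[of x] g0(2)[of x] by (cases "x \<in> {a<..<b}") (auto simp: G_def)
  qed
 qed
 have sing: "AE x in lebesgue. x ~= c" for c :: real by (rule AE_completion[OF AE_lborel_singleton])
 \<comment> \<open>With P k close to \<gamma> s, the distance w k t is close to d(\<gamma> s,
   \<gamma> t) and w k s is close to 0; the total error is 2 * w k s.\<close>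
 have dG: "d (\<gamma> s) (\<gamma> t) <= (LINT x:{s..t}|lebesgue. G x)" if st: "a <= s" "s <= t" "t <= b" for s t
 proof (rule field_le_epsilon)
  fix e :: real assume "0 < e"
  hence e: "0 < e / 2" by simp
  have I: "s \<in> {a..b}" "t \<in> {a..b}" using st by auto
  obtain k where k: "w k s < e / 2" using Pd[OF I(1) e] by (auto simp: w_def)
  have "d (\<gamma> s) (\<gamma> t) <= w k s + w k t"
   unfolding w_def by (rule triangle'[OF \<gamma>_in[OF I(1)] PZ \<gamma>_in[OF I(2)]])
  moreover have "w k t - w k s <= (LINT x:{s..t}|lebesgue. G x)"
   unfolding fI[OF st, symmetric] set_lebesgue_integral_def
  proof (rule integral_mono_AE)
   show "integrable lebesgue (%x. indicator {s..t} x *\<^sub>R f k x)" "integrable lebesgue (%x. indicator {s..t} x *\<^sub>R G x)"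
    using set_integrable_interval[OF fi[of k]] set_integrable_interval[OF Gi] by (simp_all add: set_integrable_def)
   show "AE x in lebesgue. indicator {s..t} x *\<^sub>R f k x <= indicator {s..t} x *\<^sub>R G x"
    using good sing[of a] sing[of b]
   proof eventually_elim
    case (elim x)
    show ?case
    proof (cases "x \<in> {s..t}")
     case True
     hence "x \<in> {a<..<b}" using elim(2,3) st by auto
     hence "\<bar>f k x\<bar> <= G x" using elim(1) by blast
     thus ?thesis using True by (simp add: abs_le_iff)
    qed simp
   qed
  qed
  ultimately show "d (\<gamma> s) (\<gamma> t) <= (LINT x:{s..t}|lebesgue. G x) + e" using k by linarith
 qed
 have LDf: "AE t in lebesgue. ALL k. \<forall>e>0. \<exists>d>0. ALL u v. u <= t --> t <= v --> u < v --> v - u < d -->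
   \<bar>(LINT x:{u..v}|lebesgue. f k x) - f k t * (v - u)\<bar> <= e * (v - u)"
  by (intro AE_all_countable[THEN iffD2] allI) (rule lebesgue_differentiation[OF fi])
 have lim: "AE t in lebesgue. t \<in> {a<..<b} --> ((%s. d (\<gamma> s) (\<gamma> t) / \<bar>s - t\<bar>) \<longlongrightarrow> G t) (at t within {a..b})"
  using good LDf lebesgue_differentiation[OF Gi]
 proof eventually_elim
  case (elim t)
  show ?case
  proof
   assume t: "t \<in> {a<..<b}"
   have k1: "!!c. c < G t ==> EX k. c < \<bar>f k t\<bar>" using elim(1) t by blast
   show "((%s. d (\<gamma> s) (\<gamma> t) / \<bar>s - t\<bar>) \<longlongrightarrow> G t) (at t within {a..b})"
   proof (rule tendstoI)
    fix e :: real assume e: "0 < e"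
    hence e3: "0 < e / 3" "G t - e / 3 < G t" by auto
    obtain k where k: "G t - e / 3 < \<bar>f k t\<bar>" using k1[OF e3(2)] by blast
    obtain d1 where d1: "d1 > 0" "!!u v. u <= t ==> t <= v ==> u < v ==> v - u < d1 ==>
     \<bar>(LINT x:{u..v}|lebesgue. f k x) - f k t * (v - u)\<bar> <= e / 3 * (v - u)" using elim(2) e3(1) by blast
    obtain d2 where d2: "d2 > 0" "!!u v. u <= t ==> t <= v ==> u < v ==> v - u < d2 ==>
     \<bar>(LINT x:{u..v}|lebesgue. G x) - G t * (v - u)\<bar> <= e / 3 * (v - u)" using elim(3) e3(1) by blast
    \<comment> \<open>The quotient over an interval around t is bounded above by the average of G,
      through \<open>dG\<close>, and below by the average of f k, since w k is 1-Lipschitz along the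
      curve. Both averages converge at t, and f k nearly attains G there.\<close>
    have main: "dist (d (\<gamma> u) (\<gamma> v) / (v - u)) (G t) < e"
     if uv: "a <= u" "v <= b" "u <= t" "t <= v" "u < v" "v - u < d1" "v - u < d2" for u v
    proof -
     have uv': "u <= v" "0 < v - u" using uv(5) by auto
     have "d (\<gamma> u) (\<gamma> v) <= (LINT x:{u..v}|lebesgue. G x)" by (rule dG[OF uv(1) uv'(1) uv(2)])
     also have "\<dots> <= G t * (v - u) + e / 3 * (v - u)" using d2(2)[OF uv(3,4,5,7)] unfolding abs_le_iff by linarith
     finally have 1: "d (\<gamma> u) (\<gamma> v) / (v - u) <= G t + e / 3"
      using uv'(2) by (simp add: pos_divide_le_eq distrib_right)
     have "\<bar>f k t\<bar> * (v - u) = \<bar>f k t * (v - u)\<bar>" using uv'(2) by (simp add: abs_mult)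
     also have "\<dots> <= \<bar>LINT x:{u..v}|lebesgue. f k x\<bar> + e / 3 * (v - u)" using d1(2)[OF uv(3,4,5,6)] by linarith
     also have "\<bar>LINT x:{u..v}|lebesgue. f k x\<bar> <= d (\<gamma> u) (\<gamma> v)"
      unfolding fI[OF uv(1) uv'(1) uv(2)] using uv by (intro wd) auto
     finally have "(\<bar>f k t\<bar> - e / 3) * (v - u) <= d (\<gamma> u) (\<gamma> v)" by (simp add: left_diff_distrib)
     hence 2: "\<bar>f k t\<bar> - e / 3 <= d (\<gamma> u) (\<gamma> v) / (v - u)" using uv'(2) by (simp add: pos_le_divide_eq)
     show ?thesis using 1 2 k e unfolding dist_real_def by linarith
    qed
    show "\<forall>\<^sub>F s in at t within {a..b}. dist (d (\<gamma> s) (\<gamma> t) / \<bar>s - t\<bar>) (G t) < e"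
     unfolding eventually_at
    proof (intro exI[of _ "min d1 d2"] conjI ballI impI)
     show "0 < min d1 d2" using d1 d2 by simp
     fix s assume s: "s \<in> {a..b}" "s ~= t & dist s t < min d1 d2"
     show "dist (d (\<gamma> s) (\<gamma> t) / \<bar>s - t\<bar>) (G t) < e"
     proof (cases "s < t")
      case True
      thus ?thesis using main[of s t] s t by (simp add: dist_real_def)
     next
      case False
      thus ?thesis using main[of t s] s t by (simp add: dist_real_def commute[of "\<gamma> s"])
     qed
    qed
   qed
  qed
 qed
 have energy: "(\<integral>\<^sup>+ x. ennreal (G x powr p) \<partial>lebesgue) <= ennreal K"
  if p: "1 < p" and K: "!!n. (\<Sum>i<2 ^ n. D n i powr p) <= K * \<delta> n powr (p - 1)" for p K
 proof -
  \<comment> \<open>The p-th power of the difference quotient over the cell of level n containing t.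
    Its integral is at most K, and its lower limit dominates G^p almost everywhere, so Fatou's lemma
    yields the bound.\<close>
  define Q where "Q n t = (\<Sum>i<2 ^ n. ennreal ((D n i / \<delta> n) powr p) * indicator {\<tau> n i..<\<tau> n (Suc i)} t)" for n t
  have [measurable]: "Q n \<in> borel_measurable lebesgue" for n
  proof -
   have [measurable]: "{\<tau> n i..<\<tau> n (Suc i)} \<in> sets lebesgue" for i by simp
   show ?thesis unfolding Q_def by measurable
  qed
  have QK: "(\<integral>\<^sup>+ t. Q n t \<partial>lebesgue) <= ennreal K" for n
  proof -
   have cell: "{\<tau> n i..<\<tau> n (Suc i)} \<in> sets lebesgue" "emeasure lebesgue {\<tau> n i..<\<tau> n (Suc i)} = ennreal (\<delta> n)" for i
    by (simp_all add: \<tau>_Suc)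
   note [measurable] = cell(1)
   have "(\<integral>\<^sup>+ t. Q n t \<partial>lebesgue) =
    (\<Sum>i<2 ^ n. \<integral>\<^sup>+ t. ennreal ((D n i / \<delta> n) powr p) * indicator {\<tau> n i..<\<tau> n (Suc i)} t \<partial>lebesgue)"
    unfolding Q_def by (rule nn_integral_sum) measurable
   also have "\<dots> = (\<Sum>i<2 ^ n. ennreal ((D n i / \<delta> n) powr p) * ennreal (\<delta> n))"
    by (intro sum.cong refl) (simp only: nn_integral_cmult_indicator[OF cell(1)] cell(2))
   also have "\<dots> = ennreal (\<Sum>i<2 ^ n. (D n i / \<delta> n) powr p * \<delta> n)"
    by (subst sum_ennreal[symmetric]) (auto simp: ennreal_mult)
   also have "(\<Sum>i<2 ^ n. (D n i / \<delta> n) powr p * \<delta> n) = (\<Sum>i<2 ^ n. D n i powr p) / \<delta> n powr (p - 1)"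
    unfolding sum_divide_distrib
   proof (rule sum.cong[OF refl])
    fix i
    have "\<delta> n powr p = \<delta> n powr (p - 1) * \<delta> n" by (simp add: powr_diff)
    thus "(D n i / \<delta> n) powr p * \<delta> n = D n i powr p / \<delta> n powr (p - 1)"
     by (simp add: powr_divide)
   qed
   also have "\<dots> <= K"
   proof -
    have "0 < \<delta> n powr (p - 1)" using less_imp_neq[OF \<delta>_pos[of n]] by simp
    thus ?thesis using K[of n] by (simp only: pos_divide_le_eq)
   qed
   finally show ?thesis by (simp add: ennreal_leI)
  qed
  have "AE t in lebesgue. ennreal (G t powr p) <= liminf (%n. Q n t)"
   using good LDf
  proof eventually_elim
   case (elim t)
   show ?case
   proof (cases "t \<in> {a<..<b} & G t ~= 0")
    case False
    hence "G t = 0" by (auto simp: G_def)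
    thus ?thesis by simp
   next
    case True
    hence t: "t \<in> {a<..<b}" and tI: "t \<in> {a..b}" "t \<in> {a..<b}" and Gt: "0 < G t" using G0[of t] by auto
    have k1: "!!c. c < G t ==> EX k. c < \<bar>f k t\<bar>" using elim(1) t by blast
    have low: "ennreal (c powr p) <= liminf (%n. Q n t)" if c: "0 <= c" "c < G t" for c
    proof (rule Liminf_bounded)
     obtain k where k: "c < \<bar>f k t\<bar>" using k1[OF c(2)] by blast
     define e where "e = \<bar>f k t\<bar> - c"
     have e: "0 < e" using k by (simp add: e_def)
     obtain d1 where d1: "d1 > 0" "!!u v. u <= t ==> t <= v ==> u < v ==> v - u < d1 ==>
      \<bar>(LINT x:{u..v}|lebesgue. f k x) - f k t * (v - u)\<bar> <= e * (v - u)" using elim(2) e by blast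
     have "\<forall>\<^sub>F n in sequentially. \<delta> n < d1" using \<delta>_tendsto d1(1) by (rule order_tendstoD(2))
     thus "\<forall>\<^sub>F n in sequentially. ennreal (c powr p) <= Q n t"
     proof eventually_elim
      case (elim n)
      let ?i = "\<phi> n t"
      let ?u = "\<tau> n ?i" and ?v = "\<tau> n (Suc ?i)"
      have i: "?i < 2 ^ n" by (rule \<phi>_less[OF tI(2)])
      have uv: "?u <= t" "t <= ?v" "t < ?v" "?u < ?v" "?v - ?u < d1" "?v - ?u = \<delta> n"
       using \<phi>_bounds(1,2)[OF tI(1), of n] elim by (auto simp: \<tau>_Suc)
      have I: "?u \<in> {a..b}" "?v \<in> {a..b}" using i \<tau>_in[of ?i n] \<tau>_in[of "Suc ?i" n] by auto
      have "\<bar>f k t\<bar> * \<delta> n = \<bar>f k t * (?v - ?u)\<bar>" by (simp add: abs_mult uv(6))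
      also have "\<dots> <= \<bar>LINT x:{?u..?v}|lebesgue. f k x\<bar> + e * \<delta> n"
       using d1(2)[OF uv(1,2,4,5)] unfolding uv(6) by linarith
      also have "\<bar>LINT x:{?u..?v}|lebesgue. f k x\<bar> <= D n ?i"
       unfolding D_def using I uv(4) wd[OF I, of k] by (subst fI) auto
      finally have "c * \<delta> n <= D n ?i" by (simp add: e_def left_diff_distrib)
      hence "c <= D n ?i / \<delta> n" by (simp add: pos_le_divide_eq)
      hence "c powr p <= (D n ?i / \<delta> n) powr p" using c p by (intro powr_mono2) auto
      hence "ennreal (c powr p) <= ennreal ((D n ?i / \<delta> n) powr p) * indicator {?u..<?v} t"
       using uv by (simp add: ennreal_leI)
      also have "\<dots> <= Q n t" unfolding Q_def using i
       by (intro member_le_sum[of ?i "{..<2 ^ n}" "%i. ennreal ((D n i / \<delta> n) powr p) * indicator {\<tau> n i..<\<tau> n (Suc i)} t"]) auto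
      finally show ?case .
     qed
    qed
    \<comment> \<open>The supremum that defines G need not be attained, so G t is approached by
      strictly smaller constants.\<close>
    have "(%j. G t * (1 - inverse (real (Suc j)))) \<longlonglongrightarrow> G t * (1 - 0)"
     by (intro tendsto_intros LIMSEQ_inverse_real_of_nat)
    hence "(%j. (G t * (1 - inverse (real (Suc j)))) powr p) \<longlonglongrightarrow> G t powr p"
     using Gt by (intro tendsto_powr) auto
    hence "(%j. ennreal ((G t * (1 - inverse (real (Suc j)))) powr p)) \<longlonglongrightarrow> ennreal (G t powr p)"
     by (rule tendsto_ennrealI)
    thus ?thesis
    proof (rule LIMSEQ_le_const2, intro exI[of _ 0] allI impI)
     fix j :: nat
     have "inverse (real (Suc j)) <= 1" "0 < inverse (real (Suc j))" by (auto simp: inverse_le_1_iff)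
     hence "0 <= G t * (1 - inverse (real (Suc j)))" "G t * (1 - inverse (real (Suc j))) < G t * 1"
      using Gt by (auto intro!: mult_nonneg_nonneg mult_strict_left_mono simp del: mult_1_right)
     thus "ennreal ((G t * (1 - inverse (real (Suc j)))) powr p) <= liminf (%n. Q n t)" by (intro low) auto
    qed
   qed
  qed
  hence "(\<integral>\<^sup>+ t. ennreal (G t powr p) \<partial>lebesgue) <= (\<integral>\<^sup>+ t. liminf (%n. Q n t) \<partial>lebesgue)"
   by (rule nn_integral_mono_AE)
  also have "\<dots> <= liminf (%n. \<integral>\<^sup>+ t. Q n t \<partial>lebesgue)" by (rule nn_integral_liminf) measurable
  also have "\<dots> <= ennreal K" using QK by (intro Liminf_le) auto
  finally show ?thesis .
 qed
 show ?thesis by (rule that[OF Gi G0 dG lim energy])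
qed

end

section \<open>Curves of finite energy\<close>

text \<open>Young's inequality at A = V / W gives p A^(p-1) g <= g^p w^(1-p) + (p-1) A^p w
  pointwise; after integration this choice of A turns it into the assertion. The weight 1 gives
  Jensen's inequality on a cell, and a weight adapted to the energy gives Minkowski's integral
  inequality.\<close>

lemma nn_integral_Jensen_weighted:
 fixes g w :: "'y => real"
 assumes p: "1 < p" and g [measurable]: "g \<in> borel_measurable Y" and w [measurable]: "w \<in> borel_measurable Y"
  and g0: "!!y. 0 <= g y" and w0: "!!y. y \<in> space Y ==> 0 < w y"
  and W: "(\<integral>\<^sup>+ y. ennreal (w y) \<partial>Y) = ennreal W" "0 <= W"
  and V: "(\<integral>\<^sup>+ y. ennreal (g y) \<partial>Y) = ennreal V" "0 <= V"
 shows "ennreal (V powr p) <= ennreal (W powr (p - 1)) * (\<integral>\<^sup>+ y. ennreal (g y powr p * w y powr (1 - p)) \<partial>Y)"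
proof (cases "V = 0")
 case True thus ?thesis by simp
next
 case False
 hence V0: "0 < V" using V(2) by simp
 have "W ~= 0"
 proof
  assume "W = 0"
  hence "(\<integral>\<^sup>+ y. ennreal (w y) \<partial>Y) = 0" using W(1) by simp
  hence "AE y in Y. ennreal (w y) = 0" by (subst (asm) nn_integral_0_iff_AE) auto
  with AE_space have "AE y in Y. False"
  proof eventually_elim
   case (elim y)
   thus False using w0[of y] by (simp add: ennreal_eq_0_iff)
  qed
  hence "(\<integral>\<^sup>+ y. ennreal (g y) \<partial>Y) = (\<integral>\<^sup>+ y. 0 \<partial>Y)" by (intro nn_integral_cong_AE) auto
  thus False using V V0 by simp
 qed
 hence W0: "0 < W" using W(2) by simp
 define A where "A = V / W"
 have A0: "0 < A" using V0 W0 by (simp add: A_def)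
 let ?r = "\<integral>\<^sup>+ y. ennreal (g y powr p * w y powr (1 - p)) \<partial>Y"
 have pt: "p * A powr (p - 1) * g y <= g y powr p * w y powr (1 - p) + (p - 1) * A powr p * w y" if y: "y \<in> space Y" for y
 proof -
  define x where "x = g y / w y"
  have wy: "0 < w y" by (rule w0[OF y])
  have x: "0 <= x" using g0[of y] wy by (simp add: x_def)
  have q: "p / (p - 1) > 1" "1 / p + 1 / (p / (p - 1)) = 1" using p by (auto simp: field_simps)
  have "x * A powr (p - 1) <= x powr p / p + (A powr (p - 1)) powr (p / (p - 1)) / (p / (p - 1))"
   by (rule Youngs_inequality[OF p q x]) simp
  also have "(A powr (p - 1)) powr (p / (p - 1)) = A powr p" using p by (simp add: powr_powr)
  finally have "p * (x * A powr (p - 1)) <= p * (x powr p / p + A powr p / (p / (p - 1)))"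
   using p by (intro mult_left_mono) auto
  also have "\<dots> = x powr p + (p - 1) * A powr p" using p by (simp add: field_simps)
  finally have "w y * (p * (x * A powr (p - 1))) <= w y * (x powr p + (p - 1) * A powr p)"
   using wy by (intro mult_left_mono) auto
  moreover have "w y * (p * (x * A powr (p - 1))) = p * A powr (p - 1) * g y" using wy by (simp add: x_def)
  moreover have "w y * (x powr p + (p - 1) * A powr p) = g y powr p * w y powr (1 - p) + (p - 1) * A powr p * w y"
   using wy by (simp add: x_def powr_divide powr_diff algebra_simps)
  ultimately show ?thesis by simp
 qed
 have "ennreal (p * A powr (p - 1)) * ennreal V = (\<integral>\<^sup>+ y. ennreal (p * A powr (p - 1)) * ennreal (g y) \<partial>Y)"
  by (subst nn_integral_cmult) (auto simp: V(1))
 also have "\<dots> <= (\<integral>\<^sup>+ y. ennreal (g y powr p * w y powr (1 - p)) + ennreal ((p - 1) * A powr p) * ennreal (w y) \<partial>Y)"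
  using pt p g0 less_imp_le[OF w0]
  by (intro nn_integral_mono) (simp add: ennreal_mult[symmetric] ennreal_plus[symmetric] ennreal_leI del: ennreal_plus)
 also have "\<dots> = ?r + ennreal ((p - 1) * A powr p) * ennreal W"
  by (subst nn_integral_add) (auto simp: nn_integral_cmult W(1))
 finally have main: "ennreal (p * A powr (p - 1)) * ennreal V <= ?r + ennreal ((p - 1) * A powr p) * ennreal W" .
 show ?thesis
 proof (cases "?r = \<infinity>")
  case True
  thus ?thesis using W0 by (simp add: ennreal_mult_top ennreal_mult_eq_top_iff)
 next
  case False
  then obtain r where r: "?r = ennreal r" "0 <= r" by (cases ?r) auto
  have "ennreal (p * A powr (p - 1) * V) <= ennreal (r + (p - 1) * A powr p * W)"
   using main r p V W by (simp add: ennreal_mult[symmetric] ennreal_plus[symmetric] del: ennreal_plus)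
  hence "p * A powr (p - 1) * V <= r + (p - 1) * A powr p * W"
   using r p W by (subst (asm) ennreal_le_iff) auto
  moreover have VAW: "V = A * W" using W0 by (simp add: A_def)
  moreover have "p * A powr (p - 1) * (A * W) = p * (A powr p * W)" using A0 by (simp add: powr_diff)
  ultimately have "p * (A powr p * W) <= r + (p - 1) * (A powr p * W)" by (metis mult.assoc)
  hence "A powr p * W <= r" by (simp add: left_diff_distrib)
  hence "W powr (p - 1) * (A powr p * W) <= W powr (p - 1) * r" by (intro mult_left_mono) auto
  moreover have "W powr (p - 1) * (A powr p * W) = V powr p"
   unfolding VAW using W0 A0 by (simp add: powr_mult powr_diff)
  ultimately have "V powr p <= W powr (p - 1) * r" by simp
  thus ?thesis unfolding r(1) using r(2) by (simp add: ennreal_mult[symmetric] ennreal_leI)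
 qed
qed

lemma (in metric_target) chain_le:
 assumes "!!k. k \<in> {i..j} ==> x k \<in> Z" "i <= j"
 shows "d (x i) (x j) <= (\<Sum>k\<in>{i..<j}. d (x k) (x (Suc k)))"
 using assms(2,1)
proof (induction j rule: dec_induct)
 case base thus ?case by simp
next
 case (step j)
 have "d (x i) (x (Suc j)) <= d (x i) (x j) + d (x j) (x (Suc j))"
  using step by (intro triangle step.prems) auto
 thus ?case using step by simp
qed

context dyadic_interval
begin

lemma small_of_energy:
 fixes x :: "nat => nat => real"
 assumes p: "1 < p" and x: "!!n i. 0 <= x n i" and K: "!!n. (\<Sum>i<2 ^ n. x n i powr p) <= K * \<delta> n powr (p - 1)" and e: "0 < e"
 shows "\<exists>\<theta>>0. ALL n J. J \<subseteq> {..<2 ^ n} --> (\<Sum>i\<in>J. x n i) <= \<theta> * (real (card J) * \<delta> n) + e"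
proof -
 obtain \<theta> where \<theta>: "0 < \<theta>" "\<theta> powr (1 - p) * K <= e" by (rule ex_theta_small[OF e p])
 have "(\<Sum>i\<in>J. x n i) <= \<theta> * (real (card J) * \<delta> n) + e" if J: "J \<subseteq> {..<2 ^ n}" for n J
 proof -
  have dp: "0 < \<delta> n powr (p - 1)" using less_imp_neq[OF \<delta>_pos[of n]] by simp
  have "(\<Sum>i\<in>J. x n i) <= (\<Sum>i\<in>J. \<theta> * \<delta> n + \<theta> powr (1 - p) * (x n i powr p / \<delta> n powr (p - 1)))"
   by (intro sum_mono le_theta_energy x \<delta>_pos \<theta>(1) p)
  also have "\<dots> = \<theta> * (real (card J) * \<delta> n) + \<theta> powr (1 - p) * ((\<Sum>i\<in>J. x n i powr p) / \<delta> n powr (p - 1))"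
   by (simp add: sum.distrib sum_distrib_left sum_divide_distrib)
  also have "(\<Sum>i\<in>J. x n i powr p) / \<delta> n powr (p - 1) <= K"
  proof -
   have "(\<Sum>i\<in>J. x n i powr p) <= (\<Sum>i<2 ^ n. x n i powr p)" using J by (intro sum_mono2) auto
   thus ?thesis using K[of n] dp by (simp add: pos_divide_le_eq)
  qed
  finally show ?thesis using \<theta>(2) by (smt (verit) mult_left_mono powr_ge_zero)
 qed
 thus ?thesis using \<theta>(1) by blast
qed

end

section \<open>Majorants and energies of absolutely continuous curves\<close>

locale ac_setting = Lp_target Z d p + dyadic_interval a b
 for Z :: "'z set" and d :: "'z => 'z => real" and p a b :: real
begin

text \<open>On the bounded interval f is at most 1 + f^p, because p > 1.\<close>

lemma integrable_if_powr:
 assumes [measurable]: "f \<in> borel_measurable lebesgue" and f0: "!!x. 0 <= f x" and supp: "!!x. x \<notin> {a..b} ==> f x = 0"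
  and fp: "(\<integral>\<^sup>+ x. ennreal (f x powr p) \<partial>lebesgue) < \<infinity>"
 shows "integrable lebesgue f"
proof -
 have "(\<integral>\<^sup>+ x. ennreal (f x) \<partial>lebesgue) <= (\<integral>\<^sup>+ x. indicator {a..b} x + ennreal (f x powr p) \<partial>lebesgue)"
 proof (rule nn_integral_mono)
  fix x
  have "f x <= indicator {a..b} x + f x powr p"
  proof (cases "f x <= 1")
   case True
   hence "f x <= indicator {a..b} x" using supp[of x] by (auto split: split_indicator)
   thus ?thesis using powr_ge_zero[of "f x" p] by linarith
  next
   case False
   hence "f x powr 1 <= f x powr p" using p_gt_1 by (intro powr_mono) auto
   thus ?thesis using False by (auto split: split_indicator)
  qed
  hence "ennreal (f x) <= ennreal (indicator {a..b} x + f x powr p)" by (rule ennreal_leI)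
  also have "\<dots> = indicator {a..b} x + ennreal (f x powr p)" by (simp add: ennreal_indicator)
  finally show "ennreal (f x) <= indicator {a..b} x + ennreal (f x powr p)" .
 qed
 also have "\<dots> = emeasure lebesgue {a..b} + (\<integral>\<^sup>+ x. ennreal (f x powr p) \<partial>lebesgue)"
  by (subst nn_integral_add) (auto intro!: borel_measurable_indicator)
 also have "\<dots> < \<infinity>" using fp less_imp_le[OF ab] by simp
 finally show "integrable lebesgue f" using f0 by (intro integrableI_nonneg) auto
qed

text \<open>The function in \<open>AC\<close> may change sign and is constrained on the interval
  only. Its absolute value, cut off outside, is still a majorant and is integrable on the
  line.\<close>

lemma AC_majorant:
 assumes c: "c \<in> AC {a..b} Z d p"
 obtains m where "integrable lebesgue m" "!!x. 0 <= m x" "(\<integral>\<^sup>+ x. ennreal (m x powr p) \<partial>lebesgue) < \<infinity>"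
  "!!s t. a <= s ==> s <= t ==> t <= b ==> d (c s) (c t) <= (LINT x:{s..t}|lebesgue. m x)"
proof -
 obtain m where m: "m \<in> borel_measurable (lebesgue_on {a..b})"
   "(\<integral>\<^sup>+ t. ennreal (\<bar>m t\<bar> powr p) \<partial>lebesgue_on {a..b}) < \<infinity>"
   "!!s t. s \<in> {a..b} ==> t \<in> {a..b} ==> s <= t ==> d (c s) (c t) <= (LINT r:{s..t}|lebesgue. m r)"
  using c unfolding AC_def by blast
 define f where "f x = indicator {a..b} x * \<bar>m x\<bar>" for x
 have [measurable]: "(%x. indicator {a..b} x *\<^sub>R m x) \<in> borel_measurable lebesgue"
  using m(1) by (subst (asm) borel_measurable_restrict_space_iff) auto
 have fm [measurable]: "f \<in> borel_measurable lebesgue"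
 proof -
  have eq: "f = (%x. \<bar>indicator {a..b} x *\<^sub>R m x\<bar>)" by (auto simp: f_def abs_mult)
  show ?thesis unfolding eq by measurable
 qed
 have f0: "0 <= f x" for x by (simp add: f_def)
 have "(\<integral>\<^sup>+ x. ennreal (f x powr p) \<partial>lebesgue) = (\<integral>\<^sup>+ t. ennreal (\<bar>m t\<bar> powr p) \<partial>lebesgue_on {a..b})"
  by (subst nn_integral_restrict_space) (auto intro!: nn_integral_cong simp: f_def split: split_indicator)
 hence fp: "(\<integral>\<^sup>+ x. ennreal (f x powr p) \<partial>lebesgue) < \<infinity>" using m(2) by simp
 have fi: "integrable lebesgue f" by (rule integrable_if_powr[OF fm f0 _ fp]) (simp add: f_def)
 have "d (c s) (c t) <= (LINT x:{s..t}|lebesgue. f x)" if st: "a <= s" "s <= t" "t <= b" for s t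
 proof -
  have "d (c s) (c t) <= (LINT r:{s..t}|lebesgue. m r)" using m(3)[of s t] st by auto
  also have "\<dots> <= (LINT r:{s..t}|lebesgue. f r)"
   unfolding set_lebesgue_integral_def
  proof (rule integral_mono')
   show "integrable lebesgue (%x. indicator {s..t} x *\<^sub>R f x)" by (rule integrable_mult_indicator[OF _ fi]) auto
   show "indicator {s..t} x *\<^sub>R m x <= indicator {s..t} x *\<^sub>R f x" for x using st by (auto simp: f_def split: split_indicator)
   show "0 <= indicator {s..t} x *\<^sub>R f x" for x using f0[of x] by simp
  qed
  finally show ?thesis .
 qed
 thus ?thesis using that[OF fi f0 fp] by blast
qed

lemma AC_I:
 assumes c: "c \<in> {a..b} \<rightarrow>\<^sub>E Z" and m: "integrable lebesgue m" "(\<integral>\<^sup>+ x. ennreal (\<bar>m x\<bar> powr p) \<partial>lebesgue) < \<infinity>"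
  "!!s t. a <= s ==> s <= t ==> t <= b ==> d (c s) (c t) <= (LINT x:{s..t}|lebesgue. m x)"
 shows "c \<in> AC {a..b} Z d p"
proof -
 have "(\<integral>\<^sup>+ t. ennreal (\<bar>m t\<bar> powr p) \<partial>lebesgue_on {a..b}) <= (\<integral>\<^sup>+ x. ennreal (\<bar>m x\<bar> powr p) \<partial>lebesgue)"
  by (subst nn_integral_restrict_space) (auto intro!: nn_integral_mono split: split_indicator)
 hence "(\<integral>\<^sup>+ t. ennreal (\<bar>m t\<bar> powr p) \<partial>lebesgue_on {a..b}) < \<infinity>" using m(2) by (rule order.strict_trans1)
 moreover have "m \<in> borel_measurable (lebesgue_on {a..b})" using m(1) by (intro measurable_restrict_space1) auto
 ultimately show ?thesis unfolding AC_def using c m(3) by auto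
qed

text \<open>Jensen's inequality with weight 1 on each cell. Cells open on the left are disjoint, so
  the integrals of m^p over them add up to at most K.\<close>

lemma majorant_energy:
 assumes m: "integrable lebesgue m" "!!x. 0 <= m x" "(\<integral>\<^sup>+ x. ennreal (m x powr p) \<partial>lebesgue) = ennreal K" "0 <= K"
 shows "(\<Sum>i<2 ^ n. (LINT x:{\<tau> n i..\<tau> n (Suc i)}|lebesgue. m x) powr p) <= K * \<delta> n powr (p - 1)"
proof -
 have mm [measurable]: "m \<in> borel_measurable lebesgue" using m(1) by simp
 let ?C = "%i. {\<tau> n i<..\<tau> n (Suc i)}"
 let ?m = "%i. LINT x:{\<tau> n i..\<tau> n (Suc i)}|lebesgue. m x"
 have cell: "ennreal (?m i powr p) <= ennreal (\<delta> n powr (p - 1)) * (\<integral>\<^sup>+ x \<in> ?C i. ennreal (m x powr p) \<partial>lebesgue)" for i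
 proof -
  let ?Y = "lebesgue_on (?C i)"
  have C [measurable]: "?C i \<in> sets lebesgue" by simp
  have m0: "0 <= ?m i" unfolding set_lebesgue_integral_def using m(2) by (intro integral_nonneg_AE) auto
  have "(\<integral>\<^sup>+ x. ennreal (m x) \<partial>?Y) = (\<integral>\<^sup>+ x. ennreal (indicator {\<tau> n i..\<tau> n (Suc i)} x *\<^sub>R m x) \<partial>lebesgue)"
   using AE_completion[OF AE_lborel_singleton[of "\<tau> n i"]]
   by (subst nn_integral_restrict_space, simp)
    (intro nn_integral_cong_AE, auto elim!: eventually_mono split: split_indicator)
  also have "\<dots> = ennreal (?m i)"
   unfolding set_lebesgue_integral_def using m(2) integrable_mult_indicator[OF _ m(1), of "{\<tau> n i..\<tau> n (Suc i)}"]
   by (intro nn_integral_eq_integral) auto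
  finally have 1: "(\<integral>\<^sup>+ x. ennreal (m x) \<partial>?Y) = ennreal (?m i)" .
  have 2: "(\<integral>\<^sup>+ x. ennreal 1 \<partial>?Y) = ennreal (\<delta> n)"
   by (simp add: emeasure_restrict_space \<tau>_Suc)
  have mY: "m \<in> borel_measurable ?Y" by (intro measurable_restrict_space1 mm)
  from nn_integral_Jensen_weighted[OF p_gt_1 mY _ m(2) _ 2 _ 1 m0]
  have "ennreal (?m i powr p) <= ennreal (\<delta> n powr (p - 1)) * (\<integral>\<^sup>+ x. ennreal (m x powr p * 1 powr (1 - p)) \<partial>?Y)" by simp
  also have "(\<integral>\<^sup>+ x. ennreal (m x powr p * 1 powr (1 - p)) \<partial>?Y) = (\<integral>\<^sup>+ x \<in> ?C i. ennreal (m x powr p) \<partial>lebesgue)"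
   by (subst nn_integral_restrict_space) auto
  finally show ?thesis .
 qed
 have "ennreal (\<Sum>i<2 ^ n. ?m i powr p) = (\<Sum>i<2 ^ n. ennreal (?m i powr p))" by (rule sum_ennreal[symmetric]) simp
 also have "\<dots> <= (\<Sum>i<2 ^ n. ennreal (\<delta> n powr (p - 1)) * (\<integral>\<^sup>+ x \<in> ?C i. ennreal (m x powr p) \<partial>lebesgue))"
  by (intro sum_mono cell)
 also have "\<dots> = ennreal (\<delta> n powr (p - 1)) * (\<Sum>i<2 ^ n. emeasure (density lebesgue (%x. ennreal (m x powr p))) (?C i))"
  by (simp add: sum_distrib_left emeasure_density)
 also have "(\<Sum>i<2 ^ n. emeasure (density lebesgue (%x. ennreal (m x powr p))) (?C i)) =
   emeasure (density lebesgue (%x. ennreal (m x powr p))) (\<Union>i<2 ^ n. ?C i)"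
  using cells_disjoint by (intro sum_emeasure) auto
 also have "\<dots> <= emeasure (density lebesgue (%x. ennreal (m x powr p))) UNIV" by (intro emeasure_mono) auto
 also have "\<dots> = ennreal K" by (subst emeasure_density) (auto simp: m(3))
 finally have "ennreal (\<Sum>i<2 ^ n. ?m i powr p) <= ennreal (\<delta> n powr (p - 1)) * ennreal K"
  by (simp add: mult_left_mono)
 hence "ennreal (\<Sum>i<2 ^ n. ?m i powr p) <= ennreal (\<delta> n powr (p - 1) * K)" using m(4) by (simp add: ennreal_mult)
 thus ?thesis using m(4) by (subst (asm) ennreal_le_iff) (auto simp: mult.commute)
qed

lemma AC_small_dist:
 assumes m: "integrable lebesgue m" "!!s t. a <= s ==> s <= t ==> t <= b ==> d (c s) (c t) <= (LINT x:{s..t}|lebesgue. m x)"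
  and x: "!!n. x n \<in> {a..b}" "x \<longlonglongrightarrow> t" and t: "t \<in> {a..b}" and m0: "!!x. 0 <= m x"
 shows "(%n. d (c (x n)) (c t)) \<longlonglongrightarrow> 0"
proof -
 have "(%n. LINT y|lebesgue. indicator {min (x n) t..max (x n) t} y *\<^sub>R m y) \<longlonglongrightarrow> (LINT y|(lebesgue :: real measure). (0::real))"
 proof (rule Bochner_Integration.integral_dominated_convergence[where w = m and f = "%_. 0 :: real"
   and s = "%n y. indicator {min (x n) t..max (x n) t} y *\<^sub>R m y"])
  show "AE y in lebesgue. (%n. indicator {min (x n) t..max (x n) t} y *\<^sub>R m y) \<longlonglongrightarrow> 0"
   using AE_completion[OF AE_lborel_singleton[of t]]
  proof eventually_elim
   case (elim y)
   hence "0 < \<bar>y - t\<bar>" by simp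
   hence "\<forall>\<^sub>F n in sequentially. dist (x n) t < \<bar>y - t\<bar>" using x(2) by (rule tendstoD[rotated])
   hence "\<forall>\<^sub>F n in sequentially. indicator {min (x n) t..max (x n) t} y *\<^sub>R m y = 0"
    by eventually_elim (auto simp: dist_real_def split: split_indicator)
   thus ?case by (rule tendsto_eventually)
  qed
  show "AE y in lebesgue. norm (indicator {min (x n) t..max (x n) t} y *\<^sub>R m y) <= m y" for n
   using m0 by (intro AE_I2) (auto split: split_indicator)
  show "(%y. indicator {min (x n) t..max (x n) t} y *\<^sub>R m y) \<in> borel_measurable lebesgue" for n
   using integrable_mult_indicator[OF _ m(1), of "{min (x n) t..max (x n) t}"] by auto
 qed (use m in auto)
 hence l: "(%n. LINT y:{min (x n) t..max (x n) t}|lebesgue. m y) \<longlonglongrightarrow> 0" by (simp add: set_lebesgue_integral_def)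
 show ?thesis
 proof (rule Lim_null_comparison[OF _ l], rule always_eventually, rule allI)
  fix n
  have "d (c (x n)) (c t) <= (LINT y:{min (x n) t..max (x n) t}|lebesgue. m y)"
   using m(2)[of "x n" t] m(2)[of t "x n"] x(1)[of n] t by (cases "x n <= t") (auto simp: commute[of "c t"])
  thus "norm (d (c (x n)) (c t)) <= (LINT y:{min (x n) t..max (x n) t}|lebesgue. m y)" by simp
 qed
qed

lemma AC_ac_curve:
 assumes c: "c \<in> AC {a..b} Z d p"
 shows "ac_curve Z d a b c" and "\<exists>K\<ge>0. ALL n. (\<Sum>i<2 ^ n. d (c (\<tau> n i)) (c (\<tau> n (Suc i))) powr p) <= K * \<delta> n powr (p - 1)"
proof -
 obtain m where m: "integrable lebesgue m" "!!x. 0 <= m x" "(\<integral>\<^sup>+ x. ennreal (m x powr p) \<partial>lebesgue) < \<infinity>"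
  "!!s t. a <= s ==> s <= t ==> t <= b ==> d (c s) (c t) <= (LINT x:{s..t}|lebesgue. m x)"
  by (rule AC_majorant[OF c]) (rule that, assumption+)
 define K where "K = enn2real (\<integral>\<^sup>+ x. ennreal (m x powr p) \<partial>lebesgue)"
 have K: "(\<integral>\<^sup>+ x. ennreal (m x powr p) \<partial>lebesgue) = ennreal K" "0 <= K" using m(3) by (auto simp: K_def)
 have E: "(\<Sum>i<2 ^ n. d (c (\<tau> n i)) (c (\<tau> n (Suc i))) powr p) <= K * \<delta> n powr (p - 1)" for n
 proof -
  have "(\<Sum>i<2 ^ n. d (c (\<tau> n i)) (c (\<tau> n (Suc i))) powr p) <= (\<Sum>i<2 ^ n. (LINT x:{\<tau> n i..\<tau> n (Suc i)}|lebesgue. m x) powr p)"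
  proof (intro sum_mono powr_mono2)
   fix i assume "i \<in> {..<2 ^ n :: nat}"
   thus "d (c (\<tau> n i)) (c (\<tau> n (Suc i))) <= (LINT x:{\<tau> n i..\<tau> n (Suc i)}|lebesgue. m x)"
    using \<tau>_in[of i n] \<tau>_in[of "Suc i" n] \<tau>_mono[of i "Suc i" n] by (intro m(4)) auto
  qed (use p_gt_1 in auto)
  also have "\<dots> <= K * \<delta> n powr (p - 1)" by (rule majorant_energy[OF m(1,2) K])
  finally show ?thesis .
 qed
 thus "\<exists>K\<ge>0. ALL n. (\<Sum>i<2 ^ n. d (c (\<tau> n i)) (c (\<tau> n (Suc i))) powr p) <= K * \<delta> n powr (p - 1)" using K(2) by blast
 have inZ: "c t \<in> Z" if "t \<in> {a..b}" for t using c that by (auto simp: AC_def)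
 show "ac_curve Z d a b c"
 proof
  show "c t \<in> Z" if "t \<in> {a..b}" for t using inZ that .
  show "((%s. d (c s) (c t)) \<longlongrightarrow> 0) (at t within {a..b})" if t: "t \<in> {a..b}" for t
   unfolding tendsto_at_iff_sequentially
  proof (intro allI impI)
   fix x assume x: "ALL i. x i \<in> {a..b} - {t}" "x \<longlonglongrightarrow> t"
   show "((%s. d (c s) (c t)) \<circ> x) \<longlonglongrightarrow> 0"
    unfolding comp_def by (rule AC_small_dist[OF m(1,4) _ x(2) t m(2)]) (use x(1) in auto)
  qed
  show "\<exists>\<theta>>0. ALL n J. J \<subseteq> {..<2 ^ n} --> (\<Sum>i\<in>J. d (c (\<tau> n i)) (c (\<tau> n (Suc i)))) <= \<theta> * (real (card J) * \<delta> n) + e"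
   if "0 < e" for e
   by (rule small_of_energy[OF p_gt_1 _ E that]) simp
 qed
qed

lemma metric_deriv_eq:
 assumes "t \<in> {a<..<b}" "((%s. d (c s) (c t) / \<bar>s - t\<bar>) \<longlongrightarrow> g) (at t within {a..b})"
 shows "metric_deriv {a..b} d c t = g"
proof -
 have "at t within {a..b} = at t" using assms(1) by (intro at_within_interior) auto
 hence "at t within {a..b} ~= bot" by simp
 thus ?thesis unfolding metric_deriv_def using assms(2) by (intro tendsto_Lim)
qed

lemma metric_derivative_AC:
 assumes c: "ac_curve Z d a b c" and K: "!!n. (\<Sum>i<2 ^ n. d (c (\<tau> n i)) (c (\<tau> n (Suc i))) powr p) <= K * \<delta> n powr (p - 1)"
 obtains G where "integrable lebesgue G" "!!x. 0 <= G x" "(\<integral>\<^sup>+ x. ennreal (G x powr p) \<partial>lebesgue) < \<infinity>"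
  "!!s t. a <= s ==> s <= t ==> t <= b ==> d (c s) (c t) <= (LINT x:{s..t}|lebesgue. G x)"
  "AE t in lebesgue. t \<in> {a<..<b} --> ((%s. d (c s) (c t) / \<bar>s - t\<bar>) \<longlongrightarrow> G t) (at t within {a..b})"
proof -
 interpret c: ac_curve Z d a b c by fact
 show ?thesis
 proof (rule c.metric_derivative)
  fix G assume G: "integrable lebesgue G" "!!x. 0 <= G x"
   "!!s t. a <= s ==> s <= t ==> t <= b ==> d (c s) (c t) <= (LINT x:{s..t}|lebesgue. G x)"
   "AE t in lebesgue. t \<in> {a<..<b} --> ((%s. d (c s) (c t) / \<bar>s - t\<bar>) \<longlongrightarrow> G t) (at t within {a..b})"
   "!!p K. 1 < p ==> (!!n. (\<Sum>i<2 ^ n. c.D n i powr p) <= K * \<delta> n powr (p - 1)) ==>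
    (\<integral>\<^sup>+ x. ennreal (G x powr p) \<partial>lebesgue) <= ennreal K"
  have "(\<integral>\<^sup>+ x. ennreal (G x powr p) \<partial>lebesgue) <= ennreal K"
   by (rule G(5)[OF p_gt_1]) (use K in "simp add: c.D_def")
  hence "(\<integral>\<^sup>+ x. ennreal (G x powr p) \<partial>lebesgue) < \<infinity>" by (rule order.strict_trans1) simp
  from that[OF G(1,2) this G(3,4)] show thesis .
 qed
qed

text \<open>Minimality of the metric derivative among the majorants: difference quotients over
  intervals with endpoint t are bounded by averages of m, which converge to m t.\<close>

lemma metric_deriv_le:
 assumes m: "integrable lebesgue m" "!!s t. a <= s ==> s <= t ==> t <= b ==> d (c s) (c t) <= (LINT x:{s..t}|lebesgue. m x)"
  and G: "AE t in lebesgue. t \<in> {a<..<b} --> ((%s. d (c s) (c t) / \<bar>s - t\<bar>) \<longlongrightarrow> G t) (at t within {a..b})"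
 shows "AE t in lebesgue. t \<in> {a<..<b} --> G t <= m t"
 using G lebesgue_differentiation[OF m(1)]
proof eventually_elim
 case (elim t)
 show ?case
 proof (rule impI, rule field_le_epsilon)
  fix e :: real assume t: "t \<in> {a<..<b}" and e: "0 < e"
  obtain d1 where d1: "d1 > 0" "!!u v. u <= t ==> t <= v ==> u < v ==> v - u < d1 ==>
   \<bar>(LINT x:{u..v}|lebesgue. m x) - m t * (v - u)\<bar> <= e * (v - u)" using elim(2) e by blast
  have "at t within {a..b} = at t" using t by (intro at_within_interior) auto
  hence nb: "at t within {a..b} ~= bot" by simp
  have lim: "((%s. d (c s) (c t) / \<bar>s - t\<bar>) \<longlongrightarrow> G t) (at t within {a..b})" using elim(1) t by blast
  have main: "d (c u) (c v) / (v - u) <= m t + e" if uv: "a <= u" "v <= b" "u <= t" "t <= v" "u < v" "v - u < d1" for u v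
  proof -
   have "d (c u) (c v) <= (LINT x:{u..v}|lebesgue. m x)" using uv by (intro m(2)) auto
   also have "\<dots> <= (m t + e) * (v - u)" using d1(2)[OF uv(3-6)] unfolding abs_le_iff distrib_right by linarith
   finally show ?thesis using uv(5) by (simp add: pos_divide_le_eq)
  qed
  show "G t <= m t + e"
  proof (rule tendsto_upperbound[OF lim _ nb])
   show "\<forall>\<^sub>F s in at t within {a..b}. d (c s) (c t) / \<bar>s - t\<bar> <= m t + e"
    unfolding eventually_at
   proof (intro exI[of _ d1] conjI ballI impI d1(1))
    fix s assume s: "s \<in> {a..b}" "s ~= t & dist s t < d1"
    show "d (c s) (c t) / \<bar>s - t\<bar> <= m t + e"
    proof (cases "s < t")
     case True
     thus ?thesis using main[of s t] s t by (simp add: dist_real_def)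
    next
     case False
     thus ?thesis using main[of t s] s t by (simp add: dist_real_def commute[of "c s"])
    qed
   qed
  qed
 qed
qed

text \<open>Between two nodes of one level the distance is at most \<theta> times the time
  difference plus e. This makes the values at the last nodes before t a Cauchy sequence and provides
  the limit with a modulus of continuity; the error e is fixed first, then \<theta>, then the
  level.\<close>

lemma dyadic_extension:
 assumes compl: "mcomplete" and inZ: "!!n i. i <= 2 ^ n ==> \<gamma> (\<tau> n i) \<in> Z"
  and small: "!!e. 0 < e ==> \<exists>\<theta>>0. ALL n J. J \<subseteq> {..<2 ^ n} -->
    (\<Sum>i\<in>J. d (\<gamma> (\<tau> n i)) (\<gamma> (\<tau> n (Suc i)))) <= \<theta> * (real (card J) * \<delta> n) + e"
 obtains f where "f \<in> {a..b} \<rightarrow>\<^sub>E Z" "ac_curve Z d a b f" "!!n i. i <= 2 ^ n ==> f (\<tau> n i) = \<gamma> (\<tau> n i)"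
proof -
 let ?x = "%t n. \<gamma> (\<tau> n (\<phi> n t))"
 have xZ: "?x t n \<in> Z" if "t \<in> {a..b}" for t n by (rule inZ[OF \<phi>_bounds(3)[OF that]])
 have same: "d (\<gamma> (\<tau> n i)) (\<gamma> (\<tau> n j)) <= \<theta> * (\<tau> n j - \<tau> n i) + e"
  if \<theta>: "ALL n J. J \<subseteq> {..<2 ^ n} --> (\<Sum>i\<in>J. d (\<gamma> (\<tau> n i)) (\<gamma> (\<tau> n (Suc i)))) <= \<theta> * (real (card J) * \<delta> n) + e"
   and ij: "i <= j" "j <= 2 ^ n" for \<theta> e n i j
 proof -
  have "d (\<gamma> (\<tau> n i)) (\<gamma> (\<tau> n j)) <= (\<Sum>k\<in>{i..<j}. d (\<gamma> (\<tau> n k)) (\<gamma> (\<tau> n (Suc k))))"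
   using ij by (intro chain_le[of i j "%k. \<gamma> (\<tau> n k)"] inZ) auto
  also have "\<dots> <= \<theta> * (real (card {i..<j}) * \<delta> n) + e"
  proof -
   have "{i..<j} \<subseteq> {..<2 ^ n}" using ij by auto
   thus ?thesis using \<theta> by blast
  qed
  also have "real (card {i..<j}) * \<delta> n = \<tau> n j - \<tau> n i" using ij by (simp add: \<tau>_def of_nat_diff algebra_simps)
  finally show ?thesis .
 qed
 \<comment> \<open>A node of level n is also a node of level m >= n, so both points are compared
   within level m, and their times differ by at most one mesh width of level n.\<close>
 have levels: "d (?x t n) (?x t m) <= \<theta> * \<delta> n + e"
  if \<theta>: "ALL n J. J \<subseteq> {..<2 ^ n} --> (\<Sum>i\<in>J. d (\<gamma> (\<tau> n i)) (\<gamma> (\<tau> n (Suc i)))) <= \<theta> * (real (card J) * \<delta> n) + e"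
   and \<theta>0: "0 < \<theta>" and t: "t \<in> {a..b}" and nm: "n <= m" for \<theta> e t n m
 proof -
  define k where "k = m - n"
  have m: "m = n + k" using nm by (simp add: k_def)
  have e1: "\<tau> n (\<phi> n t) = \<tau> m (2 ^ k * \<phi> n t)" unfolding m by (rule \<tau>_refine)
  have "\<tau> m (2 ^ k * \<phi> n t) <= t" using \<phi>_bounds(1)[OF t, of n] e1 by simp
  from \<phi>_mono[OF this, of m] have le: "2 ^ k * \<phi> n t <= \<phi> m t" by simp
  have "d (?x t n) (?x t m) <= \<theta> * (\<tau> m (\<phi> m t) - \<tau> m (2 ^ k * \<phi> n t)) + e"
   unfolding e1 by (rule same[OF \<theta> le \<phi>_bounds(3)[OF t]])
  also have "\<tau> m (\<phi> m t) - \<tau> m (2 ^ k * \<phi> n t) <= \<delta> n"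
   using \<phi>_bounds(1)[OF t, of m] \<phi>_bounds(2)[OF t, of n] e1 by simp
  finally show ?thesis using \<theta>0 by (simp add: mult_left_mono)
 qed
 have lim: "EX l. l \<in> Z & (%n. d (?x t n) l) \<longlonglongrightarrow> 0" if t: "t \<in> {a..b}" for t
 proof -
  have "MCauchy (?x t)"
   unfolding MCauchy_def
  proof (intro conjI allI impI)
   show "range (?x t) \<subseteq> Z" using xZ[OF t] by auto
   fix e :: real assume e: "e > 0"
   hence "0 < e / 2" by simp
   from small[OF this] obtain \<theta> where \<theta>: "\<theta> > 0"
    "ALL n J. J \<subseteq> {..<2 ^ n} --> (\<Sum>i\<in>J. d (\<gamma> (\<tau> n i)) (\<gamma> (\<tau> n (Suc i)))) <= \<theta> * (real (card J) * \<delta> n) + e / 2" by blast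
   have "\<forall>\<^sub>F n in sequentially. \<delta> n < e / 2 / \<theta>" using \<delta>_tendsto e \<theta>(1) by (intro order_tendstoD(2)) auto
   then obtain N where N: "!!n. n \<ge> N ==> \<delta> n < e / 2 / \<theta>" by (auto simp: eventually_sequentially)
   have *: "d (?x t n) (?x t m) < e" if "N <= n" "n <= m" for n m
   proof -
    have "d (?x t n) (?x t m) <= \<theta> * \<delta> n + e / 2" by (rule levels[OF \<theta>(2,1) t that(2)])
    moreover have "\<theta> * \<delta> n < \<theta> * (e / 2 / \<theta>)" using N[OF that(1)] \<theta>(1) by (rule mult_strict_left_mono)
    moreover have "\<theta> * (e / 2 / \<theta>) = e / 2" using \<theta>(1) by simp
    ultimately show ?thesis by linarith
   qed
   show "EX N. ALL n n'. N <= n --> N <= n' --> d (?x t n) (?x t n') < e"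
   proof (intro exI[of _ N] allI impI)
    fix n n' assume "N <= n" "N <= n'"
    thus "d (?x t n) (?x t n') < e"
     using *[of n n'] *[of n' n] unfolding commute[of "?x t n'" "?x t n"] by (cases "n <= n'") simp_all
   qed
  qed
  with compl obtain l where l: "limitin mtopology (?x t) l sequentially" unfolding mcomplete_def by blast
  hence "l \<in> Z" using limitin_topspace[of mtopology] by simp
  moreover have "(%n. d (?x t n) l) \<longlonglongrightarrow> 0"
  proof (rule tendstoI)
   fix e :: real assume "e > 0"
   thus "\<forall>\<^sub>F n in sequentially. dist (d (?x t n) l) 0 < e"
    using l by (auto simp: limitin_metric elim: eventually_mono)
  qed
  ultimately show ?thesis by blast
 qed
 define f where "f = (\<lambda>t\<in>{a..b}. SOME l. l \<in> Z & (%n. d (?x t n) l) \<longlonglongrightarrow> 0)"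
 have f: "f t \<in> Z" "(%n. d (?x t n) (f t)) \<longlonglongrightarrow> 0" if "t \<in> {a..b}" for t
  using someI_ex[OF lim[OF that]] that by (auto simp: f_def)
 have fd: "f (\<tau> n i) = \<gamma> (\<tau> n i)" if i: "i <= 2 ^ n" for n i
 proof -
  have t: "\<tau> n i \<in> {a..b}" by (rule \<tau>_in[OF i])
  have "?x (\<tau> n i) (k + n) = \<gamma> (\<tau> n i)" for k
   using \<phi>_\<tau>[of "k + n" "2 ^ k * i"] \<tau>_refine[of n i k] by (simp add: add.commute)
  hence "(%k. d (\<gamma> (\<tau> n i)) (f (\<tau> n i))) \<longlonglongrightarrow> 0"
   using LIMSEQ_ignore_initial_segment[OF f(2)[OF t], of n] by simp
  hence "d (\<gamma> (\<tau> n i)) (f (\<tau> n i)) = 0" by (simp add: LIMSEQ_const_iff)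
  thus ?thesis using inZ[OF i] f(1)[OF t] by simp
 qed
 have mod: "d (f s) (f t) <= \<theta> * (t - s) + e"
  if \<theta>: "ALL n J. J \<subseteq> {..<2 ^ n} --> (\<Sum>i\<in>J. d (\<gamma> (\<tau> n i)) (\<gamma> (\<tau> n (Suc i)))) <= \<theta> * (real (card J) * \<delta> n) + e"
   and \<theta>0: "0 < \<theta>" and st: "a <= s" "s <= t" "t <= b" for \<theta> e s t
 proof -
  have I: "s \<in> {a..b}" "t \<in> {a..b}" using st by auto
  have "d (f s) (f t) <= \<theta> * (t - s + \<delta> n) + e + d (?x s n) (f s) + d (?x t n) (f t)" for n
  proof -
   have "d (?x s n) (?x t n) <= \<theta> * (\<tau> n (\<phi> n t) - \<tau> n (\<phi> n s)) + e"
    by (rule same[OF \<theta> \<phi>_mono[OF st(2)] \<phi>_bounds(3)[OF I(2)]])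
   also have "\<theta> * (\<tau> n (\<phi> n t) - \<tau> n (\<phi> n s)) <= \<theta> * (t - s + \<delta> n)"
    using \<phi>_bounds(1)[OF I(2), of n] \<phi>_bounds(2)[OF I(1), of n] \<theta>0 by (intro mult_left_mono) auto
   finally have 1: "d (?x s n) (?x t n) <= \<theta> * (t - s + \<delta> n) + e" by simp
   have 2: "d (f s) (f t) <= d (?x s n) (f s) + d (?x s n) (f t)" by (rule triangle''[OF f(1)[OF I(1)] xZ[OF I(1)] f(1)[OF I(2)]])
   have 3: "d (?x s n) (f t) <= d (?x s n) (?x t n) + d (?x t n) (f t)" by (rule triangle[OF xZ[OF I(1)] xZ[OF I(2)] f(1)[OF I(2)]])
   show ?thesis using 1 2 3 by linarith
  qed
  moreover have "(%n. \<theta> * (t - s + \<delta> n) + e + d (?x s n) (f s) + d (?x t n) (f t)) \<longlonglongrightarrow> \<theta> * (t - s + 0) + e + 0 + 0"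
   by (intro tendsto_add tendsto_mult tendsto_const \<delta>_tendsto f(2) I)
  ultimately have "d (f s) (f t) <= \<theta> * (t - s + 0) + e + 0 + 0"
   by (intro LIMSEQ_le_const[where X = "%n. \<theta> * (t - s + \<delta> n) + e + d (?x s n) (f s) + d (?x t n) (f t)"]) auto
  thus ?thesis by simp
 qed
 have ac: "ac_curve Z d a b f"
 proof
  show "f t \<in> Z" if "t \<in> {a..b}" for t using f(1)[OF that] .
  show "((%s. d (f s) (f t)) \<longlongrightarrow> 0) (at t within {a..b})" if t: "t \<in> {a..b}" for t
  proof (rule tendstoI)
   fix e :: real assume e: "0 < e"
   hence "0 < e / 2" by simp
   from small[OF this] obtain \<theta> where \<theta>: "\<theta> > 0"
    "ALL n J. J \<subseteq> {..<2 ^ n} --> (\<Sum>i\<in>J. d (\<gamma> (\<tau> n i)) (\<gamma> (\<tau> n (Suc i)))) <= \<theta> * (real (card J) * \<delta> n) + e / 2" by blast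
   have *: "d (f u) (f v) < e" if "a <= u" "u <= v" "v <= b" "v - u < e / 2 / \<theta>" for u v
   proof -
    have "d (f u) (f v) <= \<theta> * (v - u) + e / 2" by (rule mod[OF \<theta>(2,1) that(1-3)])
    moreover have "\<theta> * (v - u) < \<theta> * (e / 2 / \<theta>)" using that(4) \<theta>(1) by (rule mult_strict_left_mono)
    moreover have "\<theta> * (e / 2 / \<theta>) = e / 2" using \<theta>(1) by simp
    ultimately show ?thesis by linarith
   qed
   show "\<forall>\<^sub>F s in at t within {a..b}. dist (d (f s) (f t)) 0 < e"
    unfolding eventually_at
   proof (intro exI[of _ "e / 2 / \<theta>"] conjI ballI impI)
    show "0 < e / 2 / \<theta>" using e \<theta>(1) by simp
    fix s assume "s \<in> {a..b}" "s ~= t & dist s t < e / 2 / \<theta>"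
    thus "dist (d (f s) (f t)) 0 < e"
     using *[of s t] *[of t s] t commute[of "f s" "f t"] by (cases "s <= t") (auto simp: dist_real_def)
   qed
  qed
  show "\<exists>\<theta>>0. ALL n J. J \<subseteq> {..<2 ^ n} --> (\<Sum>i\<in>J. d (f (\<tau> n i)) (f (\<tau> n (Suc i)))) <= \<theta> * (real (card J) * \<delta> n) + e"
   if "0 < e" for e
  proof -
   have eq: "(\<Sum>i\<in>J. d (f (\<tau> n i)) (f (\<tau> n (Suc i)))) = (\<Sum>i\<in>J. d (\<gamma> (\<tau> n i)) (\<gamma> (\<tau> n (Suc i))))" if "J \<subseteq> {..<2 ^ n}" for n J
   proof (rule sum.cong[OF refl])
    fix i assume "i \<in> J"
    hence "i < 2 ^ n" using that by auto
    thus "d (f (\<tau> n i)) (f (\<tau> n (Suc i))) = d (\<gamma> (\<tau> n i)) (\<gamma> (\<tau> n (Suc i)))" using fd[of i n] fd[of "Suc i" n] by simp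
   qed
   show ?thesis using small[OF that] by (auto simp: eq)
  qed
 qed
 have "f \<in> {a..b} \<rightarrow>\<^sub>E Z" using f(1) by (auto simp: f_def)
 thus ?thesis using that ac fd by blast
qed

end

section \<open>The isometry onto curves of classes\<close>

context Lp_target
begin

lemma Lp_base_change:
 assumes "G \<in> Lp Y Z d p G'" "G' \<in> L0 Y Z d"
 shows "Lp Y Z d p G = Lp Y Z d p G'"
proof -
 have G: "G \<in> L0 Y Z d" using assms(1) by (rule Lp_in_L0)
 have fin: "int_dist_powr Y d p (rep Y Z d G) (rep Y Z d G') < \<infinity>" by (rule LpD(2)[OF assms])
 have fin': "int_dist_powr Y d p (rep Y Z d G') (rep Y Z d G) < \<infinity>" by (subst int_dist_powr_commute) (rule fin)
 have "int_dist_powr Y d p (rep Y Z d F) (rep Y Z d G) < \<infinity> \<longleftrightarrow> int_dist_powr Y d p (rep Y Z d F) (rep Y Z d G') < \<infinity>"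
  if "F \<in> L0 Y Z d" for F
  using map_dist_triangle(1)[OF rep_in(2)[OF that] rep_in(2)[OF G] rep_in(2)[OF assms(2)] _ fin]
   map_dist_triangle(1)[OF rep_in(2)[OF that] rep_in(2)[OF assms(2)] rep_in(2)[OF G] _ fin'] by blast
 thus ?thesis unfolding Lp_def by blast
qed

lemma cls_const_in_L0: "z \<in> Z ==> cls Y Z (%_. z) \<in> L0 Y Z d"
 using cls_in_L0[OF L0s_const[of z Y]] cls_cong[of Y "\<lambda>y\<in>space Y. z" "%_. z" Z] by simp

lemma cls_const_in_Lp:
 assumes "finite_measure Y" "z \<in> Z" "z0 \<in> Z"
 shows "cls Y Z (%_. z) \<in> Lp Y Z d p (cls Y Z (%_. z0))"
proof -
 interpret finite_measure Y by fact
 have eq: "cls Y Z (%_. z) = cls Y Z (\<lambda>y\<in>space Y. z)" for z by (rule cls_cong) simp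
 have "int_dist_powr Y d p (\<lambda>y\<in>space Y. z) (\<lambda>y\<in>space Y. z0) = (\<integral>\<^sup>+ y. ennreal (d z z0 powr p) \<partial>Y)"
  unfolding int_dist_powr_def by (rule nn_integral_cong) simp
 also have "\<dots> < \<infinity>" using emeasure_finite[of "space Y"] by (auto simp: ennreal_mult_eq_top_iff less_top[symmetric])
 finally show ?thesis unfolding eq using assms by (subst cls_in_Lp_iff) (auto intro: L0s_const)
qed

lemma LpI_eq:
 assumes "finite_measure (lebesgue_on I)" "z0 \<in> Z"
 shows "LpI I Z d p = Lp (lebesgue_on I) Z d p (cls (lebesgue_on I) Z (%_. z0))"
proof -
 have "Lp (lebesgue_on I) Z d p (cls (lebesgue_on I) Z (%_. z)) = Lp (lebesgue_on I) Z d p (cls (lebesgue_on I) Z (%_. z0))"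
  if "z \<in> Z" for z
  using assms that by (intro Lp_base_change cls_const_in_Lp cls_const_in_L0)
 thus ?thesis unfolding LpI_def using assms(2) by blast
qed

lemma Lp_dist_powr_cls:
 assumes "f \<in> L0s Y Z d" "g \<in> L0s Y Z d" "int_dist_powr Y d p f g < \<infinity>"
 shows "ennreal (Lp_dist Y Z d p (cls Y Z f) (cls Y Z g) powr p) = int_dist_powr Y d p f g"
 unfolding Lp_dist_cls[OF assms(1,2)] by (rule map_dist_powr[OF assms(3)])

end

lemma isometry_inj_on:
 assumes "Metric_space X dX" "isometric_mapping X dX Y dY \<phi>" "Metric_space Y dY"
 shows "inj_on \<phi> X"
proof (rule inj_onI)
 fix x x' assume x: "x \<in> X" "x' \<in> X" "\<phi> x = \<phi> x'"
 have \<phi>: "dY (\<phi> x) (\<phi> x') = dX x x'" "\<phi> x' \<in> Y" using assms(2) x(1,2) unfolding isometric_mapping_def by auto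
 have "dX x x' = 0" using Metric_space.mdist_zero[OF assms(3) \<phi>(2)] \<phi>(1) unfolding x(3) by simp
 thus "x = x'" using Metric_space.zero[OF assms(1)] x(1,2) by simp
qed

lemma (in dyadic_interval) finite_measure_interval: "finite_measure (lebesgue_on {a..b})"
 by (rule finite_measureI) (use ab in "simp add: emeasure_restrict_space")

section \<open>Jointly measurable maps and their two kinds of sections\<close>

locale sections = ac_setting N d p a b
 for N :: "'n set" and d :: "'n => 'n => real" and p a b :: real +
 fixes M :: "'m measure" and h :: "('m => 'n) set"
 assumes h: "h \<in> L0 M N d" and compl: "mcomplete" and N_ne: "N ~= {}"
begin

abbreviation "I \<equiv> {a..b}"
abbreviation "\<mu> \<equiv> lebesgue_on {a..b}"
abbreviation "X \<equiv> Lp M N d p h"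
abbreviation "DX \<equiv> Lp_dist M N d p"
abbreviation "LI \<equiv> LpI {a..b} N d p"
abbreviation "dI \<equiv> Lp_dist (lebesgue_on {a..b}) N d p"
abbreviation "PM \<equiv> caratheodory_product (lebesgue_on {a..b}) M"
abbreviation "h0 \<equiv> rep M N d h"

definition "z0 = (SOME z. z \<in> N)"
definition "k0 = (\<lambda>t\<in>{a..b}. z0)"
definition "H = (\<lambda>w\<in>space (\<mu> \<Otimes>\<^sub>M M). h0 (snd w))"

lemma z0: "z0 \<in> N" unfolding z0_def using N_ne by (simp add: some_in_eq)

lemma space_\<mu>: "space \<mu> = I" by simp

lemmas fin_\<mu> = finite_measure_interval

lemma k0: "k0 \<in> L0s \<mu> N d" unfolding k0_def using L0s_const[OF z0, of \<mu>] by simp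

lemma h0: "h0 \<in> L0s M N d" and h0_cls: "cls M N h0 = h"
 using rep_in(2)[OF h] cls_rep[OF h] .

lemma H_L0s: "H \<in> L0s (\<mu> \<Otimes>\<^sub>M M) N d" unfolding H_def by (rule L0s_snd[OF h0])

lemma H_PM: "H \<in> L0s PM N d" by (rule L0s_caratheodory[OF H_L0s])

lemma H_eq: "t \<in> I ==> x \<in> space M ==> H (t, x) = h0 x" by (simp add: H_def space_pair_measure)

lemma LI_eq: "LI = Lp \<mu> N d p (cls \<mu> N k0)"
proof -
 have "cls \<mu> N (%_. z0) = cls \<mu> N k0" by (rule cls_cong) (simp add: k0_def)
 thus ?thesis using LpI_eq[OF fin_\<mu> z0] by simp
qed

sublocale X: Lp_target X DX p by (rule Lp_target_Lp[OF h])

sublocale L: Lp_target LI dI p unfolding LI_eq by (rule Lp_target_Lp[OF cls_in_L0[OF k0]])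

lemma h_in_X: "h \<in> X" by (rule Lp_base_in[OF h])

lemma LIX_eq: "LpI I X DX p = Lp \<mu> X DX p (cls \<mu> X (%_. h))"
 by (rule X.LpI_eq[OF fin_\<mu> h_in_X])

definition const_h :: "real => ('m => 'n) set" where "const_h = (\<lambda>t\<in>I. h)"

lemma const_h: "const_h \<in> L0s \<mu> X DX" "cls \<mu> X (%_. h) = cls \<mu> X const_h"
proof -
 show "const_h \<in> L0s \<mu> X DX" unfolding const_h_def using X.L0s_const[OF h_in_X, of \<mu>] by simp
 show "cls \<mu> X (%_. h) = cls \<mu> X const_h" by (rule cls_cong) (simp add: const_h_def)
qed

lemma h_hat_eq: "h_hat I M N d h = cls PM N H"
 unfolding h_hat_def using H_PM by (auto simp: H_def space_caratheodory_product space_pair_measure intro!: cls_cong)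

text \<open>The exceptional set consists of points of M and does not depend on t: the strip over its
  complement is where g is the base map, as Tonelli's theorem requires.\<close>

definition nice :: "(real \<times> 'm => 'n) => bool" where
 "nice g \<longleftrightarrow> g \<in> L0s (\<mu> \<Otimes>\<^sub>M M) N d \<and>
   (EX S. sigma_finite_set M S & (\<forall>t\<in>I. \<forall>x\<in>space M - S. g (t, x) = h0 x))"

lemma niceD: "nice g ==> g \<in> L0s (\<mu> \<Otimes>\<^sub>M M) N d" by (simp add: nice_def)

lemma nice_PM: "nice g ==> g \<in> L0s PM N d" by (intro L0s_caratheodory niceD)

lemma nice_H: "nice H"
proof -
 have "sigma_finite_set M {}" unfolding sigma_finite_set_def by (auto intro!: exI[of _ "%_. {}"])
 thus ?thesis unfolding nice_def using H_L0s H_eq by blast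
qed

lemma section_t: "nice g ==> t \<in> I ==> (\<lambda>x\<in>space M. g (t, x)) \<in> L0s M N d"
 using L0s_section[OF niceD, of g t] by simp

lemma section_x: "nice g ==> x \<in> space M ==> (\<lambda>t\<in>I. g (t, x)) \<in> L0s \<mu> N d"
proof -
 assume g: "nice g" and x: "x \<in> space M"
 have "(\<lambda>t\<in>space \<mu>. (\<lambda>z\<in>space (M \<Otimes>\<^sub>M \<mu>). g (snd z, fst z)) (x, t)) \<in> L0s \<mu> N d"
  by (rule L0s_section[OF L0s_swap[OF niceD[OF g]] x])
 moreover have "(\<lambda>t\<in>space \<mu>. (\<lambda>z\<in>space (M \<Otimes>\<^sub>M \<mu>). g (snd z, fst z)) (x, t)) = (\<lambda>t\<in>I. g (t, x))"
  using x by (auto simp: space_pair_measure intro!: restrict_ext)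
 ultimately show ?thesis by simp
qed

abbreviation "Jt g g' t \<equiv> int_dist_powr M d p (%x. g (t, x)) (%x. g' (t, x))"
abbreviation "Jx g g' x \<equiv> int_dist_powr \<mu> d p (%t. g (t, x)) (%t. g' (t, x))"

lemma nice_Tonelli:
 assumes g: "nice g" and g': "nice g'"
 shows "int_dist_powr PM d p g g' = (\<integral>\<^sup>+ t. Jt g g' t \<partial>\<mu>)"
  and "int_dist_powr PM d p g g' = (\<integral>\<^sup>+ x. Jx g g' x \<partial>M)"
  and "(%t. Jt g g' t) \<in> borel_measurable \<mu>" and "(%x. Jx g g' x) \<in> borel_measurable M"
proof -
 obtain S S' where S: "sigma_finite_set M S" "\<forall>t\<in>I. \<forall>x\<in>space M - S. g (t, x) = h0 x"
  "sigma_finite_set M S'" "\<forall>t\<in>I. \<forall>x\<in>space M - S'. g' (t, x) = h0 x"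
  using g g' by (auto simp: nice_def)
 let ?w = "%z. ennreal (d (g z) (g' z) powr p)"
 have [measurable]: "(%z. d (g z) (g' z)) \<in> borel_measurable (\<mu> \<Otimes>\<^sub>M M)" by (rule L0s_dist_measurable[OF niceD[OF g] niceD[OF g']])
 have w: "?w \<in> borel_measurable (\<mu> \<Otimes>\<^sub>M M)" by measurable
 have w0: "?w (t, x) = 0" if "t \<in> space \<mu>" "x \<in> space M - (S \<union> S')" for t x
  using S(2,4) that L0s_in[OF h0, of x] by auto
 note T = nn_integral_caratheodory_product[OF fin_\<mu> sigma_finite_set_Un[OF S(1,3)] w w0]
 show "int_dist_powr PM d p g g' = (\<integral>\<^sup>+ t. Jt g g' t \<partial>\<mu>)" unfolding int_dist_powr_def by (rule T(1))
 show "int_dist_powr PM d p g g' = (\<integral>\<^sup>+ x. Jx g g' x \<partial>M)" unfolding int_dist_powr_def by (rule T(2))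
 show "(%t. Jt g g' t) \<in> borel_measurable \<mu>" unfolding int_dist_powr_def by (rule T(3))
 show "(%x. Jx g g' x) \<in> borel_measurable M" unfolding int_dist_powr_def by (rule T(4))
qed

definition fin :: "(real \<times> 'm => 'n) => bool" where
 "fin g \<longleftrightarrow> nice g & int_dist_powr PM d p g H < \<infinity>"

lemma Lp_prod_iff: "nice g ==> cls PM N g \<in> Lp_prod I M N d p h \<longleftrightarrow> int_dist_powr PM d p g H < \<infinity>"
 unfolding Lp_prod_def h_hat_eq by (rule cls_in_Lp_iff[OF nice_PM H_PM])

lemma Lp_prod_cases:
 assumes "F \<in> Lp_prod I M N d p h"
 obtains g where "fin g" "F = cls PM N g"
proof -
 have HL: "cls PM N H \<in> L0 PM N d" by (rule cls_in_L0[OF H_PM])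
 have F: "F \<in> Lp PM N d p (cls PM N H)" using assms by (simp add: Lp_prod_def h_hat_eq)
 let ?c = "rep PM N d F"
 have c: "?c \<in> L0s PM N d" "cls PM N ?c = F" by (rule LpD(1)[OF F HL], rule LpD(3)[OF F HL])
 have cf: "int_dist_powr PM d p ?c H < \<infinity>" using cls_in_Lp_iff[OF c(1) H_PM, of p] F c(2) by simp
 have "int_dist_powr PM d p ?c (%z. h0 (snd z)) = int_dist_powr PM d p ?c H"
  unfolding int_dist_powr_def by (rule nn_integral_cong) (auto simp: H_def space_caratheodory_product space_pair_measure)
 with cf have "int_dist_powr PM d p ?c (%z. h0 (snd z)) < \<infinity>" by simp
 then obtain g S where g: "g \<in> L0s (\<mu> \<Otimes>\<^sub>M M) N d" "sigma_finite_set M S" "AE z in PM. ?c z = g z"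
  "!!a' b'. a' \<in> space \<mu> ==> b' \<in> space M - S ==> g (a', b') = h0 b'"
  by (rule nice_representative[OF c(1) h0]) (rule that, assumption+)
 have n: "nice g" unfolding nice_def using g(1,2,4) by auto
 have eq: "F = cls PM N g" using cls_cong_AE[OF g(3), of N] c(2) by simp
 hence "fin g" using n Lp_prod_iff[OF n] assms by (simp add: fin_def)
 thus ?thesis using that eq by blast
qed

text \<open>The section maps are defined through the arbitrary choice \<open>rep\<close>. Agreement
  on almost all sections, in either order, allows them to be computed from any nice map.\<close>

lemma rep_AE:
 assumes "nice g"
 shows "AE t in \<mu>. AE x in M. rep PM N d (cls PM N g) (t, x) = g (t, x)"
  and "AE x in M. AE t in \<mu>. rep PM N d (cls PM N g) (t, x) = g (t, x)"
proof -
 have A: "AE z in PM. rep PM N d (cls PM N g) z = g z" by (rule rep_cls[OF nice_PM[OF assms]])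
 show "AE t in \<mu>. AE x in M. rep PM N d (cls PM N g) (t, x) = g (t, x)" by (rule AE_caratheodory_hull[OF A])
 show "AE x in M. AE t in \<mu>. rep PM N d (cls PM N g) (t, x) = g (t, x)" by (rule AE_caratheodory_hull[OF A])
qed

lemma sec_I_cls: "nice g ==> sec_I I M N d p h (cls PM N g) = cls \<mu> X (%t. cls M N (%x. g (t, x)))"
 unfolding sec_I_def using rep_AE(1)[of g] by (intro cls_cong_AE) (auto elim!: eventually_mono intro!: cls_cong_AE)

lemma sec_M_cls: "nice g ==> sec_M I M N d p (cls PM N g) = cls M LI (%x. cls \<mu> N (%t. g (t, x)))"
 unfolding sec_M_def using rep_AE(2)[of g] by (intro cls_cong_AE) (auto elim!: eventually_mono intro!: cls_cong_AE)

lemma fin_Jt_AE: assumes "fin g" shows "AE t in \<mu>. Jt g H t < \<infinity>"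
proof -
 have n: "nice g" and f: "int_dist_powr PM d p g H < \<infinity>" using assms by (auto simp: fin_def)
 have "(\<integral>\<^sup>+ t. Jt g H t \<partial>\<mu>) ~= \<infinity>" using f unfolding nice_Tonelli(1)[OF n nice_H] by simp
 hence "AE t in \<mu>. Jt g H t ~= \<infinity>" by (rule nn_integral_PInf_AE[OF nice_Tonelli(3)[OF n nice_H]])
 thus ?thesis by eventually_elim (simp add: less_top)
qed

lemma fin_Jx_AE: assumes "fin g" shows "AE x in M. Jx g H x < \<infinity>"
proof -
 have n: "nice g" and f: "int_dist_powr PM d p g H < \<infinity>" using assms by (auto simp: fin_def)
 have "(\<integral>\<^sup>+ x. Jx g H x \<partial>M) ~= \<infinity>" using f unfolding nice_Tonelli(2)[OF n nice_H] by simp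
 hence "AE x in M. Jx g H x ~= \<infinity>" by (rule nn_integral_PInf_AE[OF nice_Tonelli(4)[OF n nice_H]])
 thus ?thesis by eventually_elim (simp add: less_top)
qed

lemma Jt_H: "t \<in> I ==> Jt g H t = int_dist_powr M d p (%x. g (t, x)) h0"
 unfolding int_dist_powr_def by (rule nn_integral_cong) (simp add: H_eq)

lemma int_dist_powr_restrict:
 "int_dist_powr Y d p (\<lambda>y\<in>space Y. f y) (\<lambda>y\<in>space Y. g y) = int_dist_powr Y d p f g"
 unfolding int_dist_powr_def by (rule nn_integral_cong) simp

lemma cls_restrict: "cls Y Z' (\<lambda>y\<in>space Y. f y) = cls Y Z' f"
 by (rule cls_cong) simp

lemma Jt_finite:
 assumes "nice g" "nice g'" "t \<in> I" "Jt g H t < \<infinity>" "Jt g' H t < \<infinity>"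
 shows "Jt g g' t < \<infinity>"
proof -
 have 1: "int_dist_powr M d p (\<lambda>x\<in>space M. g (t, x)) h0 < \<infinity>" "int_dist_powr M d p (\<lambda>x\<in>space M. g' (t, x)) h0 < \<infinity>"
  using assms(4,5) unfolding Jt_H[OF assms(3)] by (simp_all add: int_dist_powr_def cong: nn_integral_cong)
 have "int_dist_powr M d p (\<lambda>x\<in>space M. g (t, x)) (\<lambda>x\<in>space M. g' (t, x)) < \<infinity>"
  by (rule map_dist_triangle(1)[OF section_t[OF assms(1,3)] h0 section_t[OF assms(2,3)] 1(1)])
   (subst int_dist_powr_commute, rule 1(2))
 thus ?thesis by (simp only: int_dist_powr_restrict)
qed

text \<open>
 Replacing a map by its base point on the null set of parameters where its section is not
 $p$-integrable makes every section an element of the space of classes.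
\<close>
lemma sec_I_representative:
 assumes g: "fin g"
 obtains u where "u \<in> L0s \<mu> X DX" "sec_I I M N d p h (cls PM N g) = cls \<mu> X u"
  "AE t in \<mu>. u t = cls M N (%x. g (t, x)) & Jt g H t < \<infinity>"
proof -
 have n: "nice g" using g by (simp add: fin_def)
 obtain S where S: "sigma_finite_set M S" "\<forall>t\<in>I. \<forall>x\<in>space M - S. g (t, x) = h0 x" using n by (auto simp: nice_def)
 define P where "P z \<longleftrightarrow> Jt g H (fst z) < \<infinity>" for z :: "real \<times> 'm"
 have [measurable]: "(%t. Jt g H t) \<in> borel_measurable \<mu>" by (rule nice_Tonelli(3)[OF n nice_H])
 have Ps: "{z \<in> space (\<mu> \<Otimes>\<^sub>M M). P z} \<in> sets (\<mu> \<Otimes>\<^sub>M M)" unfolding P_def by measurable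
 define g1 where "g1 = (\<lambda>z\<in>space (\<mu> \<Otimes>\<^sub>M M). if P z then g z else H z)"
 have g1: "g1 \<in> L0s (\<mu> \<Otimes>\<^sub>M M) N d" unfolding g1_def by (rule L0s_if[OF niceD[OF n] H_L0s Ps])
 define u where "u = (\<lambda>t\<in>space \<mu>. cls M N (%x. g1 (t, x)))"
 have g1t: "g1 (t, x) = (if Jt g H t < \<infinity> then g (t, x) else h0 x)" if "t \<in> I" "x \<in> space M" for t x
  using that by (simp add: g1_def P_def space_pair_measure H_eq)
 have "u \<in> L0s \<mu> (Lp M N d p (cls M N h0)) DX"
  unfolding u_def
 proof (rule Lp_classes_L0sI[OF h0 g1 S(1)])
  show "g1 (t, x) = h0 x" if "t \<in> space \<mu>" "x \<in> space M - S" for t x using that S(2) by (auto simp: g1t)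
  fix t assume "t \<in> space \<mu>"
  hence t: "t \<in> I" by simp
  have "int_dist_powr M d p (%x. g1 (t, x)) h0 = (if Jt g H t < \<infinity> then Jt g H t else 0)"
   unfolding Jt_H[OF t] unfolding int_dist_powr_def using L0s_in[OF h0]
   by (auto intro!: nn_integral_cong simp: g1t[OF t] Jt_H[OF t, unfolded int_dist_powr_def] int_dist_powr_def
     nn_integral_0_iff_AE cong: nn_integral_cong)
  thus "int_dist_powr M d p (%x. g1 (t, x)) h0 < \<infinity>" by simp
 qed
 hence u: "u \<in> L0s \<mu> X DX" by (simp add: h0_cls)
 have AEu: "AE t in \<mu>. u t = cls M N (%x. g (t, x)) & Jt g H t < \<infinity>"
  using fin_Jt_AE[OF g] AE_space
 proof eventually_elim
  case (elim t)
  hence "u t = cls M N (%x. g1 (t, x))" by (simp add: u_def)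
  also have "\<dots> = cls M N (%x. g (t, x))" using elim by (intro cls_cong) (simp add: g1t)
  finally show ?case using elim by simp
 qed
 have "sec_I I M N d p h (cls PM N g) = cls \<mu> X u"
  unfolding sec_I_cls[OF n] by (rule cls_cong_AE) (use AEu in "auto elim: eventually_mono")
 thus ?thesis using that u AEu by blast
qed

lemma sec_I_int_dist:
 assumes g: "fin g" and g': "fin g'" and u: "AE t in \<mu>. u t = cls M N (%x. g (t, x)) & Jt g H t < \<infinity>"
  and u': "AE t in \<mu>. u' t = cls M N (%x. g' (t, x)) & Jt g' H t < \<infinity>"
 shows "int_dist_powr \<mu> DX p u u' = int_dist_powr PM d p g g'"
proof -
 have n: "nice g" "nice g'" using g g' by (auto simp: fin_def)
 have "AE t in \<mu>. ennreal (DX (u t) (u' t) powr p) = Jt g g' t"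
  using u u' AE_space
 proof eventually_elim
  case (elim t)
  hence t: "t \<in> I" by simp
  have fin: "Jt g g' t < \<infinity>" using Jt_finite[OF n t] elim by simp
  have "ennreal (DX (u t) (u' t) powr p) =
   ennreal (DX (cls M N (\<lambda>x\<in>space M. g (t, x))) (cls M N (\<lambda>x\<in>space M. g' (t, x))) powr p)"
   using elim by (simp only: cls_restrict)
  also have "\<dots> = int_dist_powr M d p (\<lambda>x\<in>space M. g (t, x)) (\<lambda>x\<in>space M. g' (t, x))"
   by (rule Lp_dist_powr_cls[OF section_t[OF n(1) t] section_t[OF n(2) t]]) (simp only: int_dist_powr_restrict fin)
  finally show ?case by (simp only: int_dist_powr_restrict)
 qed
 hence "int_dist_powr \<mu> DX p u u' = (\<integral>\<^sup>+ t. Jt g g' t \<partial>\<mu>)"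
  unfolding int_dist_powr_def[of \<mu> DX] by (rule nn_integral_cong_AE)
 thus ?thesis by (simp add: nice_Tonelli(1)[OF n])
qed

lemma fin_H: "fin H"
 unfolding fin_def using nice_H int_dist_powr_eq_0[OF H_PM H_PM] by simp

lemma const_h_AE: "AE t in \<mu>. const_h t = cls M N (%x. H (t, x)) & Jt H H t < \<infinity>"
proof (rule AE_I2)
 fix t assume "t \<in> space \<mu>"
 hence t: "t \<in> I" by simp
 have "cls M N (%x. H (t, x)) = cls M N h0" by (rule cls_cong) (simp add: H_eq[OF t])
 moreover have "Jt H H t = 0"
 proof -
  have "Jt H H t = (\<integral>\<^sup>+ x. 0 \<partial>M)" unfolding int_dist_powr_def using L0s_in[OF h0] by (intro nn_integral_cong) (simp add: H_eq[OF t])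
  thus ?thesis by simp
 qed
 ultimately show "const_h t = cls M N (%x. H (t, x)) & Jt H H t < \<infinity>" using t by (simp add: const_h_def h0_cls)
qed

text \<open>Distances are preserved by Tonelli's theorem. Surjectivity is
  \<open>joint_representative\<close>, and there the completeness of N enters.\<close>

lemma isometry_sec_I:
 "isometry (Lp_prod I M N d p h) (Lp_dist PM N d p) (LpI I X DX p) (Lp_dist \<mu> X DX p) (sec_I I M N d p h)"
 unfolding isometry_def isometric_mapping_def
proof (intro conjI funcsetI ballI)
 have in_LIX: "sec_I I M N d p h F \<in> LpI I X DX p" if "F \<in> Lp_prod I M N d p h" for F
 proof (rule Lp_prod_cases[OF that])
  fix g assume g: "fin g" "F = cls PM N g"
  show ?thesis
  proof (rule sec_I_representative[OF g(1)])
   fix u assume u: "u \<in> L0s \<mu> X DX" "sec_I I M N d p h (cls PM N g) = cls \<mu> X u"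
    "AE t in \<mu>. u t = cls M N (%x. g (t, x)) & Jt g H t < \<infinity>"
   have "int_dist_powr \<mu> DX p u const_h = int_dist_powr PM d p g H"
    by (rule sec_I_int_dist[OF g(1) fin_H u(3) const_h_AE])
   thus ?thesis unfolding LIX_eq const_h(2) g(2) u(2)
    using g(1) by (subst cls_in_Lp_iff[OF u(1) const_h(1)]) (simp add: fin_def)
  qed
 qed
 thus "sec_I I M N d p h F \<in> LpI I X DX p" if "F \<in> Lp_prod I M N d p h" for F using that .
 show "Lp_dist \<mu> X DX p (sec_I I M N d p h F) (sec_I I M N d p h F') = Lp_dist PM N d p F F'"
  if "F \<in> Lp_prod I M N d p h" "F' \<in> Lp_prod I M N d p h" for F F'
 proof (rule Lp_prod_cases[OF that(1)], rule Lp_prod_cases[OF that(2)])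
  fix g g' assume g: "fin g" "F = cls PM N g" and g': "fin g'" "F' = cls PM N g'"
  have n: "nice g" "nice g'" using g g' by (auto simp: fin_def)
  show ?thesis
  proof (rule sec_I_representative[OF g(1)], rule sec_I_representative[OF g'(1)])
   fix u u' assume u: "u \<in> L0s \<mu> X DX" "sec_I I M N d p h (cls PM N g) = cls \<mu> X u"
    "AE t in \<mu>. u t = cls M N (%x. g (t, x)) & Jt g H t < \<infinity>"
    and u': "u' \<in> L0s \<mu> X DX" "sec_I I M N d p h (cls PM N g') = cls \<mu> X u'"
    "AE t in \<mu>. u' t = cls M N (%x. g' (t, x)) & Jt g' H t < \<infinity>"
   show ?thesis
    unfolding g(2) g'(2) u(2) u'(2) Lp_dist_cls[OF u(1) u'(1)] Lp_dist_cls[OF nice_PM[OF n(1)] nice_PM[OF n(2)]] map_dist_def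
     sec_I_int_dist[OF g(1) g'(1) u(3) u'(3)] ..
  qed
 qed
 show "sec_I I M N d p h ` Lp_prod I M N d p h = LpI I X DX p"
 proof (intro equalityI subsetI)
  show "U \<in> LpI I X DX p" if "U \<in> sec_I I M N d p h ` Lp_prod I M N d p h" for U using that in_LIX by auto
  fix U assume "U \<in> LpI I X DX p"
  hence U: "U \<in> Lp \<mu> X DX p (cls \<mu> X const_h)" by (simp add: LIX_eq const_h(2))
  have cL: "cls \<mu> X const_h \<in> L0 \<mu> X DX" by (rule cls_in_L0[OF const_h(1)])
  let ?u = "rep \<mu> X DX U"
  have u: "?u \<in> L0s \<mu> X DX" "cls \<mu> X ?u = U" by (rule X.LpD(1)[OF U cL], rule X.LpD(3)[OF U cL])
  have uf: "int_dist_powr \<mu> DX p ?u const_h < \<infinity>" using cls_in_Lp_iff[OF u(1) const_h(1), of p] U u(2) by simp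
  have "?u \<in> L0s \<mu> (Lp M N d p (cls M N h0)) DX" using u(1) by (simp add: h0_cls)
  then obtain g S where g: "g \<in> L0s (\<mu> \<Otimes>\<^sub>M M) N d" "sigma_finite_set M S"
   "!!a' b'. a' \<in> space \<mu> ==> b' \<in> space M - S ==> g (a', b') = h0 b'"
   "!!a'. a' \<in> space \<mu> ==> cls M N (%x. g (a', x)) = ?u a'"
   by (rule joint_representative[OF h0 compl]) (rule that, assumption+)
  have n: "nice g" unfolding nice_def using g(1,2,3) by auto
  have "AE t in \<mu>. ennreal (DX (?u t) (const_h t) powr p) = Jt g H t"
  proof (rule AE_I2)
   fix t assume t': "t \<in> space \<mu>"
   hence t: "t \<in> I" by simp
   have "cls M N (\<lambda>x\<in>space M. g (t, x)) = ?u t" using g(4)[OF t'] by (simp only: cls_restrict)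
   moreover have "?u t \<in> Lp M N d p (cls M N h0)" using X.L0s_in[OF u(1) t'] by (simp add: h0_cls)
   ultimately have "int_dist_powr M d p (\<lambda>x\<in>space M. g (t, x)) h0 < \<infinity>"
    using cls_in_Lp_iff[OF section_t[OF n t] h0, of p] by simp
   from Lp_dist_powr_cls[OF section_t[OF n t] h0 this]
   have "ennreal (DX (?u t) h powr p) = int_dist_powr M d p (\<lambda>x\<in>space M. g (t, x)) h0"
    using \<open>cls M N (\<lambda>x\<in>space M. g (t, x)) = ?u t\<close> by (simp add: h0_cls)
   also have "\<dots> = Jt g H t" unfolding int_dist_powr_def by (rule nn_integral_cong) (simp add: H_eq[OF t])
   finally show "ennreal (DX (?u t) (const_h t) powr p) = Jt g H t" using t by (simp add: const_h_def)
  qed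
  hence "int_dist_powr \<mu> DX p ?u const_h = (\<integral>\<^sup>+ t. Jt g H t \<partial>\<mu>)"
   unfolding int_dist_powr_def[of \<mu> DX] by (rule nn_integral_cong_AE)
  hence "int_dist_powr PM d p g H < \<infinity>" using uf by (simp add: nice_Tonelli(1)[OF n nice_H])
  hence "cls PM N g \<in> Lp_prod I M N d p h" by (simp add: Lp_prod_iff[OF n])
  moreover have "sec_I I M N d p h (cls PM N g) = cls \<mu> X ?u"
   unfolding sec_I_cls[OF n] by (rule cls_cong) (rule g(4))
  hence "sec_I I M N d p h (cls PM N g) = U" unfolding u(2) .
  ultimately show "U \<in> sec_I I M N d p h ` Lp_prod I M N d p h" by blast
 qed
qed

end

section \<open>The isometry onto families of curves\<close>

lemma isometry_compose:
 assumes "isometry X dX Y dY \<phi>" "isometry Y dY Z dZ \<psi>"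
 shows "isometry X dX Z dZ (\<psi> \<circ> \<phi>)"
proof -
 have "\<phi> x \<in> Y" if "x \<in> X" for x using assms(1) that by (auto simp: isometry_def isometric_mapping_def)
 moreover have "(\<psi> \<circ> \<phi>) ` X = Z" using assms by (auto simp: isometry_def image_comp[symmetric])
 ultimately show ?thesis using assms by (auto simp: isometry_def isometric_mapping_def)
qed

lemma isometry_inv_into:
 assumes "isometry X dX Y dY \<phi>" "inj_on \<phi> X"
 shows "isometry Y dY X dX (inv_into X \<phi>)"
proof -
 have im: "\<phi> ` X = Y" using assms(1) by (simp add: isometry_def)
 have "dX (inv_into X \<phi> y) (inv_into X \<phi> y') = dY y y'" if "y \<in> Y" "y' \<in> Y" for y y'
 proof -
  have y: "inv_into X \<phi> y \<in> X" "inv_into X \<phi> y' \<in> X" using that im by (auto intro: inv_into_into)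
  have "dX (inv_into X \<phi> y) (inv_into X \<phi> y') = dY (\<phi> (inv_into X \<phi> y)) (\<phi> (inv_into X \<phi> y'))"
   using assms(1) y by (simp add: isometry_def isometric_mapping_def)
  thus ?thesis using that im by (simp add: f_inv_into_f)
 qed
 moreover have "inv_into X \<phi> ` Y = X" using inv_into_image_cancel[OF assms(2) subset_refl] im by simp
 ultimately show ?thesis by (auto simp: isometry_def isometric_mapping_def)
qed

context sections
begin

text \<open>The interval has finite measure, so the constant curve at h0 x and the base curve k0 are
  at finite distance and may be exchanged.\<close>

lemma in_LI_iff:
 assumes n: "nice g" and x: "x \<in> space M"
 shows "cls \<mu> N (%t. g (t, x)) \<in> LI \<longleftrightarrow> Jx g H x < \<infinity>"
proof -
 interpret F: finite_measure \<mu> by (rule fin_\<mu>)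
 note r = int_dist_powr_restrict[of \<mu>, unfolded space_\<mu>]
 note s = section_x[OF n x] section_x[OF nice_H x]
 have "int_dist_powr \<mu> d p (\<lambda>t\<in>I. H (t, x)) k0 = (\<integral>\<^sup>+ t. ennreal (d (h0 x) z0 powr p) \<partial>\<mu>)"
  unfolding int_dist_powr_def by (rule nn_integral_cong) (simp add: k0_def H_eq x)
 also have "\<dots> < \<infinity>" using F.emeasure_finite[of "space \<mu>"] by (auto simp: ennreal_mult_eq_top_iff less_top[symmetric])
 finally have Hk: "int_dist_powr \<mu> d p (\<lambda>t\<in>I. H (t, x)) k0 < \<infinity>" .
 hence kH: "int_dist_powr \<mu> d p k0 (\<lambda>t\<in>I. H (t, x)) < \<infinity>" by (subst int_dist_powr_commute)
 have "cls \<mu> N (%t. g (t, x)) = cls \<mu> N (\<lambda>t\<in>I. g (t, x))" using cls_restrict[of \<mu> N "%t. g (t, x)"] by simp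
 hence "cls \<mu> N (%t. g (t, x)) \<in> LI \<longleftrightarrow> int_dist_powr \<mu> d p (\<lambda>t\<in>I. g (t, x)) k0 < \<infinity>"
  unfolding LI_eq by (simp only: cls_in_Lp_iff[OF s(1) k0])
 also have "\<dots> \<longleftrightarrow> int_dist_powr \<mu> d p (\<lambda>t\<in>I. g (t, x)) (\<lambda>t\<in>I. H (t, x)) < \<infinity>"
  using map_dist_triangle(1)[OF s(1) k0 s(2) _ kH] map_dist_triangle(1)[OF s(1,2) k0 _ Hk] by blast
 finally show ?thesis by (simp only: r)
qed

lemma dI_powr:
 assumes n: "nice g" "nice g'" and x: "x \<in> space M" and f: "Jx g H x < \<infinity>" "Jx g' H x < \<infinity>"
 shows "ennreal (dI (cls \<mu> N (%t. g (t, x))) (cls \<mu> N (%t. g' (t, x))) powr p) = Jx g g' x"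
proof -
 note r = int_dist_powr_restrict[of \<mu>, unfolded space_\<mu>] and c = cls_restrict[of \<mu>, unfolded space_\<mu>]
 note s = section_x[OF n(1) x] section_x[OF n(2) x] section_x[OF nice_H x]
 have "int_dist_powr \<mu> d p (\<lambda>t\<in>I. g (t, x)) (\<lambda>t\<in>I. g' (t, x)) < \<infinity>"
  by (rule map_dist_triangle(1)[OF s(1,3,2)], simp only: r f, subst int_dist_powr_commute, simp only: r f)
 from Lp_dist_powr_cls[OF s(1,2) this] show ?thesis by (simp only: r c)
qed

text \<open>The counterpart of \<open>sec_I_representative\<close> for sections in t: a section that
  is not p-integrable is replaced by the constant curve at h0 x. The factors are swapped because
  \<open>Lp_classes_L0sI\<close> takes classes in the second variable.\<close>

lemma sec_M_representative:
 assumes g: "fin g"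
 obtains v where "v \<in> L0s M LI dI" "cls M LI (%x. cls \<mu> N (%t. g (t, x))) = cls M LI v"
  "AE x in M. v x = cls \<mu> N (%t. g (t, x)) & Jx g H x < \<infinity>"
proof -
 have n: "nice g" using g by (simp add: fin_def)
 have [measurable]: "(%x. Jx g H x) \<in> borel_measurable M" by (rule nice_Tonelli(4)[OF n nice_H])
 define P where "P z \<longleftrightarrow> Jx g H (fst z) < \<infinity>" for z :: "'m \<times> real"
 have Ps: "{z \<in> space (M \<Otimes>\<^sub>M \<mu>). P z} \<in> sets (M \<Otimes>\<^sub>M \<mu>)" unfolding P_def by measurable
 define g1 where "g1 = (\<lambda>z\<in>space (M \<Otimes>\<^sub>M \<mu>). if P z then (\<lambda>z\<in>space (M \<Otimes>\<^sub>M \<mu>). g (snd z, fst z)) z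
  else (\<lambda>z\<in>space (M \<Otimes>\<^sub>M \<mu>). H (snd z, fst z)) z)"
 have g1: "g1 \<in> L0s (M \<Otimes>\<^sub>M \<mu>) N d" unfolding g1_def
  by (rule L0s_if[OF L0s_swap[OF niceD[OF n]] L0s_swap[OF niceD[OF nice_H]] Ps])
 have g1x: "g1 (x, t) = (if Jx g H x < \<infinity> then g (t, x) else H (t, x))" if "t \<in> I" "x \<in> space M" for t x
  using that by (simp add: g1_def P_def space_pair_measure)
 define v where "v = (\<lambda>x\<in>space M. cls \<mu> N (%t. g1 (x, t)))"
 have sf: "sigma_finite_set \<mu> (space \<mu>)" by (rule sigma_finite_set_space[OF fin_\<mu>])
 have "v \<in> L0s M (Lp \<mu> N d p (cls \<mu> N k0)) dI"
  unfolding v_def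
 proof (rule Lp_classes_L0sI[OF k0 g1 sf])
  fix x assume x: "x \<in> space M"
  define g2 where "g2 = (if Jx g H x < \<infinity> then g else H)"
  have n2: "nice g2" "Jx g2 H x < \<infinity>" using n nice_H int_dist_powr_eq_0[OF section_x[OF nice_H x] section_x[OF nice_H x]]
   int_dist_powr_restrict[of \<mu> "%t. H (t, x)" "%t. H (t, x)"] by (auto simp: g2_def)
  have "cls \<mu> N (\<lambda>t\<in>I. g2 (t, x)) \<in> LI" using in_LI_iff[OF n2(1) x] n2(2) cls_restrict[of \<mu> N "%t. g2 (t, x)"] by simp
  hence "int_dist_powr \<mu> d p (\<lambda>t\<in>I. g2 (t, x)) k0 < \<infinity>" unfolding LI_eq cls_in_Lp_iff[OF section_x[OF n2(1) x] k0] .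
  moreover have "int_dist_powr \<mu> d p (%t. g1 (x, t)) k0 = int_dist_powr \<mu> d p (\<lambda>t\<in>I. g2 (t, x)) k0"
   unfolding int_dist_powr_def by (rule nn_integral_cong) (simp add: g1x x g2_def)
  ultimately show "int_dist_powr \<mu> d p (%t. g1 (x, t)) k0 < \<infinity>" by simp
 qed auto
 hence v: "v \<in> L0s M LI dI" by (simp add: LI_eq)
 have AEv: "AE x in M. v x = cls \<mu> N (%t. g (t, x)) & Jx g H x < \<infinity>"
  using fin_Jx_AE[OF g] AE_space
 proof eventually_elim
  case (elim x)
  hence "v x = cls \<mu> N (%t. g1 (x, t))" by (simp add: v_def)
  also have "\<dots> = cls \<mu> N (%t. g (t, x))" using elim by (intro cls_cong) (simp add: g1x)
  finally show ?case using elim by simp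
 qed
 have "cls M LI (%x. cls \<mu> N (%t. g (t, x))) = cls M LI v"
  by (rule cls_cong_AE) (use AEv in "auto elim: eventually_mono")
 thus ?thesis using that v AEv by blast
qed

lemma sec_M_int_dist:
 assumes n: "nice g" "nice g'" and v: "AE x in M. v x = cls \<mu> N (%t. g (t, x)) & Jx g H x < \<infinity>"
  and v': "AE x in M. v' x = cls \<mu> N (%t. g' (t, x)) & Jx g' H x < \<infinity>"
 shows "int_dist_powr M dI p v v' = int_dist_powr PM d p g g'"
proof -
 have "AE x in M. ennreal (dI (v x) (v' x) powr p) = Jx g g' x"
  using v v' AE_space
 proof eventually_elim
  case (elim x)
  thus ?case using dI_powr[OF n elim(3)] by simp
 qed
 hence "int_dist_powr M dI p v v' = (\<integral>\<^sup>+ x. Jx g g' x \<partial>M)"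
  unfolding int_dist_powr_def[of M dI] by (rule nn_integral_cong_AE)
 thus ?thesis by (simp add: nice_Tonelli(2)[OF n])
qed

lemma h_const_eq: "h_const I M N d p h = cls M LI (%x. cls \<mu> N (%t. H (t, x)))"
 unfolding h_const_def by (rule cls_cong, rule cls_cong) (simp add: H_eq)

lemma sec_M_in:
 assumes "fin g" shows "cls M LI (%x. cls \<mu> N (%t. g (t, x))) \<in> Lp M LI dI p (h_const I M N d p h)"
proof (rule sec_M_representative[OF assms], rule sec_M_representative[OF fin_H])
 fix v vh
 assume v: "v \<in> L0s M LI dI" "cls M LI (%x. cls \<mu> N (%t. g (t, x))) = cls M LI v"
  "AE x in M. v x = cls \<mu> N (%t. g (t, x)) & Jx g H x < \<infinity>"
  and vh: "vh \<in> L0s M LI dI" "cls M LI (%x. cls \<mu> N (%t. H (t, x))) = cls M LI vh"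
  "AE x in M. vh x = cls \<mu> N (%t. H (t, x)) & Jx H H x < \<infinity>"
 have n: "nice g" using assms by (simp add: fin_def)
 show ?thesis unfolding h_const_eq v(2) vh(2) cls_in_Lp_iff[OF v(1) vh(1)]
  using assms by (simp only: sec_M_int_dist[OF n nice_H v(3) vh(3)] fin_def)
qed

lemma sec_M_dist:
 assumes g: "fin g" "fin g'"
 shows "Lp_dist M LI dI p (cls M LI (%x. cls \<mu> N (%t. g (t, x)))) (cls M LI (%x. cls \<mu> N (%t. g' (t, x))))
  = map_dist PM d p g g'"
proof (rule sec_M_representative[OF g(1)], rule sec_M_representative[OF g(2)])
 fix v v'
 assume v: "v \<in> L0s M LI dI" "cls M LI (%x. cls \<mu> N (%t. g (t, x))) = cls M LI v"
  "AE x in M. v x = cls \<mu> N (%t. g (t, x)) & Jx g H x < \<infinity>"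
  and v': "v' \<in> L0s M LI dI" "cls M LI (%x. cls \<mu> N (%t. g' (t, x))) = cls M LI v'"
  "AE x in M. v' x = cls \<mu> N (%t. g' (t, x)) & Jx g' H x < \<infinity>"
 have n: "nice g" "nice g'" using g by (simp_all add: fin_def)
 show ?thesis unfolding v(2) v'(2) Lp_dist_cls[OF v(1) v'(1)] map_dist_def sec_M_int_dist[OF n v(3) v'(3)] ..
qed

text \<open>The map g' from \<open>joint_representative\<close> has no reason to equal the base map
  on a large strip. It is used only over M0, the sigma-finite set where V differs from the family of
  constant curves, and H is used elsewhere; the result is nice.\<close>

lemma sec_M_surj:
 assumes V: "V \<in> Lp M LI dI p (h_const I M N d p h)"
 obtains g where "fin g" "V = cls M LI (%x. cls \<mu> N (%t. g (t, x)))"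
proof (rule sec_M_representative[OF fin_H])
 fix vh assume vh: "vh \<in> L0s M LI dI" "cls M LI (%x. cls \<mu> N (%t. H (t, x))) = cls M LI vh"
  "AE x in M. vh x = cls \<mu> N (%t. H (t, x)) & Jx H H x < \<infinity>"
 have cL: "cls M LI vh \<in> L0 M LI dI" by (rule cls_in_L0[OF vh(1)])
 have V': "V \<in> Lp M LI dI p (cls M LI vh)" using V by (simp only: h_const_eq vh(2))
 let ?v = "rep M LI dI V"
 have v: "?v \<in> L0s M LI dI" "cls M LI ?v = V" by (rule L.LpD(1)[OF V' cL], rule L.LpD(3)[OF V' cL])
 have vf: "int_dist_powr M dI p ?v vh < \<infinity>" using cls_in_Lp_iff[OF v(1) vh(1), of p] V' v(2) by simp
 define M0 where "M0 = {x \<in> space M. ?v x ~= vh x}"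
 have M0: "sigma_finite_set M M0" unfolding M0_def by (rule L.sigma_finite_set_distinct[OF v(1) vh(1) vf])
 have "?v \<in> L0s M (Lp \<mu> N d p (cls \<mu> N k0)) dI" using v(1) by (simp only: LI_eq)
 then obtain g' S where g': "g' \<in> L0s (M \<Otimes>\<^sub>M \<mu>) N d"
  "!!x. x \<in> space M ==> cls \<mu> N (%t. g' (x, t)) = ?v x"
  by (rule joint_representative[OF k0 compl]) (rule that, assumption+)
 have Ps: "{w \<in> space (\<mu> \<Otimes>\<^sub>M M). snd w \<in> M0} \<in> sets (\<mu> \<Otimes>\<^sub>M M)"
  using sigma_finite_set_sets[OF M0] by measurable
 define g where "g = (\<lambda>w\<in>space (\<mu> \<Otimes>\<^sub>M M). if snd w \<in> M0 then (\<lambda>w\<in>space (\<mu> \<Otimes>\<^sub>M M). g' (snd w, fst w)) w else H w)"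
 have g: "g \<in> L0s (\<mu> \<Otimes>\<^sub>M M) N d" unfolding g_def by (rule L0s_if[OF L0s_swap[OF g'(1)] H_L0s Ps])
 have gx: "g (t, x) = (if x \<in> M0 then g' (x, t) else H (t, x))" if "t \<in> I" "x \<in> space M" for t x
  using that by (simp add: g_def space_pair_measure)
 have n: "nice g" unfolding nice_def
 proof (intro conjI g exI[of _ M0] M0 ballI)
  fix t x assume "t \<in> I" "x \<in> space M - M0"
  thus "g (t, x) = h0 x" by (simp add: gx H_eq del: atLeastAtMost_iff)
 qed
 have AEv: "AE x in M. ?v x = cls \<mu> N (%t. g (t, x)) & Jx g H x < \<infinity>"
  using vh(3) AE_space
 proof eventually_elim
  case (elim x)
  have "?v x = cls \<mu> N (%t. g (t, x))"
  proof (cases "x \<in> M0")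
   case True
   have "cls \<mu> N (%t. g (t, x)) = cls \<mu> N (%t. g' (x, t))" using True elim by (intro cls_cong) (simp add: gx)
   thus ?thesis using g'(2)[OF elim(2)] by simp
  next
   case False
   have "cls \<mu> N (%t. g (t, x)) = cls \<mu> N (%t. H (t, x))" using False elim by (intro cls_cong) (simp add: gx)
   thus ?thesis using False elim by (simp add: M0_def)
  qed
  moreover have "?v x \<in> LI" by (rule L.L0s_in[OF v(1) elim(2)])
  ultimately show ?case using in_LI_iff[OF n elim(2)] by simp
 qed
 have "int_dist_powr M dI p ?v vh = int_dist_powr PM d p g H" by (rule sec_M_int_dist[OF n nice_H AEv vh(3)])
 hence "fin g" using vf n by (simp add: fin_def)
 moreover have "cls M LI (%x. cls \<mu> N (%t. g (t, x))) = cls M LI ?v"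
  by (rule cls_cong_AE) (use AEv in "auto elim: eventually_mono")
 hence "V = cls M LI (%x. cls \<mu> N (%t. g (t, x)))" using v(2) by (simp only:)
 ultimately show thesis by (rule that)
qed

lemma fin_nice: "fin g ==> nice g" by (simp add: fin_def)

lemma fin_in_Lp_prod: "fin g ==> cls PM N g \<in> Lp_prod I M N d p h"
 using Lp_prod_iff[OF fin_nice, of g] by (simp add: fin_def)

lemma isometry_sec_M:
 "isometry (Lp_prod I M N d p h) (Lp_dist PM N d p) (Lp M LI dI p (h_const I M N d p h)) (Lp_dist M LI dI p) (sec_M I M N d p)"
 unfolding isometry_def isometric_mapping_def
proof (intro conjI funcsetI ballI equalityI subsetI)
 have in_L: "sec_M I M N d p F \<in> Lp M LI dI p (h_const I M N d p h)" if "F \<in> Lp_prod I M N d p h" for F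
 proof (rule Lp_prod_cases[OF that])
  fix g assume g: "fin g" "F = cls PM N g"
  show ?thesis unfolding g(2) sec_M_cls[OF fin_nice[OF g(1)]] by (rule sec_M_in[OF g(1)])
 qed
 thus "sec_M I M N d p F \<in> Lp M LI dI p (h_const I M N d p h)" if "F \<in> Lp_prod I M N d p h" for F using that .
 show "Lp_dist M LI dI p (sec_M I M N d p F) (sec_M I M N d p F') = Lp_dist PM N d p F F'"
  if "F \<in> Lp_prod I M N d p h" "F' \<in> Lp_prod I M N d p h" for F F'
 proof (rule Lp_prod_cases[OF that(1)], rule Lp_prod_cases[OF that(2)])
  fix g g' assume g: "fin g" "F = cls PM N g" and g': "fin g'" "F' = cls PM N g'"
  note n = fin_nice[OF g(1)] fin_nice[OF g'(1)]
  show ?thesis unfolding g(2) g'(2) sec_M_cls[OF n(1)] sec_M_cls[OF n(2)] sec_M_dist[OF g(1) g'(1)]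
   Lp_dist_cls[OF nice_PM[OF n(1)] nice_PM[OF n(2)]] ..
 qed
 show "V \<in> Lp M LI dI p (h_const I M N d p h)" if "V \<in> sec_M I M N d p ` Lp_prod I M N d p h" for V
  using that in_L by auto
 show "V \<in> sec_M I M N d p ` Lp_prod I M N d p h" if "V \<in> Lp M LI dI p (h_const I M N d p h)" for V
 proof (rule sec_M_surj[OF that])
  fix g assume g: "fin g" "V = cls M LI (%x. cls \<mu> N (%t. g (t, x)))"
  hence "V = sec_M I M N d p (cls PM N g)" by (simp only: sec_M_cls[OF fin_nice[OF g(1)]])
  thus ?thesis using fin_in_Lp_prod[OF g(1)] by (rule image_eqI)
 qed
qed

lemma Metric_space_LIX: "Metric_space (LpI I X DX p) (Lp_dist \<mu> X DX p)"
 unfolding LIX_eq const_h(2) by (rule X.Metric_space_Lp[OF cls_in_L0[OF const_h(1)]])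

lemma Metric_space_LM: "Metric_space (Lp M LI dI p (h_const I M N d p h)) (Lp_dist M LI dI p)"
proof (rule sec_M_representative[OF fin_H])
 fix vh assume vh: "vh \<in> L0s M LI dI" "cls M LI (%x. cls \<mu> N (%t. H (t, x))) = cls M LI vh"
 show ?thesis unfolding h_const_eq vh(2) by (rule L.Metric_space_Lp[OF cls_in_L0[OF vh(1)]])
qed

lemma inj_sec_I: "inj_on (sec_I I M N d p h) (Lp_prod I M N d p h)"
proof (rule isometry_inj_on[OF _ _ Metric_space_LIX])
 show "Metric_space (Lp_prod I M N d p h) (Lp_dist PM N d p)"
  unfolding Lp_prod_def h_hat_eq by (rule Metric_space_Lp[OF cls_in_L0[OF H_PM]])
 show "isometric_mapping (Lp_prod I M N d p h) (Lp_dist PM N d p) (LpI I X DX p) (Lp_dist \<mu> X DX p) (sec_I I M N d p h)"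
  using isometry_sec_I by (simp add: isometry_def)
qed

lemma isometry_i_bar:
 "isometry (LpI I X DX p) (Lp_dist \<mu> X DX p) (Lp M LI dI p (h_const I M N d p h)) (Lp_dist M LI dI p) (i_bar I M N d p h)"
 unfolding i_bar_def by (rule isometry_compose[OF isometry_inv_into[OF isometry_sec_I inj_sec_I] isometry_sec_M])

lemma inj_i_bar: "inj_on (i_bar I M N d p h) (LpI I X DX p)"
 by (rule isometry_inj_on[OF Metric_space_LIX _ Metric_space_LM]) (use isometry_i_bar in "simp add: isometry_def")

lemma i_bar_fin:
 assumes "fin g"
 shows "i_bar I M N d p h (cls \<mu> X (%t. cls M N (%x. g (t, x)))) = cls M LI (%x. cls \<mu> N (%t. g (t, x)))"
proof -
 have "i_bar I M N d p h (sec_I I M N d p h (cls PM N g)) = sec_M I M N d p (cls PM N g)"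
  unfolding i_bar_def comp_def using inv_into_f_f[OF inj_sec_I fin_in_Lp_prod[OF assms]] by simp
 thus ?thesis by (simp only: sec_I_cls[OF fin_nice[OF assms]] sec_M_cls[OF fin_nice[OF assms]])
qed

end

section \<open>Families of curves\<close>

text \<open>By \<open>L0sI\<close>, membership is a matter of distances to countably many points,
  and these are preserved. For the converse the dense set is taken inside the range of the composed
  map, where \<iota> can be inverted. Curves and their classes are exchanged in this way.\<close>

lemma L0s_isometric_iff:
 assumes Z1: "metric_target Z1 d1" and Z2: "metric_target Z2 d2" and \<iota>: "isometric_mapping Z1 d1 Z2 d2 \<iota>"
  and f: "f \<in> space Y \<rightarrow>\<^sub>E Z1"
 shows "f \<in> L0s Y Z1 d1 \<longleftrightarrow> (\<lambda>y\<in>space Y. \<iota> (f y)) \<in> L0s Y Z2 d2"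
proof -
 interpret Z1: metric_target Z1 d1 by fact
 interpret Z2: metric_target Z2 d2 by fact
 have \<iota>1: "\<iota> z \<in> Z2" if "z \<in> Z1" for z using \<iota> that by (auto simp: isometric_mapping_def)
 have \<iota>2: "d2 (\<iota> z) (\<iota> z') = d1 z z'" if "z \<in> Z1" "z' \<in> Z1" for z z' using \<iota> that by (auto simp: isometric_mapping_def)
 have fin: "f y \<in> Z1" if "y \<in> space Y" for y using f that by auto
 show ?thesis
 proof
  assume fL: "f \<in> L0s Y Z1 d1"
  obtain C where C: "countable C" "C \<subseteq> Z1" "!!y e. y \<in> space Y ==> e > 0 ==> \<exists>z\<in>C. d1 (f y) z < e"
   by (rule Z1.L0s_dense[OF fL]) (rule that, assumption+)
  show "(\<lambda>y\<in>space Y. \<iota> (f y)) \<in> L0s Y Z2 d2"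
  proof (rule Z2.L0sI)
   show "(\<lambda>y\<in>space Y. \<iota> (f y)) \<in> space Y \<rightarrow>\<^sub>E Z2" using fin \<iota>1 by auto
   show "countable (\<iota> ` C)" "\<iota> ` C \<subseteq> Z2" using C(1,2) \<iota>1 by auto
   fix y and e :: real assume y: "y \<in> space Y" and e: "0 < e"
   obtain z where z: "z \<in> C" "d1 (f y) z < e" using C(3)[OF y e] by blast
   have "z \<in> Z1" using z(1) C(2) by blast
   thus "\<exists>z\<in>\<iota> ` C. d2 ((\<lambda>y\<in>space Y. \<iota> (f y)) y) z < e" using z y \<iota>2[OF fin[OF y], of z] by (auto intro!: bexI[of _ z])
  next
   fix z' assume "z' \<in> \<iota> ` C"
   then obtain z where z: "z' = \<iota> z" "z \<in> Z1" using C(2) by blast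
   have "(%y. d2 ((\<lambda>y\<in>space Y. \<iota> (f y)) y) z') \<in> borel_measurable Y \<longleftrightarrow> (%y. d1 (f y) z) \<in> borel_measurable Y"
    by (rule measurable_cong) (simp add: z(1) \<iota>2[OF fin z(2)])
   thus "(%y. d2 ((\<lambda>y\<in>space Y. \<iota> (f y)) y) z') \<in> borel_measurable Y" using Z1.L0s_dist_const[OF fL z(2)] by blast
  qed
 next
  assume fL: "(\<lambda>y\<in>space Y. \<iota> (f y)) \<in> L0s Y Z2 d2"
  obtain C where C: "countable C" "C \<subseteq> (\<lambda>y\<in>space Y. \<iota> (f y)) ` space Y" "C \<subseteq> Z2"
   "!!y e. y \<in> space Y ==> e > 0 ==> \<exists>z\<in>C. d2 ((\<lambda>y\<in>space Y. \<iota> (f y)) y) z < e"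
   by (rule Z2.L0s_dense[OF fL]) (rule that, assumption+)
  have CZ: "C \<subseteq> \<iota> ` Z1" using C(2) fin by auto
  let ?D = "inv_into Z1 \<iota> ` C"
  have inv: "inv_into Z1 \<iota> z \<in> Z1" "\<iota> (inv_into Z1 \<iota> z) = z" if "z \<in> C" for z
   using that CZ by (auto intro!: inv_into_into f_inv_into_f)
  show "f \<in> L0s Y Z1 d1"
  proof (rule Z1.L0sI[OF f])
   show "countable ?D" "?D \<subseteq> Z1" using C(1) inv(1) by auto
   fix y and e :: real assume y: "y \<in> space Y" and e: "0 < e"
   obtain z where z: "z \<in> C" "d2 ((\<lambda>y\<in>space Y. \<iota> (f y)) y) z < e" using C(4)[OF y e] by blast
   have "d1 (f y) (inv_into Z1 \<iota> z) < e" using \<iota>2[OF fin[OF y] inv(1)[OF z(1)]] inv(2)[OF z(1)] z(2) y by simp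
   thus "\<exists>z\<in>?D. d1 (f y) z < e" using z(1) by blast
  next
   fix z' assume "z' \<in> ?D"
   then obtain z where z: "z \<in> C" "z' = inv_into Z1 \<iota> z" by blast
   have "(%y. d2 ((\<lambda>y\<in>space Y. \<iota> (f y)) y) z) \<in> borel_measurable Y \<longleftrightarrow> (%y. d1 (f y) z') \<in> borel_measurable Y"
    by (rule measurable_cong) (use \<iota>2[OF fin inv(1)[OF z(1)]] inv(2)[OF z(1)] z(2) in simp)
   thus "(%y. d1 (f y) z') \<in> borel_measurable Y" using Z2.L0s_dist_const[OF fL, of z] z(1) C(3) by blast
  qed
 qed
qed

text \<open>\<open>push\<close> composes with an arbitrarily chosen compatible representative; two
  of them agree almost everywhere, and so do the compositions.\<close>

lemma push_cls:
 assumes "f \<in> space Y \<rightarrow> D" "f \<in> cls Y Z f"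
 shows "compatible Y D (cls Y Z f) f" and "push Y D W \<phi> (cls Y Z f) = cls Y W (%y. \<phi> (f y))"
proof -
 show c: "compatible Y D (cls Y Z f) f" using assms by (simp add: compatible_def)
 let ?g = "SOME g. compatible Y D (cls Y Z f) g"
 have "compatible Y D (cls Y Z f) ?g" by (rule someI[of _ f]) (rule c)
 hence "?g \<in> cls Y Z f" unfolding compatible_def by (rule conjunct1)
 hence "AE y in Y. ?g y = f y" by (rule cls_memD)
 hence "AE y in Y. (\<phi> \<circ> ?g) y = \<phi> (f y)" by eventually_elim simp
 thus "push Y D W \<phi> (cls Y Z f) = cls Y W (%y. \<phi> (f y))" unfolding push_def by (rule cls_cong_AE)
qed

context dyadic_interval
begin

lemma \<phi>_measurable: "\<phi> n \<in> measurable (lebesgue_on {a..b}) (count_space UNIV)"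
proof -
 have "\<phi> n \<in> measurable lborel (count_space UNIV)" unfolding \<phi>_def[abs_def] by measurable
 thus ?thesis by (intro measurable_restrict_space1 measurable_completion)
qed

text \<open>Every neighbourhood of t in the interval, also at an endpoint, has positive measure.
  Continuity then extends almost everywhere statements about curves to every t.\<close>

lemma AE_interval_near:
 assumes P: "AE s in lebesgue_on {a..b}. P s" and t: "t \<in> {a..b}" and e: "0 < e"
 shows "\<exists>s\<in>{a..b}. \<bar>s - t\<bar> < e & P s"
proof (rule ccontr)
 assume neg: "\<not> ?thesis"
 define l r where "l = max a (t - e/2)" and "r = min b (t + e/2)"
 have lr: "l < r" "{l..r} \<subseteq> {a..b}" using ab t e by (auto simp: l_def r_def)
 have near: "s \<in> {a..b} & \<bar>s - t\<bar> < e" if "s \<in> {l..r}" for s using that e by (auto simp: l_def r_def)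
 have S: "{l..r} \<in> sets (lebesgue_on {a..b})" using lr(2) by (auto simp: sets_restrict_space intro!: image_eqI[of _ _ "{l..r}"])
 have "AE s in lebesgue_on {a..b}. s \<notin> {l..r}" using P by eventually_elim (use neg near in blast)
 hence "{l..r} \<in> null_sets (lebesgue_on {a..b})" by (subst AE_iff_null_sets[OF S])
 hence "emeasure (lebesgue_on {a..b}) {l..r} = 0" by (rule null_setsD1)
 thus False using lr by (simp add: emeasure_restrict_space)
qed

end

section \<open>The metric space of absolutely continuous curves\<close>

context ac_setting
begin

lemma AC_ext: "c \<in> AC {a..b} Z d p ==> c \<in> {a..b} \<rightarrow>\<^sub>E Z" by (simp add: AC_def)

lemma AC_in: "c \<in> AC {a..b} Z d p ==> t \<in> {a..b} ==> c t \<in> Z" by (auto simp: AC_def)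

lemma AC_tendsto:
 assumes c: "c \<in> AC {a..b} Z d p" and x: "!!n. x n \<in> {a..b}" "x \<longlonglongrightarrow> t" "t \<in> {a..b}"
 shows "(%n. d (c (x n)) (c t)) \<longlonglongrightarrow> 0"
proof -
 obtain m where m: "integrable lebesgue m" "!!x. 0 <= m x"
  "!!s t. a <= s ==> s <= t ==> t <= b ==> d (c s) (c t) <= (LINT x:{s..t}|lebesgue. m x)"
  by (rule AC_majorant[OF c]) (rule that, assumption+)
 show ?thesis by (rule AC_small_dist[OF m(1,3) x m(2)])
qed

lemma AC_const: "z \<in> Z ==> (\<lambda>t\<in>{a..b}. z) \<in> AC {a..b} Z d p"
 by (rule AC_I[where m = "%_. 0"]) auto

text \<open>By continuity the curve is the pointwise limit of the step functions given by its values
  at the last dyadic nodes.\<close>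

lemma AC_L0s:
 assumes c: "c \<in> AC {a..b} Z d p"
 shows "c \<in> L0s (lebesgue_on {a..b}) Z d"
proof -
 let ?F = "%n i. \<lambda>t\<in>space (lebesgue_on {a..b}). c (\<tau> n (min i (2 ^ n)))"
 have F: "?F n i \<in> L0s (lebesgue_on {a..b}) Z d" for n i by (rule L0s_const) (intro AC_in[OF c] \<tau>_in, simp)
 show ?thesis
 proof (rule L0s_limit[OF L0s_pieces[OF F \<phi>_measurable]])
  show "c \<in> space (lebesgue_on {a..b}) \<rightarrow>\<^sub>E Z" using AC_ext[OF c] by simp
  fix t assume "t \<in> space (lebesgue_on {a..b})"
  hence t: "t \<in> {a..b}" by simp
  have "(%n. d (c (\<tau> n (\<phi> n t))) (c t)) \<longlonglongrightarrow> 0"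
   by (rule AC_tendsto[OF c _ \<tau>_\<phi>_tendsto[OF t] t]) (intro \<tau>_in \<phi>_bounds(3)[OF t])
  moreover have "(\<lambda>y\<in>space (lebesgue_on {a..b}). ?F n (\<phi> n y) y) t = c (\<tau> n (\<phi> n t))" for n
   using t \<phi>_bounds(3)[OF t, of n] by (simp add: min_absorb1)
  ultimately show "(%n. d ((\<lambda>y\<in>space (lebesgue_on {a..b}). ?F n (\<phi> n y) y) t) (c t)) \<longlonglongrightarrow> 0" by simp
 qed
qed

lemma AC_bounded:
 assumes c: "c \<in> AC {a..b} Z d p"
 obtains B where "!!t. t \<in> {a..b} ==> d (c a) (c t) <= B"
proof -
 obtain m where m: "integrable lebesgue m" "!!x. 0 <= m x"
  "!!s t. a <= s ==> s <= t ==> t <= b ==> d (c s) (c t) <= (LINT x:{s..t}|lebesgue. m x)"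
  by (rule AC_majorant[OF c]) (rule that, assumption+)
 show thesis
 proof (rule that)
  fix t assume t: "t \<in> {a..b}"
  have "(LINT x:{a..t}|lebesgue. m x) <= (LINT x|lebesgue. m x)"
   unfolding set_lebesgue_integral_def
   by (rule integral_mono) (use m integrable_mult_indicator[OF _ m(1), of "{a..t}"] in "auto split: split_indicator")
  thus "d (c a) (c t) <= (LINT x|lebesgue. m x)" using m(3)[of a t] t by simp
 qed
qed

lemma AC_int_dist_finite:
 assumes c: "c \<in> AC {a..b} Z d p" and c': "c' \<in> AC {a..b} Z d p"
 shows "int_dist_powr (lebesgue_on {a..b}) d p c c' < \<infinity>"
proof -
 interpret F: finite_measure "lebesgue_on {a..b}" by (rule finite_measure_interval)
 obtain B where B: "!!t. t \<in> {a..b} ==> d (c a) (c t) <= B" by (rule AC_bounded[OF c]) (rule that)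
 obtain B' where B': "!!t. t \<in> {a..b} ==> d (c' a) (c' t) <= B'" by (rule AC_bounded[OF c']) (rule that)
 have aI: "a \<in> {a..b}" using ab by simp
 define K where "K = B + d (c a) (c' a) + B'"
 have le: "d (c t) (c' t) <= K" if t: "t \<in> {a..b}" for t
 proof -
  have "d (c t) (c' t) <= d (c t) (c a) + d (c a) (c' t)" by (rule triangle) (intro AC_in[OF c] AC_in[OF c'] t aI)+
  moreover have "d (c a) (c' t) <= d (c a) (c' a) + d (c' a) (c' t)" by (rule triangle) (intro AC_in[OF c] AC_in[OF c'] t aI)+
  ultimately show ?thesis using B[OF t] B'[OF t] commute[of "c t" "c a"] by (simp add: K_def)
 qed
 have "int_dist_powr (lebesgue_on {a..b}) d p c c' <= (\<integral>\<^sup>+ t. ennreal (K powr p) \<partial>lebesgue_on {a..b})"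
  unfolding int_dist_powr_def by (rule nn_integral_mono) (use le p_gt_1 in "auto intro!: ennreal_leI powr_mono2")
 also have "\<dots> < \<infinity>" using F.emeasure_finite[of "space (lebesgue_on {a..b})"]
  by (auto simp: ennreal_mult_eq_top_iff less_top[symmetric])
 finally show ?thesis .
qed

text \<open>Near any t there are times at which the curves agree, and both are continuous. This is
  the injectivity of the maps from curves to classes.\<close>

lemma AC_eq_if_AE:
 assumes c: "c \<in> AC {a..b} Z d p" and c': "c' \<in> AC {a..b} Z d p" and ae: "AE t in lebesgue_on {a..b}. c t = c' t"
 shows "c = c'"
proof
 fix t show "c t = c' t"
 proof (cases "t \<in> {a..b}")
  case t: True
  have "ALL n. EX s. s \<in> {a..b} & \<bar>s - t\<bar> < inverse (real (Suc n)) & c s = c' s"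
   using AE_interval_near[OF ae t] by (meson inverse_positive_iff_positive of_nat_0_less_iff zero_less_Suc)
  from choice[OF this] obtain s where s: "!!n. s n \<in> {a..b}" "!!n. \<bar>s n - t\<bar> < inverse (real (Suc n))" "!!n. c (s n) = c' (s n)" by blast
  have "(%n. s n - t) \<longlonglongrightarrow> 0"
   by (rule Lim_null_comparison[OF _ LIMSEQ_inverse_real_of_nat]) (use s(2) in "auto intro!: always_eventually less_imp_le")
  hence lim: "s \<longlonglongrightarrow> t" by (rule LIM_zero_cancel)
  have "(%n. d (c (s n)) (c t) + d (c' (s n)) (c' t)) \<longlonglongrightarrow> 0 + 0"
   by (intro tendsto_add AC_tendsto[OF c s(1) lim t] AC_tendsto[OF c' s(1) lim t])
  moreover have "d (c t) (c' t) <= d (c (s n)) (c t) + d (c' (s n)) (c' t)" for n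
   using triangle[OF AC_in[OF c t] AC_in[OF c s(1)[of n]] AC_in[OF c' t]] commute[of "c t" "c (s n)"] s(3)[of n] by simp
  ultimately have "d (c t) (c' t) <= 0" by (auto intro: LIMSEQ_le_const)
  thus ?thesis using zero[OF AC_in[OF c t] AC_in[OF c' t]] nonneg[of "c t" "c' t"] by simp
 next
  case False
  thus ?thesis using AC_ext[OF c] AC_ext[OF c'] by (auto simp: PiE_def extensional_def)
 qed
qed

lemma Metric_space_AC: "Metric_space (AC {a..b} Z d p) (map_dist (lebesgue_on {a..b}) d p)"
proof
 fix c c' c'' assume c: "c \<in> AC {a..b} Z d p" and c': "c' \<in> AC {a..b} Z d p"
 show "map_dist (lebesgue_on {a..b}) d p c c' = 0 \<longleftrightarrow> c = c'"
  unfolding map_dist_eq_0[OF AC_L0s[OF c] AC_L0s[OF c'] AC_int_dist_finite[OF c c']]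
  using AC_eq_if_AE[OF c c'] by auto
 assume c'': "c'' \<in> AC {a..b} Z d p"
 show "map_dist (lebesgue_on {a..b}) d p c c'' <= map_dist (lebesgue_on {a..b}) d p c c' + map_dist (lebesgue_on {a..b}) d p c' c''"
  by (rule map_dist_triangle(2)[OF AC_L0s[OF c] AC_L0s[OF c'] AC_L0s[OF c''] AC_int_dist_finite[OF c c'] AC_int_dist_finite[OF c' c'']])
qed (auto simp: map_dist_nonneg intro: map_dist_commute)

lemma Lp_target_AC: "Lp_target (AC {a..b} Z d p) (map_dist (lebesgue_on {a..b}) d p) p"
 by (intro Lp_target.intro metric_target.intro Metric_space_AC Lp_target_axioms.intro p_gt_1)

end

section \<open>Families of curves given by jointly measurable maps\<close>

context sections
begin

abbreviation "AN \<equiv> AC {a..b} N d p"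
abbreviation "dA \<equiv> map_dist (lebesgue_on {a..b}) d p"
abbreviation "ACX \<equiv> AC {a..b} (Lp M N d p h) (Lp_dist M N d p) p"
abbreviation "q \<equiv> q_map {a..b} N"

sublocale X: ac_setting X DX p a b
 by (intro ac_setting.intro Lp_target_Lp[OF h]) unfold_locales

sublocale A: Lp_target AN dA p by (rule Lp_target_AC)

lemma k0_AC: "k0 \<in> AN" unfolding k0_def by (rule AC_const[OF z0])

lemma isometric_q: "isometric_mapping AN dA LI dI q"
 unfolding isometric_mapping_def q_map_def
proof (intro conjI funcsetI ballI)
 fix c c' assume c: "c \<in> AN"
 show "cls \<mu> N c \<in> LI"
  unfolding LI_eq cls_in_Lp_iff[OF AC_L0s[OF c] k0] by (rule AC_int_dist_finite[OF c k0_AC])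
 assume c': "c' \<in> AN"
 show "dI (cls \<mu> N c) (cls \<mu> N c') = dA c c'" by (rule Lp_dist_cls[OF AC_L0s[OF c] AC_L0s[OF c']])
qed

lemma q_in: "c \<in> AN ==> q c \<in> LI" using isometric_q by (auto simp: isometric_mapping_def)

lemma inj_q: "inj_on q AN"
 by (rule isometry_inj_on[OF Metric_space_AC isometric_q]) (rule L.Metric_space_axioms)

lemma Q_in: 
 assumes "c \<in> ACX" shows "cls \<mu> X c \<in> LpI I X DX p"
proof -
 have "const_h \<in> ACX" unfolding const_h_def by (rule X.AC_const[OF h_in_X])
 thus ?thesis unfolding LIX_eq const_h(2) cls_in_Lp_iff[OF X.AC_L0s[OF assms] const_h(1)]
  by (rule X.AC_int_dist_finite[OF assms])
qed

lemma inj_Q: "inj_on (cls \<mu> X) ACX"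
proof (rule inj_onI)
 fix c c' assume c: "c \<in> ACX" "c' \<in> ACX" "cls \<mu> X c = cls \<mu> X c'"
 have "AE t in \<mu>. c t = c' t" using c(3) cls_eq_iff[of c \<mu> X c'] X.AC_ext[OF c(1)] by simp
 thus "c = c'" by (rule X.AC_eq_if_AE[OF c(1,2)])
qed

definition AC_nice :: "(real \<times> 'm => 'n) => bool" where
 "AC_nice g \<longleftrightarrow> nice g & (\<forall>x\<in>space M. (\<lambda>t\<in>I. g (t, x)) \<in> AN)"

definition curves :: "(real \<times> 'm => 'n) => 'm => real => 'n" where
 "curves g = (\<lambda>x\<in>space M. \<lambda>t\<in>I. g (t, x))"

lemma AC_niceD: "AC_nice g ==> nice g" by (simp add: AC_nice_def)

lemma curves_in: "AC_nice g ==> x \<in> space M ==> curves g x \<in> AN" by (simp add: AC_nice_def curves_def)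

lemma curves_ext: "AC_nice g ==> curves g \<in> space M \<rightarrow>\<^sub>E AN"
 using curves_in[of g] by (auto simp: curves_def PiE_def)

lemma AC_nice_H: "AC_nice H"
 unfolding AC_nice_def
proof (intro conjI nice_H ballI)
 fix x assume x: "x \<in> space M"
 have "(\<lambda>t\<in>I. H (t, x)) = (\<lambda>t\<in>I. h0 x)" by (rule restrict_ext) (simp add: H_eq x)
 thus "(\<lambda>t\<in>I. H (t, x)) \<in> AN" using AC_const[OF L0s_in[OF h0 x]] by simp
qed

text \<open>Measurability and separability are known for the classes of the curves, by
  \<open>Lp_classes_L0sI\<close>, and are pulled back along the isometric map
  \<open>q\<close>.\<close>

lemma curves_L0s:
 assumes g: "AC_nice g" shows "curves g \<in> L0s M AN dA"
proof -
 have n: "nice g" by (rule AC_niceD[OF g])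
 let ?g = "\<lambda>z\<in>space (M \<Otimes>\<^sub>M \<mu>). g (snd z, fst z)"
 have sf: "sigma_finite_set \<mu> (space \<mu>)" by (rule sigma_finite_set_space[OF fin_\<mu>])
 have "(\<lambda>x\<in>space M. cls \<mu> N (%t. ?g (x, t))) \<in> L0s M (Lp \<mu> N d p (cls \<mu> N k0)) dI"
 proof (rule Lp_classes_L0sI[OF k0 L0s_swap[OF niceD[OF n]] sf])
  fix x assume x: "x \<in> space M"
  have "int_dist_powr \<mu> d p (%t. ?g (x, t)) k0 = int_dist_powr \<mu> d p (curves g x) k0"
   unfolding int_dist_powr_def by (rule nn_integral_cong) (simp add: curves_def x space_pair_measure)
  thus "int_dist_powr \<mu> d p (%t. ?g (x, t)) k0 < \<infinity>" using AC_int_dist_finite[OF curves_in[OF g x] k0_AC] by simp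
 qed auto
 moreover have "(\<lambda>x\<in>space M. cls \<mu> N (%t. ?g (x, t))) = (\<lambda>x\<in>space M. q (curves g x))"
  unfolding q_map_def by (rule restrict_ext, rule cls_cong) (simp add: curves_def space_pair_measure)
 ultimately have "(\<lambda>x\<in>space M. q (curves g x)) \<in> L0s M LI dI" by (simp only: LI_eq)
 thus ?thesis
  unfolding L0s_isometric_iff[OF A.metric_target_axioms L.metric_target_axioms isometric_q curves_ext[OF g]] .
qed

lemma curves_dist:
 assumes g: "AC_nice g" "AC_nice g'"
 shows "int_dist_powr M dA p (curves g) (curves g') = int_dist_powr PM d p g g'"
proof -
 have "ennreal (dA (curves g x) (curves g' x) powr p) = Jx g g' x" if x: "x \<in> space M" for x
  unfolding map_dist_powr[OF AC_int_dist_finite[OF curves_in[OF g(1) x] curves_in[OF g(2) x]]]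
  unfolding int_dist_powr_def by (rule nn_integral_cong) (simp add: curves_def x)
 hence "int_dist_powr M dA p (curves g) (curves g') = (\<integral>\<^sup>+ x. Jx g g' x \<partial>M)"
  unfolding int_dist_powr_def[of M dA] by (rule nn_integral_cong)
 thus ?thesis by (simp add: nice_Tonelli(2)[OF AC_niceD[OF g(1)] AC_niceD[OF g(2)]])
qed

lemma h_const_AC_eq: "h_const_AC I M N d p h = cls M AN (curves H)"
 unfolding h_const_AC_def by (rule cls_cong) (auto simp: curves_def H_eq)

lemma curves_LA: "AC_nice g ==> cls M AN (curves g) \<in> Lp_AC I M N d p h \<longleftrightarrow> fin g"
 unfolding Lp_AC_def h_const_AC_eq fin_def
 using cls_in_Lp_iff[OF curves_L0s[of g] curves_L0s[OF AC_nice_H], of p] by (simp add: curves_dist AC_nice_H AC_niceD)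

lemma Lp_dist_curves:
 assumes "AC_nice g" "AC_nice g'" "fin g" "fin g'"
 shows "Lp_dist M AN dA p (cls M AN (curves g)) (cls M AN (curves g'))
  = Lp_dist M LI dI p (cls M LI (%x. cls \<mu> N (%t. g (t, x)))) (cls M LI (%x. cls \<mu> N (%t. g' (t, x))))"
 unfolding sec_M_dist[OF assms(3,4)] Lp_dist_cls[OF curves_L0s[OF assms(1)] curves_L0s[OF assms(2)]] map_dist_def[of _ dA]
  curves_dist[OF assms(1,2)] by (simp add: map_dist_def)

definition section_class :: "(real \<times> 'm => 'n) => ('m => (real => 'n) set) set" where
 "section_class g = cls M LI (%x. cls \<mu> N (%t. g (t, x)))"

text \<open>Each push-forward in the theorem is evaluated on the family of curves of one jointly
  measurable g; afterwards the maps only relabel g.\<close>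

lemma section_class_q:
 assumes g: "AC_nice g"
 shows "section_class g = cls M LI (\<lambda>x\<in>space M. q (curves g x))"
  and "(\<lambda>x\<in>space M. q (curves g x)) \<in> cls M LI (\<lambda>x\<in>space M. q (curves g x))"
  and "q_push I M N d p (cls M AN (curves g)) = section_class g"
  and "compatible M (q ` AN) (section_class g) (\<lambda>x\<in>space M. q (curves g x))"
  and "q_inv_push I M N d p (section_class g) = cls M AN (curves g)"
  and "t \<in> I ==> e_push I M N d p t (cls M AN (curves g)) = cls M N (%x. g (t, x))"
proof -
 show 1: "section_class g = cls M LI (\<lambda>x\<in>space M. q (curves g x))"
  unfolding section_class_def by (rule cls_cong, simp add: q_map_def, rule cls_cong) (simp add: curves_def)
 show 2: "(\<lambda>x\<in>space M. q (curves g x)) \<in> cls M LI (\<lambda>x\<in>space M. q (curves g x))"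
  by (rule cls_self) (use q_in curves_in[OF g] in auto)
 have cs: "curves g \<in> space M \<rightarrow> AN" "curves g \<in> cls M AN (curves g)" using curves_ext[OF g] cls_self[OF curves_ext[OF g]] by auto
 show "q_push I M N d p (cls M AN (curves g)) = section_class g"
  unfolding q_push_def push_cls(2)[OF cs] 1 by (rule cls_cong) simp
 have im: "(\<lambda>x\<in>space M. q (curves g x)) \<in> space M \<rightarrow> q ` AN" using curves_in[OF g] by auto
 show "compatible M (q ` AN) (section_class g) (\<lambda>x\<in>space M. q (curves g x))" unfolding 1 by (rule push_cls(1)[OF im 2])
 show "q_inv_push I M N d p (section_class g) = cls M AN (curves g)"
  unfolding q_inv_push_def 1 push_cls(2)[OF im 2]
  by (rule cls_cong) (simp add: inv_into_f_f[OF inj_q curves_in[OF g]])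
 show "t \<in> I ==> e_push I M N d p t (cls M AN (curves g)) = cls M N (%x. g (t, x))"
  unfolding e_push_def push_cls(2)[OF cs] by (rule cls_cong) (simp add: curves_def)
qed

text \<open>The sections of g represent c at every time, not merely at almost every time; this is
  what the evaluation formula rests on.\<close>

definition lifts :: "(real => ('m => 'n) set) => (real \<times> 'm => 'n) => bool" where
 "lifts c g \<longleftrightarrow> AC_nice g & fin g & c \<in> ACX & (\<forall>t\<in>I. c t = cls M N (%x. g (t, x)))"

lemma lifts_i_bar: "lifts c g ==> i_bar I M N d p h (cls \<mu> X c) = section_class g"
proof -
 assume "lifts c g"
 hence g: "fin g" "!!t. t \<in> I ==> c t = cls M N (%x. g (t, x))" by (auto simp: lifts_def)
 have "cls \<mu> X c = cls \<mu> X (%t. cls M N (%x. g (t, x)))" by (rule cls_cong) (simp add: g(2))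
 thus ?thesis unfolding section_class_def by (simp only: i_bar_fin[OF g(1)])
qed

lemma lifts_i_tilde: "lifts c g ==> i_tilde I M N d p h c = cls M AN (curves g)"
 using lifts_i_bar[of c g] section_class_q(5)[of g] by (simp add: i_tilde_def Q_map_def lifts_def)

end

section \<open>Lifting curves of classes\<close>

lemma sum_double: "(\<Sum>j<2 * k. f j) = (\<Sum>i<k. f (2 * i) + f (2 * i + 1))" for k :: nat and f :: "nat => real"
 by (induction k) simp_all

lemma (in dyadic_interval) \<delta>_neq_0 [simp]: "\<delta> n ~= 0"
 using less_imp_neq[OF \<delta>_pos[of n]] by (rule not_sym)

context ac_setting
begin

text \<open>Convexity with l = 1/2 costs a factor 2^(p-1) when a cell is bisected, and this is
  exactly the factor by which \<delta>^(p-1) shrinks.\<close>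

lemma energy_mono:
 assumes inZ: "!!n i. i <= 2 ^ n ==> \<gamma> (\<tau> n i) \<in> Z"
 shows "(\<Sum>i<2 ^ n. d (\<gamma> (\<tau> n i)) (\<gamma> (\<tau> n (Suc i))) powr p) / \<delta> n powr (p - 1)
  <= (\<Sum>i<2 ^ Suc n. d (\<gamma> (\<tau> (Suc n) i)) (\<gamma> (\<tau> (Suc n) (Suc i))) powr p) / \<delta> (Suc n) powr (p - 1)"
proof -
 let ?u = "%i. d (\<gamma> (\<tau> (Suc n) i)) (\<gamma> (\<tau> (Suc n) (Suc i)))"
 have half: "(1/2::real) powr (1 - p) = 2 powr (p - 1)"
  using powr_minus[of "2::real" "1 - p"] by (simp add: powr_divide inverse_eq_divide)
 have \<delta>2: "\<delta> n powr (p - 1) = 2 powr (p - 1) * \<delta> (Suc n) powr (p - 1)" unfolding \<delta>_Suc[of n] by (simp add: powr_mult)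
 have step: "d (\<gamma> (\<tau> n i)) (\<gamma> (\<tau> n (Suc i))) powr p <= 2 powr (p - 1) * (?u (2 * i) powr p + ?u (2 * i + 1) powr p)"
  if i: "i < 2 ^ n" for i
 proof -
  have \<tau>: "\<tau> n i = \<tau> (Suc n) (2 * i)" "\<tau> n (Suc i) = \<tau> (Suc n) (Suc (2 * i + 1))"
   using \<tau>_refine[of n i 1] \<tau>_refine[of n "Suc i" 1] by simp_all
  have "d (\<gamma> (\<tau> n i)) (\<gamma> (\<tau> n (Suc i))) <= ?u (2 * i) + ?u (2 * i + 1)"
   unfolding \<tau> Suc_eq_plus1[symmetric] by (rule triangle) (intro inZ, use i in simp)+
  hence "d (\<gamma> (\<tau> n i)) (\<gamma> (\<tau> n (Suc i))) powr p <= (?u (2 * i) + ?u (2 * i + 1)) powr p"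
   using p_gt_1 by (intro powr_mono2) auto
  also have "\<dots> <= (1/2) powr (1 - p) * ?u (2 * i) powr p + (1 - 1/2) powr (1 - p) * ?u (2 * i + 1) powr p"
   by (rule powr_convex_combination[OF p_gt_1]) auto
  finally show ?thesis using half by (simp add: distrib_left)
 qed
 have "(\<Sum>i<2 ^ n. d (\<gamma> (\<tau> n i)) (\<gamma> (\<tau> n (Suc i))) powr p) <= (\<Sum>i<2 ^ n. 2 powr (p - 1) * (?u (2 * i) powr p + ?u (2 * i + 1) powr p))"
  by (rule sum_mono) (use step in simp)
 also have "\<dots> = 2 powr (p - 1) * (\<Sum>i<2 ^ Suc n. ?u i powr p)"
  using sum_double[of "%i. ?u i powr p" "2 ^ n"] by (simp add: sum_distrib_left)
 finally show ?thesis unfolding \<delta>2 by (simp add: divide_simps mult_ac)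
qed

text \<open>\<open>dyadic_extension\<close> yields a continuous limit whose energies are those of
  the dyadic data. Its metric derivative is p-integrable by the energy bound and serves as the
  majorant demanded by \<open>AC\<close>.\<close>

lemma AC_extension:
 assumes compl: "mcomplete" and inZ: "!!n i. i <= 2 ^ n ==> \<gamma> (\<tau> n i) \<in> Z"
  and K: "!!n. (\<Sum>i<2 ^ n. d (\<gamma> (\<tau> n i)) (\<gamma> (\<tau> n (Suc i))) powr p) / \<delta> n powr (p - 1) <= K"
 obtains f where "f \<in> AC {a..b} Z d p" "!!n i. i <= 2 ^ n ==> f (\<tau> n i) = \<gamma> (\<tau> n i)"
proof -
 have K': "(\<Sum>i<2 ^ n. d (\<gamma> (\<tau> n i)) (\<gamma> (\<tau> n (Suc i))) powr p) <= K * \<delta> n powr (p - 1)" for n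
 proof -
  have "0 < \<delta> n powr (p - 1)" by simp
  from pos_divide_le_eq[OF this] K[of n] show ?thesis by blast
 qed
 have small: "\<exists>\<theta>>0. ALL n J. J \<subseteq> {..<2 ^ n} -->
    (\<Sum>i\<in>J. d (\<gamma> (\<tau> n i)) (\<gamma> (\<tau> n (Suc i)))) <= \<theta> * (real (card J) * \<delta> n) + e" if "0 < e" for e
  by (rule small_of_energy[OF p_gt_1 nonneg K' that])
 obtain f where f: "f \<in> {a..b} \<rightarrow>\<^sub>E Z" "ac_curve Z d a b f" "!!n i. i <= 2 ^ n ==> f (\<tau> n i) = \<gamma> (\<tau> n i)"
  by (rule dyadic_extension[OF compl inZ small]) (assumption | rule that)+
 have "(\<Sum>i<2 ^ n. d (f (\<tau> n i)) (f (\<tau> n (Suc i))) powr p) <= K * \<delta> n powr (p - 1)" for n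
  using K'[of n] by (simp add: f(3))
 then obtain G where G: "integrable lebesgue G" "!!x. 0 <= G x" "(\<integral>\<^sup>+ x. ennreal (G x powr p) \<partial>lebesgue) < \<infinity>"
  "!!s t. a <= s ==> s <= t ==> t <= b ==> d (f s) (f t) <= (LINT x:{s..t}|lebesgue. G x)"
  by (rule metric_derivative_AC[OF f(2)]) (rule that, assumption+)
 have "f \<in> AC {a..b} Z d p" by (rule AC_I[OF f(1) G(1) _ G(4)]) (use G(2,3) in auto)
 thus thesis by (rule that) (rule f(3))
qed

end

context sections
begin

lemma lifts_exist:
 assumes c: "c \<in> ACX"
 obtains g where "lifts c g"
proof -
 define \<gamma> where "\<gamma> t = rep M N d (c t)" for t
 have \<gamma>L: "\<gamma> t \<in> L0s M N d" and \<gamma>c: "cls M N (\<gamma> t) = c t" if "t \<in> I" for t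
  unfolding \<gamma>_def using LpD(1,3)[OF X.AC_in[OF c that] h] by auto
 have \<gamma>D: "int_dist_powr M d p (\<gamma> s) (\<gamma> t) = ennreal (DX (c s) (c t) powr p)" if "s \<in> I" "t \<in> I" for s t
  unfolding \<gamma>_def by (rule Lp_dist_powr[OF X.AC_in[OF c that(1)] X.AC_in[OF c that(2)] h, symmetric])
 have \<gamma>N: "\<gamma> t x \<in> N" if "t \<in> I" "x \<in> space M" for t x using L0s_in[OF \<gamma>L[OF that(1)] that(2)] .
 define E where "E n x = (\<Sum>i<2 ^ n. d (\<gamma> (\<tau> n i) x) (\<gamma> (\<tau> n (Suc i)) x) powr p) / \<delta> n powr (p - 1)" for n x
 have \<tau>I: "\<tau> n i \<in> I" "\<tau> n (Suc i) \<in> I" if "i < 2 ^ n" for n i by (rule \<tau>_in, use that in simp)+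
 have dm: "(%x. d (\<gamma> (\<tau> n i) x) (\<gamma> (\<tau> n (Suc i)) x)) \<in> borel_measurable M" if "i < 2 ^ n" for n i
  by (rule L0s_dist_measurable[OF \<gamma>L[OF \<tau>I(1)[OF that]] \<gamma>L[OF \<tau>I(2)[OF that]]])
 have Em [measurable]: "E n \<in> borel_measurable M" for n
  unfolding E_def[abs_def] by (intro borel_measurable_divide borel_measurable_sum powr_real_measurable borel_measurable_const dm) (simp add: lessThan_iff)
 have E0: "0 <= E n x" for n x unfolding E_def by (intro divide_nonneg_nonneg sum_nonneg) auto
 have mono: "E n x <= E (Suc n) x" if "x \<in> space M" for n x
  unfolding E_def by (rule energy_mono[of "%t. \<gamma> t x"]) (intro \<gamma>N \<tau>_in that)
 obtain K where K: "K \<ge> 0" "!!n. (\<Sum>i<2 ^ n. DX (c (\<tau> n i)) (c (\<tau> n (Suc i))) powr p) <= K * \<delta> n powr (p - 1)"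
  using X.AC_ac_curve(2)[OF c] by blast
 have IE: "(\<integral>\<^sup>+ x. ennreal (E n x) \<partial>M) <= ennreal K" for n
 proof -
  let ?w = "%i x. d (\<gamma> (\<tau> n i) x) (\<gamma> (\<tau> n (Suc i)) x) powr p" and ?r = "1 / \<delta> n powr (p - 1)"
  have wm: "(%x. ennreal (?w i x)) \<in> borel_measurable M" if "i \<in> {..<2 ^ n}" for i
   using dm[of i n] that by (intro measurable_compose[OF _ measurable_ennreal] powr_real_measurable borel_measurable_const) auto
  have r0: "0 <= ?r" by simp
  have "ennreal (E n x) = ennreal ?r * (\<Sum>i<2 ^ n. ennreal (?w i x))" for x
  proof -
   have "E n x = ?r * (\<Sum>i<2 ^ n. ?w i x)" by (simp add: E_def)
   thus ?thesis by (simp only: ennreal_mult'[OF r0] sum_ennreal[OF powr_ge_zero])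
  qed
  hence "(\<integral>\<^sup>+ x. ennreal (E n x) \<partial>M) = (\<integral>\<^sup>+ x. ennreal ?r * (\<Sum>i<2 ^ n. ennreal (?w i x)) \<partial>M)" by (simp only:)
  also have "\<dots> = ennreal ?r * (\<Sum>i<2 ^ n. \<integral>\<^sup>+ x. ennreal (?w i x) \<partial>M)"
   by (subst nn_integral_cmult, rule borel_measurable_sum, erule wm, subst nn_integral_sum, erule wm, rule refl)
  also have "(\<Sum>i<2 ^ n. \<integral>\<^sup>+ x. ennreal (?w i x) \<partial>M) = (\<Sum>i<2 ^ n. ennreal (DX (c (\<tau> n i)) (c (\<tau> n (Suc i))) powr p))"
   by (rule sum.cong[OF refl], rule \<gamma>D[unfolded int_dist_powr_def]) (use \<tau>I in "simp_all del: atLeastAtMost_iff")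
  also have "\<dots> = ennreal (\<Sum>i<2 ^ n. DX (c (\<tau> n i)) (c (\<tau> n (Suc i))) powr p)" by (rule sum_ennreal) simp
  also have "ennreal ?r * \<dots> = ennreal (?r * (\<Sum>i<2 ^ n. DX (c (\<tau> n i)) (c (\<tau> n (Suc i))) powr p))" by (rule ennreal_mult'[OF r0, symmetric])
  also have "\<dots> <= ennreal K" using K(2)[of n] pos_divide_le_eq[of "\<delta> n powr (p - 1)"] by (intro ennreal_leI) simp
  finally show ?thesis .
 qed
 \<comment> \<open>Points with bounded energies. Quantifying over natural bounds keeps the set
   measurable; at the remaining points, a null set, the constant curve at h0 x is used.\<close>
 define Good where "Good = {x \<in> space M. \<exists>k::nat. ALL n. E n x <= real k}"
 have GoodM: "Good \<in> sets M" unfolding Good_def by measurable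
 have "(\<integral>\<^sup>+ x. (SUP n. ennreal (E n x)) \<partial>M) = (SUP n. \<integral>\<^sup>+ x. ennreal (E n x) \<partial>M)"
  by (rule nn_integral_monotone_convergence_SUP_AE) (use mono in "auto intro!: ennreal_leI")
 also have "\<dots> <= ennreal K" by (rule SUP_least) (rule IE)
 finally have "(\<integral>\<^sup>+ x. (SUP n. ennreal (E n x)) \<partial>M) ~= \<infinity>" using ennreal_less_top[of K] by (auto simp: top_unique)
 hence "AE x in M. (SUP n. ennreal (E n x)) ~= \<infinity>" by (intro nn_integral_PInf_AE) auto
 hence AEgood: "AE x in M. x \<in> Good" using AE_space
 proof eventually_elim
  case (elim x)
  then obtain r where r: "0 <= r" "(SUP n. ennreal (E n x)) = ennreal r" by (cases "SUP n. ennreal (E n x)") auto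
  have "E n x <= real (nat \<lceil>r\<rceil>)" for n
  proof -
   have "ennreal (E n x) <= ennreal r" unfolding r(2)[symmetric] by (rule SUP_upper) simp
   hence "E n x <= r" using r(1) by (simp add: ennreal_le_iff)
   thus ?thesis by linarith
  qed
  thus ?case using elim(2) by (auto simp: Good_def)
 qed
 have "EX f. f \<in> AN & (ALL n i. i <= 2 ^ n --> f (\<tau> n i) = (if x \<in> Good then \<gamma> (\<tau> n i) x else h0 x))" if x: "x \<in> space M" for x
 proof (cases "x \<in> Good")
  case True
  then obtain k where k: "!!n. E n x <= real k" by (auto simp: Good_def)
  obtain f where "f \<in> AN" "!!n i. i <= 2 ^ n ==> f (\<tau> n i) = \<gamma> (\<tau> n i) x"
   by (rule AC_extension[OF compl, of "%t. \<gamma> t x" "real k"]) (intro \<gamma>N \<tau>_in x, assumption, rule k[unfolded E_def], rule that)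
  thus ?thesis using True by auto
 next
  case False
  thus ?thesis using AC_const[OF L0s_in[OF h0 x]] \<tau>_in by (intro exI[of _ "\<lambda>t\<in>I. h0 x"]) (auto simp del: atLeastAtMost_iff)
 qed
 hence "ALL x. EX f. x \<in> space M --> f \<in> AN & (ALL n i. i <= 2 ^ n --> f (\<tau> n i) = (if x \<in> Good then \<gamma> (\<tau> n i) x else h0 x))" by blast
 from choice[OF this] obtain f where f: "!!x. x \<in> space M ==> f x \<in> AN"
  and f\<tau>: "!!x n i. x \<in> space M ==> i <= 2 ^ n ==> f x (\<tau> n i) = (if x \<in> Good then \<gamma> (\<tau> n i) x else h0 x)" by blast
 have flim: "(%n. d (if x \<in> Good then \<gamma> (\<tau> n (\<phi> n t)) x else h0 x) (f x t)) \<longlonglongrightarrow> 0" if t: "t \<in> I" and x: "x \<in> space M" for t x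
 proof -
  have "(%n. d (f x (\<tau> n (\<phi> n t))) (f x t)) \<longlonglongrightarrow> 0"
   by (rule AC_tendsto[OF f[OF x] _ \<tau>_\<phi>_tendsto[OF t] t]) (intro \<tau>_in \<phi>_bounds(3)[OF t])
  thus ?thesis by (simp only: f\<tau>[OF x \<phi>_bounds(3)[OF t]])
 qed
 let ?P = "\<mu> \<Otimes>\<^sub>M M"
 define g where "g = (\<lambda>z\<in>space ?P. f (snd z) (fst z))"
 have g: "g (t, x) = f x t" if "t \<in> I" "x \<in> space M" for t x using that by (simp add: g_def space_pair_measure)
 define F where "F n i = (\<lambda>z\<in>space ?P. if snd z \<in> Good then (\<lambda>z\<in>space ?P. \<gamma> (\<tau> n (min i (2 ^ n))) (snd z)) z else H z)" for n i
 have Ps: "{z \<in> space ?P. snd z \<in> Good} \<in> sets ?P" using GoodM by measurable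
 have FL: "F n i \<in> L0s ?P N d" for n i unfolding F_def
  by (rule L0s_if[OF L0s_snd H_L0s Ps]) (intro \<gamma>L \<tau>_in, simp)
 have k: "(%z. \<phi> n (fst z)) \<in> measurable ?P (count_space UNIV)" for n by (rule measurable_compose[OF measurable_fst \<phi>_measurable])
 \<comment> \<open>The curves f x are chosen for each x separately. Joint measurability is recovered
   because g is the pointwise limit of step functions in t, whose values at the nodes are measurable
   in x.\<close>
 have gL: "g \<in> L0s ?P N d"
 proof (rule L0s_limit[OF L0s_pieces[OF FL k]])
  show "g \<in> space ?P \<rightarrow>\<^sub>E N" using AC_in[OF f] by (auto simp: g_def space_pair_measure)
  fix z n assume "z \<in> space ?P"
  then obtain t x where z: "z = (t, x)" "t \<in> I" "x \<in> space M" by (auto simp: space_pair_measure)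
  have "(\<lambda>y\<in>space ?P. F n (\<phi> n (fst y)) y) z = (if x \<in> Good then \<gamma> (\<tau> n (\<phi> n t)) x else h0 x)" for n
   using z \<phi>_bounds(3)[OF z(2), of n] by (simp add: F_def space_pair_measure H_eq min_absorb1)
  thus "(%n. d ((\<lambda>y\<in>space ?P. F n (\<phi> n (fst y)) y) z) (g z)) \<longlonglongrightarrow> 0"
   using flim[OF z(2,3)] z g by (simp del: restrict_apply)
 qed
 \<comment> \<open>Dyadic times suffice: there are countably many, each value of c is at finite
   distance from h, and the other times are limits of these.\<close>
 define S where "S = (\<Union>n. \<Union>i. {x \<in> space M. \<gamma> (\<tau> n (min i (2 ^ n))) x ~= h0 x})"
 have S: "sigma_finite_set M S" unfolding S_def
 proof (intro sigma_finite_set_UN)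
  fix n i :: nat
  have t: "\<tau> n (min i (2 ^ n)) \<in> I" by (intro \<tau>_in) simp
  show "sigma_finite_set M {x \<in> space M. \<gamma> (\<tau> n (min i (2 ^ n))) x ~= h0 x}"
   unfolding \<gamma>_def by (rule sigma_finite_set_distinct[OF LpD(1)[OF X.AC_in[OF c t] h] h0 LpD(2)[OF X.AC_in[OF c t] h]])
 qed
 have gh: "g (t, x) = h0 x" if t: "t \<in> I" and x: "x \<in> space M - S" for t x
 proof -
  have "\<gamma> (\<tau> n (\<phi> n t)) x = h0 x" for n
  proof (rule ccontr)
   assume "\<gamma> (\<tau> n (\<phi> n t)) x ~= h0 x"
   hence "x \<in> S" unfolding S_def
    by (intro UN_I[of n UNIV] UN_I[of "\<phi> n t" UNIV]) (use x \<phi>_bounds(3)[OF t, of n] in "simp_all add: min_absorb1")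
   thus False using x by simp
  qed
  hence "(%n. d (h0 x) (f x t)) \<longlonglongrightarrow> 0" using flim[OF t, of x] x by (cases "x \<in> Good") simp_all
  hence "d (h0 x) (f x t) = 0" by (simp add: LIMSEQ_const_iff)
  thus ?thesis using zero[OF L0s_in[OF h0] AC_in[OF f t]] x g[OF t] by simp
 qed
 have n: "nice g" unfolding nice_def using gL S gh by blast
 have "AC_nice g" unfolding AC_nice_def
 proof (intro conjI n ballI)
  fix x assume x: "x \<in> space M"
  have "(\<lambda>t\<in>I. g (t, x)) = f x" using AC_ext[OF f[OF x]] g x by (intro extensionalityI[of _ I]) (auto simp: PiE_def)
  thus "(\<lambda>t\<in>I. g (t, x)) \<in> AN" using f[OF x] by simp
 qed
 \<comment> \<open>Along the nodes before t the classes tend to c t in L^p, while their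
   representatives tend to g (t, x) for almost every x. Fatou's lemma shows that the two limits are
   at distance 0.\<close>
 moreover have cg: "c t = cls M N (%x. g (t, x))" and AEg: "AE x in M. g (t, x) = \<gamma> t x" if t: "t \<in> I" for t
 proof -
  let ?s = "%n. \<tau> n (\<phi> n t)"
  have sI: "?s n \<in> I" for n by (intro \<tau>_in \<phi>_bounds(3)[OF t])
  have "AE x in M. (%n. d (\<gamma> (?s n) x) ((\<lambda>x\<in>space M. g (t, x)) x)) \<longlonglongrightarrow> 0"
   using AEgood AE_space
  proof eventually_elim
   case (elim x)
   thus ?case using flim[OF t elim(2)] g[OF t elim(2)] by simp
  qed
  hence "int_dist_powr M d p (\<lambda>x\<in>space M. g (t, x)) (\<gamma> t) <= liminf (%n. int_dist_powr M d p (\<gamma> (?s n)) (\<gamma> t))"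
   by (rule int_dist_powr_Fatou[OF \<gamma>L[OF sI] section_t[OF n t] \<gamma>L[OF t]])
  also have "(%n. int_dist_powr M d p (\<gamma> (?s n)) (\<gamma> t)) = (%n. ennreal (DX (c (?s n)) (c t) powr p))" by (simp only: \<gamma>D[OF sI t])
  also have "liminf \<dots> = 0"
  proof (rule lim_imp_Liminf)
   have "(%n. DX (c (?s n)) (c t)) \<longlonglongrightarrow> 0" by (rule X.AC_tendsto[OF c sI \<tau>_\<phi>_tendsto[OF t] t])
   hence "(%n. DX (c (?s n)) (c t) powr p) \<longlonglongrightarrow> 0" by (rule tendsto_zero_powrI[OF _ tendsto_const]) (use p_gt_1 in auto)
   from tendsto_ennrealI[OF this] show "(%n. ennreal (DX (c (?s n)) (c t) powr p)) \<longlonglongrightarrow> 0" by simp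
  qed simp
  finally have "AE x in M. (\<lambda>x\<in>space M. g (t, x)) x = \<gamma> t x"
   by (simp only: int_dist_powr_eq_0[OF section_t[OF n t] \<gamma>L[OF t], symmetric] le_zero_eq)
  thus AE: "AE x in M. g (t, x) = \<gamma> t x" using AE_space by eventually_elim simp
  show "c t = cls M N (%x. g (t, x))" unfolding cls_cong_AE[OF AE] \<gamma>c[OF t] ..
 qed
 moreover have "fin g" unfolding fin_def
 proof (intro conjI n)
  have "const_h \<in> ACX" unfolding const_h_def by (rule X.AC_const[OF h_in_X])
  from X.AC_int_dist_finite[OF c this] have f: "int_dist_powr \<mu> DX p c const_h < \<infinity>" .
  have "Jt g H t = ennreal (DX (c t) (const_h t) powr p)" if "t \<in> space \<mu>" for t
  proof -
   have t: "t \<in> I" using that by simp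
   have "Jt g H t = int_dist_powr M d p (\<gamma> t) h0"
    unfolding Jt_H[OF t, of g] by (rule int_dist_powr_cong_AE[OF AEg[OF t]]) simp
   also have "\<dots> = ennreal (DX (c t) h powr p)" unfolding \<gamma>_def by (rule Lp_dist_powr[OF X.AC_in[OF c t] h_in_X h, symmetric])
   finally show ?thesis using t by (simp add: const_h_def)
  qed
  hence "int_dist_powr PM d p g H = int_dist_powr \<mu> DX p c const_h"
   unfolding nice_Tonelli(1)[OF n nice_H] int_dist_powr_def[of \<mu> DX] by (rule nn_integral_cong)
  thus "int_dist_powr PM d p g H < \<infinity>" using f by simp
 qed
 ultimately have "lifts c g" using c by (auto simp: lifts_def)
 thus thesis by (rule that)
qed

end

section \<open>Joint measurability of speeds\<close>

context dyadic_interval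
begin

text \<open>The bound on the index makes every pair (n, i) name a time in the interval, so
  quantifiers over i range over all natural numbers.\<close>

definition \<sigma> :: "nat => nat => real" where "\<sigma> n i = \<tau> n (min i (2 ^ n))"

lemma \<sigma>_in: "\<sigma> n i \<in> {a..b}" unfolding \<sigma>_def by (rule \<tau>_in) simp

lemma \<sigma>_\<phi>_tendsto: "s \<in> {a..b} ==> (%n. \<sigma> n (\<phi> n s)) \<longlonglongrightarrow> s"
 using \<tau>_\<phi>_tendsto[of s] \<phi>_bounds(3)[of s] by (simp add: \<sigma>_def min_absorb1)

text \<open>The node following t is strictly later and at most one mesh width away. It depends
  measurably on t, so the speed can be computed along these times jointly in t and x.\<close>

lemma \<sigma>_Suc_\<phi>:
 assumes t: "t \<in> {a<..<b}"
 shows "\<sigma> n (Suc (\<phi> n t)) ~= t" "(%n. \<sigma> n (Suc (\<phi> n t))) \<longlonglongrightarrow> t"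
proof -
 have tI: "t \<in> {a..b}" "t \<in> {a..<b}" using t by auto
 have eq: "\<sigma> n (Suc (\<phi> n t)) = \<tau> n (\<phi> n t) + \<delta> n" for n
  using \<phi>_less[OF tI(2), of n] \<tau>_Suc[of n "\<phi> n t"] by (simp add: \<sigma>_def min_absorb1)
 show "\<sigma> n (Suc (\<phi> n t)) ~= t" using \<phi>_bounds(2)[OF tI(1), of n] by (simp add: eq)
 show "(%n. \<sigma> n (Suc (\<phi> n t))) \<longlonglongrightarrow> t"
  using tendsto_add[OF \<tau>_\<phi>_tendsto[OF tI(1)] \<delta>_tendsto] by (simp add: eq)
qed

lemma AE_interior:
 assumes "AE t in lebesgue. t \<in> {a<..<b} --> P t"
 shows "AE t in lebesgue_on {a..b}. t \<in> {a<..<b} & P t"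
proof -
 have "AE t in lebesgue. t \<notin> {a, b}" by (rule AE_not_in) (simp add: null_sets_completionI)
 hence "AE t in lebesgue. t \<in> {a..b} --> t \<in> {a<..<b} & P t"
  using assms by eventually_elim auto
 thus ?thesis by (subst AE_restrict_space_iff) auto
qed

text \<open>The Cauchy condition at t with all quantifiers countable, so that measurability of the
  set where it holds can be read off.\<close>

definition dyadic_Cauchy :: "(real => real) => real => bool" where
 "dyadic_Cauchy F t \<longleftrightarrow> (\<forall>j::nat. \<exists>k::nat. ALL n i n' i'.
   \<sigma> n i ~= t & \<sigma> n' i' ~= t & \<bar>\<sigma> n i - t\<bar> < inverse (real (Suc k)) & \<bar>\<sigma> n' i' - t\<bar> < inverse (real (Suc k)) -->
   \<bar>F (\<sigma> n i) - F (\<sigma> n' i')\<bar> <= inverse (real (Suc j)))"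

text \<open>Away from t the function is continuous, so its values at dyadic times near t control its
  values at all times near t. The weak inequality in the Cauchy condition survives the passage to
  the limit, and completeness of the reals gives the limit.\<close>

lemma convergent_iff_dyadic_Cauchy:
 assumes t: "t \<in> {a<..<b}"
  and cont: "!!s x. s \<in> {a..b} ==> s ~= t ==> (!!n. x n \<in> {a..b}) ==> x \<longlonglongrightarrow> s ==> (%n. F (x n)) \<longlonglongrightarrow> F s"
 shows "(EX L. (F \<longlongrightarrow> L) (at t within {a..b})) \<longleftrightarrow> dyadic_Cauchy F t"
proof
 assume "EX L. (F \<longlongrightarrow> L) (at t within {a..b})"
 then obtain L where L: "(F \<longlongrightarrow> L) (at t within {a..b})" by blast
 show "dyadic_Cauchy F t" unfolding dyadic_Cauchy_def
 proof
  fix j :: nat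
  have "0 < inverse (real (Suc j)) / 2" by simp
  from tendstoD[OF L this] obtain e where e: "0 < e"
   "!!s. s \<in> {a..b} ==> s ~= t ==> dist s t < e ==> dist (F s) L < inverse (real (Suc j)) / 2"
   unfolding eventually_at by blast
  obtain k where k: "inverse (real (Suc k)) < e" using reals_Archimedean[OF e(1)] by blast
  have est: "\<bar>F (\<sigma> n i) - L\<bar> < inverse (real (Suc j)) / 2" if "\<sigma> n i ~= t" "\<bar>\<sigma> n i - t\<bar> < inverse (real (Suc k))" for n i
   using e(2)[OF \<sigma>_in that(1)] that(2) k by (simp add: dist_real_def)
  show "EX k. ALL n i n' i'. \<sigma> n i ~= t & \<sigma> n' i' ~= t & \<bar>\<sigma> n i - t\<bar> < inverse (real (Suc k)) & \<bar>\<sigma> n' i' - t\<bar> < inverse (real (Suc k)) -->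
   \<bar>F (\<sigma> n i) - F (\<sigma> n' i')\<bar> <= inverse (real (Suc j))"
  proof (intro exI[of _ k] allI impI)
   fix n i n' i' assume A: "\<sigma> n i ~= t & \<sigma> n' i' ~= t & \<bar>\<sigma> n i - t\<bar> < inverse (real (Suc k)) & \<bar>\<sigma> n' i' - t\<bar> < inverse (real (Suc k))"
   show "\<bar>F (\<sigma> n i) - F (\<sigma> n' i')\<bar> <= inverse (real (Suc j))"
    using est[of n i] est[of n' i'] A by linarith
  qed
 qed
next
 assume C: "dyadic_Cauchy F t"
 have at: "at t within {a..b} = at t" using t by (intro at_within_Icc_at) auto
 have "cauchy_filter (filtermap F (at t within {a..b}))"
  unfolding cauchy_filter_metric_filtermap
 proof (intro allI impI)
  fix e :: real assume "0 < e"
  then obtain j where j: "inverse (real (Suc j)) < e" using reals_Archimedean by blast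
  obtain k where k: "!!n i n' i'. \<sigma> n i ~= t ==> \<sigma> n' i' ~= t ==> \<bar>\<sigma> n i - t\<bar> < inverse (real (Suc k)) ==>
   \<bar>\<sigma> n' i' - t\<bar> < inverse (real (Suc k)) ==> \<bar>F (\<sigma> n i) - F (\<sigma> n' i')\<bar> <= inverse (real (Suc j))"
   using C unfolding dyadic_Cauchy_def by blast
  let ?P = "%s. s \<in> {a..b} & s ~= t & \<bar>s - t\<bar> < inverse (real (Suc k))"
  have ev: "\<forall>\<^sub>F n in sequentially. \<sigma> n (\<phi> n s) ~= t & \<bar>\<sigma> n (\<phi> n s) - t\<bar> < inverse (real (Suc k))" if s: "?P s" for s
  proof (rule eventually_conj)
   have lim: "(%n. \<sigma> n (\<phi> n s)) \<longlonglongrightarrow> s" using s by (intro \<sigma>_\<phi>_tendsto) blast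
   show "\<forall>\<^sub>F n in sequentially. \<sigma> n (\<phi> n s) ~= t" by (rule tendsto_imp_eventually_ne[OF lim]) (use s in blast)
   have "(%n. \<bar>\<sigma> n (\<phi> n s) - t\<bar>) \<longlonglongrightarrow> \<bar>s - t\<bar>" by (intro tendsto_intros lim)
   thus "\<forall>\<^sub>F n in sequentially. \<bar>\<sigma> n (\<phi> n s) - t\<bar> < inverse (real (Suc k))"
    by (rule order_tendstoD) (use s in blast)
  qed
  have "dist (F s) (F s') < e" if s: "?P s" and s': "?P s'" for s s'
  proof -
   have "(%n. F (\<sigma> n (\<phi> n r))) \<longlonglongrightarrow> F r" if "?P r" for r
    by (rule cont[OF _ _ \<sigma>_in \<sigma>_\<phi>_tendsto]) (use that in simp_all)
   from this[OF s] this[OF s'] have "(%n. \<bar>F (\<sigma> n (\<phi> n s)) - F (\<sigma> n (\<phi> n s'))\<bar>) \<longlonglongrightarrow> \<bar>F s - F s'\<bar>" by (intro tendsto_intros)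
   moreover have "\<forall>\<^sub>F n in sequentially. \<bar>F (\<sigma> n (\<phi> n s)) - F (\<sigma> n (\<phi> n s'))\<bar> <= inverse (real (Suc j))"
    using ev[OF s] ev[OF s'] by eventually_elim (rule k, simp_all)
   ultimately have "\<bar>F s - F s'\<bar> <= inverse (real (Suc j))" by (rule tendsto_upperbound) simp
   thus ?thesis using j by (simp add: dist_real_def)
  qed
  moreover have "eventually ?P (at t within {a..b})"
   unfolding eventually_at by (rule exI[of _ "inverse (real (Suc k))"]) (auto simp: dist_real_def)
  ultimately show "EX P. eventually P (at t within {a..b}) & (ALL x y. P x & P y --> dist (F x) (F y) < e)"
   by (intro exI[of _ ?P]) blast
 qed
 hence "EX c. filtermap F (at t within {a..b}) <= nhds c"
  by (rule cauchy_filter_complete_converges[OF _ complete_UNIV]) (simp_all add: filtermap_bot_iff at)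
 thus "EX L. (F \<longlongrightarrow> L) (at t within {a..b})" by (simp add: filterlim_def)
qed

end

section \<open>Difference quotients and speeds of a family of curves\<close>

context sections
begin

abbreviation speed :: "(real \<times> 'm => 'n) => 'm => real => real" where
 "speed g x \<equiv> metric_deriv {a..b} d (curves g x)"

definition quot :: "(real \<times> 'm => 'n) => 'm => real => real => real" where
 "quot g x t s = d (curves g x s) (curves g x t) / \<bar>s - t\<bar>"

definition lim_ex :: "(real \<times> 'm => 'n) => real \<times> 'm => bool" where
 "lim_ex g z \<longleftrightarrow> fst z \<in> {a<..<b} & (EX L. (quot g (snd z) (fst z) \<longlongrightarrow> L) (at (fst z) within {a..b}))"

text \<open>\<open>metric_deriv\<close> is a \<open>Lim\<close> and hence an arbitrary value where
  no limit exists. Setting it to 0 there gives a function that is measurable in both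
  variables.\<close>

definition psi :: "(real \<times> 'm => 'n) => real \<times> 'm => real" where
 "psi g z = (if lim_ex g z then speed g (snd z) (fst z) else 0)"

lemma curves_eq: "t \<in> I ==> x \<in> space M ==> curves g x t = g (t, x)" by (simp add: curves_def)

lemma quot_nonneg: "0 <= quot g x t s" by (simp add: quot_def)

lemma lim_ex_tendsto: "lim_ex g (t, x) ==> (quot g x t \<longlongrightarrow> speed g x t) (at t within I)"
proof -
 assume A: "lim_ex g (t, x)"
 then obtain L where L: "t \<in> {a<..<b}" "(quot g x t \<longlongrightarrow> L) (at t within I)" by (auto simp: lim_ex_def)
 have "speed g x t = L" by (rule metric_deriv_eq[OF L(1)]) (use L(2) in "simp add: quot_def[abs_def]")
 thus ?thesis using L(2) by simp
qed

lemma lim_ex_speed: "lim_ex g (t, x) ==> (%n. quot g x t (\<sigma> n (Suc (\<phi> n t)))) \<longlonglongrightarrow> speed g x t"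
proof -
 assume A: "lim_ex g (t, x)"
 hence t: "t \<in> {a<..<b}" by (simp add: lim_ex_def)
 have "ALL i. \<sigma> i (Suc (\<phi> i t)) \<in> I - {t}" using \<sigma>_Suc_\<phi>(1)[OF t] \<sigma>_in by blast
 thus ?thesis using lim_ex_tendsto[OF A, unfolded tendsto_at_iff_sequentially comp_def, rule_format, OF _ \<sigma>_Suc_\<phi>(2)[OF t]] by simp
qed

lemma psi_nonneg: "0 <= psi g z"
proof (cases "lim_ex g z")
 case True
 hence "lim_ex g (fst z, snd z)" by simp
 from LIMSEQ_le_const[OF lim_ex_speed[OF this], of 0] show ?thesis using quot_nonneg True by (auto simp: psi_def)
qed (simp add: psi_def)

lemma fst_measurable: "(%z. fst z) \<in> borel_measurable (\<mu> \<Otimes>\<^sub>M M)"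
proof (rule measurable_compose[OF measurable_fst])
 have "(%t::real. t) \<in> borel_measurable lborel" by simp
 thus "(%t. t) \<in> borel_measurable \<mu>" by (intro measurable_restrict_space1 measurable_completion)
qed

text \<open>Countably many sections can be glued, so the time may depend on z through a countable
  index. A constant index serves the Cauchy condition, and the index of the node following t serves
  the speed.\<close>

lemma dist_section_measurable:
 assumes g: "AC_nice g" and s: "!!i. s i \<in> I" and k: "k \<in> measurable (\<mu> \<Otimes>\<^sub>M M) (count_space (UNIV :: nat set))"
 shows "(%z. quot g (snd z) (fst z) (s (k z))) \<in> borel_measurable (\<mu> \<Otimes>\<^sub>M M)"
proof -
 let ?P = "\<mu> \<Otimes>\<^sub>M M"
 have n: "nice g" by (rule AC_niceD[OF g])
 have F: "(\<lambda>z\<in>space ?P. (\<lambda>x\<in>space M. g (s i, x)) (snd z)) \<in> L0s ?P N d" for i by (rule L0s_snd[OF section_t[OF n s]])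
 have [measurable]: "(%z. d ((\<lambda>y\<in>space ?P. (\<lambda>z\<in>space ?P. (\<lambda>x\<in>space M. g (s (k y), x)) (snd z)) y) z) (g z)) \<in> borel_measurable ?P"
  by (rule L0s_dist_measurable[OF L0s_pieces[OF F k] niceD[OF n]])
 have [measurable]: "(%z. s (k z)) \<in> borel_measurable ?P" by (rule measurable_compose[OF k]) simp
 note fst_measurable [measurable]
 have "(%z. d ((\<lambda>y\<in>space ?P. (\<lambda>z\<in>space ?P. (\<lambda>x\<in>space M. g (s (k y), x)) (snd z)) y) z) (g z) / \<bar>s (k z) - fst z\<bar>) \<in> borel_measurable ?P"
  by measurable
 also have "?this \<longleftrightarrow> ?thesis"
 proof (rule measurable_cong)
  fix z assume "z \<in> space ?P"
  then obtain t x where z: "z = (t, x)" "t \<in> I" "x \<in> space M" by (auto simp: space_pair_measure)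
  show "d ((\<lambda>y\<in>space ?P. (\<lambda>z\<in>space ?P. (\<lambda>x\<in>space M. g (s (k y), x)) (snd z)) y) z) (g z) / \<bar>s (k z) - fst z\<bar> = quot g (snd z) (fst z) (s (k z))"
   using z curves_eq[OF z(2,3)] curves_eq[OF s z(3)] by (simp add: quot_def space_pair_measure)
 qed
 finally show ?thesis .
qed

lemma quot_continuous:
 assumes g: "AC_nice g" and x: "x \<in> space M" and t: "t \<in> I" and s: "s \<in> I" "s ~= t" "!!n. y n \<in> I" "y \<longlonglongrightarrow> s"
 shows "(%n. quot g x t (y n)) \<longlonglongrightarrow> quot g x t s"
proof -
 note c = curves_in[OF g x]
 have lim: "(%n. d (curves g x (y n)) (curves g x s)) \<longlonglongrightarrow> 0" by (rule AC_tendsto[OF c s(3,4,1)])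
 have "norm (d (curves g x (y n)) (curves g x t) - d (curves g x s) (curves g x t)) <= d (curves g x (y n)) (curves g x s)" for n
  using triangle[OF AC_in[OF c s(3)[of n]] AC_in[OF c s(1)] AC_in[OF c t]] triangle[OF AC_in[OF c s(1)] AC_in[OF c s(3)[of n]] AC_in[OF c t]]
   commute[of "curves g x s" "curves g x (y n)"] by simp
 hence "(%n. d (curves g x (y n)) (curves g x t) - d (curves g x s) (curves g x t)) \<longlonglongrightarrow> 0"
  by (intro Lim_null_comparison[OF _ lim] always_eventually allI)
 hence "(%n. d (curves g x (y n)) (curves g x t)) \<longlonglongrightarrow> d (curves g x s) (curves g x t)" by (rule LIM_zero_cancel)
 thus ?thesis unfolding quot_def using s(2) by (intro tendsto_intros s(4)) auto
qed

lemma lim_ex_sets: "AC_nice g ==> {z \<in> space (\<mu> \<Otimes>\<^sub>M M). lim_ex g z} \<in> sets (\<mu> \<Otimes>\<^sub>M M)"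
proof -
 assume g: "AC_nice g"
 have eq: "{z \<in> space (\<mu> \<Otimes>\<^sub>M M). lim_ex g z} = {z \<in> space (\<mu> \<Otimes>\<^sub>M M). fst z \<in> {a<..<b} & dyadic_Cauchy (quot g (snd z) (fst z)) (fst z)}"
 proof (rule Collect_cong, rule conj_cong[OF refl])
  fix z assume "z \<in> space (\<mu> \<Otimes>\<^sub>M M)"
  hence z: "fst z \<in> I" "snd z \<in> space M" by (auto simp: space_pair_measure)
  show "lim_ex g z \<longleftrightarrow> fst z \<in> {a<..<b} & dyadic_Cauchy (quot g (snd z) (fst z)) (fst z)"
   unfolding lim_ex_def
  proof (rule conj_cong[OF refl], rule convergent_iff_dyadic_Cauchy)
   fix s y assume "s \<in> I" "s ~= fst z" "!!n. y n \<in> I" "y \<longlonglongrightarrow> s"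
   thus "(%n. quot g (snd z) (fst z) (y n)) \<longlonglongrightarrow> quot g (snd z) (fst z) s" by (rule quot_continuous[OF g z(2,1)])
  qed
 qed
 have [measurable]: "(%z. quot g (snd z) (fst z) (\<sigma> n i)) \<in> borel_measurable (\<mu> \<Otimes>\<^sub>M M)" for n i
  by (rule dist_section_measurable[OF g, of "%_. \<sigma> n i" "%_. 0"]) (rule \<sigma>_in, simp)
 note fst_measurable [measurable]
 show ?thesis unfolding eq dyadic_Cauchy_def greaterThanLessThan_iff by measurable
qed

lemma psi_measurable: "AC_nice g ==> psi g \<in> borel_measurable (\<mu> \<Otimes>\<^sub>M M)"
proof -
 assume g: "AC_nice g"
 have "(%z. quot g (snd z) (fst z) (\<sigma> n (Suc (\<phi> n (fst z))))) \<in> borel_measurable (\<mu> \<Otimes>\<^sub>M M)" for n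
  by (rule dist_section_measurable[OF g, of "%i. \<sigma> n (Suc i)" "%z. \<phi> n (fst z)"])
   (rule \<sigma>_in, rule measurable_compose[OF measurable_fst \<phi>_measurable])
 hence e: "(%z. if lim_ex g z then quot g (snd z) (fst z) (\<sigma> n (Suc (\<phi> n (fst z)))) else 0) \<in> borel_measurable (\<mu> \<Otimes>\<^sub>M M)" for n
  by (intro measurable_If lim_ex_sets[OF g] borel_measurable_const)
 show ?thesis
 proof (rule borel_measurable_LIMSEQ_real[OF _ e])
  fix z show "(%n. if lim_ex g z then quot g (snd z) (fst z) (\<sigma> n (Suc (\<phi> n (fst z)))) else 0) \<longlonglongrightarrow> psi g z"
   using lim_ex_speed[of g "fst z" "snd z"] by (cases "lim_ex g z") (simp_all add: psi_def)
 qed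
qed

text \<open>The density G is obtained for one x at a time, by a supremum along that curve;
  \<open>psi\<close> agrees with it almost everywhere and is measurable in (t, x).\<close>

lemma speed_density:
 assumes g: "AC_nice g" and x: "x \<in> space M"
 obtains G where "integrable lebesgue G" "!!r. 0 <= G r" 
  "!!s t. a <= s ==> s <= t ==> t <= b ==> d (g (s, x)) (g (t, x)) <= (LINT r:{s..t}|lebesgue. G r)"
  "AE t in \<mu>. lim_ex g (t, x) & psi g (t, x) = G t"
proof -
 note c = curves_in[OF g x]
 obtain K where K: "!!n. (\<Sum>i<2 ^ n. d (curves g x (\<tau> n i)) (curves g x (\<tau> n (Suc i))) powr p) <= K * \<delta> n powr (p - 1)"
  using AC_ac_curve(2)[OF c] by blast
 obtain G where G: "integrable lebesgue G" "!!r. 0 <= G r"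
  "!!s t. a <= s ==> s <= t ==> t <= b ==> d (curves g x s) (curves g x t) <= (LINT r:{s..t}|lebesgue. G r)"
  "AE t in lebesgue. t \<in> {a<..<b} --> ((%s. d (curves g x s) (curves g x t) / \<bar>s - t\<bar>) \<longlongrightarrow> G t) (at t within {a..b})"
  by (rule metric_derivative_AC[OF AC_ac_curve(1)[OF c] K]) (rule that, assumption+)
 show thesis
 proof (rule that[OF G(1,2)])
  fix s t assume "a <= s" "s <= t" "t <= b"
  thus "d (g (s, x)) (g (t, x)) <= (LINT r:{s..t}|lebesgue. G r)" using G(3)[of s t] x by (simp add: curves_def)
 next
  show "AE t in \<mu>. lim_ex g (t, x) & psi g (t, x) = G t" using AE_interior[OF G(4)]
  proof eventually_elim
   case (elim t)
   hence t: "t \<in> {a<..<b}" and lim: "((%s. d (curves g x s) (curves g x t) / \<bar>s - t\<bar>) \<longlongrightarrow> G t) (at t within {a..b})" by blast+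
   have 1: "lim_ex g (t, x)" unfolding lim_ex_def using t lim by (auto simp: quot_def[abs_def])
   show ?case using 1 metric_deriv_eq[OF t lim] by (simp add: psi_def)
  qed
 qed
qed

lemma psi_speed: "lim_ex g (t, x) ==> psi g (t, x) = speed g x t" by (simp add: psi_def)

lemma AE_psi_x:
 assumes g: "AC_nice g" and x: "x \<in> space M" shows "AE t in \<mu>. lim_ex g (t, x)"
 by (rule speed_density[OF g x]) (auto elim: eventually_mono)

text \<open>Outside the set S of a nice map the curves are constant, so their speed exists at every
  interior time and is 0.\<close>

lemma AC_nice_support:
 assumes g: "AC_nice g"
 obtains S where "sigma_finite_set M S" "!!t x. t \<in> I ==> x \<in> space M - S ==> psi g (t, x) = 0"
  "!!t x. t \<in> {a<..<b} ==> x \<in> space M - S ==> lim_ex g (t, x)"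
proof -
 obtain S where S: "sigma_finite_set M S" "!!t x. t \<in> I ==> x \<in> space M - S ==> g (t, x) = h0 x"
  using AC_niceD[OF g] unfolding nice_def by blast
 have z: "((%s. d (curves g x s) (curves g x t) / \<bar>s - t\<bar>) \<longlongrightarrow> 0) (at t within I)" if t: "t \<in> I" and x: "x \<in> space M - S" for t x
 proof (rule tendsto_eventually, unfold eventually_at_filter, rule always_eventually, intro allI impI)
  fix s assume s: "s \<in> I"
  have "d (h0 x) (h0 x) = 0" using L0s_in[OF h0] x by simp
  thus "d (curves g x s) (curves g x t) / \<bar>s - t\<bar> = 0" using S(2)[OF s x] S(2)[OF t x] s t x by (simp add: curves_def)
 qed
 show thesis
 proof (rule that[OF S(1)])
  fix t x assume t: "t \<in> {a<..<b}" and x: "x \<in> space M - S"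
  hence tI: "t \<in> I" by simp
  show "lim_ex g (t, x)" unfolding lim_ex_def using t z[OF tI x] by (auto simp: quot_def[abs_def])
 next
  fix t x assume t: "t \<in> I" and x: "x \<in> space M - S"
  show "psi g (t, x) = 0"
  proof (cases "lim_ex g (t, x)")
   case True
   hence "t \<in> {a<..<b}" by (simp add: lim_ex_def)
   from metric_deriv_eq[OF this z[OF t x]] True show ?thesis by (simp add: psi_def)
  qed (simp add: psi_def)
 qed
qed

text \<open>For each x the speed exists at almost every t. The set of failures is jointly measurable
  and lies over a sigma-finite set, up to endpoints, so Tonelli's theorem exchanges the order of the
  variables.\<close>

lemma AE_psi_t:
 assumes g: "AC_nice g" shows "AE t in \<mu>. t \<in> {a<..<b} & (AE x in M. lim_ex g (t, x))"
proof -
 obtain S where S: "sigma_finite_set M S" "!!t x. t \<in> {a<..<b} ==> x \<in> space M - S ==> lim_ex g (t, x)"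
  by (rule AC_nice_support[OF g]) (rule that)
 let ?w = "%z. indicator {z \<in> space (\<mu> \<Otimes>\<^sub>M M). fst z \<in> {a<..<b} & \<not> lim_ex g z} z :: ennreal"
 have L [measurable]: "Measurable.pred (\<mu> \<Otimes>\<^sub>M M) (lim_ex g)" using lim_ex_sets[OF g] by (simp only: pred_def)
 note fst_measurable [measurable]
 have w: "?w \<in> borel_measurable (\<mu> \<Otimes>\<^sub>M M)" unfolding greaterThanLessThan_iff by measurable
 have w0: "?w (t, x) = 0" if "t \<in> space \<mu>" "x \<in> space M - S" for t x using S(2) that by (auto simp: indicator_def)
 note T = nn_integral_caratheodory_product[OF fin_\<mu> S(1) w w0]
 have "(\<integral>\<^sup>+ x. \<integral>\<^sup>+ t. ?w (t, x) \<partial>\<mu> \<partial>M) = (\<integral>\<^sup>+ x. 0 \<partial>M)"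
 proof (rule nn_integral_cong)
  fix x assume x: "x \<in> space M"
  have "AE t in \<mu>. ?w (t, x) = 0" using AE_psi_x[OF g x] by eventually_elim (simp add: indicator_def)
  hence "(\<integral>\<^sup>+ t. ?w (t, x) \<partial>\<mu>) = (\<integral>\<^sup>+ t. 0 \<partial>\<mu>)" by (rule nn_integral_cong_AE)
  thus "(\<integral>\<^sup>+ t. ?w (t, x) \<partial>\<mu>) = 0" by simp
 qed
 hence "(\<integral>\<^sup>+ t. \<integral>\<^sup>+ x. ?w (t, x) \<partial>M \<partial>\<mu>) = 0" using T(1,2) by simp
 hence "AE t in \<mu>. (\<integral>\<^sup>+ x. ?w (t, x) \<partial>M) = 0" using T(3) by (simp add: nn_integral_0_iff_AE)
 moreover have "AE t in \<mu>. t \<in> {a<..<b} & True" by (rule AE_interior) simp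
 ultimately show ?thesis using AE_space
 proof eventually_elim
  case (elim t)
  have "(%x. ?w (t, x)) \<in> borel_measurable M" by (rule measurable_compose[OF measurable_Pair1'[OF elim(3)] w])
  hence "AE x in M. ?w (t, x) = 0" using elim(1) by (simp add: nn_integral_0_iff_AE)
  hence "AE x in M. lim_ex g (t, x)" using AE_space
   by eventually_elim (use elim(2,3) in "auto simp: indicator_def space_pair_measure split: if_splits")
  thus ?case using elim(2) by blast
 qed
qed

end

section \<open>The energy identity\<close>

context sections
begin

definition energy :: "(real \<times> 'm => 'n) => real => ennreal" where
 "energy g t = (\<integral>\<^sup>+ x. ennreal (psi g (t, x) powr p) \<partial>M)"

text \<open>The L^p norm over M of the speeds at time t, a candidate for the metric derivative of
  the curve of classes.\<close>

definition bound :: "(real \<times> 'm => 'n) => real => real" where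
 "bound g t = indicator I t * enn2real (energy g t) powr (1 / p)"

lemma psi_powr_measurable: "AC_nice g ==> (%z. ennreal (psi g z powr p)) \<in> borel_measurable (\<mu> \<Otimes>\<^sub>M M)"
 using psi_measurable[of g] by measurable

text \<open>\<open>speed\<close> and \<open>psi\<close> agree at almost every t for every x, and at
  almost every x for almost every t. Integrals of the speed are thus replaced by those of the
  measurable \<open>psi\<close> before the order is exchanged.\<close>

lemma energy_Tonelli:
 assumes g: "AC_nice g"
 shows "energy g \<in> borel_measurable \<mu>"
  and "(\<integral>\<^sup>+ x. \<integral>\<^sup>+ t. ennreal (speed g x t powr p) \<partial>\<mu> \<partial>M) = (\<integral>\<^sup>+ t. energy g t \<partial>\<mu>)"
  and "AE t in \<mu>. (\<integral>\<^sup>+ x. ennreal (speed g x t powr p) \<partial>M) = energy g t"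
proof -
 obtain S where S: "sigma_finite_set M S" "!!t x. t \<in> I ==> x \<in> space M - S ==> psi g (t, x) = 0"
  by (rule AC_nice_support[OF g]) (rule that)
 have w0: "ennreal (psi g (t, x) powr p) = 0" if "t \<in> space \<mu>" "x \<in> space M - S" for t x using S(2) that p_gt_1 by simp
 note T = nn_integral_caratheodory_product[OF fin_\<mu> S(1) psi_powr_measurable[OF g] w0]
 show "energy g \<in> borel_measurable \<mu>" using T(3) by (simp only: energy_def[abs_def])
 have "(\<integral>\<^sup>+ x. \<integral>\<^sup>+ t. ennreal (speed g x t powr p) \<partial>\<mu> \<partial>M) = (\<integral>\<^sup>+ x. \<integral>\<^sup>+ t. ennreal (psi g (t, x) powr p) \<partial>\<mu> \<partial>M)"
 proof (rule nn_integral_cong, rule nn_integral_cong_AE)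
  fix x assume "x \<in> space M"
  from AE_psi_x[OF g this] show "AE t in \<mu>. ennreal (speed g x t powr p) = ennreal (psi g (t, x) powr p)"
   by eventually_elim (simp add: psi_speed)
 qed
 thus "(\<integral>\<^sup>+ x. \<integral>\<^sup>+ t. ennreal (speed g x t powr p) \<partial>\<mu> \<partial>M) = (\<integral>\<^sup>+ t. energy g t \<partial>\<mu>)"
  using T(1,2) by (simp add: energy_def)
 show "AE t in \<mu>. (\<integral>\<^sup>+ x. ennreal (speed g x t powr p) \<partial>M) = energy g t" using AE_psi_t[OF g]
 proof eventually_elim
  case (elim t)
  hence "AE x in M. ennreal (speed g x t powr p) = ennreal (psi g (t, x) powr p)" by (auto simp: psi_speed elim: eventually_mono)
  thus ?case unfolding energy_def by (rule nn_integral_cong_AE)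
 qed
qed

lemma bound_nonneg: "0 <= bound g t" by (simp add: bound_def)

lemma nn_integral_subinterval:
 assumes "a <= s" "t <= b"
 shows "(\<integral>\<^sup>+ r. f r \<partial>lebesgue_on {s..t}) = (\<integral>\<^sup>+ r. f r * indicator {s..t} r \<partial>\<mu>)"
 by (subst (1 2) nn_integral_restrict_space) (use assms in "auto intro!: nn_integral_cong simp: indicator_def")

lemma measurable_subinterval: "f \<in> measurable \<mu> B ==> a <= s ==> t <= b ==> f \<in> measurable (lebesgue_on {s..t}) B"
 by (rule measurable_restrict_mono[of f lebesgue "{a..b}"]) auto

lemma bound_powr:
 assumes "energy g t < \<infinity>" "t \<in> I" shows "ennreal (bound g t powr p) = energy g t"
proof -
 have "bound g t powr p = enn2real (energy g t)" using assms(2) p_gt_1 by (simp add: bound_def powr_powr)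
 thus ?thesis using assms(1) by simp
qed

lemma bound_measurable: "AC_nice g ==> bound g \<in> borel_measurable lebesgue"
proof -
 assume g: "AC_nice g"
 have "(%t. enn2real (energy g t) powr (1 / p)) \<in> borel_measurable \<mu>" using energy_Tonelli(1)[OF g] by measurable
 hence "(%t. indicator I t *\<^sub>R (enn2real (energy g t) powr (1 / p))) \<in> borel_measurable lebesgue"
  by (subst (asm) borel_measurable_restrict_space_iff) auto
 thus ?thesis unfolding bound_def[abs_def] by simp
qed

lemma energy_finite_AE:
 assumes g: "AC_nice g" and fin: "(\<integral>\<^sup>+ t. energy g t \<partial>\<mu>) < \<infinity>"
 shows "AE t in \<mu>. energy g t < \<infinity>"
proof -
 have "AE t in \<mu>. energy g t ~= \<infinity>" by (rule nn_integral_PInf_AE[OF energy_Tonelli(1)[OF g]]) (use fin in simp)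
 thus ?thesis by eventually_elim (simp add: less_top)
qed

lemma bound_integrable:
 assumes g: "AC_nice g" and fin: "(\<integral>\<^sup>+ t. energy g t \<partial>\<mu>) < \<infinity>"
 shows "(\<integral>\<^sup>+ t. ennreal (bound g t powr p) \<partial>lebesgue) < \<infinity>" and "integrable lebesgue (bound g)"
proof -
 have m [measurable]: "bound g \<in> borel_measurable lebesgue" by (rule bound_measurable[OF g])
 have "(\<integral>\<^sup>+ t. ennreal (bound g t powr p) \<partial>lebesgue) = (\<integral>\<^sup>+ t. ennreal (bound g t powr p) \<partial>\<mu>)"
  by (subst nn_integral_restrict_space) (auto intro!: nn_integral_cong simp: bound_def split: split_indicator)
 also have "\<dots> = (\<integral>\<^sup>+ t. energy g t \<partial>\<mu>)"
 proof (rule nn_integral_cong_AE)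
  show "AE t in \<mu>. ennreal (bound g t powr p) = energy g t" using energy_finite_AE[OF g fin] AE_space
   by eventually_elim (rule bound_powr, simp_all)
 qed
 finally show 1: "(\<integral>\<^sup>+ t. ennreal (bound g t powr p) \<partial>lebesgue) < \<infinity>" using fin by simp
 show "integrable lebesgue (bound g)" by (rule integrable_if_powr[OF m bound_nonneg _ 1]) (simp add: bound_def)
qed

text \<open>
 Minkowski's integral inequality for the speeds, from the weighted Jensen inequality with
 weight \<open>bound g + e\<close>; the summand \<open>e > 0\<close> keeps the weight positive.
\<close>
lemma section_dist_le_aux:
 assumes g: "AC_nice g" and fin: "(\<integral>\<^sup>+ t. energy g t \<partial>\<mu>) < \<infinity>" and st: "a <= s" "s <= t" "t <= b" and e: "0 < e"
 shows "int_dist_powr M d p (%x. g (s, x)) (%x. g (t, x)) <= ennreal (((LINT r:{s..t}|lebesgue. bound g r) + e * (t - s)) powr p)"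
proof -
 define w where "w r = bound g r + e" for r
 let ?Y = "lebesgue_on {s..t}"
 define W where "W = (LINT r:{s..t}|lebesgue. bound g r) + e * (t - s)"
 have w0: "0 < w r" for r using bound_nonneg[of g r] e by (simp add: w_def)
 have bm [measurable]: "bound g \<in> borel_measurable lebesgue" by (rule bound_measurable[OF g])
 have wl [measurable]: "w \<in> borel_measurable lebesgue" unfolding w_def[abs_def] by measurable
 have w\<mu> [measurable]: "w \<in> borel_measurable \<mu>" by (rule measurable_restrict_space1[OF wl])
 have wY: "w \<in> borel_measurable ?Y" by (rule measurable_restrict_space1[OF wl])
 have sb: "set_integrable lebesgue {s..t} (bound g)"
  unfolding set_integrable_def by (rule integrable_mult_indicator[OF _ bound_integrable(2)[OF g fin]]) simp
 have W0: "0 <= W" unfolding W_def set_lebesgue_integral_def using bound_nonneg e st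
  by (intro add_nonneg_nonneg mult_nonneg_nonneg Bochner_Integration.integral_nonneg) (auto simp: bound_nonneg)
 have [measurable]: "{s..t} \<in> sets lebesgue" by simp
 have WI: "(\<integral>\<^sup>+ r. ennreal (w r) \<partial>?Y) = ennreal W"
 proof -
  have "(\<integral>\<^sup>+ r. ennreal (w r) \<partial>?Y) = (\<integral>\<^sup>+ r. ennreal (indicator {s..t} r * bound g r) + ennreal e * indicator {s..t} r \<partial>lebesgue)"
   by (subst nn_integral_restrict_space)
    (use e bound_nonneg in "auto intro!: nn_integral_cong simp: w_def indicator_def")
  also have "\<dots> = (\<integral>\<^sup>+ r. ennreal (indicator {s..t} r * bound g r) \<partial>lebesgue) + ennreal e * emeasure lebesgue {s..t}"
   by (subst nn_integral_add, measurable) (simp add: nn_integral_cmult_indicator)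
  also have "(\<integral>\<^sup>+ r. ennreal (indicator {s..t} r * bound g r) \<partial>lebesgue) = ennreal (LINT r:{s..t}|lebesgue. bound g r)"
   using nn_integral_eq_integral[OF sb[unfolded set_integrable_def]] bound_nonneg by (simp add: set_lebesgue_integral_def)
  also have "\<dots> + ennreal e * emeasure lebesgue {s..t} = ennreal W"
  proof -
   have "0 <= (LINT r:{s..t}|lebesgue. bound g r)" unfolding set_lebesgue_integral_def by (rule Bochner_Integration.integral_nonneg) (simp add: bound_nonneg)
   thus ?thesis using st e by (simp add: W_def ennreal_mult[symmetric] ennreal_plus[symmetric] del: ennreal_plus)
  qed
  finally show ?thesis .
 qed
 obtain S where S: "sigma_finite_set M S" "!!t x. t \<in> I ==> x \<in> space M - S ==> psi g (t, x) = 0"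
  by (rule AC_nice_support[OF g]) (rule that)
 \<comment> \<open>Integrated over M at time r, this is energy times w^(1-p), that is bound^p
   w^(1-p), which is at most w. The integral over [s, t] is then at most W, and the factor W^(p-1)
   from Jensen's inequality completes W^p.\<close>
 let ?v = "%z. ennreal (psi g z powr p) * (ennreal (w (fst z) powr (1 - p)) * indicator {s..t} (fst z))"
 note psi_powr_measurable[OF g, measurable]
 have fm: "fst \<in> measurable (\<mu> \<Otimes>\<^sub>M M) \<mu>" by simp
 have um: "(%r. ennreal (w r powr (1 - p)) * indicator {s..t} r) \<in> borel_measurable \<mu>"
 proof -
  have "{s..t} \<in> sets \<mu>" using st by (auto simp: sets_restrict_space intro!: image_eqI[of _ _ "{s..t}"])
  thus ?thesis by measurable
 qed
 have v: "?v \<in> borel_measurable (\<mu> \<Otimes>\<^sub>M M)"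
  by (intro borel_measurable_times_ennreal psi_powr_measurable[OF g] measurable_compose[OF fm um])
 have v0: "?v (r, x) = 0" if "r \<in> space \<mu>" "x \<in> space M - S" for r x using S(2) that p_gt_1 by simp
 note T = nn_integral_caratheodory_product[OF fin_\<mu> S(1) v v0]
 have point: "ennreal (d (g (s, x)) (g (t, x)) powr p) <= ennreal (W powr (p - 1)) * (\<integral>\<^sup>+ r. ?v (r, x) \<partial>\<mu>)"
  if x: "x \<in> space M" for x
 proof -
  obtain G where G: "integrable lebesgue G" "!!r. 0 <= G r"
   "d (g (s, x)) (g (t, x)) <= (LINT r:{s..t}|lebesgue. G r)" "AE t in \<mu>. lim_ex g (t, x) & psi g (t, x) = G t"
   by (rule speed_density[OF g x]) (rule that, assumption, assumption, rule_tac [2] TrueI | use st in blast)+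
  have ps: "(%r. psi g (r, x)) \<in> borel_measurable \<mu>"
   by (rule measurable_compose[OF measurable_Pair2'[OF x] psi_measurable[OF g]])
  define V where "V = (LINT r:{s..t}|lebesgue. G r)"
  have V0: "0 <= V" unfolding V_def set_lebesgue_integral_def by (rule Bochner_Integration.integral_nonneg) (simp add: G(2))
  have "(\<integral>\<^sup>+ r. ennreal (psi g (r, x)) \<partial>?Y) = (\<integral>\<^sup>+ r. ennreal (psi g (r, x)) * indicator {s..t} r \<partial>\<mu>)"
   by (rule nn_integral_subinterval[OF st(1,3)])
  also have "\<dots> = (\<integral>\<^sup>+ r. ennreal (G r) * indicator {s..t} r \<partial>\<mu>)"
   by (rule nn_integral_cong_AE) (use G(4) in "auto elim: eventually_mono")
  also have "\<dots> = (\<integral>\<^sup>+ r. ennreal (G r) \<partial>?Y)" by (rule nn_integral_subinterval[OF st(1,3), symmetric])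
  also have "\<dots> = (\<integral>\<^sup>+ r. ennreal (indicator {s..t} r * G r) \<partial>lebesgue)"
   by (subst nn_integral_restrict_space) (auto intro!: nn_integral_cong simp: indicator_def)
  also have "\<dots> = ennreal V"
   using nn_integral_eq_integral[OF integrable_mult_indicator[OF _ G(1), of "{s..t}"]] G(2) by (simp add: V_def set_lebesgue_integral_def)
  finally have VI: "(\<integral>\<^sup>+ r. ennreal (psi g (r, x)) \<partial>?Y) = ennreal V" .
  have "ennreal (d (g (s, x)) (g (t, x)) powr p) <= ennreal (V powr p)"
   using G(3) p_gt_1 by (intro ennreal_leI powr_mono2) (auto simp: V_def)
  also have "\<dots> <= ennreal (W powr (p - 1)) * (\<integral>\<^sup>+ r. ennreal (psi g (r, x) powr p * w r powr (1 - p)) \<partial>?Y)"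
   by (rule nn_integral_Jensen_weighted[OF p_gt_1 measurable_subinterval[OF ps st(1,3)] wY psi_nonneg w0 WI W0 VI V0])
  also have "(\<integral>\<^sup>+ r. ennreal (psi g (r, x) powr p * w r powr (1 - p)) \<partial>?Y) = (\<integral>\<^sup>+ r. ?v (r, x) \<partial>\<mu>)"
   unfolding nn_integral_subinterval[OF st(1,3)] by (rule nn_integral_cong) (simp add: ennreal_mult mult_ac)
  finally show ?thesis .
 qed
 have "int_dist_powr M d p (%x. g (s, x)) (%x. g (t, x)) <= (\<integral>\<^sup>+ x. ennreal (W powr (p - 1)) * (\<integral>\<^sup>+ r. ?v (r, x) \<partial>\<mu>) \<partial>M)"
  unfolding int_dist_powr_def by (rule nn_integral_mono) (rule point)
 also have "\<dots> = ennreal (W powr (p - 1)) * (\<integral>\<^sup>+ x. \<integral>\<^sup>+ r. ?v (r, x) \<partial>\<mu> \<partial>M)" by (rule nn_integral_cmult) (rule T(4))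
 also have "(\<integral>\<^sup>+ x. \<integral>\<^sup>+ r. ?v (r, x) \<partial>\<mu> \<partial>M) = (\<integral>\<^sup>+ r. \<integral>\<^sup>+ x. ?v (r, x) \<partial>M \<partial>\<mu>)" using T(1,2) by simp
 also have "\<dots> <= (\<integral>\<^sup>+ r. ennreal (w r) * indicator {s..t} r \<partial>\<mu>)"
 proof (rule nn_integral_mono_AE)
  show "AE r in \<mu>. (\<integral>\<^sup>+ x. ?v (r, x) \<partial>M) <= ennreal (w r) * indicator {s..t} r"
   using energy_finite_AE[OF g fin] AE_space
  proof eventually_elim
   case (elim r)
   have pm: "(%x. ennreal (psi g (r, x) powr p)) \<in> borel_measurable M"
    by (rule measurable_compose[OF measurable_Pair1'[OF elim(2)] psi_powr_measurable[OF g]])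
   have "(\<integral>\<^sup>+ x. ?v (r, x) \<partial>M) = energy g r * (ennreal (w r powr (1 - p)) * indicator {s..t} r)"
    unfolding energy_def using nn_integral_multc[OF pm] by simp
   also have "energy g r = ennreal (bound g r powr p)" using bound_powr[OF elim(1)] elim(2) by simp
   also have "ennreal (bound g r powr p) * (ennreal (w r powr (1 - p)) * indicator {s..t} r)
     <= ennreal (w r powr p) * (ennreal (w r powr (1 - p)) * indicator {s..t} r)"
    using bound_nonneg e p_gt_1 by (intro mult_right_mono ennreal_leI powr_mono2) (auto simp: w_def)
   also have "\<dots> = ennreal (w r) * indicator {s..t} r"
    using w0[of r] by (simp add: mult.assoc[symmetric] ennreal_mult[symmetric] powr_add[symmetric])
   finally show ?case .
  qed
 qed
 also have "\<dots> = ennreal W" using nn_integral_subinterval[OF st(1,3), of "%r. ennreal (w r)"] WI by simp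
 also have "ennreal (W powr (p - 1)) * ennreal W = ennreal (W powr p)"
 proof (cases "W = 0")
  case False
  have "W powr (p - 1) * W = W powr p" using powr_add[of W "p - 1" 1] W0 by simp
  thus ?thesis using W0 by (simp add: ennreal_mult[symmetric])
 qed (use p_gt_1 in simp)
 finally show ?thesis unfolding W_def by (simp add: mult_left_mono)
qed

lemma section_dist_le:
 assumes g: "AC_nice g" and fin: "(\<integral>\<^sup>+ t. energy g t \<partial>\<mu>) < \<infinity>" and st: "a <= s" "s <= t" "t <= b"
 shows "int_dist_powr M d p (%x. g (s, x)) (%x. g (t, x)) <= ennreal ((LINT r:{s..t}|lebesgue. bound g r) powr p)"
proof -
 let ?A = "LINT r:{s..t}|lebesgue. bound g r" and ?e = "%n. inverse (real (Suc n))"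
 have A0: "0 <= ?A" unfolding set_lebesgue_integral_def by (rule Bochner_Integration.integral_nonneg) (simp add: bound_nonneg)
 have "(%n. ?A + ?e n * (t - s)) \<longlonglongrightarrow> ?A + 0 * (t - s)" by (intro tendsto_intros LIMSEQ_inverse_real_of_nat)
 hence "(%n. (?A + ?e n * (t - s)) powr p) \<longlonglongrightarrow> (?A + 0 * (t - s)) powr p"
  by (rule tendsto_powr'[OF _ tendsto_const]) (use A0 st p_gt_1 in "auto intro!: always_eventually")
 from tendsto_ennrealI[OF this] have "(%n. ennreal ((?A + ?e n * (t - s)) powr p)) \<longlonglongrightarrow> ennreal (?A powr p)" by simp
 thus ?thesis by (rule LIMSEQ_le_const) (intro exI[of _ 0] allI impI section_dist_le_aux[OF g fin st], simp)
qed

lemma section_dist_class: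
 assumes n: "nice g" and st: "s \<in> I" "t \<in> I" and fin: "int_dist_powr M d p (%x. g (s, x)) (%x. g (t, x)) < \<infinity>"
 shows "ennreal (DX (cls M N (%x. g (s, x))) (cls M N (%x. g (t, x))) powr p) = int_dist_powr M d p (%x. g (s, x)) (%x. g (t, x))"
 using Lp_dist_powr_cls[OF section_t[OF n st(1)] section_t[OF n st(2)]] fin by (simp only: int_dist_powr_restrict cls_restrict)

lemma section_class_finite:
 assumes n: "nice g" and t: "t \<in> I" shows "cls M N (%x. g (t, x)) \<in> X \<longleftrightarrow> Jt g H t < \<infinity>"
proof -
 have "cls M N (\<lambda>x\<in>space M. g (t, x)) \<in> Lp M N d p (cls M N h0) \<longleftrightarrow> int_dist_powr M d p (\<lambda>x\<in>space M. g (t, x)) h0 < \<infinity>"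
  by (rule cls_in_Lp_iff[OF section_t[OF n t] h0])
 moreover have "int_dist_powr M d p (\<lambda>x\<in>space M. g (t, x)) h0 = Jt g H t"
  unfolding int_dist_powr_def by (rule nn_integral_cong) (simp add: H_eq[OF t])
 ultimately show ?thesis by (simp only: cls_restrict h0_cls)
qed

lemma DX_le:
 assumes g: "AC_nice g" and fin: "(\<integral>\<^sup>+ t. energy g t \<partial>\<mu>) < \<infinity>" and st: "a <= s" "s <= t" "t <= b"
 shows "DX (cls M N (%x. g (s, x))) (cls M N (%x. g (t, x))) <= (LINT r:{s..t}|lebesgue. bound g r)"
proof -
 let ?A = "LINT r:{s..t}|lebesgue. bound g r" and ?D = "DX (cls M N (%x. g (s, x))) (cls M N (%x. g (t, x)))"
 have A0: "0 <= ?A" unfolding set_lebesgue_integral_def by (rule Bochner_Integration.integral_nonneg) (simp add: bound_nonneg)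
 have I: "s \<in> I" "t \<in> I" using st by auto
 note le = section_dist_le[OF g fin st]
 have f: "int_dist_powr M d p (%x. g (s, x)) (%x. g (t, x)) < \<infinity>" by (rule order.strict_trans1[OF le]) simp
 have "ennreal (?D powr p) <= ennreal (?A powr p)" using le section_dist_class[OF AC_niceD[OF g] I f] by simp
 hence "?D powr p <= ?A powr p" by (simp add: ennreal_le_iff)
 thus ?thesis using powr_less_mono2[of p ?A ?D] A0 p_gt_1 by linarith
qed

text \<open>By \<open>section_dist_le\<close> all sections are at finite distance from each other,
  so it suffices that one of them is at finite distance from h. The function \<open>bound\<close> is
  then a majorant of the resulting curve of classes.\<close>

lemma lifts_if_energy:
 assumes g: "AC_nice g" "fin g" and fin: "(\<integral>\<^sup>+ t. energy g t \<partial>\<mu>) < \<infinity>"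
 obtains c where "lifts c g"
proof -
 have n: "nice g" by (rule AC_niceD[OF g(1)])
 have aI: "a \<in> I" using ab by simp
 \<comment> \<open>\<open>fin\<close> guarantees a finite distance to h at almost every time only;
   one such time is enough.\<close>
 obtain t0 where t0: "t0 \<in> I" "Jt g H t0 < \<infinity>" using AE_interval_near[OF fin_Jt_AE[OF g(2)] aI, of 1] by auto
 have cX: "cls M N (%x. g (t, x)) \<in> X" if t: "t \<in> I" for t
 proof -
  have "int_dist_powr M d p (%x. g (t, x)) (%x. g (t0, x)) < \<infinity>"
  proof (cases "t <= t0")
   case True
   show ?thesis by (rule order.strict_trans1[OF section_dist_le[OF g(1) fin]]) (use True t t0 in auto)
  next
   case False
   have "int_dist_powr M d p (%x. g (t0, x)) (%x. g (t, x)) < \<infinity>"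
    by (rule order.strict_trans1[OF section_dist_le[OF g(1) fin]]) (use False t t0 in auto)
   thus ?thesis by (subst int_dist_powr_commute)
  qed
  hence 1: "int_dist_powr M d p (\<lambda>x\<in>space M. g (t, x)) (\<lambda>x\<in>space M. g (t0, x)) < \<infinity>" by (simp only: int_dist_powr_restrict)
  have 2: "int_dist_powr M d p (\<lambda>x\<in>space M. g (t0, x)) (\<lambda>x\<in>space M. H (t0, x)) < \<infinity>" using t0(2) by (simp only: int_dist_powr_restrict)
  have "int_dist_powr M d p (\<lambda>x\<in>space M. g (t, x)) (\<lambda>x\<in>space M. H (t0, x)) < \<infinity>"
   by (rule map_dist_triangle(1)[OF section_t[OF n t] section_t[OF n t0(1)] section_t[OF nice_H t0(1)] 1 2])
  also have "int_dist_powr M d p (\<lambda>x\<in>space M. g (t, x)) (\<lambda>x\<in>space M. H (t0, x)) = Jt g H t"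
   unfolding int_dist_powr_def by (rule nn_integral_cong) (simp add: H_eq[OF t] H_eq[OF t0(1)])
  finally show ?thesis unfolding section_class_finite[OF n t] .
 qed
 define c where "c = (\<lambda>t\<in>I. cls M N (%x. g (t, x)))"
 have "c \<in> ACX"
 proof (rule X.AC_I)
  show "c \<in> I \<rightarrow>\<^sub>E X" using cX by (auto simp: c_def simp del: atLeastAtMost_iff)
  show "integrable lebesgue (bound g)" by (rule bound_integrable(2)[OF g(1) fin])
  show "(\<integral>\<^sup>+ x. ennreal (\<bar>bound g x\<bar> powr p) \<partial>lebesgue) < \<infinity>" using bound_integrable(1)[OF g(1) fin] by (simp add: bound_nonneg)
  fix s t assume st: "a <= s" "s <= t" "t <= b"
  thus "DX (c s) (c t) <= (LINT r:{s..t}|lebesgue. bound g r)" using DX_le[OF g(1) fin st] by (simp add: c_def)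
 qed
 hence "lifts c g" using g by (simp add: lifts_def c_def)
 thus thesis by (rule that)
qed

text \<open>Fatou's lemma along the nodes following t bounds the energy by the p-th power of the
  metric derivative G of c. This comes first because it makes the total energy finite; then
  \<open>bound\<close> is a majorant of c, and G, being minimal among the majorants, is at most
  \<open>bound\<close>.\<close>

lemma lifts_metric_derivative:
 assumes L: "lifts c g"
 shows "(\<integral>\<^sup>+ t. energy g t \<partial>\<mu>) < \<infinity>" and "AE t in \<mu>. ennreal (metric_deriv I DX c t powr p) = energy g t"
proof -
 have g: "AC_nice g" and c: "c \<in> ACX" and cg: "!!t. t \<in> I ==> c t = cls M N (%x. g (t, x))" using L by (auto simp: lifts_def)
 have n: "nice g" by (rule AC_niceD[OF g])
 obtain K where K: "!!n. (\<Sum>i<2 ^ n. DX (c (\<tau> n i)) (c (\<tau> n (Suc i))) powr p) <= K * \<delta> n powr (p - 1)"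
  using X.AC_ac_curve(2)[OF c] by blast
 obtain G where G: "integrable lebesgue G" "!!r. 0 <= G r" "(\<integral>\<^sup>+ x. ennreal (G x powr p) \<partial>lebesgue) < \<infinity>"
  "!!s t. a <= s ==> s <= t ==> t <= b ==> DX (c s) (c t) <= (LINT r:{s..t}|lebesgue. G r)"
  "AE t in lebesgue. t \<in> {a<..<b} --> ((%s. DX (c s) (c t) / \<bar>s - t\<bar>) \<longlongrightarrow> G t) (at t within {a..b})"
  by (rule X.metric_derivative_AC[OF X.AC_ac_curve(1)[OF c] K]) (rule that, assumption+)
 have cD: "int_dist_powr M d p (%x. g (s, x)) (%x. g (t, x)) = ennreal (DX (c s) (c t) powr p)" if s: "s \<in> I" and t: "t \<in> I" for s t
 proof -
  have J: "Jt g H s < \<infinity>" "Jt g H t < \<infinity>"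
   using X.AC_in[OF c s] X.AC_in[OF c t] by (simp_all only: cg[OF s] cg[OF t] section_class_finite[OF n s] section_class_finite[OF n t])
  have H: "int_dist_powr M d p (\<lambda>x\<in>space M. g (s, x)) h0 < \<infinity>" "int_dist_powr M d p (\<lambda>x\<in>space M. g (t, x)) h0 < \<infinity>"
   using J unfolding Jt_H[OF s, of g] Jt_H[OF t, of g] by (simp_all add: int_dist_powr_def cong: nn_integral_cong)
  have "int_dist_powr M d p (\<lambda>x\<in>space M. g (s, x)) (\<lambda>x\<in>space M. g (t, x)) < \<infinity>"
   by (rule map_dist_triangle(1)[OF section_t[OF n s] h0 section_t[OF n t] H(1)]) (subst int_dist_powr_commute, rule H(2))
  thus ?thesis using section_dist_class[OF n s t] cg[OF s] cg[OF t] by (simp only: int_dist_powr_restrict)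
 qed
 have upper: "AE t in \<mu>. energy g t <= ennreal (G t powr p)" using AE_psi_t[OF g] AE_interior[OF G(5)]
 proof eventually_elim
  case (elim t)
  hence t: "t \<in> {a<..<b}" "t \<in> I" and lim: "((%s. DX (c s) (c t) / \<bar>s - t\<bar>) \<longlongrightarrow> G t) (at t within {a..b})" by auto
  let ?s = "%n. \<sigma> n (Suc (\<phi> n t))"
  have s: "?s n \<in> I - {t}" for n using \<sigma>_in \<sigma>_Suc_\<phi>(1)[OF t(1)] by blast
  have sI: "?s n \<in> I" for n by (rule \<sigma>_in)
  have r0: "0 < \<bar>?s n - t\<bar>" for n using s[of n] by simp
  have G_lim: "(%n. DX (c (?s n)) (c t) / \<bar>?s n - t\<bar>) \<longlonglongrightarrow> G t"
   using lim[unfolded tendsto_at_iff_sequentially comp_def, rule_format, OF s \<sigma>_Suc_\<phi>(2)[OF t(1)]] .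
  let ?q = "%n x. (d (g (?s n, x)) (g (t, x)) / \<bar>?s n - t\<bar>) powr p"
  have dm: "(%x. d (g (?s n, x)) (g (t, x))) \<in> borel_measurable M" for n
  proof -
   have "(%x. d ((\<lambda>x\<in>space M. g (?s n, x)) x) ((\<lambda>x\<in>space M. g (t, x)) x)) \<in> borel_measurable M"
    by (rule L0s_dist_measurable[OF section_t[OF n sI] section_t[OF n t(2)]])
   thus ?thesis by (simp cong: measurable_cong)
  qed
  have qm: "(%x. ennreal (?q n x)) \<in> borel_measurable M" for n using dm[of n] by measurable
  have qI: "(\<integral>\<^sup>+ x. ennreal (?q n x) \<partial>M) = ennreal ((DX (c (?s n)) (c t) / \<bar>?s n - t\<bar>) powr p)" for n
  proof -
   let ?r = "1 / \<bar>?s n - t\<bar> powr p"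
   have "(\<integral>\<^sup>+ x. ennreal (?q n x) \<partial>M) = (\<integral>\<^sup>+ x. ennreal ?r * ennreal (d (g (?s n, x)) (g (t, x)) powr p) \<partial>M)"
    by (rule nn_integral_cong) (simp add: powr_divide ennreal_mult[symmetric])
   also have "\<dots> = ennreal ?r * int_dist_powr M d p (%x. g (?s n, x)) (%x. g (t, x))"
    unfolding int_dist_powr_def by (rule nn_integral_cmult) (use dm[of n] in measurable)
   also have "\<dots> = ennreal ((DX (c (?s n)) (c t) / \<bar>?s n - t\<bar>) powr p)"
    unfolding cD[OF sI t(2)] by (simp add: powr_divide ennreal_mult[symmetric])
   finally show ?thesis .
  qed
  have "energy g t <= (\<integral>\<^sup>+ x. liminf (%n. ennreal (?q n x)) \<partial>M)"
   unfolding energy_def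
  proof (rule nn_integral_mono_AE)
   have "AE x in M. lim_ex g (t, x)" using elim by blast
   thus "AE x in M. ennreal (psi g (t, x) powr p) <= liminf (%n. ennreal (?q n x))" using AE_space
   proof eventually_elim
    case (elim x)
    have "(%n. quot g x t (?s n)) \<longlonglongrightarrow> psi g (t, x)" using lim_ex_speed[OF elim(1)] psi_speed[OF elim(1)] by simp
    hence "(%n. d (g (?s n, x)) (g (t, x)) / \<bar>?s n - t\<bar>) \<longlonglongrightarrow> psi g (t, x)"
     by (simp only: quot_def curves_eq[OF sI elim(2)] curves_eq[OF t(2) elim(2)])
    hence "(%n. ?q n x) \<longlonglongrightarrow> psi g (t, x) powr p"
     by (rule tendsto_powr'[OF _ tendsto_const]) (use p_gt_1 in "auto intro!: always_eventually")
    from tendsto_ennrealI[OF this] have "liminf (%n. ennreal (?q n x)) = ennreal (psi g (t, x) powr p)"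
     by (intro lim_imp_Liminf) simp_all
    thus ?case by simp
   qed
  qed
  also have "\<dots> <= liminf (%n. \<integral>\<^sup>+ x. ennreal (?q n x) \<partial>M)" by (rule nn_integral_liminf) (rule qm)
  also have "\<dots> = ennreal (G t powr p)"
   unfolding qI
  proof (rule lim_imp_Liminf)
   have "(%n. (DX (c (?s n)) (c t) / \<bar>?s n - t\<bar>) powr p) \<longlonglongrightarrow> G t powr p"
    by (rule tendsto_powr'[OF G_lim tendsto_const]) (use p_gt_1 in "auto intro!: always_eventually")
   thus "(%n. ennreal ((DX (c (?s n)) (c t) / \<bar>?s n - t\<bar>) powr p)) \<longlonglongrightarrow> ennreal (G t powr p)" by (rule tendsto_ennrealI)
  qed simp
  finally show ?case .
 qed
 have "(\<integral>\<^sup>+ t. energy g t \<partial>\<mu>) <= (\<integral>\<^sup>+ t. ennreal (G t powr p) \<partial>\<mu>)" by (rule nn_integral_mono_AE[OF upper])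
 also have "\<dots> <= (\<integral>\<^sup>+ t. ennreal (G t powr p) \<partial>lebesgue)"
  by (subst nn_integral_restrict_space) (auto intro!: nn_integral_mono simp: indicator_def)
 also have "\<dots> < \<infinity>" by (rule G(3))
 finally show fin: "(\<integral>\<^sup>+ t. energy g t \<partial>\<mu>) < \<infinity>" .
 have "AE t in lebesgue. t \<in> {a<..<b} --> G t <= bound g t"
 proof (rule X.metric_deriv_le[OF bound_integrable(2)[OF g fin] _ G(5)])
  fix s t assume st: "a <= s" "s <= t" "t <= b"
  thus "DX (c s) (c t) <= (LINT r:{s..t}|lebesgue. bound g r)" using DX_le[OF g fin st] cg[of s] cg[of t] by simp
 qed
 from AE_interior[OF this] upper AE_interior[OF G(5)] energy_finite_AE[OF g fin]
 show "AE t in \<mu>. ennreal (metric_deriv I DX c t powr p) = energy g t"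
 proof eventually_elim
  case (elim t)
  hence t: "t \<in> {a<..<b}" "t \<in> I" by auto
  have md: "metric_deriv I DX c t = G t" by (rule X.metric_deriv_eq[OF t(1)]) (use elim in blast)
  have "ennreal (G t powr p) <= ennreal (bound g t powr p)" using elim(1) G(2) p_gt_1 by (intro ennreal_leI powr_mono2) auto
  also have "\<dots> = energy g t" by (rule bound_powr[OF elim(4) t(2)])
  finally show ?case unfolding md using elim(2) by (rule antisym)
 qed
qed

end

section \<open>Evaluation and the main theorem\<close>

lemma (in ac_setting) AC_continuous:
 assumes c: "c \<in> AC {a..b} Z d p" and t: "t \<in> {a..b}" and e: "0 < e"
 obtains r where "0 < r" "!!s. s \<in> {a..b} ==> \<bar>s - t\<bar> < r ==> d (c s) (c t) < e"
proof -
 interpret ac_curve Z d a b c by (rule AC_ac_curve(1)[OF c])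
 obtain r where r: "0 < r" "!!s. s \<in> {a..b} ==> s ~= t ==> dist s t < r ==> dist (d (c s) (c t)) 0 < e"
  using tendstoD[OF \<gamma>_cont[OF t] e] unfolding eventually_at by blast
 have "d (c s) (c t) < e" if "s \<in> {a..b}" "\<bar>s - t\<bar> < r" for s
  using r(2)[OF that(1)] that(2) e AC_in[OF c t] by (cases "s = t") (simp_all add: dist_real_def)
 with r(1) show thesis by (rule that)
qed

context sections
begin

text \<open>
 The evaluations of a class-valued map are recovered from its jointly measurable representative
 as essential limits.
\<close>
lemma joint_evaluation:
 assumes f: "f \<in> L0s M AN dA"
 shows "(\<lambda>z\<in>space (\<mu> \<Otimes>\<^sub>M M). f (snd z) (fst z)) \<in> L0s (\<mu> \<Otimes>\<^sub>M M) N d"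
proof -
 interpret F: finite_measure \<mu> by (rule fin_\<mu>)
 have fA: "f x \<in> AN" if "x \<in> space M" for x using A.L0s_in[OF f that] .
 let ?P = "\<mu> \<Otimes>\<^sub>M M"
 have "(\<lambda>x\<in>space M. q (f x)) \<in> L0s M LI dI"
  using f unfolding L0s_isometric_iff[OF A.metric_target_axioms L.metric_target_axioms isometric_q A.L0s_ext[OF f]] .
 hence "(\<lambda>x\<in>space M. q (f x)) \<in> L0s M (Lp \<mu> N d p (cls \<mu> N k0)) dI" by (simp only: LI_eq)
 then obtain g S where g: "g \<in> L0s (M \<Otimes>\<^sub>M \<mu>) N d"
  "!!x. x \<in> space M ==> cls \<mu> N (%t. g (x, t)) = (\<lambda>x\<in>space M. q (f x)) x"
  by (rule joint_representative[OF k0 compl]) (rule that, assumption+)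
 have gf: "AE t in \<mu>. g (x, t) = f x t" if x: "x \<in> space M" for x
 proof -
  have "f x \<in> cls \<mu> N (%t. g (x, t))" using g(2)[OF x] x cls_self[of "f x" \<mu> N] AC_ext[OF fA[OF x]] by (simp add: q_map_def)
  from cls_memD[OF this] show ?thesis by eventually_elim simp
 qed
 obtain C where C: "countable C" "C \<subseteq> N" "!!y e. y \<in> space (M \<Otimes>\<^sub>M \<mu>) ==> e > 0 ==> \<exists>z\<in>C. d (g y) z < e"
  by (rule L0s_dense[OF g(1)]) (rule that, assumption+)
 let ?f = "\<lambda>z\<in>space ?P. f (snd z) (fst z)"
 show ?thesis
 proof (rule L0sI[OF _ C(1,2)])
  show "?f \<in> space ?P \<rightarrow>\<^sub>E N" using AC_in[OF fA] by (auto simp: space_pair_measure)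
  fix z and e :: real assume "z \<in> space ?P" and e: "0 < e"
  then obtain t x where z: "z = (t, x)" "t \<in> I" "x \<in> space M" "z \<in> space ?P" by (auto simp: space_pair_measure)
  have e2: "0 < e / 2" using e by simp
  obtain r where r: "0 < r" "!!s. s \<in> I ==> \<bar>s - t\<bar> < r ==> d (f x s) (f x t) < e / 2"
   by (rule AC_continuous[OF fA[OF z(3)] z(2) e2]) (rule that)
  \<comment> \<open>Points of the countable set approximate values of g, and g agrees with the curve
    only at almost every time. Continuity of the curve permits moving from t to a nearby time of
    agreement.\<close>
  obtain s where s: "s \<in> I" "\<bar>s - t\<bar> < r" "g (x, s) = f x s" using AE_interval_near[OF gf[OF z(3)] z(2) r(1)] by blast
  have "(x, s) \<in> space (M \<Otimes>\<^sub>M \<mu>)" using s(1) z(3) by (simp add: space_pair_measure)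
  from C(3)[OF this e2] obtain y where y: "y \<in> C" "d (f x s) y < e / 2" using s(3) by auto
  have "d (f x t) y <= d (f x t) (f x s) + d (f x s) y" by (rule triangle) (use y(1) C(2) AC_in[OF fA[OF z(3)]] s(1) z(2) in auto)
  also have "\<dots> < e" using r(2)[OF s(1,2)] y(2) commute[of "f x t" "f x s"] by simp
  finally show "\<exists>y\<in>C. d (?f z) y < e" using y(1) z by auto
 next
  fix y assume "y \<in> C"
  hence y: "y \<in> N" using C(2) by blast
  let ?i = "%k. inverse (real (Suc k))"
  \<comment> \<open>By continuity, d(f x t) y < r holds iff, for some k and n, d(f x s) y <= r -
    1/(k+1) at almost every s within 1/(n+1) of t. In terms of g this is the vanishing of an
    integral over s, which is measurable in (t, x).\<close>
  let ?B = "%r k n z. {s \<in> space \<mu>. \<bar>s - fst z\<bar> < ?i n & r - ?i k < d (g (snd z, s)) y}"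
  have key: "d (?f z) y < r \<longleftrightarrow> (EX k n. (\<integral>\<^sup>+ s. indicator (?B r k n z) s \<partial>\<mu>) = 0)" if zP: "z \<in> space ?P" for z r
  proof -
   obtain t x where z: "z = (t, x)" "t \<in> I" "x \<in> space M" using zP by (auto simp: space_pair_measure)
   note fx = fA[OF z(3)]
   have dm: "(%s. d (g (x, s)) y) \<in> borel_measurable \<mu>"
    by (rule measurable_compose[OF measurable_Pair1'[OF z(3)] L0s_dist_const[OF g(1) y]])
   have Bm: "?B r k n z \<in> sets \<mu>" for k n
   proof -
    have [measurable]: "(%s. s) \<in> borel_measurable \<mu>" by (intro measurable_restrict_space1 measurable_completion) simp
    show ?thesis unfolding z(1) fst_conv snd_conv using dm by measurable
   qed
   have B0: "(\<integral>\<^sup>+ s. indicator (?B r k n z) s \<partial>\<mu>) = 0 \<longleftrightarrow> (AE s in \<mu>. \<bar>s - t\<bar> < ?i n --> d (f x s) y <= r - ?i k)" for k n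
   proof -
    have "(\<integral>\<^sup>+ s. indicator (?B r k n z) s \<partial>\<mu>) = 0 \<longleftrightarrow> (AE s in \<mu>. s \<notin> ?B r k n z)"
     unfolding AE_iff_null_sets[OF Bm, symmetric] nn_integral_indicator[OF Bm]
     by (rule iffI, rule null_setsI, assumption, rule Bm, rule null_setsD1)
    also have "\<dots> \<longleftrightarrow> (AE s in \<mu>. \<bar>s - t\<bar> < ?i n --> d (f x s) y <= r - ?i k)"
    proof
     show "AE s in \<mu>. \<bar>s - t\<bar> < ?i n --> d (f x s) y <= r - ?i k" if "AE s in \<mu>. s \<notin> ?B r k n z"
      using that gf[OF z(3)] AE_space by eventually_elim (auto simp: z(1))
     show "AE s in \<mu>. s \<notin> ?B r k n z" if "AE s in \<mu>. \<bar>s - t\<bar> < ?i n --> d (f x s) y <= r - ?i k"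
      using that gf[OF z(3)] AE_space by eventually_elim (auto simp: z(1))
    qed
    finally show ?thesis .
   qed
   have fz: "?f z = f x t" using z zP by simp
   show ?thesis unfolding B0 fz
   proof
    assume lt: "d (f x t) y < r"
    hence e: "0 < (r - d (f x t) y) / 2" by simp
    obtain k where k: "?i k < (r - d (f x t) y) / 2" using reals_Archimedean[OF e] by blast
    obtain \<rho> where \<rho>: "0 < \<rho>" "!!s. s \<in> I ==> \<bar>s - t\<bar> < \<rho> ==> d (f x s) (f x t) < (r - d (f x t) y) / 2"
     by (rule AC_continuous[OF fx z(2) e]) (rule that)
    obtain n where n: "?i n < \<rho>" using reals_Archimedean[OF \<rho>(1)] by blast
    have "d (f x s) y <= r - ?i k" if s: "s \<in> space \<mu>" "\<bar>s - t\<bar> < ?i n" for s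
    proof -
     have sI: "s \<in> I" using s(1) by simp
     have "d (f x s) y <= d (f x s) (f x t) + d (f x t) y" by (rule triangle[OF AC_in[OF fx sI] AC_in[OF fx z(2)] y])
     also have "\<dots> <= (r - d (f x t) y) / 2 + d (f x t) y" using \<rho>(2)[OF sI] s(2) n by simp
     also have "\<dots> <= r - ?i k" using k by (simp add: field_simps)
     finally show ?thesis .
    qed
    hence "AE s in \<mu>. \<bar>s - t\<bar> < ?i n --> d (f x s) y <= r - ?i k" by (intro AE_I2) blast
    thus "EX k n. AE s in \<mu>. \<bar>s - t\<bar> < ?i n --> d (f x s) y <= r - ?i k" by blast
   next
    assume "EX k n. AE s in \<mu>. \<bar>s - t\<bar> < ?i n --> d (f x s) y <= r - ?i k"
    then obtain k n where ae: "AE s in \<mu>. \<bar>s - t\<bar> < ?i n --> d (f x s) y <= r - ?i k" by blast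
    have ik: "0 < ?i k" by simp
    obtain \<rho> where \<rho>: "0 < \<rho>" "!!s. s \<in> I ==> \<bar>s - t\<bar> < \<rho> ==> d (f x s) (f x t) < ?i k"
     by (rule AC_continuous[OF fx z(2) ik]) (rule that)
    have "0 < min \<rho> (?i n)" using \<rho>(1) by simp
    from AE_interval_near[OF ae z(2) this] obtain s where s: "s \<in> I" "\<bar>s - t\<bar> < min \<rho> (?i n)"
     "\<bar>s - t\<bar> < ?i n --> d (f x s) y <= r - ?i k" by blast
    have "d (f x t) y <= d (f x t) (f x s) + d (f x s) y" by (rule triangle[OF AC_in[OF fx z(2)] AC_in[OF fx s(1)] y])
    also have "\<dots> < r" using \<rho>(2)[OF s(1)] s(2,3) commute[of "f x t" "f x s"] by simp
    finally show "d (f x t) y < r" .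
   qed
  qed
  have m: "(%z. \<integral>\<^sup>+ s. indicator (?B r k n z) s \<partial>\<mu>) \<in> borel_measurable ?P" for r k n
  proof -
   let ?Q = "?P \<Otimes>\<^sub>M \<mu>"
   have s: "(%w. snd w) \<in> borel_measurable ?Q"
   proof (rule measurable_compose[OF measurable_snd])
    show "(%s. s) \<in> borel_measurable \<mu>" by (intro measurable_restrict_space1 measurable_completion) simp
   qed
   have t: "(%w. fst (fst w)) \<in> borel_measurable ?Q" by (rule measurable_compose[OF measurable_fst fst_measurable])
   have D: "(%w. d (g (snd (fst w), snd w)) y) \<in> borel_measurable ?Q"
    by (rule measurable_compose[OF _ L0s_dist_const[OF g(1) y]]) simp
   note [measurable] = s t D
   have "(%(z, s). indicator {w \<in> space ?Q. \<bar>snd w - fst (fst w)\<bar> < ?i n & r - ?i k < d (g (snd (fst w), snd w)) y} (z, s) :: ennreal) \<in> borel_measurable ?Q"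
    unfolding case_prod_beta' prod.collapse by measurable
   from F.borel_measurable_nn_integral[OF this]
   have "(%z. \<integral>\<^sup>+ s. indicator {w \<in> space ?Q. \<bar>snd w - fst (fst w)\<bar> < ?i n & r - ?i k < d (g (snd (fst w), snd w)) y} (z, s) \<partial>\<mu>) \<in> borel_measurable ?P" .
   also have "?this \<longleftrightarrow> ?thesis"
    by (rule measurable_cong, rule nn_integral_cong) (simp add: indicator_def space_pair_measure)
   finally show ?thesis .
  qed
  show "(%z. d (?f z) y) \<in> borel_measurable ?P"
   unfolding borel_measurable_iff_less
  proof
   fix r
   have "{z \<in> space ?P. d (?f z) y < r} = {z \<in> space ?P. EX k n. (\<integral>\<^sup>+ s. indicator (?B r k n z) s \<partial>\<mu>) = 0}"
    by (rule Collect_cong, rule conj_cong[OF refl]) (rule key)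
   also have "\<dots> \<in> sets ?P"
   proof -
    have "{z \<in> space ?P. (\<integral>\<^sup>+ s. indicator (?B r k n z) s \<partial>\<mu>) = 0} \<in> sets ?P" for k n using m[of n r k] by measurable
    thus ?thesis by (intro sets.sets_Collect_countable_Ex)
   qed
   finally show "{z \<in> space ?P. d (?f z) y < r} \<in> sets ?P" .
  qed
 qed
qed

text \<open>\<open>joint_evaluation\<close> makes the chosen representative product-measurable. The
  finite distance to the family of constant curves, measured in the space of curves, supplies the
  sigma-finite set that a nice map requires.\<close>

lemma Lp_AC_cases:
 assumes f: "f \<in> Lp_AC I M N d p h"
 obtains g where "AC_nice g" "fin g" "f = cls M AN (curves g)"
proof -
 have f': "f \<in> Lp M AN dA p (cls M AN (curves H))" using f by (simp add: Lp_AC_def h_const_AC_eq)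
 have HL: "curves H \<in> L0s M AN dA" by (rule curves_L0s[OF AC_nice_H])
 let ?F = "rep M AN dA f"
 note F = A.LpD[OF f' cls_in_L0[OF HL]]
 have Ff: "int_dist_powr M dA p ?F (curves H) < \<infinity>" using cls_in_Lp_iff[OF F(1) HL, of p] f' F(3) by simp
 define g where "g = (\<lambda>z\<in>space (\<mu> \<Otimes>\<^sub>M M). ?F (snd z) (fst z))"
 have gx: "g (t, x) = ?F x t" if "t \<in> I" "x \<in> space M" for t x using that by (simp add: g_def space_pair_measure)
 define S where "S = {x \<in> space M. ?F x ~= curves H x}"
 have S: "sigma_finite_set M S" unfolding S_def by (rule A.sigma_finite_set_distinct[OF F(1) HL Ff])
 have gh: "g (t, x) = h0 x" if t: "t \<in> I" and x: "x \<in> space M - S" for t x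
 proof -
  have "?F x = curves H x" "x \<in> space M" using x by (auto simp: S_def)
  thus ?thesis using gx[OF t, of x] H_eq[OF t, of x] curves_eq[OF t, of x H] by simp
 qed
 have "g \<in> L0s (\<mu> \<Otimes>\<^sub>M M) N d" unfolding g_def by (rule joint_evaluation[OF F(1)])
 hence n: "nice g" unfolding nice_def using S gh by blast
 have FA: "?F x \<in> AN" if "x \<in> space M" for x by (rule A.L0s_in[OF F(1) that])
 have cF: "(\<lambda>t\<in>I. g (t, x)) = ?F x" if x: "x \<in> space M" for x
  using AC_ext[OF FA[OF x]] gx x by (intro extensionalityI[of _ I]) (auto simp: PiE_def)
 have g: "AC_nice g" unfolding AC_nice_def using n FA cF by simp
 have "curves g = ?F" using A.L0s_ext[OF F(1)] cF by (intro extensionalityI[of _ "space M"]) (auto simp: PiE_def curves_def)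
 hence eq: "f = cls M AN (curves g)" using F(3) by simp
 hence "fin g" using curves_LA[OF g] f by simp
 with g show thesis using eq by (rule that)
qed

text \<open>On lifted curves the distance is that of the images under the isometry
  \<open>i_bar\<close>, since passing from curves to their classes preserves distances on both
  sides.\<close>

lemma i_tilde_isometric:
 "isometric_mapping ACX (map_dist \<mu> DX p) (Lp_AC I M N d p h) (Lp_dist M AN dA p) (i_tilde I M N d p h)"
 unfolding isometric_mapping_def
proof (intro conjI funcsetI ballI)
 fix c assume c: "c \<in> ACX"
 obtain g where L: "lifts c g" by (rule lifts_exist[OF c])
 hence g: "AC_nice g" "fin g" by (auto simp: lifts_def)
 show "i_tilde I M N d p h c \<in> Lp_AC I M N d p h" unfolding lifts_i_tilde[OF L] using curves_LA[OF g(1)] g(2) by simp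
 fix c' assume c': "c' \<in> ACX"
 obtain g' where L': "lifts c' g'" by (rule lifts_exist[OF c'])
 hence g': "AC_nice g'" "fin g'" by (auto simp: lifts_def)
 have "Lp_dist M AN dA p (i_tilde I M N d p h c) (i_tilde I M N d p h c')
  = Lp_dist M LI dI p (i_bar I M N d p h (cls \<mu> X c)) (i_bar I M N d p h (cls \<mu> X c'))"
  unfolding lifts_i_tilde[OF L] lifts_i_tilde[OF L'] lifts_i_bar[OF L] lifts_i_bar[OF L'] section_class_def
  by (rule Lp_dist_curves[OF g(1) g'(1) g(2) g'(2)])
 also have "\<dots> = Lp_dist \<mu> X DX p (cls \<mu> X c) (cls \<mu> X c')"
  using isometry_i_bar Q_in[OF c] Q_in[OF c'] unfolding isometry_def isometric_mapping_def by blast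
 also have "\<dots> = map_dist \<mu> DX p c c'" by (rule Lp_dist_cls[OF X.AC_L0s[OF c] X.AC_L0s[OF c']])
 finally show "Lp_dist M AN dA p (i_tilde I M N d p h c) (i_tilde I M N d p h c') = map_dist \<mu> DX p c c'" .
qed

lemma inj_i_tilde: "inj_on (i_tilde I M N d p h) ACX"
proof (rule isometry_inj_on[OF X.Metric_space_AC i_tilde_isometric])
 show "Metric_space (Lp_AC I M N d p h) (Lp_dist M AN dA p)"
  unfolding Lp_AC_def h_const_AC_eq by (rule A.Metric_space_Lp[OF cls_in_L0[OF curves_L0s[OF AC_nice_H]]])
qed

lemma speed_rep:
 assumes g: "AC_nice g"
 shows "AE x in M. rep M AN dA (cls M AN (curves g)) x = curves g x"
 by (rule rep_cls[OF curves_L0s[OF g]])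

end

theorem theorem3p19:
  fixes M :: "'m measure" and N :: "'n set" and d :: "'n \<Rightarrow> 'n \<Rightarrow> real"
    and a b p :: real and h :: "('m \<Rightarrow> 'n) set"
  assumes "space M \<noteq> {}" and "Metric_space N d" and "N \<noteq> {}" and "a < b"
    and "h \<in> L0 M N d" and "1 < p"
    and "Metric_space.mcomplete N d"
  shows
    "let I = {a..b}; \<mu> = lebesgue_on I;
         X = Lp M N d p h; D = Lp_dist M N d p;
         L = LpI I N d p; d\<^sub>p = Lp_dist \<mu> N d p;
         A = AC I N d p; d\<^sub>A = map_dist \<mu> d p;
         ACX = AC_Lp I M N d p h;
         LA = Lp_AC I M N d p h;
         ib = i_bar I M N d p h; it = i_tilde I M N d p h;
         Q = Q_map I M N d p h; q = q_map I N
     in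
       isometry (LpI I X D p) (Lp_dist \<mu> X D p)
                (Lp M L d\<^sub>p p (h_const I M N d p h)) (Lp_dist M L d\<^sub>p p) ib
     \<and> (\<forall>c\<in>ACX. Q c \<in> LpI I X D p \<and> (\<exists>f. compatible M (q ` A) (ib (Q c)) f))
     \<and> isometric_mapping ACX (map_dist \<mu> D p) LA (Lp_dist M A d\<^sub>A p) it
     \<and> (\<forall>f \<in> it ` ACX.
          q_push I M N d p f \<in> Lp M L d\<^sub>p p (h_const I M N d p h)
        \<and> inv_into (LpI I X D p) ib (q_push I M N d p f) \<in> Q ` ACX
        \<and> inv_into ACX it f
            = inv_into ACX Q (inv_into (LpI I X D p) ib (q_push I M N d p f)))
     \<and> (\<forall>f \<in> it ` ACX. \<forall>t\<in>I. inv_into ACX it f t = e_push I M N d p t f)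
     \<and> (\<forall>c\<in>ACX. AE t in \<mu>.
          ennreal (metric_deriv I D c t powr p)
            = (\<integral>\<^sup>+ x. ennreal (metric_deriv I d (rep M A d\<^sub>A (it c) x) t powr p) \<partial>M))
     \<and> it ` ACX = {f \<in> LA.
          (\<integral>\<^sup>+ x. (\<integral>\<^sup>+ t. ennreal (metric_deriv I d (rep M A d\<^sub>A f x) t powr p) \<partial>\<mu>) \<partial>M) < \<infinity>}"
proof -
 interpret sections N d p a b M h
  using assms by (intro sections.intro ac_setting.intro Lp_target.intro metric_target.intro Lp_target_axioms.intro
    dyadic_interval.intro sections_axioms.intro)
 have Q: "Q_map {a..b} M N d p h = cls (lebesgue_on {a..b}) (Lp M N d p h)" by (rule ext) (simp add: Q_map_def)
 let ?it = "i_tilde {a..b} M N d p h" and ?ib = "i_bar {a..b} M N d p h" and ?X = "Lp M N d p h" and ?D = "Lp_dist M N d p"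
 let ?\<mu> = "lebesgue_on {a..b}" and ?A = "AC {a..b} N d p" and ?dA = "map_dist (lebesgue_on {a..b}) d p"
 let ?ACX = "AC {a..b} (Lp M N d p h) (Lp_dist M N d p) p"
 \<comment> \<open>For almost every x the two curves coincide as functions, so their speeds agree at
   every t, with an exceptional set independent of t.\<close>
 have rep_speed: "AE x in M. metric_deriv {a..b} d (rep M ?A ?dA (cls M ?A (curves g)) x) = metric_deriv {a..b} d (curves g x)"
  if "AC_nice g" for g
  using speed_rep[OF that] by eventually_elim simp
 \<comment> \<open>Converts the integral in the description of the range, formulated with
   \<open>rep\<close>, into the total energy of a jointly measurable lift, in the order of
   integration used by \<open>lifts_if_energy\<close>.\<close>
 have total: "(\<integral>\<^sup>+ x. (\<integral>\<^sup>+ t. ennreal (metric_deriv {a..b} d (rep M ?A ?dA (cls M ?A (curves g)) x) t powr p) \<partial>?\<mu>) \<partial>M)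
   = (\<integral>\<^sup>+ t. energy g t \<partial>?\<mu>)" if g: "AC_nice g" for g
  unfolding energy_Tonelli(2)[OF g, symmetric]
  by (rule nn_integral_cong_AE) (use rep_speed[OF g] in eventually_elim, simp)
 have inverse: "q_push {a..b} M N d p (?it c) = ?ib (cls ?\<mu> ?X c)" if c: "c \<in> ?ACX" for c
 proof -
  obtain g where L: "lifts c g" by (rule lifts_exist[OF c])
  hence "AC_nice g" by (simp add: lifts_def)
  from section_class_q(3)[OF this] show ?thesis unfolding lifts_i_tilde[OF L] lifts_i_bar[OF L] .
 qed
 show ?thesis
  unfolding Let_def AC_Lp_def Q
 proof (intro conjI ballI)
  show "isometry (LpI {a..b} ?X ?D p) (Lp_dist ?\<mu> ?X ?D p) (Lp M (LpI {a..b} N d p) (Lp_dist ?\<mu> N d p) p (h_const {a..b} M N d p h))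
   (Lp_dist M (LpI {a..b} N d p) (Lp_dist ?\<mu> N d p) p) ?ib" by (rule isometry_i_bar)
  show "isometric_mapping ?ACX (map_dist ?\<mu> ?D p) (Lp_AC {a..b} M N d p h) (Lp_dist M ?A ?dA p) ?it" by (rule i_tilde_isometric)
 next
  fix c assume c: "c \<in> ?ACX"
  obtain g where L: "lifts c g" by (rule lifts_exist[OF c])
  hence g: "AC_nice g" by (simp add: lifts_def)
  show "cls ?\<mu> ?X c \<in> LpI {a..b} ?X ?D p" by (rule Q_in[OF c])
  show "EX f. compatible M (q_map {a..b} N ` ?A) (?ib (cls ?\<mu> ?X c)) f"
   unfolding lifts_i_bar[OF L] by (rule exI, rule section_class_q(4)[OF g])
  show "AE t in ?\<mu>. ennreal (metric_deriv {a..b} ?D c t powr p)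
   = (\<integral>\<^sup>+ x. ennreal (metric_deriv {a..b} d (rep M ?A ?dA (?it c) x) t powr p) \<partial>M)"
   using lifts_metric_derivative(2)[OF L] energy_Tonelli(3)[OF g]
  proof eventually_elim
   case (elim t)
   have "(\<integral>\<^sup>+ x. ennreal (metric_deriv {a..b} d (rep M ?A ?dA (?it c) x) t powr p) \<partial>M)
    = (\<integral>\<^sup>+ x. ennreal (metric_deriv {a..b} d (curves g x) t powr p) \<partial>M)"
    unfolding lifts_i_tilde[OF L] by (rule nn_integral_cong_AE) (use rep_speed[OF g] in eventually_elim, simp)
   thus ?case using elim by simp
  qed
 next
  fix f assume "f \<in> ?it ` ?ACX"
  then obtain c where c: "c \<in> ?ACX" and f: "f = ?it c" by blast
  have im: "?ib (cls ?\<mu> ?X c) \<in> Lp M (LpI {a..b} N d p) (Lp_dist ?\<mu> N d p) p (h_const {a..b} M N d p h)"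
   using isometry_i_bar Q_in[OF c] unfolding isometry_def isometric_mapping_def by blast
  have ib: "inv_into (LpI {a..b} ?X ?D p) ?ib (q_push {a..b} M N d p f) = cls ?\<mu> ?X c"
   unfolding f inverse[OF c] by (rule inv_into_f_f[OF inj_i_bar Q_in[OF c]])
  have it: "inv_into ?ACX ?it f = c" unfolding f by (rule inv_into_f_f[OF inj_i_tilde c])
  show "q_push {a..b} M N d p f \<in> Lp M (LpI {a..b} N d p) (Lp_dist ?\<mu> N d p) p (h_const {a..b} M N d p h)"
   unfolding f inverse[OF c] by (rule im)
  show "inv_into (LpI {a..b} ?X ?D p) ?ib (q_push {a..b} M N d p f) \<in> cls ?\<mu> ?X ` ?ACX" unfolding ib using c by (rule imageI)
  show "inv_into ?ACX ?it f = inv_into ?ACX (cls ?\<mu> ?X) (inv_into (LpI {a..b} ?X ?D p) ?ib (q_push {a..b} M N d p f))"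
   unfolding ib it by (rule inv_into_f_f[OF inj_Q c, symmetric])
  fix t assume t: "t \<in> {a..b}"
  obtain g where L: "lifts c g" by (rule lifts_exist[OF c])
  hence g: "AC_nice g" "c t = cls M N (%x. g (t, x))" using t by (auto simp: lifts_def)
  show "inv_into ?ACX ?it f t = e_push {a..b} M N d p t f"
   unfolding it unfolding f lifts_i_tilde[OF L] section_class_q(6)[OF g(1) t] by (rule g(2))
 next
  show "?it ` ?ACX = {f \<in> Lp_AC {a..b} M N d p h.
   (\<integral>\<^sup>+ x. (\<integral>\<^sup>+ t. ennreal (metric_deriv {a..b} d (rep M ?A ?dA f x) t powr p) \<partial>?\<mu>) \<partial>M) < \<infinity>}" (is "_ = ?R")
  proof (intro equalityI subsetI)
   fix f assume "f \<in> ?it ` ?ACX"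
   then obtain c where c: "c \<in> ?ACX" and f: "f = ?it c" by blast
   obtain g where L: "lifts c g" by (rule lifts_exist[OF c])
   hence g: "AC_nice g" by (simp add: lifts_def)
   have "f \<in> Lp_AC {a..b} M N d p h" using i_tilde_isometric c unfolding f isometric_mapping_def by blast
   thus "f \<in> ?R" using total[OF g] lifts_metric_derivative(1)[OF L] unfolding f lifts_i_tilde[OF L] by simp
  next
   fix f assume f: "f \<in> ?R"
   hence fL: "f \<in> Lp_AC {a..b} M N d p h" by blast
   obtain g where g: "AC_nice g" "fin g" "f = cls M ?A (curves g)" by (rule Lp_AC_cases[OF fL])
   have "(\<integral>\<^sup>+ t. energy g t \<partial>?\<mu>) < \<infinity>" using f total[OF g(1)] g(3) by simp
   then obtain c where L: "lifts c g" by (rule lifts_if_energy[OF g(1,2)])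
   hence "c \<in> ?ACX" by (simp add: lifts_def)
   thus "f \<in> ?it ` ?ACX" unfolding g(3) lifts_i_tilde[OF L, symmetric] by (rule imageI)
  qed
 qed
qed

end
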